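(* Let $\sigma>0$, $L>0$, $\nu>0$, $\rho>0$ and $\gamma\in\mathbb{R}$. For all sufficiently small $\epsilon\in(0,1)$ (depending on the parameters of the problem), with $\delta=e^{-1/\epsilon}$, $\theta_\epsilon$ the cut-off function and $\tilde v=-\frac{d(\theta_\epsilon\phi)}{dr}$ the background azimuthal flow described in the context, the steady axisymmetric Navier-Stokes system $$u \frac{\partial u}{\partial r}+ w\frac{\partial u}{\partial z}-\frac{v^2}{r}=-\frac{1}{\rho}\frac{\partial p}{\partial r} +\nu \Big(\frac{\partial ^2 u}{\partial r^2}+\frac{1}{r}\frac{\partial u}{\partial r}-\frac{u}{r^2}+\frac{\partial^2 u}{\partial z^2}\Big),$$ $$u \frac{\partial v}{\partial r}+ w\frac{\partial v}{\partial z}+\frac{uv}{r}=\nu \Big(\frac{\partial ^2 v}{\partial r^2}+\frac{1}{r}\frac{\partial v}{\partial r}-\frac{v}{r^2}+\frac{\partial^2 v}{\partial z^2}\Big),$$ $$u \frac{\partial w}{\partial r}+ w\frac{\partial w}{\partial z}=-\frac{1}{\rho}\frac{\partial p}{\partial z} +\nu \Big(\frac{\partial ^2 w}{\partial r^2}+\frac{1}{r}\frac{\partial w}{\partial r}+\frac{\partial^2 w}{\partial z^2}\Big),$$ $$\frac{\partial(ru) }{\partial r}+\frac{\partial (rw)}{\partial z}=0$$ on $\Omega'=\{(r,z):\sigma\le r<\infty,\ 0\le z\le L\}$, with boundary conditions $$(u,v,w)=(0,\tilde v,0)\ \text{ on } \Gamma_i\cup\Gamma_l,\qquad \Big(\frac{\partial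 u}{\partial z},\frac{\partial v}{\partial z},w\Big)=(0,0,0)\ \text{ on }\Gamma_u,$$ where $\Gamma_i=\{r\ge\sigma,\ z=0\}$, $\Gamma_l=\{r=\sigma,\ 0\le z\le L\}$, $\Gamma_u=\{r\ge\sigma,\ z=L\}$, admits a weak solution $(u,v,w)$ in the following sense: the triple $(u,v-\tilde v,w)$, renamed $(u,v,w)$, with $\mathbf{U}=(u,w)$, satisfies $(\mathbf U,v)\in \mathbf V_2\times V_1$ and, for every $(\mathbf U_1,v_1)$ with $\mathbf U_1=(u_1,w_1)\in\mathbf V_2$ and $v_1\in V_1$, $$\int_{\Omega'}(\mathbf{U} \cdot \nabla)\mathbf{U} \cdot \mathbf{U}_1 \, r\,dr\,dz -\int_{\Omega'}\frac{(v+\tilde{v})^2}{r} u_1 \, r\,dr\,dz= -\nu \int_{\Omega'} \nabla \mathbf{U}: \nabla \mathbf{U}_1\, r\,dr\,dz -\nu \int_{\Omega'} \frac{u u_1}{r^2}\, r\,dr\,dz,$$ $$\int_{\Omega'} (\mathbf{U} \cdot \nabla v) v_1\, r\,dr\,dz+\int_{\Omega'} u \frac{\partial \tilde{v}}{\partial r} v_1\, r\,dr\,dz + \int_{\Omega'} \frac{u(v+\tilde{v})}{r} v_1\, r\,dr\,dz=-\nu \int_{\Omega'} \nabla v \cdot \nabla v_1\, r\,dr\,dz -\nu \int_{\Omega'} \nabla \tilde{v} \cdot \nabla v_1\, r\,dr\,dz -\nu \int_{\Omega'} \frac{(v+\tilde{v}) v_1}{r^2}\, r\,dr\,dz.$$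
   Context: Notation: $(r,z)$ are the radial and axial cylindrical coordinates, $(u,v,w)$ the radial, azimuthal and axial velocity components (all independent of the angle), $p$ the pressure, $\nabla=(\partial_r,\partial_z)$, and $\mathbf U\cdot\nabla=u\,\partial_r+w\,\partial_z$. For $\mathbf U=(u,w)$ and $\mathbf U_1=(u_1,w_1)$, $\nabla\mathbf U:\nabla\mathbf U_1=\nabla u\cdot\nabla u_1+\nabla w\cdot\nabla w_1$. Background flow: $\phi(r)=-\frac{\gamma}{2\pi}\ln r$ (so that $-\phi'(r)=\frac{\gamma}{2\pi r}$). For $0<\epsilon<1$ put $\delta=e^{-1/\epsilon}$. The function $\theta_\epsilon=\theta_\epsilon(r)$ is a $C^2$ cut-off function on $r\ge\sigma$ such that $\theta_\epsilon(r)=1$ for $\sigma\le r\le\sigma+\frac{\delta^2}{2}$, $\theta_\epsilon(r)=0$ for $r\ge \sigma+\delta+\frac{\delta^2}{2}$, and $|\theta_\epsilon'(r)|\le\frac{\epsilon}{r-\sigma}$ for $\sigma+\frac{\delta^2}{2}\le r\le\sigma+\delta+\frac{\delta^2}{2}$. (It is obtained by regularizing the function equal to $1$ for $\sigma\le r\le\sigma+\delta^2$, to $\epsilon\ln\frac{\delta}{r-\sigma}$ for $\sigma+\delta^2\le r\le\sigma+\delta$, and to $0$ for $r\ge\sigma+\delta$.) The background flow is $(\tilde u,\tilde v,\tilde w)=(0,-\frac{d(\theta_\epsilon\phi)}{dr},0)$; in particular $\tilde v=\frac{\gamma}{2\pi\sigma}$ at $r=\sigma$ and $\tilde v=0$ for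 $r\ge\sigma+\delta+\frac{\delta^2}{2}$. Function spaces: $$V_1=\Big\{v : \int_{\Omega'} \Big[\Big(\frac{\partial v}{\partial r}\Big)^2+\Big(\frac{\partial v}{\partial z}\Big)^2\Big]\, r\,dr\,dz < \infty,\ v|_{z=0}=v|_{r=\sigma}=0\Big\},$$ a Hilbert space with inner product $(v,v_1)_{V_1}=\int_{\Omega'}\big(\frac{\partial v}{\partial r}\frac{\partial v_1}{\partial r}+\frac{\partial v}{\partial z}\frac{\partial v_1}{\partial z}\big)r\,dr\,dz$, and $$\mathbf V_2=\Big\{(u,w)\in V_1\times V_1 : \frac{\partial(ru)}{\partial r}+\frac{\partial(rw)}{\partial z}=0,\ w|_{z=L}=0\Big\}.$$ Boundary values are understood in the sense of traces and derivatives in the weak sense. *)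

theory Defs
  imports "HOL-Analysis.Analysis"
begin

section \<open>Weak derivatives\<close>

primrec C_diff :: "nat \<Rightarrow> ('a::euclidean_space \<Rightarrow> real) \<Rightarrow> bool" where
  "C_diff 0 f \<longleftrightarrow> continuous_on UNIV f"
| "C_diff (Suc k) f \<longleftrightarrow>
     (\<forall>x. f differentiable (at x)) \<and> (\<forall>b. C_diff k (\<lambda>x. frechet_derivative f (at x) b))"

definition smooth :: "('a::euclidean_space \<Rightarrow> real) \<Rightarrow> bool" where
  "smooth f \<longleftrightarrow> (\<forall>k. C_diff k f)"

definition test_function :: "'a::euclidean_space set \<Rightarrow> ('a \<Rightarrow> real) \<Rightarrow> bool" where
  "test_function S f \<longleftrightarrow>
     smooth f \<and> (\<exists>K. compact K \<and> K \<subseteq> S \<and> (\<forall>x. x \<notin> K \<longrightarrow> f x = 0))"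

definition loc_integrable :: "'a::euclidean_space set \<Rightarrow> ('a \<Rightarrow> real) \<Rightarrow> bool" where
  "loc_integrable S f \<longleftrightarrow> (\<forall>K. compact K \<and> K \<subseteq> S \<longrightarrow> set_integrable lborel K f)"

definition has_weak_deriv ::
    "'a::euclidean_space set \<Rightarrow> 'a \<Rightarrow> ('a \<Rightarrow> real) \<Rightarrow> ('a \<Rightarrow> real) \<Rightarrow> bool" where
  "has_weak_deriv S b f g \<longleftrightarrow>
     loc_integrable S f \<and> loc_integrable S g \<and>
     (\<forall>\<psi>. test_function S \<psi> \<longrightarrow>
        (LINT x:S|lborel. f x * frechet_derivative \<psi> (at x) b) = - (LINT x:S|lborel. g x * \<psi> x))"

text \<open>A representative of the weak derivative in direction \<open>b\<close>. On an open set it is unique up to a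
  null set, but its values outside the set are arbitrary; it is only ever used on open sets.\<close>

definition weak_deriv :: "'a::euclidean_space set \<Rightarrow> 'a \<Rightarrow> ('a \<Rightarrow> real) \<Rightarrow> 'a \<Rightarrow> real" where
  "weak_deriv S b f = (SOME g. has_weak_deriv S b f g)"


section \<open>Traces\<close>

text \<open>
  \<open>f\<close>, weakly differentiable on \<open>S\<close>, has trace \<open>h\<close> on the boundary piece parametrized at unit speed by
  \<open>c\<close> on \<open>I\<close>: the trace operator is the continuous extension of the restriction map from functions
  that are smooth up to the boundary. Convergence is \<open>H\<^sup>1\<close> on bounded parts of \<open>S\<close> and \<open>L\<^sup>2\<close> on
  bounded parts of the boundary piece; where \<open>r\<close> is bounded and bounded away from \<open>0\<close>, the weight
  \<open>r\<close> is irrelevant for these.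
\<close>

definition has_trace ::
    "(real \<times> real) set \<Rightarrow> (real \<Rightarrow> real \<times> real) \<Rightarrow> real set \<Rightarrow> (real \<times> real \<Rightarrow> real) \<Rightarrow> (real \<Rightarrow> real) \<Rightarrow> bool"
  where
  "has_trace S c I f h \<longleftrightarrow>
     h \<in> borel_measurable borel \<and>
     (\<exists>\<psi> :: nat \<Rightarrow> real \<times> real \<Rightarrow> real. (\<forall>n. smooth (\<psi> n)) \<and>
       (\<forall>R>0.
         (\<lambda>n. \<integral>\<^sup>+x\<in>S \<inter> ball 0 R. ennreal (
              (\<psi> n x - f x)\<^sup>2
            + (frechet_derivative (\<psi> n) (at x) (1, 0) - weak_deriv S (1, 0) f x)\<^sup>2
            + (frechet_derivative (\<psi> n) (at x) (0, 1) - weak_deriv S (0, 1) f x)\<^sup>2) \<partial>lborel)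
           \<longlonglongrightarrow> 0 \<and>
         (\<lambda>n. \<integral>\<^sup>+s\<in>{s \<in> I. c s \<in> ball 0 R}. ennreal ((\<psi> n (c s) - h s)\<^sup>2) \<partial>lborel) \<longlonglongrightarrow> 0))"


section \<open>The domain and the function spaces\<close>

text \<open>
  Points are pairs \<open>(r, z)\<close>. \<open>Om \<sigma> L\<close> is the interior of \<open>\<Omega>'\<close>; the difference is a null set, so
  integrals over the two agree.
\<close>

definition Om :: "real \<Rightarrow> real \<Rightarrow> (real \<times> real) set" where
  "Om \<sigma> L = {\<sigma><..} \<times> {0<..<L}"

definition d_r :: "real \<Rightarrow> real \<Rightarrow> (real \<times> real \<Rightarrow> real) \<Rightarrow> real \<times> real \<Rightarrow> real" where
  "d_r \<sigma> L = weak_deriv (Om \<sigma> L) (1, 0)"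

definition d_z :: "real \<Rightarrow> real \<Rightarrow> (real \<times> real \<Rightarrow> real) \<Rightarrow> real \<times> real \<Rightarrow> real" where
  "d_z \<sigma> L = weak_deriv (Om \<sigma> L) (0, 1)"

definition grad :: "real \<Rightarrow> real \<Rightarrow> (real \<times> real \<Rightarrow> real) \<Rightarrow> real \<times> real \<Rightarrow> real \<times> real" where
  "grad \<sigma> L f x = (d_r \<sigma> L f x, d_z \<sigma> L f x)"

text \<open>The integral of \<open>f\<close> over \<open>\<Omega>'\<close> with respect to \<open>r dr dz\<close>.\<close>

definition cyl_integral :: "real \<Rightarrow> real \<Rightarrow> (real \<times> real \<Rightarrow> real) \<Rightarrow> real" where
  "cyl_integral \<sigma> L f = (LINT x:Om \<sigma> L|lborel. f x * fst x)"

definition V1 :: "real \<Rightarrow> real \<Rightarrow> (real \<times> real \<Rightarrow> real) set" where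
  "V1 \<sigma> L = {v.
     (\<exists>g. has_weak_deriv (Om \<sigma> L) (1, 0) v g) \<and>
     (\<exists>g. has_weak_deriv (Om \<sigma> L) (0, 1) v g) \<and>
     set_integrable lborel (Om \<sigma> L) (\<lambda>(r, z). ((d_r \<sigma> L v (r, z))\<^sup>2 + (d_z \<sigma> L v (r, z))\<^sup>2) * r) \<and>
     has_trace (Om \<sigma> L) (\<lambda>r. (r, 0)) {\<sigma>..} v (\<lambda>_. 0) \<and>
     has_trace (Om \<sigma> L) (\<lambda>z. (\<sigma>, z)) {0..L} v (\<lambda>_. 0)}"

definition V2 :: "real \<Rightarrow> real \<Rightarrow> ((real \<times> real \<Rightarrow> real) \<times> (real \<times> real \<Rightarrow> real)) set" where
  "V2 \<sigma> L = {(u, w). u \<in> V1 \<sigma> L \<and> w \<in> V1 \<sigma> L \<and>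
     (AE x in lborel. x \<in> Om \<sigma> L \<longrightarrow>
        d_r \<sigma> L (\<lambda>(r, z). r * u (r, z)) x + d_z \<sigma> L (\<lambda>(r, z). r * w (r, z)) x = 0) \<and>
     has_trace (Om \<sigma> L) (\<lambda>r. (r, L)) {\<sigma>..} w (\<lambda>_. 0)}"


section \<open>The background flow\<close>

definition phi :: "real \<Rightarrow> real \<Rightarrow> real" where
  "phi \<gamma> r = - (\<gamma> / (2 * pi)) * ln r"

text \<open>\<open>\<theta>\<close> only matters on \<open>r \<ge> \<sigma>\<close>; its derivatives at \<open>\<sigma>\<close> are one-sided.\<close>

definition cutoff :: "real \<Rightarrow> real \<Rightarrow> (real \<Rightarrow> real) \<Rightarrow> bool" where
  "cutoff \<sigma> \<epsilon> \<theta> \<longleftrightarrow> (let \<delta> = exp (- 1 / \<epsilon>) in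
     (\<exists>\<theta>' \<theta>''.
        (\<forall>r\<ge>\<sigma>. (\<theta> has_real_derivative \<theta>' r) (at r within {\<sigma>..})) \<and>
        (\<forall>r\<ge>\<sigma>. (\<theta>' has_real_derivative \<theta>'' r) (at r within {\<sigma>..})) \<and>
        continuous_on {\<sigma>..} \<theta>'' \<and>
        (\<forall>r\<in>{\<sigma> + \<delta>\<^sup>2 / 2 .. \<sigma> + \<delta> + \<delta>\<^sup>2 / 2}. \<bar>\<theta>' r\<bar> \<le> \<epsilon> / (r - \<sigma>))) \<and>
     (\<forall>r\<in>{\<sigma> .. \<sigma> + \<delta>\<^sup>2 / 2}. \<theta> r = 1) \<and>
     (\<forall>r\<ge>\<sigma> + \<delta> + \<delta>\<^sup>2 / 2. \<theta> r = 0))"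

definition v_bg :: "real \<Rightarrow> real \<Rightarrow> (real \<Rightarrow> real) \<Rightarrow> real \<Rightarrow> real" where
  "v_bg \<sigma> \<gamma> \<theta> r = - vector_derivative (\<lambda>s. \<theta> s * phi \<gamma> s) (at r within {\<sigma>..})"

definition dv_bg :: "real \<Rightarrow> real \<Rightarrow> (real \<Rightarrow> real) \<Rightarrow> real \<Rightarrow> real" where
  "dv_bg \<sigma> \<gamma> \<theta> r = vector_derivative (v_bg \<sigma> \<gamma> \<theta>) (at r within {\<sigma>..})"


section \<open>Weak solutions\<close>

text \<open>
  The weak formulation for the deviation \<open>(u, v, w)\<close> from the background flow. The pressure, and with
  it \<open>\<rho>\<close>, is eliminated by the divergence-free test functions. All integrands below are integrable
  for members of the spaces: the Poincare inequality in \<open>z\<close> puts \<open>V1\<close> into the weighted \<open>H\<^sup>1\<close>, hence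
  into the weighted \<open>L\<^sup>4\<close>, and the background flow is \<open>C\<^sup>1\<close> with bounded support. The gradient of
  the background flow is \<open>(dv_bg \<sigma> \<gamma> \<theta> r, 0)\<close>.
\<close>

definition weak_perturbation ::
    "real \<Rightarrow> real \<Rightarrow> real \<Rightarrow> real \<Rightarrow> (real \<Rightarrow> real) \<Rightarrow>
     (real \<times> real \<Rightarrow> real) \<Rightarrow> (real \<times> real \<Rightarrow> real) \<Rightarrow> (real \<times> real \<Rightarrow> real) \<Rightarrow> bool" where
  "weak_perturbation \<sigma> L \<nu> \<gamma> \<theta> u v w \<longleftrightarrow>
     (u, w) \<in> V2 \<sigma> L \<and> v \<in> V1 \<sigma> L \<and>
     (\<forall>(u1, w1) \<in> V2 \<sigma> L. \<forall>v1 \<in> V1 \<sigma> L.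
        cyl_integral \<sigma> L (\<lambda>x. (u x * d_r \<sigma> L u x + w x * d_z \<sigma> L u x) * u1 x
                            + (u x * d_r \<sigma> L w x + w x * d_z \<sigma> L w x) * w1 x)
        - cyl_integral \<sigma> L (\<lambda>(r, z). (v (r, z) + v_bg \<sigma> \<gamma> \<theta> r)\<^sup>2 / r * u1 (r, z))
        = - \<nu> * cyl_integral \<sigma> L (\<lambda>x. grad \<sigma> L u x \<bullet> grad \<sigma> L u1 x + grad \<sigma> L w x \<bullet> grad \<sigma> L w1 x)
          - \<nu> * cyl_integral \<sigma> L (\<lambda>(r, z). u (r, z) * u1 (r, z) / r\<^sup>2)
        \<and>
        cyl_integral \<sigma> L (\<lambda>x. (u x * d_r \<sigma> L v x + w x * d_z \<sigma> L v x) * v1 x)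
        + cyl_integral \<sigma> L (\<lambda>(r, z). u (r, z) * dv_bg \<sigma> \<gamma> \<theta> r * v1 (r, z))
        + cyl_integral \<sigma> L (\<lambda>(r, z). u (r, z) * (v (r, z) + v_bg \<sigma> \<gamma> \<theta> r) / r * v1 (r, z))
        = - \<nu> * cyl_integral \<sigma> L (\<lambda>x. grad \<sigma> L v x \<bullet> grad \<sigma> L v1 x)
          - \<nu> * cyl_integral \<sigma> L (\<lambda>(r, z). (dv_bg \<sigma> \<gamma> \<theta> r, 0) \<bullet> grad \<sigma> L v1 (r, z))
          - \<nu> * cyl_integral \<sigma> L (\<lambda>(r, z). (v (r, z) + v_bg \<sigma> \<gamma> \<theta> r) * v1 (r, z) / r\<^sup>2))"

definition weak_solution ::
    "real \<Rightarrow> real \<Rightarrow> real \<Rightarrow> real \<Rightarrow> (real \<Rightarrow> real) \<Rightarrow>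
     (real \<times> real \<Rightarrow> real) \<Rightarrow> (real \<times> real \<Rightarrow> real) \<Rightarrow> (real \<times> real \<Rightarrow> real) \<Rightarrow> bool" where
  "weak_solution \<sigma> L \<nu> \<gamma> \<theta> u v w \<longleftrightarrow>
     weak_perturbation \<sigma> L \<nu> \<gamma> \<theta> u (\<lambda>(r, z). v (r, z) - v_bg \<sigma> \<gamma> \<theta> r) w"

end

(*
  The two weak equations say that G(U, .) = 0 on M, the closed space of jets (values and weak
  gradients) of divergence-free (u, w) and of v. By skewness of advection the derivatives in the
  nonlinear terms can be put on the test function, so G only involves products of undifferentiated
  components of U; these are weakly continuous on balls of M by a Poincare inequality on small cells.
  In G(U, U) the nonlinear terms cancel. The linear terms with the background flow V are small
  compared with the gradient norm: integrating by parts leaves only V and not its derivative, and as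
  |V| is of order epsilon / (r - sigma), Hardy's inequality at r = sigma applies. Hence G(U, U) >= 0
  on a large sphere, where Brouwer degree gives zeros on finite-dimensional subspaces, and weak
  compactness of balls of M gives a zero of G.
*)
theory Submission
  imports Defs "HOL-Homology.Homology"
begin

section \<open>Zeros of vector fields: degree, weak compactness and the Galerkin limit\<close>

section \<open>Zeros of vector fields on finite-dimensional discs\<close>

text \<open>The strip is unbounded in \<open>r\<close>, so the energy space does not embed compactly
  into L2 and strong convergence is available on bounded parts only. This suffices because each
  product of two unknowns is paired with one fixed L2 function, a component of the test jet: that
  function can be truncated in size and in \<open>r\<close>, and the remainder is controlled by a
  uniform L4 bound on the unknowns.

  Members of \<open>V1\<close> are functions subject to trace conditions, not classes, and form no
  Hilbert space as a type. Passing to jets in copies of the L2 space of the plane gives one, and the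
  traces and the divergence constraint then have to be shown closed. Zero traces are converted into
  the statement that the function is, on almost every line, a primitive starting from 0; all
  integrations by parts are Fubini arguments on such lines.

  The logarithmic cut-off is what makes \<open>|V| (r - \<sigma>)\<close> of order
  \<open>\<epsilon>\<close> although \<open>V\<close> keeps its full value at the wall. No
  comparable smallness holds for \<open>V\<close> or its derivative.\<close>

definition nrm :: "nat \<Rightarrow> (nat \<Rightarrow> real) \<Rightarrow> nat \<Rightarrow> real" where
  "nrm p v = (\<lambda>i. if i \<le> p then v i / sqrt (\<Sum>j\<le>p. (v j)\<^sup>2) else 0)"

lemma sum_nrm_eq_1:
  assumes "(\<Sum>i\<le>p. (v i)\<^sup>2) \<noteq> 0"
  shows "(\<Sum>i\<le>p. (nrm p v i)\<^sup>2) = 1"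
proof -
  have "0 \<le> (\<Sum>i\<le>p. (v i)\<^sup>2)" by (simp add: sum_nonneg)
  then have "(\<Sum>i\<le>p. (nrm p v i)\<^sup>2) = (\<Sum>i\<le>p. (v i)\<^sup>2 / (\<Sum>i\<le>p. (v i)\<^sup>2))"
    by (intro sum.cong) (auto simp: nrm_def power_divide)
  also have "\<dots> = 1" using assms by (simp flip: sum_divide_distrib)
  finally show ?thesis .
qed

text \<open>Dividing a nowhere vanishing homotopy of fields by its length gives a homotopy of sphere
  maps. In \<open>nrm\<close> the coordinates beyond \<open>p\<close> are set to 0 because
  \<open>nsphere p\<close> lives in the space of all real sequences.\<close>

lemma homotopic_nrm:
  fixes V :: "real \<Rightarrow> (nat \<Rightarrow> real) \<Rightarrow> nat \<Rightarrow> real"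
  assumes cont: "\<And>i. i \<le> p \<Longrightarrow>
      continuous_map (prod_topology (top_of_set {0..1}) X) euclideanreal (\<lambda>z. V (fst z) (snd z) i)"
    and nz: "\<And>t x. t \<in> {0..1} \<Longrightarrow> x \<in> topspace X \<Longrightarrow> (\<Sum>i\<le>p. (V t x i)\<^sup>2) \<noteq> 0"
  shows "homotopic_with (\<lambda>x. True) X (nsphere p) (\<lambda>x. nrm p (V 0 x)) (\<lambda>x. nrm p (V 1 x))"
proof -
  let ?P = "prod_topology (top_of_set {0..1::real}) X"
  have cs: "continuous_map ?P euclideanreal (\<lambda>z. nrm p (V (fst z) (snd z)) i)" for i
  proof (cases "i \<le> p")
    case True
    have "continuous_map ?P euclideanreal (\<lambda>z. sqrt (\<Sum>j\<le>p. (V (fst z) (snd z) j)\<^sup>2))"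
      by (intro continuous_intros cont) auto
    moreover have "sqrt (\<Sum>j\<le>p. (V (fst z) (snd z) j)\<^sup>2) \<noteq> 0" if "z \<in> topspace ?P" for z
      using that nz[of "fst z" "snd z"] by (auto simp: topspace_prod_topology)
    ultimately have "continuous_map ?P euclideanreal
        (\<lambda>z. V (fst z) (snd z) i / sqrt (\<Sum>j\<le>p. (V (fst z) (snd z) j)\<^sup>2))"
      by (intro continuous_map_real_divide cont True) auto
    then show ?thesis using True by (simp add: nrm_def)
  qed (simp add: nrm_def)
  have "continuous_map ?P (nsphere p) (\<lambda>z. nrm p (V (fst z) (snd z)))"
    unfolding nsphere continuous_map_in_subtopology continuous_map_componentwise_UNIV
    using cs nz by (auto simp: topspace_prod_topology sum_nrm_eq_1) (simp add: nrm_def)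
  then show ?thesis
    unfolding homotopic_with
    by (subst homotopic_with) (auto intro!: exI[of _ "\<lambda>z. nrm p (V (fst z) (snd z))"])
qed

text \<open>If \<open>F\<close> had no zero, its normalization on the sphere of radius
  \<open>R\<close> would be homotopic to the identity, since \<open>F\<close> never points strictly
  inward there, and also to a constant, by shrinking the radius to 0. The sphere would then be
  contractible.\<close>

lemma zero_on_disc:
  fixes F :: "(nat \<Rightarrow> real) \<Rightarrow> nat \<Rightarrow> real" and p :: nat and R :: real
  defines "D \<equiv> {x. (\<Sum>i\<le>p. (x i)\<^sup>2) \<le> R\<^sup>2 \<and> (\<forall>i>p. x i = 0)}"
  assumes "R > 0"
    and cont: "\<And>i. i \<le> p \<Longrightarrow> continuous_map (subtopology (powertop_real UNIV) D) euclideanreal (\<lambda>x. F x i)"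
    and pos: "\<And>x. x \<in> D \<Longrightarrow> (\<Sum>i\<le>p. (x i)\<^sup>2) = R\<^sup>2 \<Longrightarrow> (\<Sum>i\<le>p. x i * F x i) \<ge> 0"
  shows "\<exists>x\<in>D. \<forall>i\<le>p. F x i = 0"
proof (rule ccontr)
  assume "\<not> ?thesis"
  then have nz: "(\<Sum>i\<le>p. (F x i)\<^sup>2) \<noteq> 0" if "x \<in> D" for x
    using that by (auto simp: sum_nonneg_eq_0_iff)
  let ?X = "nsphere p" and ?I = "top_of_set {0..1::real}"
  have tX: "x \<in> topspace ?X \<longleftrightarrow> (\<Sum>i\<le>p. (x i)\<^sup>2) = 1 \<and> (\<forall>i>p. x i = 0)" for x
    by (simp add: nsphere)
  have scl: "(\<lambda>i. s * R * x i) \<in> D" if "x \<in> topspace ?X" "s \<in> {0..1}" for s x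
  proof -
    have "(\<Sum>i\<le>p. (s * R * x i)\<^sup>2) = (s * R)\<^sup>2 * (\<Sum>i\<le>p. (x i)\<^sup>2)"
      by (simp add: power_mult_distrib sum_distrib_left)
    also have "\<dots> = (s * R)\<^sup>2" using that by (simp add: tX)
    also have "\<dots> \<le> R\<^sup>2" using that \<open>R > 0\<close> by (intro power_mono) (auto intro: mult_left_le_one_le)
    finally show ?thesis using that by (simp add: D_def tX)
  qed
  have cx: "continuous_map (prod_topology ?I ?X) euclideanreal (\<lambda>z. snd z i)" for i
    using continuous_map_compose[OF continuous_map_snd continuous_map_nsphere_projection] by (simp add: o_def)
  have ct: "continuous_map (prod_topology ?I ?X) euclideanreal (\<lambda>z. fst z)"
    using continuous_map_into_fulltopology[OF continuous_map_fst] by auto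
  have cF: "continuous_map (prod_topology ?I ?X) euclideanreal (\<lambda>z. F (\<lambda>k. s (fst z) * R * snd z k) i)"
    if "i \<le> p" "continuous_map (prod_topology ?I ?X) euclideanreal (\<lambda>z. s (fst z))" "\<And>t. t \<in> {0..1} \<Longrightarrow> s t \<in> {0..1}" for i s
  proof -
    have "continuous_map (prod_topology ?I ?X) (subtopology (powertop_real UNIV) D) (\<lambda>z k. s (fst z) * R * snd z k)"
      unfolding continuous_map_in_subtopology continuous_map_componentwise_UNIV
      using scl that by (auto intro!: continuous_intros cx)
    from continuous_map_compose[OF this cont[OF that(1)]] show ?thesis by (simp add: o_def)
  qed
  \<comment> \<open>Straight line from the identity to \<open>F\<close>. For \<open>t < 1\<close>
    its inner product with \<open>x\<close> is at least \<open>1 - t > 0\<close>, so the weak sign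
    condition on the sphere suffices; at \<open>t = 1\<close> the absence of zeros of
    \<open>F\<close> takes over. The factor 1 keeps the shape \<open>s * R\<close> required by
    \<open>cF\<close>.\<close>
  define V1 where "V1 = (\<lambda>t x i. (1 - t) * x i + t * F (\<lambda>k. 1 * R * x k) i)"
  have h1: "homotopic_with (\<lambda>x. True) ?X ?X (\<lambda>x. nrm p (V1 0 x)) (\<lambda>x. nrm p (V1 1 x))"
  proof (rule homotopic_nrm)
    fix i assume "i \<le> p"
    show "continuous_map (prod_topology ?I ?X) euclideanreal (\<lambda>z. V1 (fst z) (snd z) i)"
      unfolding V1_def by (intro continuous_intros cx ct cF \<open>i \<le> p\<close>) auto
  next
    fix t :: real and x assume t: "t \<in> {0..1}" and x: "x \<in> topspace ?X"
    show "(\<Sum>i\<le>p. (V1 t x i)\<^sup>2) \<noteq> 0"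
    proof
      assume "(\<Sum>i\<le>p. (V1 t x i)\<^sup>2) = 0"
      then have z: "V1 t x i = 0" if "i \<le> p" for i using that by (simp add: sum_nonneg_eq_0_iff)
      show False
      proof (cases "t = 1")
        case True
        then have "(\<Sum>i\<le>p. (F (\<lambda>k. 1 * R * x k) i)\<^sup>2) = 0" using z by (simp add: V1_def)
        then show False using nz scl[OF x, of 1] by simp
      next
        case False
        have xD: "(\<lambda>i. 1 * R * x i) \<in> D" using scl[OF x, of 1] by simp
        have "(\<Sum>i\<le>p. (1 * R * x i)\<^sup>2) = R\<^sup>2"
          using x by (simp add: tX power_mult_distrib flip: sum_distrib_left)
        from pos[OF xD this] have "0 \<le> R * (\<Sum>i\<le>p. x i * F (\<lambda>k. 1 * R * x k) i)"
          by (simp add: sum_distrib_left mult.assoc)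
        then have q: "0 \<le> (\<Sum>i\<le>p. x i * F (\<lambda>k. 1 * R * x k) i)"
          using \<open>R > 0\<close> by (simp add: zero_le_mult_iff)
        have "0 = (\<Sum>i\<le>p. x i * V1 t x i)" using z by simp
        also have "\<dots> = (1 - t) * (\<Sum>i\<le>p. (x i)\<^sup>2) + t * (\<Sum>i\<le>p. x i * F (\<lambda>k. 1 * R * x k) i)"
          by (simp add: V1_def sum_distrib_left flip: sum.distrib) (simp add: algebra_simps power2_eq_square)
        also have "\<dots> > 0" using x q t False by (intro add_pos_nonneg mult_nonneg_nonneg) (auto simp: tX)
        finally show False by simp
      qed
    qed
  qed
  \<comment> \<open>The radius shrinks from \<open>R\<close> to 0, so the homotopy starts where the
    previous one ends and finishes at a constant map.\<close>
  define V2 where "V2 = (\<lambda>t x. F (\<lambda>k. (1 - t) * R * x k))"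
  have h2: "homotopic_with (\<lambda>x. True) ?X ?X (\<lambda>x. nrm p (V2 0 x)) (\<lambda>x. nrm p (V2 1 x))"
  proof (rule homotopic_nrm)
    fix i assume "i \<le> p"
    show "continuous_map (prod_topology ?I ?X) euclideanreal (\<lambda>z. V2 (fst z) (snd z) i)"
      unfolding V2_def by (rule cF) (auto intro!: continuous_intros ct \<open>i \<le> p\<close>)
  next
    fix t :: real and x assume t: "t \<in> {0..1}" and x: "x \<in> topspace ?X"
    then show "(\<Sum>i\<le>p. (V2 t x i)\<^sup>2) \<noteq> 0"
      unfolding V2_def by (intro nz scl) auto
  qed
  have "homotopic_with (\<lambda>x. True) ?X ?X (\<lambda>x. nrm p (V1 0 x)) (\<lambda>x. nrm p (V2 1 x))"
    using homotopic_with_trans[OF h1, of "\<lambda>x. nrm p (V2 1 x)"] h2 by (simp add: V1_def V2_def)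
  then have "homotopic_with (\<lambda>x. True) ?X ?X id (\<lambda>x. nrm p (F (\<lambda>k. 0)))"
  proof (rule homotopic_with_eq)
    fix x assume "x \<in> topspace ?X"
    then show "id x = nrm p (V1 0 x)" by (auto simp: V1_def nrm_def tX fun_eq_iff)
  qed (auto simp: V2_def)
  then have "contractible_space ?X" unfolding contractible_space_def by blast
  then show False by (simp add: non_contractible_space_nsphere)
qed

section \<open>Weak compactness in Hilbert spaces\<close>

text \<open>A minimizing sequence for the distance is Cauchy by the parallelogram law; completeness
  and closedness give a minimizer, and minimality along lines through it gives
  orthogonality.\<close>

lemma orthogonal_projection_exists:
  fixes M :: "'h::{real_inner,complete_space} set"
  assumes M: "subspace M" "closed M"
  shows "\<exists>m\<in>M. \<forall>y\<in>M. inner (x - m) y = 0"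
proof -
  define d where "d = infdist x M"
  have ne: "M \<noteq> {}" using M subspace_0 by blast
  have d0: "d \<ge> 0" by (simp add: d_def infdist_nonneg)
  have dle: "d \<le> norm (x - m)" if "m \<in> M" for m
    using infdist_le[OF that, of x] by (simp add: d_def dist_norm)
  have "\<exists>m\<in>M. norm (x - m) < d + inverse (Suc n)" for n
  proof -
    have "Inf (dist x ` M) < d + inverse (Suc n)" using ne by (simp add: d_def infdist_notempty)
    from cInf_lessD[OF _ this] ne show ?thesis by (auto simp: dist_norm)
  qed
  then obtain m where m: "\<And>n. m n \<in> M" "\<And>n. norm (x - m n) < d + inverse (Suc n)" by metis
  \<comment> \<open>Parallelogram law: the midpoint of \<open>a\<close> and \<open>b\<close> lies in
    \<open>M\<close>, so its distance from \<open>x\<close> is at least \<open>d\<close>.\<close>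
  have par: "(norm (a - b))\<^sup>2 \<le> 2 * ((norm (x - a))\<^sup>2 - d\<^sup>2) + 2 * ((norm (x - b))\<^sup>2 - d\<^sup>2)"
    if "a \<in> M" "b \<in> M" for a b
  proof -
    have "(1/2) *\<^sub>R (a + b) \<in> M" using that M by (simp add: subspace_add subspace_scale)
    from dle[OF this] have "d\<^sup>2 \<le> (norm (x - (1/2) *\<^sub>R (a + b)))\<^sup>2" using d0 by (simp add: power_mono)
    also have "\<dots> = (norm (x - a))\<^sup>2 / 2 + (norm (x - b))\<^sup>2 / 2 - (norm (a - b))\<^sup>2 / 4"
      by (simp add: power2_norm_eq_inner inner_diff_left inner_diff_right inner_add_left inner_add_right
          inner_commute field_simps)
    finally show ?thesis by (simp add: field_simps)
  qed
  have lim: "(\<lambda>n. norm (x - m n)) \<longlonglongrightarrow> d"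
  proof (rule tendsto_sandwich)
    show "(\<lambda>n. d) \<longlonglongrightarrow> d" by simp
    show "(\<lambda>n. d + inverse (real (Suc n))) \<longlonglongrightarrow> d"
      using tendsto_add[OF tendsto_const LIMSEQ_inverse_real_of_nat, of d] by simp
    show "\<forall>\<^sub>F n in sequentially. d \<le> norm (x - m n)" using m(1) dle by simp
    show "\<forall>\<^sub>F n in sequentially. norm (x - m n) \<le> d + inverse (real (Suc n))"
      using m(2) by (intro always_eventually allI less_imp_le)
  qed
  have lim2: "(\<lambda>n. (norm (x - m n))\<^sup>2 - d\<^sup>2) \<longlonglongrightarrow> 0"
    using tendsto_diff[OF tendsto_power[OF lim, of 2] tendsto_const, of "d\<^sup>2"] by simp
  have "Cauchy m"
  proof (rule metric_CauchyI)
    fix e :: real assume "e > 0"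
    then have "e\<^sup>2 / 4 > 0" by simp
    from order_tendstoD(2)[OF lim2 this] obtain N
      where N: "\<And>n. n \<ge> N \<Longrightarrow> (norm (x - m n))\<^sup>2 - d\<^sup>2 < e\<^sup>2 / 4" by (auto simp: eventually_sequentially)
    have "dist (m k) (m l) < e" if "k \<ge> N" "l \<ge> N" for k l
    proof -
      have *: "A < E" if "A \<le> 2 * B + 2 * C" "B < E / 4" "C < E / 4" for A B C E :: real
        using that by linarith
      have "(norm (m k - m l))\<^sup>2 < e\<^sup>2" by (rule *[OF par[OF m(1) m(1)] N[OF that(1)] N[OF that(2)]])
      then show ?thesis using \<open>e > 0\<close> by (simp add: dist_norm power_less_imp_less_base)
    qed
    then show "\<exists>N. \<forall>k\<ge>N. \<forall>l\<ge>N. dist (m k) (m l) < e" by blast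
  qed
  then obtain m0 where m0: "m \<longlonglongrightarrow> m0" using Cauchy_convergent convergent_def by blast
  have m0M: "m0 \<in> M" using closed_sequentially[OF M(2) m(1) m0] .
  have "(\<lambda>n. norm (x - m n)) \<longlonglongrightarrow> norm (x - m0)" by (intro tendsto_intros m0)
  then have nd: "norm (x - m0) = d" using lim LIMSEQ_unique by blast
  have "inner (x - m0) y = 0" if y: "y \<in> M" for y
  proof (cases "y = 0")
    case False
    \<comment> \<open>The minimizer of the quadratic below; it lowers the squared distance by
      exactly the square of \<open>inner (x - m0) y\<close> over the squared norm of
      \<open>y\<close>.\<close>
    define t where "t = inner (x - m0) y / (norm y)\<^sup>2"
    have "m0 + t *\<^sub>R y \<in> M" using m0M y M by (simp add: subspace_add subspace_scale)
    from dle[OF this] have "(norm (x - m0))\<^sup>2 \<le> (norm (x - m0 - t *\<^sub>R y))\<^sup>2"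
      using d0 nd by (simp add: power_mono diff_diff_eq)
    also have "\<dots> = (norm (x - m0))\<^sup>2 - 2 * t * inner (x - m0) y + t\<^sup>2 * (norm y)\<^sup>2"
      unfolding power2_norm_eq_inner
      by (simp add: inner_diff_left inner_diff_right inner_commute algebra_simps power2_eq_square)
    also have "\<dots> = (norm (x - m0))\<^sup>2 - (inner (x - m0) y)\<^sup>2 / (norm y)\<^sup>2"
      using False by (simp add: t_def field_simps power2_eq_square)
    finally have "(inner (x - m0) y)\<^sup>2 / (norm y)\<^sup>2 \<le> 0" by simp
    then show ?thesis using False by (simp add: divide_le_0_iff)
  qed simp
  then show ?thesis using m0M by blast
qed

text \<open>A functional is determined by its kernel and one value off it; \<open>w\<close> is the
  part orthogonal to the kernel of a point where \<open>f\<close> does not vanish, and a suitable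
  multiple of \<open>w\<close> represents \<open>f\<close>.\<close>

lemma riesz_representation:
  fixes f :: "'h::{real_inner,complete_space} \<Rightarrow> real"
  assumes f: "bounded_linear f"
  shows "\<exists>h. \<forall>x. f x = inner h x"
proof (cases "\<forall>x. f x = 0")
  case True
  then show ?thesis by (auto intro: exI[of _ 0])
next
  case False
  then obtain z where z: "f z \<noteq> 0" by blast
  interpret f: bounded_linear f by fact
  let ?K = "{x. f x = 0}"
  have "subspace ?K" by (auto simp: subspace_def f.add f.scaleR f.zero)
  moreover have "closed ?K"
    by (intro closed_Collect_eq f.continuous_on continuous_intros)
  ultimately obtain m where m: "f m = 0" "\<And>y. f y = 0 \<Longrightarrow> inner (z - m) y = 0"
    using orthogonal_projection_exists[of ?K z] by auto
  define w where "w = z - m"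
  have w: "f w \<noteq> 0" "w \<noteq> 0" using z m by (auto simp: w_def f.diff f.zero)
  have "f x = inner ((f w / (norm w)\<^sup>2) *\<^sub>R w) x" for x
  proof -
    have "f (x - (f x / f w) *\<^sub>R w) = 0" using w by (simp add: f.diff f.scaleR)
    from m(2)[OF this] have "inner w x = f x / f w * (norm w)\<^sup>2"
      by (simp add: w_def inner_diff_right power2_norm_eq_inner)
    then show ?thesis using w by (simp add: field_simps)
  qed
  then show ?thesis by blast
qed

text \<open>The initial topology of all functionals \<open>\<lambda>U. inner U h\<close>, obtained
  in one stroke by viewing \<open>U\<close> as a point of the product space
  \<open>'h \<Rightarrow> real\<close>. Tychonoff's theorem then applies directly.\<close>

definition weak_topology :: "'h::real_inner topology" where
  "weak_topology = pullback_topology UNIV (\<lambda>U h. inner U h) euclidean"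

lemma topspace_weak_topology [simp]: "topspace weak_topology = UNIV"
  by (simp add: weak_topology_def topspace_pullback_topology)

lemma continuous_map_weak_inner:
  "continuous_map weak_topology euclideanreal (\<lambda>U. inner U h)"
proof -
  have "continuous_map euclidean euclideanreal (\<lambda>f :: 'a \<Rightarrow> real. f h)"
    by (simp add: continuous_on_product_coordinates)
  from continuous_map_pullback[OF this] show ?thesis by (simp add: weak_topology_def o_def)
qed

lemma continuous_map_into_weak:
  assumes "\<And>h. continuous_map X euclideanreal (\<lambda>x. inner (g x) h)"
  shows "continuous_map X weak_topology g"
  unfolding weak_topology_def
proof (rule continuous_map_pullback')
  show "continuous_map X euclidean ((\<lambda>U h. inner U h) \<circ> g)"
    unfolding euclidean_product_topology[symmetric] continuous_map_componentwise_UNIV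
    using assms by simp
qed auto

text \<open>Banach-Alaoglu: the image in the product space consists of the linear functionals
  bounded by \<open>R\<close> times the norm that annihilate the orthogonal complement of
  \<open>M\<close>. These are closed conditions inside a product of compact intervals, and the Riesz
  representation turns the functionals back into vectors.\<close>

lemma compactin_weak_topology:
  fixes M :: "'h::{real_inner,complete_space} set"
  assumes M: "subspace M" "closed M" and "R > 0"
  shows "compactin weak_topology (M \<inter> cball 0 R)"
proof -
  let ?\<Lambda> = "\<lambda>(U::'h) h. inner U h"
  let ?B = "M \<inter> cball 0 R"
  \<comment> \<open>Membership in \<open>M\<close> becomes a family of equations, since a closed
    subspace is the annihilator of its orthogonal complement.\<close>
  have eq: "?\<Lambda> ` ?B = (\<Inter>x. \<Inter>y. {f. f (x + y) = f x + f y}) \<inter> (\<Inter>c. \<Inter>x. {f. f (c *\<^sub>R x) = c * f x})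
      \<inter> (\<Inter>x. {f. \<bar>f x\<bar> \<le> R * norm x}) \<inter> (\<Inter>x\<in>{x. \<forall>m\<in>M. inner m x = 0}. {f. f x = 0})" (is "_ = ?C")
  proof (intro equalityI subsetI)
    fix f assume "f \<in> ?\<Lambda> ` ?B"
    then obtain U where U: "U \<in> M" "norm U \<le> R" "f = ?\<Lambda> U" by auto
    have "\<bar>inner U x\<bar> \<le> R * norm x" for x
      by (rule order_trans[OF Cauchy_Schwarz_ineq2]) (simp add: U mult_right_mono)
    with U show "f \<in> ?C" by (auto simp: inner_add_right)
  next
    fix f assume f: "f \<in> ?C"
    have "bounded_linear f"
      by (rule bounded_linear_intro[where K = R]) (use f in \<open>auto simp: mult.commute\<close>)
    then obtain U where U: "\<And>x. f x = inner U x" using riesz_representation by blast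
    have "norm U \<le> R"
    proof (cases "U = 0")
      case True
      then show ?thesis using \<open>R > 0\<close> by simp
    next
      case False
      have "\<bar>f U\<bar> \<le> R * norm U" using f by auto
      then have "norm U * norm U \<le> R * norm U" using U by (simp add: power2_norm_eq_inner[symmetric] power2_eq_square)
      then show ?thesis using False by simp
    qed
    \<comment> \<open>\<open>U - m\<close> is orthogonal to \<open>M\<close>, so \<open>f\<close>
      annihilates it; hence it is orthogonal to \<open>U\<close>, to \<open>m\<close>, and finally
      to itself.\<close>
    moreover have "U \<in> M"
    proof -
      obtain m where m: "m \<in> M" "\<And>y. y \<in> M \<Longrightarrow> inner (U - m) y = 0"
        using orthogonal_projection_exists[OF M] by blast
      then have "f (U - m) = 0" using f by (auto simp: inner_commute)
      then have "inner U (U - m) = 0" by (simp add: U)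
      moreover have "inner m (U - m) = 0" using m by (simp add: inner_commute)
      ultimately have "inner (U - m) (U - m) = 0" by (simp add: inner_diff_left)
      then show ?thesis using m by simp
    qed
    ultimately show "f \<in> ?\<Lambda> ` ?B" using U by (auto intro!: image_eqI[of _ _ U])
  qed
  have "closed ?C"
    by (intro closed_Int closed_INT ballI closed_Collect_eq closed_Collect_le continuous_intros continuous_on_product_coordinates)
  moreover have "compact (PiE UNIV (\<lambda>x::'h. {- (R * norm x)..R * norm x}))"
    using compactin_PiE[of "\<lambda>_. euclideanreal" UNIV "\<lambda>x::'h. {- (R * norm x)..R * norm x}"]
    by (simp add: euclidean_product_topology)
  moreover have "?C \<subseteq> PiE UNIV (\<lambda>x::'h. {- (R * norm x)..R * norm x})"
    by (auto simp: abs_le_iff minus_le_iff)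
  ultimately have comp: "compact (?\<Lambda> ` ?B)"
    unfolding eq using compact_Int_closed[of "PiE UNIV (\<lambda>x::'h. {- (R * norm x)..R * norm x})" ?C]
    by (simp only: Int_absorb1)
  \<comment> \<open>Open sets of the pullback topology are preimages, so an open cover of the ball
    comes from an open cover of its compact image.\<close>
  show ?thesis
    unfolding compactin_def
  proof (intro conjI allI impI)
    fix \<U> assume \<U>: "Ball \<U> (openin weak_topology) \<and> ?B \<subseteq> \<Union> \<U>"
    then have "\<forall>S\<in>\<U>. \<exists>T. open T \<and> S = ?\<Lambda> -` T"
      by (auto simp: weak_topology_def openin_pullback_topology)
    then obtain T where T: "\<And>S. S \<in> \<U> \<Longrightarrow> open (T S)" "\<And>S. S \<in> \<U> \<Longrightarrow> S = ?\<Lambda> -` T S" by metis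
    have "?\<Lambda> ` ?B \<subseteq> \<Union> (T ` \<U>)"
    proof clarify
      fix U assume "U \<in> M" "U \<in> cball 0 R"
      then obtain S where "S \<in> \<U>" "U \<in> S" using \<U> by blast
      then show "?\<Lambda> U \<in> \<Union> (T ` \<U>)" using T(2) by blast
    qed
    with comp T(1) obtain \<F> where F: "\<F> \<subseteq> \<U>" "finite \<F>" "?\<Lambda> ` ?B \<subseteq> \<Union> (T ` \<F>)"
      by (metis compactE_image)
    have "?B \<subseteq> \<Union> \<F>"
    proof
      fix U assume "U \<in> ?B"
      then obtain S where "S \<in> \<F>" "?\<Lambda> U \<in> T S" using F(3) by blast
      then show "U \<in> \<Union> \<F>" using T(2)[of S] F(1) by blast
    qed
    then show "\<exists>\<F>. finite \<F> \<and> \<F> \<subseteq> \<U> \<and> ?B \<subseteq> \<Union> \<F>" using F by blast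
  qed auto
qed

section \<open>Galerkin approximation\<close>

text \<open>Testing against \<open>E\<close> amounts to testing against an orthonormal basis of
  \<open>span E\<close>. In its coordinates the norm is Euclidean, and \<open>G U U \<ge> 0\<close>
  on the sphere of radius \<open>R\<close> becomes the boundary condition of
  \<open>zero_on_disc\<close>.\<close>

lemma finite_galerkin:
  fixes M :: "'h::{real_inner,complete_space} set" and G :: "'h \<Rightarrow> 'h \<Rightarrow> real"
  assumes M: "subspace M" and "R > 0"
    and add: "\<And>U a b. U \<in> M \<Longrightarrow> norm U \<le> R \<Longrightarrow> a \<in> M \<Longrightarrow> b \<in> M \<Longrightarrow> G U (a + b) = G U a + G U b"
    and scale: "\<And>U a c. U \<in> M \<Longrightarrow> norm U \<le> R \<Longrightarrow> a \<in> M \<Longrightarrow> G U (c *\<^sub>R a) = c * G U a"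
    and cont: "\<And>a. a \<in> M \<Longrightarrow> continuous_map (subtopology weak_topology (M \<inter> cball 0 R)) euclideanreal (\<lambda>U. G U a)"
    and pos: "\<And>U. U \<in> M \<Longrightarrow> norm U = R \<Longrightarrow> G U U \<ge> 0"
    and E: "finite E" "E \<subseteq> M"
  shows "\<exists>U\<in>M. norm U \<le> R \<and> (\<forall>a\<in>E. G U a = 0)"
proof -
  obtain C0 where C0: "finite C0" "span C0 = span E" "pairwise orthogonal C0"
    using basis_orthogonal[OF E(1)] by blast
  \<comment> \<open>The orthogonal basis may contain the zero vector; it is removed before
    normalizing.\<close>
  define C where "C = (\<lambda>x. x /\<^sub>R norm x) ` (C0 - {0})"
  have finC: "finite C" using C0 by (simp add: C_def)
  have spM: "span E \<subseteq> M" using M E(2) by (simp add: span_minimal)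
  have CM: "C \<subseteq> M" unfolding C_def using C0(2) spM
    by (auto intro!: subspace_scale[OF M] simp: span_base subset_iff)
  have orth: "inner x y = (if x = y then 1 else 0)" if xy: "x \<in> C" "y \<in> C" for x y
  proof -
    obtain a b where ab: "a \<in> C0" "a \<noteq> 0" "x = a /\<^sub>R norm a" "b \<in> C0" "b \<noteq> 0" "y = b /\<^sub>R norm b"
      using xy by (auto simp: C_def)
    show ?thesis
    proof (cases "a = b")
      case True
      then show ?thesis using ab by (simp add: dot_square_norm power2_eq_square)
    next
      case False
      then have "inner a b = 0" using C0(3) ab by (auto simp: pairwise_def orthogonal_def)
      then have i0: "inner x y = 0" using ab by simp
      have "inner x x \<noteq> 0" using ab by simp
      then have "x \<noteq> y" using i0 by auto
      with i0 show ?thesis by simp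
    qed
  qed
  have ES: "E \<subseteq> span C"
  proof -
    have "x \<in> span C" if "x \<in> C0" for x
    proof (cases "x = 0")
      case False
      then have "x /\<^sub>R norm x \<in> span C" using that by (auto simp: C_def intro!: span_base)
      then have "norm x *\<^sub>R (x /\<^sub>R norm x) \<in> span C" by (rule span_scale)
      then show ?thesis using False by simp
    qed (simp add: span_zero)
    then have "span C0 \<subseteq> span C" by (intro span_minimal subsetI) auto
    then show ?thesis using C0(2) span_superset by blast
  qed
  show ?thesis
  proof (cases "C = {}")
    \<comment> \<open>The disc in \<open>zero_on_disc\<close> has at least one coordinate, so the
      trivial span is treated apart.\<close>
    case True
    then have "E \<subseteq> {0}" using ES by simp
    moreover have "G 0 0 = 0" using scale[of 0 0 0] M \<open>R > 0\<close> by (simp add: subspace_0)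
    ultimately show ?thesis using \<open>R > 0\<close> M by (intro bexI[of _ 0]) (auto simp: subspace_0)
  next
    case False
    \<comment> \<open>\<open>zero_on_disc\<close> counts the coordinates from 0 to \<open>p\<close>,
      whence \<open>card C - 1\<close>.\<close>
    define p where "p = card C - 1"
    have "card C > 0" using False finC by (simp add: card_gt_0_iff)
    then have cp: "card C = Suc p" by (simp add: p_def)
    obtain b where b: "bij_betw b {..p} C"
      using ex_bij_betw_nat_finite[OF finC] cp by (metis atLeast0LessThan lessThan_Suc_atMost)
    have bM: "b i \<in> M" if "i \<le> p" for i using b that CM by (auto simp: bij_betw_def)
    have bo: "inner (b i) (b j) = (if i = j then 1 else 0)" if "i \<le> p" "j \<le> p" for i j
      using orth[of "b i" "b j"] b that by (auto simp: bij_betw_def inj_on_def)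
    define V where "V = (\<lambda>c::nat \<Rightarrow> real. \<Sum>j\<le>p. c j *\<^sub>R b j)"
    have VM: "V c \<in> M" for c unfolding V_def by (intro subspace_sum[OF M] subspace_scale[OF M] bM) auto
    have Vi: "inner (V c) (V c) = (\<Sum>j\<le>p. (c j)\<^sup>2)" for c
    proof -
      have "inner (V c) (V c) = (\<Sum>i\<le>p. \<Sum>j\<le>p. c i * (c j * inner (b i) (b j)))"
        unfolding V_def inner_sum_left inner_sum_right by (intro sum.cong refl) (simp add: inner_commute)
      also have "\<dots> = (\<Sum>i\<le>p. \<Sum>j\<le>p. if i = j then (c j)\<^sup>2 else 0)"
        by (intro sum.cong) (auto simp: bo power2_eq_square)
      also have "\<dots> = (\<Sum>j\<le>p. (c j)\<^sup>2)" by (simp add: sum.delta')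
      finally show ?thesis .
    qed
    have VR: "norm (V c) \<le> R \<longleftrightarrow> (\<Sum>j\<le>p. (c j)\<^sup>2) \<le> R\<^sup>2" for c
      using \<open>R > 0\<close> by (simp add: norm_le_square Vi)
    have Vsum: "G (V c) (\<Sum>j\<in>J. d j *\<^sub>R b j) = (\<Sum>j\<in>J. d j * G (V c) (b j))"
      if "norm (V c) \<le> R" "finite J" "J \<subseteq> {..p}" for c d J
      using that(2,3)
    proof (induction J)
      case empty
      show ?case using scale[OF VM that(1), of 0 0] M by (simp add: subspace_0)
    next
      case (insert j J)
      have "(\<Sum>j\<in>J. d j *\<^sub>R b j) \<in> M"
        using insert by (intro subspace_sum[OF M] subspace_scale[OF M] bM) auto
      moreover have "d j *\<^sub>R b j \<in> M" "b j \<in> M" using insert by (auto intro: bM subspace_scale[OF M])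
      ultimately show ?case using insert by (simp add: add[OF VM that(1)] scale[OF VM that(1)])
    qed
    let ?D = "{x. (\<Sum>i\<le>p. (x i)\<^sup>2) \<le> R\<^sup>2 \<and> (\<forall>i>p. x i = 0)}"
    have "\<exists>x\<in>?D. \<forall>i\<le>p. G (V x) (b i) = 0"
    proof (rule zero_on_disc[OF \<open>R > 0\<close>])
      fix i assume "i \<le> p"
      have "continuous_map (subtopology (powertop_real UNIV) ?D) weak_topology V"
      proof (rule continuous_map_into_weak)
        fix h
        have "continuous_map (powertop_real UNIV) euclideanreal (\<lambda>x. \<Sum>j\<le>p. x j * inner (b j) h)"
          by (intro continuous_intros continuous_map_product_projection) auto
        then show "continuous_map (subtopology (powertop_real UNIV) ?D) euclideanreal (\<lambda>x. inner (V x) h)"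
          by (simp add: V_def inner_sum_left continuous_map_from_subtopology)
      qed
      then have "continuous_map (subtopology (powertop_real UNIV) ?D)
          (subtopology weak_topology (M \<inter> cball 0 R)) V"
        by (auto simp: continuous_map_in_subtopology VM VR)
      from continuous_map_compose[OF this cont[OF bM[OF \<open>i \<le> p\<close>]]]
      show "continuous_map (subtopology (powertop_real UNIV) ?D) euclideanreal (\<lambda>x. G (V x) (b i))"
        by (simp add: o_def)
    next
      fix x assume x: "x \<in> ?D" "(\<Sum>i\<le>p. (x i)\<^sup>2) = R\<^sup>2"
      then have n: "norm (V x) = R" using \<open>R > 0\<close> by (simp add: norm_eq_sqrt_inner Vi)
      have "0 \<le> G (V x) (V x)" by (rule pos[OF VM n])
      also have "\<dots> = (\<Sum>i\<le>p. x i * G (V x) (b i))"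
        using Vsum[of x "{..p}" x] n by (simp add: V_def)
      finally show "0 \<le> (\<Sum>i\<le>p. x i * G (V x) (b i))" .
    qed
    then obtain x where x: "(\<Sum>i\<le>p. (x i)\<^sup>2) \<le> R\<^sup>2" "\<And>i. i \<le> p \<Longrightarrow> G (V x) (b i) = 0" by auto
    have nV: "norm (V x) \<le> R" using x by (simp add: VR)
    have "G (V x) a = 0" if "a \<in> span C" for a
    proof -
      have "a \<in> M \<and> G (V x) a = 0"
        using that
      proof (induction rule: span_induct_alt)
        case base
        show ?case using scale[OF VM nV, of 0 0] M by (simp add: subspace_0)
      next
        case (step c y z)
        then obtain i where i: "i \<le> p" "y = b i" using b by (auto simp: bij_betw_def)
        then show ?case using step x(2)[of i] bM[of i]
          by (auto simp: add[OF VM nV] scale[OF VM nV] subspace_scale[OF M] subspace_add[OF M])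
      qed
      then show ?thesis by simp
    qed
    then show ?thesis using VM nV ES by blast
  qed
qed

text \<open>The zero sets \<open>Z a\<close> are closed in a weakly compact ball, and any finitely
  many of them meet by \<open>finite_galerkin\<close>. The finite intersection property yields a
  common point for all test vectors at once, with no basis of \<open>M\<close> and no subsequence
  involved.\<close>

theorem galerkin_zero:
  fixes M :: "'h::{real_inner,complete_space} set" and G :: "'h \<Rightarrow> 'h \<Rightarrow> real"
  assumes M: "subspace M" "closed M" and "R > 0"
    and add: "\<And>U a b. U \<in> M \<Longrightarrow> norm U \<le> R \<Longrightarrow> a \<in> M \<Longrightarrow> b \<in> M \<Longrightarrow> G U (a + b) = G U a + G U b"
    and scale: "\<And>U a c. U \<in> M \<Longrightarrow> norm U \<le> R \<Longrightarrow> a \<in> M \<Longrightarrow> G U (c *\<^sub>R a) = c * G U a"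
    and cont: "\<And>a. a \<in> M \<Longrightarrow> continuous_map (subtopology weak_topology (M \<inter> cball 0 R)) euclideanreal (\<lambda>U. G U a)"
    and pos: "\<And>U. U \<in> M \<Longrightarrow> norm U = R \<Longrightarrow> G U U \<ge> 0"
  shows "\<exists>U\<in>M. norm U \<le> R \<and> (\<forall>a\<in>M. G U a = 0)"
proof -
  let ?B = "M \<inter> cball 0 R"
  let ?X = "subtopology weak_topology ?B"
  define Z where "Z = (\<lambda>a. {U \<in> ?B. G U a = 0})"
  have cpt: "compact_space ?X" using compactin_weak_topology[OF M \<open>R > 0\<close>] compact_space_subtopology by blast
  have cl: "closedin ?X (Z a)" if "a \<in> M" for a
    using closedin_continuous_map_preimage[OF cont[OF that], of "{0}"] by (simp add: Z_def)
  have fip: "\<Inter>\<F> \<noteq> {}" if \<F>: "finite \<F>" "\<F> \<subseteq> Z ` M" for \<F>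
  proof -
    obtain E where E: "finite E" "E \<subseteq> M" "\<F> = Z ` E" using finite_subset_image[OF \<F>] by blast
    obtain U where "U \<in> M" "norm U \<le> R" "\<forall>a\<in>E. G U a = 0"
      using finite_galerkin[OF M(1) \<open>R > 0\<close> add scale cont pos E(1,2)] by blast
    then show ?thesis using E by (auto simp: Z_def)
  qed
  have "\<Inter> (Z ` M) \<noteq> {}"
    using cpt[unfolded compact_space_fip, rule_format, of "Z ` M"] cl fip by blast
  then obtain U where U: "\<And>a. a \<in> M \<Longrightarrow> U \<in> Z a" by blast
  moreover have "0 \<in> M" using M(1) by (rule subspace_0)
  ultimately show ?thesis by (auto simp: Z_def)
qed

section \<open>Square integrable functions, test functions and weak derivatives\<close>

section \<open>The Hilbert space of square integrable functions\<close>

definition sq_int :: "('a::euclidean_space \<Rightarrow> real) \<Rightarrow> bool" where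
  "sq_int f \<longleftrightarrow> f \<in> borel_measurable borel \<and> integrable lborel (\<lambda>x. (f x)\<^sup>2)"

lemma sq_int_measurable [measurable_dest]: "sq_int f \<Longrightarrow> f \<in> borel_measurable borel"
  by (simp add: sq_int_def)

lemma sq_int_iff_nn: "sq_int f \<longleftrightarrow> f \<in> borel_measurable borel \<and> (\<integral>\<^sup>+x. ennreal ((f x)\<^sup>2) \<partial>lborel) < \<infinity>"
  by (auto simp: sq_int_def integrable_iff_bounded)

lemma sq_int_bound:
  assumes "f \<in> borel_measurable borel" "integrable lborel g" "\<And>x. (f x)\<^sup>2 \<le> g x"
  shows "sq_int f"
  unfolding sq_int_def
proof
  show "integrable lborel (\<lambda>x. (f x)\<^sup>2)"
    by (rule Bochner_Integration.integrable_bound[OF assms(2)])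
      (use assms in \<open>auto intro!: AE_I2 order_trans[OF assms(3)]\<close>)
qed (use assms in auto)

lemma sq_int_add:
  assumes "sq_int f" "sq_int g" shows "sq_int (\<lambda>x. f x + g x)"
proof (rule sq_int_bound)
  show "integrable lborel (\<lambda>x. 2 * (f x)\<^sup>2 + 2 * (g x)\<^sup>2)" using assms by (simp add: sq_int_def)
  show "(f x + g x)\<^sup>2 \<le> 2 * (f x)\<^sup>2 + 2 * (g x)\<^sup>2" for x
    using sum_squares_bound[of "f x" "g x"] by (simp add: power2_sum)
qed (use assms in \<open>auto simp: sq_int_def\<close>)

lemma sq_int_scale: "sq_int f \<Longrightarrow> sq_int (\<lambda>x. c * f x)"
  by (auto simp: sq_int_def power_mult_distrib)

lemma sq_int_uminus: "sq_int f \<Longrightarrow> sq_int (\<lambda>x. - f x)"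
  by (auto simp: sq_int_def)

lemma sq_int_diff: "sq_int f \<Longrightarrow> sq_int g \<Longrightarrow> sq_int (\<lambda>x. f x - g x)"
  using sq_int_add[OF _ sq_int_uminus, of f g] by simp

lemma integrable_sq_int_mult:
  assumes "sq_int f" "sq_int g" shows "integrable lborel (\<lambda>x. f x * g x)"
proof (rule Bochner_Integration.integrable_bound)
  show "integrable lborel (\<lambda>x. (f x)\<^sup>2 + (g x)\<^sup>2)" using assms by (simp add: sq_int_def)
  show "AE x in lborel. norm (f x * g x) \<le> norm ((f x)\<^sup>2 + (g x)\<^sup>2)"
  proof (intro AE_I2)
    fix x
    have "2 * \<bar>f x * g x\<bar> \<le> (f x)\<^sup>2 + (g x)\<^sup>2"
      using sum_squares_bound[of "\<bar>f x\<bar>" "\<bar>g x\<bar>"] by (simp add: abs_mult)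
    then show "norm (f x * g x) \<le> norm ((f x)\<^sup>2 + (g x)\<^sup>2)" by simp
  qed
qed (use assms in \<open>auto simp: sq_int_def\<close>)

text \<open>Square integrability is part of the relation, which makes it a partial equivalence: the
  quotient ranges over square integrable functions only.\<close>

definition l2eq :: "('a::euclidean_space \<Rightarrow> real) \<Rightarrow> ('a \<Rightarrow> real) \<Rightarrow> bool" where
  "l2eq f g \<longleftrightarrow> sq_int f \<and> sq_int g \<and> (AE x in lborel. f x = g x)"

lemma part_equivp_l2eq: "part_equivp l2eq"
proof (rule part_equivpI)
  show "\<exists>x. l2eq x x" by (rule exI[of _ "\<lambda>_. 0"]) (simp add: l2eq_def sq_int_def)
  show "symp l2eq" by (auto intro!: sympI simp: l2eq_def elim: eventually_mono)
  show "transp l2eq"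
  proof (rule transpI)
    fix f g h :: "'b \<Rightarrow> real" assume "l2eq f g" "l2eq g h"
    then show "l2eq f h" unfolding l2eq_def by (auto elim: eventually_elim2)
  qed
qed

quotient_type (overloaded) 'a l2 = "'a::euclidean_space \<Rightarrow> real" / partial: l2eq
  by (rule part_equivp_l2eq)

instantiation l2 :: (euclidean_space) real_inner
begin

lift_definition zero_l2 :: "'a l2" is "\<lambda>_. 0" by (simp add: l2eq_def sq_int_def)
lift_definition plus_l2 :: "'a l2 \<Rightarrow> 'a l2 \<Rightarrow> 'a l2" is "\<lambda>f g x. f x + g x"
  by (auto simp: l2eq_def sq_int_add elim: eventually_elim2)
lift_definition minus_l2 :: "'a l2 \<Rightarrow> 'a l2 \<Rightarrow> 'a l2" is "\<lambda>f g x. f x - g x"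
  by (auto simp: l2eq_def sq_int_diff elim: eventually_elim2)
lift_definition uminus_l2 :: "'a l2 \<Rightarrow> 'a l2" is "\<lambda>f x. - f x"
  by (auto simp: l2eq_def sq_int_uminus elim: eventually_mono)
lift_definition scaleR_l2 :: "real \<Rightarrow> 'a l2 \<Rightarrow> 'a l2" is "\<lambda>c f x. c * f x"
  by (auto simp: l2eq_def sq_int_scale elim: eventually_mono)
lift_definition inner_l2 :: "'a l2 \<Rightarrow> 'a l2 \<Rightarrow> real" is "\<lambda>f g. LINT x|lborel. f x * g x"
  unfolding l2eq_def by (rule integral_cong_AE) (auto elim: eventually_elim2)
definition norm_l2 :: "'a l2 \<Rightarrow> real" where "norm_l2 x = sqrt (inner x x)"
definition dist_l2 :: "'a l2 \<Rightarrow> 'a l2 \<Rightarrow> real" where "dist_l2 x y = norm (x - y)"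
definition sgn_l2 :: "'a l2 \<Rightarrow> 'a l2" where "sgn_l2 x = inverse (norm x) *\<^sub>R x"
definition uniformity_l2 :: "('a l2 \<times> 'a l2) filter" where
  "uniformity_l2 = (INF e\<in>{0<..}. principal {(x, y). dist x y < e})"
definition open_l2 :: "'a l2 set \<Rightarrow> bool" where
  "open_l2 U \<longleftrightarrow> (\<forall>x\<in>U. eventually (\<lambda>(x', y). x' = x \<longrightarrow> y \<in> U) uniformity)"

instance
proof
  fix a b c :: "'a l2" and r s :: real
  show "a + b + c = a + (b + c)" by transfer (simp add: l2eq_def sq_int_add add.assoc)
  show "a + b = b + a" by transfer (simp add: l2eq_def sq_int_add add.commute)
  show "0 + a = a" by transfer (simp add: l2eq_def)
  show "- a + a = 0" by transfer (simp add: l2eq_def sq_int_def)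
  show "a - b = a + - b" by transfer (simp add: l2eq_def sq_int_diff)
  show "r *\<^sub>R (a + b) = r *\<^sub>R a + r *\<^sub>R b"
    by transfer (simp add: l2eq_def sq_int_add sq_int_scale distrib_left)
  show "(r + s) *\<^sub>R a = r *\<^sub>R a + s *\<^sub>R a"
    by transfer (simp add: l2eq_def sq_int_add sq_int_scale distrib_right)
  show "r *\<^sub>R s *\<^sub>R a = (r * s) *\<^sub>R a" by transfer (simp add: l2eq_def sq_int_scale mult.assoc)
  show "1 *\<^sub>R a = a" by transfer (simp add: l2eq_def)
  show "inner a b = inner b a" by transfer (simp add: mult.commute)
  show "inner (a + b) c = inner a c + inner b c"
    by transfer (simp add: l2eq_def distrib_right integrable_sq_int_mult)
  show "inner (r *\<^sub>R a) b = r * inner a b" by transfer (simp add: mult.assoc)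
  show "0 \<le> inner a a" by transfer simp
  show "inner a a = 0 \<longleftrightarrow> a = 0"
  proof transfer
    fix f :: "'a \<Rightarrow> real" assume "l2eq f f"
    then have f: "sq_int f" by (simp add: l2eq_def)
    then have "(LINT x|lborel. f x * f x) = 0 \<longleftrightarrow> (AE x in lborel. f x * f x = 0)"
      using integrable_sq_int_mult[OF f f] by (intro integral_nonneg_eq_0_iff_AE) auto
    then show "(LINT x|lborel. f x * f x) = 0 \<longleftrightarrow> l2eq f (\<lambda>_. 0)"
      using f by (simp add: l2eq_def) (simp add: sq_int_def)
  qed
qed (simp_all add: norm_l2_def dist_l2_def sgn_l2_def uniformity_l2_def open_l2_def)

end

lemma l2_cases: obtains f where "sq_int f" "X = abs_l2 f"
proof -
  have "\<exists>f. sq_int f \<and> X = abs_l2 f"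
    by (induction X rule: l2.abs_induct) (auto simp: l2eq_def)
  then show ?thesis using that by blast
qed

lemma abs_l2_eq_iff: "sq_int f \<Longrightarrow> sq_int g \<Longrightarrow> abs_l2 f = abs_l2 g \<longleftrightarrow> (AE x in lborel. f x = g x)"
  using Quotient3_rel[OF Quotient3_l2, of f g] by (auto simp: l2eq_def)

lemma sq_int_rep_l2: "sq_int (rep_l2 X)"
  using Quotient3_rep_reflp[OF Quotient3_l2, of X] by (simp add: l2eq_def)

lemma abs_rep_l2: "abs_l2 (rep_l2 X) = X"
  by (rule Quotient3_abs_rep[OF Quotient3_l2])

lemma rep_abs_l2: "sq_int f \<Longrightarrow> AE x in lborel. rep_l2 (abs_l2 f) x = f x"
  using abs_l2_eq_iff[OF sq_int_rep_l2, of f "abs_l2 f"] by (simp add: abs_rep_l2)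

lemma abs_l2_add: "sq_int f \<Longrightarrow> sq_int g \<Longrightarrow> abs_l2 f + abs_l2 g = abs_l2 (\<lambda>x. f x + g x)"
  by (rule plus_l2.abs_eq) (auto simp: l2eq_def)

lemma abs_l2_diff: "sq_int f \<Longrightarrow> sq_int g \<Longrightarrow> abs_l2 f - abs_l2 g = abs_l2 (\<lambda>x. f x - g x)"
  by (rule minus_l2.abs_eq) (auto simp: l2eq_def)

lemma abs_l2_scale: "sq_int f \<Longrightarrow> c *\<^sub>R abs_l2 f = abs_l2 (\<lambda>x. c * f x)"
  by (rule scaleR_l2.abs_eq) (auto simp: l2eq_def)

lemma inner_abs_l2: "sq_int f \<Longrightarrow> sq_int g \<Longrightarrow> inner (abs_l2 f) (abs_l2 g) = (LINT x|lborel. f x * g x)"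
  by (rule inner_l2.abs_eq) (auto simp: l2eq_def)

lemma norm_abs_l2:
  assumes "sq_int f"
  shows "ennreal ((norm (abs_l2 f))\<^sup>2) = (\<integral>\<^sup>+x. ennreal ((f x)\<^sup>2) \<partial>lborel)"
proof -
  have "(norm (abs_l2 f))\<^sup>2 = (LINT x|lborel. (f x)\<^sup>2)"
    using inner_abs_l2[OF assms assms] unfolding power2_norm_eq_inner by (simp add: power2_eq_square)
  then show ?thesis using assms by (simp add: nn_integral_eq_integral sq_int_def)
qed

text \<open>Riesz-Fischer: a rapidly converging subsequence converges almost everywhere, and Fatou's
  lemma turns the Cauchy estimate into convergence in norm.\<close>

instance l2 :: (euclidean_space) complete_space
proof
  fix X :: "nat \<Rightarrow> 'a l2" assume X: "Cauchy X"
  have "\<exists>f. sq_int f \<and> X n = abs_l2 f" for n using l2_cases[of "X n"] by blast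
  then obtain f where f: "\<And>n. sq_int (f n)" "\<And>n. X n = abs_l2 (f n)" by metis
  have [measurable]: "f n \<in> borel_measurable borel" for n using f(1) by (simp add: sq_int_def)
  have dX: "ennreal ((dist (X m) (X n))\<^sup>2) = (\<integral>\<^sup>+x. ennreal ((f m x - f n x)\<^sup>2) \<partial>lborel)" for m n
    by (simp add: dist_norm f abs_l2_diff norm_abs_l2 sq_int_diff)
  have "\<exists>N. \<forall>m\<ge>N. \<forall>n\<ge>N. dist (X m) (X n) < (1/8) ^ k" for k
    using X by (intro metric_CauchyD) auto
  then obtain N where N: "\<And>k m n. m \<ge> N k \<Longrightarrow> n \<ge> N k \<Longrightarrow> dist (X m) (X n) < (1/8) ^ k" by metis
  \<comment> \<open>Monotone and above both \<open>N k\<close> and \<open>k\<close>, so consecutive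
    terms are within \<open>(1/8) ^ k\<close> of each other and the indices tend to
    infinity.\<close>
  define r where "r k = sum N {..k} + k" for k
  have rN: "N k \<le> r k" for k by (auto simp: r_def member_le_sum trans_le_add1)
  have rk: "r k \<ge> k" "r k \<le> r (Suc k)" for k by (auto simp: r_def)
  define g where "g k = f (r k)" for k
  have [measurable]: "g n \<in> borel_measurable borel" for n by (simp add: g_def)
  \<comment> \<open>The fast rate leaves room for the weight \<open>4 ^ k\<close>: the sum is
    bounded by that of \<open>(1/2) ^ k\<close>, and its finiteness at a point forces the
    differences there to decay like \<open>(1/2) ^ k\<close>.\<close>
  have "(\<integral>\<^sup>+x. (suminf (\<lambda>k. ennreal (4 ^ k * (g (Suc k) x - g k x)\<^sup>2))) \<partial>lborel)
      = suminf (\<lambda>k. \<integral>\<^sup>+x. ennreal (4 ^ k * (g (Suc k) x - g k x)\<^sup>2) \<partial>lborel)"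
    by (intro nn_integral_suminf) simp
  also have "\<dots> \<le> (suminf (\<lambda>k. ennreal ((1/2) ^ k)))"
  proof (intro suminf_le summableI)
    fix k
    have "dist (X (r (Suc k))) (X (r k)) \<le> (1/8) ^ k"
      using N[of k "r (Suc k)" "r k"] rN[of k] rk(2)[of k] by simp
    then have "(dist (X (r (Suc k))) (X (r k)))\<^sup>2 \<le> ((1/8) ^ k)\<^sup>2" by (intro power_mono) auto
    also have "\<dots> \<le> (1/8) ^ k" by (simp add: power2_eq_square power_le_one mult_left_le)
    finally have *: "(dist (X (r (Suc k))) (X (r k)))\<^sup>2 \<le> (1/8) ^ k" .
    have "(\<integral>\<^sup>+x. ennreal (4 ^ k * (g (Suc k) x - g k x)\<^sup>2) \<partial>lborel)
        = ennreal (4 ^ k) * ennreal ((dist (X (r (Suc k))) (X (r k)))\<^sup>2)"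
      by (simp add: dX g_def ennreal_mult nn_integral_cmult)
    also have "\<dots> = ennreal (4 ^ k * (dist (X (r (Suc k))) (X (r k)))\<^sup>2)" by (simp add: ennreal_mult)
    also have "\<dots> \<le> ennreal (4 ^ k * (1/8) ^ k)" by (intro ennreal_leI mult_left_mono *) auto
    also have "4 ^ k * (1/8) ^ k = (1/2 :: real) ^ k" by (simp flip: power_mult_distrib)
    finally show "(\<integral>\<^sup>+x. ennreal (4 ^ k * (g (Suc k) x - g k x)\<^sup>2) \<partial>lborel) \<le> ennreal ((1/2) ^ k)" .
  qed
  also have "\<dots> < \<infinity>"
    by (subst suminf_ennreal2) (auto intro!: summable_geometric)
  finally have fin: "AE x in lborel. (suminf (\<lambda>k. ennreal (4 ^ k * (g (Suc k) x - g k x)\<^sup>2))) \<noteq> \<infinity>"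
    by (intro nn_integral_PInf_AE) auto
  define h where "h x = lim (\<lambda>k. g k x)" for x
  have [measurable]: "h \<in> borel_measurable borel" unfolding h_def by measurable
  have lim: "AE x in lborel. (\<lambda>k. g k x) \<longlonglongrightarrow> h x"
  proof (rule eventually_mono[OF fin])
    fix x assume x: "(suminf (\<lambda>k. ennreal (4 ^ k * (g (Suc k) x - g k x)\<^sup>2))) \<noteq> \<infinity>"
    define d where "d k = g (Suc k) x - g k x" for k
    define C where "C = enn2real (suminf (\<lambda>k. ennreal (4 ^ k * (d k)\<^sup>2)))"
    have C: "4 ^ k * (d k)\<^sup>2 \<le> C" for k
    proof -
      have "ennreal (4 ^ k * (d k)\<^sup>2) \<le> (suminf (\<lambda>k. ennreal (4 ^ k * (d k)\<^sup>2)))"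
        by (rule order_trans[OF _ sum_le_suminf[OF summableI, of "{k}"]]) simp_all
      also have "\<dots> = ennreal C" unfolding C_def using x by (simp add: d_def less_top)
      finally show ?thesis by (subst (asm) ennreal_le_iff) (simp_all add: C_def)
    qed
    have "\<bar>d k\<bar> \<le> sqrt C * (1/2) ^ k" for k
    proof -
      have "((2::real) ^ k)\<^sup>2 = 4 ^ k" by (simp add: power2_eq_square flip: power_mult_distrib)
      then have "(2 ^ k * d k)\<^sup>2 \<le> C" using C[of k] by (simp add: power_mult_distrib)
      then have "\<bar>2 ^ k * d k\<bar> \<le> sqrt C" by (simp add: real_le_rsqrt)
      then have "\<bar>d k\<bar> \<le> sqrt C / 2 ^ k" by (simp add: abs_mult pos_le_divide_eq mult.commute)
      then show ?thesis by (simp add: power_one_over)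
    qed
    moreover have "summable (\<lambda>k. sqrt C * (1/2) ^ k)" by (rule summable_mult, rule summable_geometric) simp
    ultimately have "summable d" by (intro summable_comparison_test'[of "\<lambda>k. sqrt C * (1/2) ^ k" 0 d]) auto
    from summable_LIMSEQ[OF this] have "(\<lambda>n. g n x - g 0 x) \<longlonglongrightarrow> suminf d"
      by (simp add: d_def sum_lessThan_telescope[of "\<lambda>k. g k x"])
    from tendsto_add[OF this tendsto_const[of "g 0 x"]] have "convergent (\<lambda>n. g n x)"
      by (auto simp: convergent_def)
    then show "(\<lambda>k. g k x) \<longlonglongrightarrow> h x" by (simp add: h_def convergent_LIMSEQ_iff)
  qed
  \<comment> \<open>Fatou's lemma along the subsequence, with \<open>f m\<close> kept fixed.\<close>
  have key: "(\<integral>\<^sup>+x. ennreal ((h x - f m x)\<^sup>2) \<partial>lborel) \<le> ennreal (e\<^sup>2)"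
    if e: "e > 0" and M: "\<And>n. n \<ge> M \<Longrightarrow> dist (X n) (X m) < e" for e m M
  proof -
    have "(\<integral>\<^sup>+x. ennreal ((h x - f m x)\<^sup>2) \<partial>lborel) = (\<integral>\<^sup>+x. liminf (\<lambda>k. ennreal ((g k x - f m x)\<^sup>2)) \<partial>lborel)"
    proof (intro nn_integral_cong_AE, use lim in eventually_elim)
      fix x assume "(\<lambda>k. g k x) \<longlonglongrightarrow> h x"
      then have "(\<lambda>k. ennreal ((g k x - f m x)\<^sup>2)) \<longlonglongrightarrow> ennreal ((h x - f m x)\<^sup>2)"
        by (intro tendsto_ennrealI tendsto_intros)
      then show "ennreal ((h x - f m x)\<^sup>2) = liminf (\<lambda>k. ennreal ((g k x - f m x)\<^sup>2))"
        by (intro lim_imp_Liminf[symmetric]) auto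
    qed
    also have "\<dots> \<le> liminf (\<lambda>k. \<integral>\<^sup>+x. ennreal ((g k x - f m x)\<^sup>2) \<partial>lborel)"
      by (intro nn_integral_liminf) simp
    also have "\<dots> \<le> ennreal (e\<^sup>2)"
    proof (rule Liminf_le)
      show "\<forall>\<^sub>F k in sequentially. (\<integral>\<^sup>+x. ennreal ((g k x - f m x)\<^sup>2) \<partial>lborel) \<le> ennreal (e\<^sup>2)"
        unfolding g_def dX[symmetric] eventually_sequentially
        using M rk(1) by (intro exI[of _ M]) (auto intro!: ennreal_leI power_mono less_imp_le[OF M] dest: le_trans)
    qed auto
    finally show ?thesis .
  qed
  obtain M0 where M0: "\<And>n. n \<ge> M0 \<Longrightarrow> dist (X n) (X M0) < 1"
    using metric_CauchyD[OF X, of 1] by auto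
  have "sq_int (\<lambda>x. h x - f M0 x)"
    using key[of 1 M0 M0] M0 by (auto simp: sq_int_iff_nn intro: le_less_trans)
  from sq_int_add[OF this f(1)[of M0]] have h: "sq_int h" by simp
  have "X \<longlonglongrightarrow> abs_l2 h"
  proof (rule metric_LIMSEQ_I)
    fix e :: real assume "e > 0"
    then obtain M where M: "\<And>m n. m \<ge> M \<Longrightarrow> n \<ge> M \<Longrightarrow> dist (X m) (X n) < e / 2"
      using metric_CauchyD[OF X, of "e/2"] by auto
    have "dist (X m) (abs_l2 h) < e" if "m \<ge> M" for m
    proof -
      have "X m - abs_l2 h = abs_l2 (\<lambda>x. f m x - h x)" by (simp add: f h abs_l2_diff)
      then have "ennreal ((dist (X m) (abs_l2 h))\<^sup>2) = (\<integral>\<^sup>+x. ennreal ((f m x - h x)\<^sup>2) \<partial>lborel)"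
        by (simp add: dist_norm norm_abs_l2 sq_int_diff f h)
      also have "\<dots> = (\<integral>\<^sup>+x. ennreal ((h x - f m x)\<^sup>2) \<partial>lborel)"
        by (subst power2_commute) rule
      also have "\<dots> \<le> ennreal ((e/2)\<^sup>2)"
        by (rule key[of "e/2" M m]) (use \<open>e > 0\<close> M that in auto)
      finally have "(dist (X m) (abs_l2 h))\<^sup>2 \<le> (e/2)\<^sup>2"
        using ennreal_le_iff[OF zero_le_power2] by blast
      then have "dist (X m) (abs_l2 h) \<le> e/2" by (rule power2_le_imp_le) (use \<open>e > 0\<close> in auto)
      then show ?thesis using \<open>e > 0\<close> by simp
    qed
    then show "\<exists>M. \<forall>m\<ge>M. dist (X m) (abs_l2 h) < e" by blast
  qed
  then show "convergent X" by (auto simp: convergent_def)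
qed

section \<open>Test functions and uniqueness of weak derivatives\<close>

lemma frechet_derivative_eqI: "(f has_derivative f') (at x) \<Longrightarrow> frechet_derivative f (at x) = f'"
  by (rule frechet_derivative_at[symmetric])

lemma differentiable_has_frechet:
  "f differentiable (at x) \<Longrightarrow> (f has_derivative frechet_derivative f (at x)) (at x)"
  by (simp add: frechet_derivative_works)

text \<open>\<open>C_diff\<close> asks for continuity only at the last stage, so lower orders have
  to be recovered by induction; differentiability supplies continuity at the bottom.\<close>

lemma C_diff_SucD: "C_diff (Suc k) f \<Longrightarrow> C_diff k f"
proof (induction k arbitrary: f)
  case 0
  then show ?case
    by (auto simp: continuous_on_eq_continuous_within intro: differentiable_imp_continuous_within)
next
  case (Suc k)
  then show ?case by (metis C_diff.simps(2))
qed

lemma C_diff_continuous: "C_diff k f \<Longrightarrow> continuous_on UNIV f"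
  by (induction k) (use C_diff_SucD in \<open>auto simp del: C_diff.simps(2)\<close>)

lemma C_diff_add: "C_diff k f \<Longrightarrow> C_diff k g \<Longrightarrow> C_diff k (\<lambda>x. f x + g x)"
proof (induction k arbitrary: f g)
  case (Suc k)
  have "frechet_derivative (\<lambda>x. f x + g x) (at x) =
      (\<lambda>b. frechet_derivative f (at x) b + frechet_derivative g (at x) b)" for x
    by (rule frechet_derivative_eqI, rule has_derivative_add)
      (use Suc.prems in \<open>auto intro: differentiable_has_frechet\<close>)
  with Suc show ?case by (simp add: differentiable_add)
qed (auto intro: continuous_on_add)

lemma C_diff_mult: "C_diff k f \<Longrightarrow> C_diff k g \<Longrightarrow> C_diff k (\<lambda>x. f x * g x)"
proof (induction k arbitrary: f g)
  case (Suc k)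
  have "frechet_derivative (\<lambda>x. f x * g x) (at x) =
      (\<lambda>b. f x * frechet_derivative g (at x) b + frechet_derivative f (at x) b * g x)" for x
    by (rule frechet_derivative_eqI, rule has_derivative_mult)
      (use Suc.prems in \<open>auto intro: differentiable_has_frechet\<close>)
  moreover have "C_diff k f" "C_diff k g" using Suc.prems by (auto intro: C_diff_SucD simp del: C_diff.simps)
  ultimately show ?case using Suc by (auto simp: differentiable_mult intro!: C_diff_add)
qed (auto intro: continuous_on_mult)

lemma C_diff_const: "C_diff k (\<lambda>x. c)"
  by (induction k arbitrary: c) auto

lemma C_diff_inner: "C_diff k (\<lambda>x. x \<bullet> h)"
proof (cases k)
  case (Suc j)
  have d: "((\<lambda>x. x \<bullet> h) has_derivative (\<lambda>b. b \<bullet> h)) (at x)" for x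
    by (auto intro!: derivative_eq_intros)
  then show ?thesis using Suc
    by (auto simp: frechet_derivative_eqI[OF d] C_diff_const differentiable_def)
qed (auto intro: continuous_intros)

lemma smooth_add: "smooth f \<Longrightarrow> smooth g \<Longrightarrow> smooth (\<lambda>x. f x + g x)"
  by (simp add: smooth_def C_diff_add)
lemma smooth_mult: "smooth f \<Longrightarrow> smooth g \<Longrightarrow> smooth (\<lambda>x. f x * g x)"
  by (simp add: smooth_def C_diff_mult)
lemma smooth_const: "smooth (\<lambda>x. c)"
  by (simp add: smooth_def C_diff_const)
lemma smooth_inner: "smooth (\<lambda>x. x \<bullet> h)"
  by (simp add: smooth_def C_diff_inner)
lemma smooth_prod: "finite A \<Longrightarrow> (\<And>i. i \<in> A \<Longrightarrow> smooth (f i)) \<Longrightarrow> smooth (\<lambda>x. \<Prod>i\<in>A. f i x)"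
  by (induction A rule: finite_induct) (auto simp: smooth_const smooth_mult)
lemma smooth_frechet: "smooth f \<Longrightarrow> smooth (\<lambda>x. frechet_derivative f (at x) b)"
  unfolding smooth_def by (metis C_diff.simps(2))
lemma smooth_differentiable: "smooth f \<Longrightarrow> f differentiable (at x)"
  unfolding smooth_def by (metis C_diff.simps(2))
lemma smooth_continuous: "smooth f \<Longrightarrow> continuous_on A f"
  unfolding smooth_def using C_diff_continuous continuous_on_subset by blast
lemma smooth_measurable [measurable_dest]: "smooth f \<Longrightarrow> f \<in> borel_measurable borel"
  using smooth_continuous[of f UNIV] by (rule borel_measurable_continuous_onI)
lemma frechet_measurable [measurable_dest]:
  "smooth f \<Longrightarrow> (\<lambda>x. frechet_derivative f (at x) b) \<in> borel_measurable borel"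
  by (rule smooth_measurable[OF smooth_frechet])

lemma smooth_has_derivative: "smooth f \<Longrightarrow> (f has_derivative frechet_derivative f (at x)) (at x)"
  by (intro differentiable_has_frechet smooth_differentiable)

lemma frechet_add:
  "smooth f \<Longrightarrow> smooth g \<Longrightarrow> frechet_derivative (\<lambda>x. f x + g x) (at x) b
    = frechet_derivative f (at x) b + frechet_derivative g (at x) b"
  by (subst frechet_derivative_eqI[OF has_derivative_add[OF smooth_has_derivative smooth_has_derivative]]) auto

lemma frechet_mult:
  "smooth f \<Longrightarrow> smooth g \<Longrightarrow> frechet_derivative (\<lambda>x. f x * g x) (at x) b
    = f x * frechet_derivative g (at x) b + frechet_derivative f (at x) b * g x"
  by (subst frechet_derivative_eqI[OF has_derivative_mult[OF smooth_has_derivative smooth_has_derivative]]) auto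

text \<open>The function \<open>exp (-1/t)\<close>, flat at 0, multiplied by negative powers of
  \<open>t\<close>. The power is carried along because the span of the family is closed under
  differentiation, which makes smoothness an induction over all \<open>n\<close> at once.\<close>

definition flat_exp :: "nat \<Rightarrow> real \<Rightarrow> real" where
  "flat_exp n t = (if t > 0 then inverse t ^ n / exp (inverse t) else 0)"

lemma flat_exp_tendsto_0: "(flat_exp n \<longlongrightarrow> 0) (at 0)"
proof (rule filterlim_split_at_real)
  show "(flat_exp n \<longlongrightarrow> 0) (at_left 0)"
    by (rule tendsto_eventually) (auto simp: flat_exp_def eventually_at_filter)
  have "((\<lambda>t. inverse t ^ n / exp (inverse t)) \<longlongrightarrow> (0::real)) (at_right 0)"
    by (rule filterlim_compose[OF tendsto_power_div_exp_0 filterlim_inverse_at_top_right])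
  then show "(flat_exp n \<longlongrightarrow> 0) (at_right 0)"
    by (rule filterlim_cong[THEN iffD1, rotated -1]) (auto simp: flat_exp_def eventually_at_filter)
qed

lemma flat_exp_deriv:
  "(flat_exp n has_real_derivative (- real n * flat_exp (n + 1) t + flat_exp (n + 2) t)) (at t)"
proof -
  consider "t > 0" | "t < 0" | "t = 0" by linarith
  then show ?thesis
  proof cases
    case 1
    have i: "(inverse has_real_derivative - (inverse t * inverse t)) (at t)"
      using DERIV_inverse[of t] 1 by (simp add: power2_eq_square)
    have e: "((\<lambda>t. exp (- inverse t)) has_real_derivative exp (- inverse t) * (inverse t * inverse t)) (at t)"
      using DERIV_fun_exp[OF DERIV_minus[OF i]] by simp
    have p: "((\<lambda>t. inverse t ^ n) has_real_derivative - real n * inverse t ^ (n + 1)) (at t)"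
    proof (cases n)
      case (Suc m)
      show ?thesis by (rule DERIV_cong[OF DERIV_power[OF i, of n]]) (simp add: Suc algebra_simps)
    qed simp
    have "((\<lambda>t. inverse t ^ n * exp (- inverse t)) has_real_derivative
        (- real n * flat_exp (n + 1) t + flat_exp (n + 2) t)) (at t)"
      using DERIV_mult[OF p e] 1 by (simp add: flat_exp_def exp_minus divide_inverse mult_ac)
    then have "((\<lambda>t. inverse t ^ n / exp (inverse t)) has_real_derivative
        (- real n * flat_exp (n + 1) t + flat_exp (n + 2) t)) (at t)"
      by (simp add: exp_minus divide_inverse)
    then show ?thesis
      by (rule DERIV_cong_ev[THEN iffD1, rotated -1])
        (use 1 in \<open>auto simp: flat_exp_def eventually_nhds intro!: exI[of _ "{0<..}"]\<close>)
  next
    case 2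
    have "((\<lambda>t. 0) has_real_derivative (- real n * flat_exp (n + 1) t + flat_exp (n + 2) t)) (at t)"
      using 2 by (simp add: flat_exp_def)
    then show ?thesis
      by (rule DERIV_cong_ev[THEN iffD1, rotated -1])
        (use 2 in \<open>auto simp: flat_exp_def eventually_nhds intro!: exI[of _ "{..<0}"]\<close>)
  next
    case 3
    \<comment> \<open>At 0 the difference quotient is the next member of the family, which tends to
      0.\<close>
    have "(\<lambda>h. (flat_exp n (0 + h) - flat_exp n 0) / h) = flat_exp (n + 1)"
      by (auto simp: flat_exp_def fun_eq_iff field_simps)
    then show ?thesis using flat_exp_tendsto_0[of "n + 1"] 3
      by (simp add: DERIV_def) (simp add: flat_exp_def)
  qed
qed

lemma smooth_flat_exp: "smooth (\<lambda>x. flat_exp n (c + x \<bullet> h))"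
proof -
  have d: "((\<lambda>x. flat_exp n (c + x \<bullet> h)) has_derivative
      (\<lambda>b. (b \<bullet> h) * (- real n * flat_exp (n + 1) (c + x \<bullet> h) + flat_exp (n + 2) (c + x \<bullet> h)))) (at x)" for n x
  proof -
    have "((\<lambda>x. c + x \<bullet> h) has_derivative (\<lambda>b. b \<bullet> h)) (at x)"
      by (auto intro!: derivative_eq_intros)
    from DERIV_compose_FDERIV[OF flat_exp_deriv this] show ?thesis by simp
  qed
  have "C_diff k (\<lambda>x. flat_exp n (c + x \<bullet> h))" for k
  proof (induction k arbitrary: n)
    case 0
    have "continuous_on UNIV (\<lambda>x. flat_exp n (c + x \<bullet> h))"
      using d by (meson has_derivative_continuous continuous_at_imp_continuous_on)
    then show ?case by simp
  next
    case (Suc k)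
    then show ?case
      unfolding C_diff.simps frechet_derivative_eqI[OF d]
      by (intro conjI allI C_diff_mult C_diff_add C_diff_const) (use d differentiable_def in blast)+
  qed
  then show ?thesis by (simp add: smooth_def)
qed

text \<open>A smooth cut-off of a box: along each coordinate \<open>exp (-1/t)\<close> is evaluated
  at \<open>m\<close> times the distances to the two faces. As this function tends to 1 at infinity
  and vanishes for negative arguments, large \<open>m\<close> approximates the indicator of the open
  box.\<close>

definition bump :: "'a::euclidean_space \<Rightarrow> 'a \<Rightarrow> nat \<Rightarrow> 'a \<Rightarrow> real" where
  "bump l u m x = (\<Prod>b\<in>Basis. flat_exp 0 (- real m * (l \<bullet> b) + x \<bullet> (real m *\<^sub>R b))
      * flat_exp 0 (real m * (u \<bullet> b) + x \<bullet> (- real m *\<^sub>R b)))"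

lemma smooth_bump: "smooth (bump l u m)"
  unfolding bump_def[abs_def] by (intro smooth_prod smooth_mult smooth_flat_exp) auto

lemma flat_exp_0_bounds: "0 \<le> flat_exp 0 t" "flat_exp 0 t \<le> 1"
  by (auto simp: flat_exp_def)

lemma bump_bounds: "0 \<le> bump l u m x" "bump l u m x \<le> 1"
  unfolding bump_def
  by (auto intro!: prod_nonneg prod_le_1 mult_nonneg_nonneg mult_le_one simp: flat_exp_0_bounds)

lemma bump_outside: "x \<notin> box l u \<Longrightarrow> bump l u m x = 0"
proof -
  assume "x \<notin> box l u"
  then obtain b where b: "b \<in> Basis" "x \<bullet> b \<le> l \<bullet> b \<or> u \<bullet> b \<le> x \<bullet> b" by (auto simp: mem_box not_less)
  then have "- real m * (l \<bullet> b) + x \<bullet> (real m *\<^sub>R b) \<le> 0 \<or> real m * (u \<bullet> b) + x \<bullet> (- real m *\<^sub>R b) \<le> 0"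
    by (auto simp: mult_left_mono)
  then have "flat_exp 0 (- real m * (l \<bullet> b) + x \<bullet> (real m *\<^sub>R b)) * flat_exp 0 (real m * (u \<bullet> b) + x \<bullet> (- real m *\<^sub>R b)) = 0"
    by (auto simp: flat_exp_def)
  then show ?thesis unfolding bump_def using b(1) by (intro prod_zero) auto
qed

lemma bump_tendsto: "(\<lambda>m. bump l u m x) \<longlonglongrightarrow> indicator (box l u) x"
proof (cases "x \<in> box l u")
  case True
  have lim: "(\<lambda>m. flat_exp 0 (real m * d)) \<longlonglongrightarrow> 1" if "d > 0" for d
  proof -
    have "(\<lambda>m. 1 / exp (inverse d * inverse (real m))) \<longlonglongrightarrow> 1 / exp (inverse d * 0)"
      by (intro tendsto_intros tendsto_inverse_0_at_top filterlim_real_sequentially) auto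
    moreover have "\<forall>\<^sub>F m in sequentially. 1 / exp (inverse d * inverse (real m)) = flat_exp 0 (real m * d)"
      using eventually_gt_at_top[of 0] by eventually_elim (use that in \<open>auto simp: flat_exp_def mult.commute\<close>)
    ultimately show ?thesis using tendsto_cong by fastforce
  qed
  have "(\<lambda>m. bump l u m x) = (\<lambda>m. \<Prod>b\<in>Basis. flat_exp 0 (real m * (x \<bullet> b - l \<bullet> b)) * flat_exp 0 (real m * (u \<bullet> b - x \<bullet> b)))"
    unfolding bump_def by (intro ext prod.cong) (simp_all add: algebra_simps)
  moreover have "(\<lambda>m. \<Prod>b\<in>Basis. flat_exp 0 (real m * (x \<bullet> b - l \<bullet> b)) * flat_exp 0 (real m * (u \<bullet> b - x \<bullet> b)))
     \<longlonglongrightarrow> (\<Prod>b\<in>(Basis::'a set). 1 * 1)"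
    by (intro tendsto_prod tendsto_mult lim) (use True in \<open>auto simp: mem_box\<close>)
  ultimately show ?thesis using True by simp
qed (simp add: bump_outside)

lemma test_function_bump: "cbox l u \<subseteq> S \<Longrightarrow> test_function S (bump l u m)"
  unfolding test_function_def
  by (intro conjI smooth_bump exI[of _ "cbox l u"]) (use box_subset_cbox[of l u] bump_outside[of _ l u m] in auto)

text \<open>The complement of the compact set \<open>K\<close> is open, so the derivative vanishes
  there together with the function.\<close>

lemma test_function_frechet:
  assumes "test_function S \<psi>" shows "test_function S (\<lambda>x. frechet_derivative \<psi> (at x) b)"
proof -
  obtain K where K: "compact K" "K \<subseteq> S" "\<And>x. x \<notin> K \<Longrightarrow> \<psi> x = 0" and s: "smooth \<psi>"
    using assms by (auto simp: test_function_def)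
  have "frechet_derivative \<psi> (at x) b = 0" if "x \<notin> K" for x
  proof -
    have "open (- K)" using K(1) by (simp add: compact_imp_closed open_Compl)
    from has_derivative_transform_within_open[OF has_derivative_const this, of x 0 \<psi>]
    have "(\<psi> has_derivative (\<lambda>_. 0)) (at x)" using that K(3) by auto
    then show ?thesis by (simp add: frechet_derivative_eqI)
  qed
  then show ?thesis using K s smooth_frechet by (auto simp: test_function_def)
qed

lemma test_function_mult:
  assumes "smooth a" "test_function S \<psi>" shows "test_function S (\<lambda>x. a x * \<psi> x)"
proof -
  obtain K where "compact K" "K \<subseteq> S" "\<And>x. x \<notin> K \<Longrightarrow> \<psi> x = 0" "smooth \<psi>"
    using assms(2) by (auto simp: test_function_def)
  then show ?thesis
    unfolding test_function_def by (intro conjI smooth_mult assms(1) exI[of _ K]) auto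
qed

lemma loc_integrable_bounded_support:
  fixes S :: "'a::euclidean_space set"
  assumes f: "loc_integrable S f" and K: "compact K" "K \<subseteq> S" "\<And>x. x \<notin> K \<Longrightarrow> \<psi> x = 0"
    and c: "continuous_on UNIV \<psi>"
  shows "integrable lborel (\<lambda>x. f x * \<psi> x)"
proof -
  have "compact (\<psi> ` K)" using K(1) c by (meson compact_continuous_image continuous_on_subset subset_UNIV)
  then have "bounded (\<psi> ` K)" by (rule compact_imp_bounded)
  then obtain B where B: "\<And>x. x \<in> K \<Longrightarrow> \<bar>\<psi> x\<bar> \<le> B" by (auto simp: bounded_iff)
  have i: "integrable lborel (\<lambda>x. indicator K x * f x)"
    using f K by (auto simp: loc_integrable_def set_integrable_def)
  have [measurable]: "\<psi> \<in> borel_measurable borel" using c by (rule borel_measurable_continuous_onI)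
  have eq: "(\<lambda>x. f x * \<psi> x) = (\<lambda>x. (indicator K x * f x) * \<psi> x)"
    using K(3) by (auto simp: fun_eq_iff indicator_def)
  show ?thesis unfolding eq
  proof (rule Bochner_Integration.integrable_bound)
    show "integrable lborel (\<lambda>x. \<bar>B\<bar> * (indicator K x * f x))" using i by simp
    show "(\<lambda>x. (indicator K x * f x) * \<psi> x) \<in> borel_measurable lborel"
      using borel_measurable_integrable[OF i] by simp
    have "\<bar>\<psi> x\<bar> \<le> \<bar>B\<bar>" if "x \<in> K" for x using B[OF that] by linarith
    then show "AE x in lborel. norm (indicator K x * f x * \<psi> x) \<le> norm (\<bar>B\<bar> * (indicator K x * f x))"
      by (auto simp: indicator_def abs_mult mult.commute intro!: AE_I2 mult_right_mono)
  qed
qed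

lemma loc_integrable_test:
  assumes "loc_integrable S f" "test_function S \<psi>"
  shows "integrable lborel (\<lambda>x. f x * \<psi> x)" "(LINT x:S|lborel. f x * \<psi> x) = (LINT x|lborel. f x * \<psi> x)"
proof -
  obtain K where K: "compact K" "K \<subseteq> S" "\<And>x. x \<notin> K \<Longrightarrow> \<psi> x = 0" and s: "smooth \<psi>"
    using assms by (auto simp: test_function_def)
  show "integrable lborel (\<lambda>x. f x * \<psi> x)"
    by (rule loc_integrable_bounded_support[OF assms(1) K smooth_continuous[OF s]])
  have "(\<lambda>x. indicator S x *\<^sub>R (f x * \<psi> x)) = (\<lambda>x. f x * \<psi> x)"
    using K by (auto simp: fun_eq_iff indicator_def)
  then show "(LINT x:S|lborel. f x * \<psi> x) = (LINT x|lborel. f x * \<psi> x)"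
    by (simp add: set_lebesgue_integral_def)
qed

text \<open>Positive and negative part define finite measures that agree on boxes, an
  intersection-stable generator of the Borel sets; hence they are equal, and so are their
  densities.\<close>

lemma AE_zero_if_box_integrals_zero:
  fixes f :: "'a::euclidean_space \<Rightarrow> real"
  assumes f: "integrable lborel f" and z: "\<And>l u. (LINT x|lborel. indicator (box l u) x * f x) = 0"
  shows "AE x in lborel. f x = 0"
proof -
  have [measurable]: "f \<in> borel_measurable borel" using f by auto
  \<comment> \<open>\<open>ennreal\<close> truncates negative reals to 0, so these are the measures
    with the positive and the negative part of \<open>f\<close> as density.\<close>
  let ?M = "density lborel (\<lambda>x. ennreal (f x))" and ?N = "density lborel (\<lambda>x. ennreal (- f x))"
  have fin: "(\<integral>\<^sup>+x. ennreal (f x) \<partial>lborel) \<noteq> \<infinity>"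
    using f by (auto simp: real_integrable_def)
  have eq: "?M = ?N"
  proof (rule measure_eqI_generator_eq)
    let ?E = "range (\<lambda>(a, b). box a b::'a set)"
    show "Int_stable ?E" by (auto simp: Int_stable_def box_Int_box)
    show "?E \<subseteq> Pow UNIV" "sets ?M = sigma_sets UNIV ?E" "sets ?N = sigma_sets UNIV ?E"
      by (simp_all add: borel_eq_box)
    let ?A = "\<lambda>n::nat. box (- (real n *\<^sub>R One)) (real n *\<^sub>R One) :: 'a set"
    show "range ?A \<subseteq> ?E" "(\<Union>i. ?A i) = UNIV" unfolding UN_box_eq_UNIV by auto
    show "emeasure ?M (?A i) \<noteq> \<infinity>" for i
    proof -
      have "emeasure ?M (?A i) \<le> (\<integral>\<^sup>+x. ennreal (f x) \<partial>lborel)"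
        by (auto simp: emeasure_density indicator_def intro!: nn_integral_mono)
      then show ?thesis using fin by (auto simp: top_unique)
    qed
    fix X assume "X \<in> ?E"
    then obtain l u where X: "X = box l u" by auto
    let ?g = "\<lambda>x. indicator (box l u) x * f x"
    have g: "integrable lborel ?g" using f integrable_real_mult_indicator[of "box l u" lborel f] by (simp add: mult.commute)
    have "ennreal (f x) * indicator X x = ennreal (?g x)" "ennreal (- f x) * indicator X x = ennreal (- ?g x)" for x
      by (auto simp: X indicator_def)
    then have e: "emeasure ?M X = (\<integral>\<^sup>+x. ennreal (?g x) \<partial>lborel)" "emeasure ?N X = (\<integral>\<^sup>+x. ennreal (- ?g x) \<partial>lborel)"
      by (simp_all add: X emeasure_density)
    have "enn2real (\<integral>\<^sup>+x. ennreal (?g x) \<partial>lborel) = enn2real (\<integral>\<^sup>+x. ennreal (- ?g x) \<partial>lborel)"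
      using z[of l u] real_lebesgue_integral_def[OF g] by simp
    moreover have "(\<integral>\<^sup>+x. ennreal (?g x) \<partial>lborel) \<noteq> \<infinity>" "(\<integral>\<^sup>+x. ennreal (- ?g x) \<partial>lborel) \<noteq> \<infinity>"
      using g by (auto simp: real_integrable_def)
    moreover have "A = B" if "enn2real A = enn2real B" "A \<noteq> \<infinity>" "B \<noteq> \<infinity>" for A B
      using that by (cases A; cases B) auto
    ultimately show "emeasure ?M X = emeasure ?N X" unfolding e by blast
  qed
  have "AE x in lborel. ennreal (f x) = ennreal (- f x)"
    using finite_density_unique[of "\<lambda>x. ennreal (f x)" lborel "\<lambda>x. ennreal (- f x)"] fin eq by simp
  then show ?thesis
  proof (rule eventually_mono)
    fix x assume "ennreal (f x) = ennreal (- f x)"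
    then show "f x = 0" by (cases "f x \<ge> 0") (auto simp: ennreal_neg ennreal_eq_0_iff dest: sym)
  qed
qed

text \<open>Testing with \<open>bump\<close> and letting \<open>m\<close> grow shows that
  \<open>g\<close> has zero integral over every box inside \<open>S\<close>; countably many closed
  boxes exhaust \<open>S\<close>.\<close>

lemma fundamental_lemma:
  fixes S :: "'a::euclidean_space set"
  assumes S: "open S" and g: "loc_integrable S g"
    and z: "\<And>\<psi>. test_function S \<psi> \<Longrightarrow> (LINT x|lborel. g x * \<psi> x) = 0"
  shows "AE x in lborel. x \<in> S \<longrightarrow> g x = 0"
proof -
  have gi: "integrable lborel (\<lambda>x. indicator (cbox a b) x * g x)" if "cbox a b \<subseteq> S" for a b
    using g that by (auto simp: loc_integrable_def set_integrable_def)
  have box0: "(LINT x|lborel. indicator (box l u) x * g x) = 0" if sub: "cbox l u \<subseteq> S" for l u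
  proof -
    let ?s = "\<lambda>m x. bump l u m x * (indicator (cbox l u) x * g x)"
    have eq: "?s m x = g x * bump l u m x" for m x
      using bump_outside[of x l u m] box_subset_cbox[of l u] by (auto simp: indicator_def)
    have [measurable]: "(\<lambda>x. indicator (cbox l u) x * g x) \<in> borel_measurable borel"
      using gi[OF sub] by auto
    have [measurable]: "bump l u m \<in> borel_measurable borel" for m
      by (rule smooth_measurable[OF smooth_bump])
    have "(\<lambda>m. LINT x|lborel. ?s m x) \<longlonglongrightarrow> (LINT x|lborel. indicator (box l u) x * (indicator (cbox l u) x * g x))"
    proof (rule integral_dominated_convergence)
      show "integrable lborel (\<lambda>x. \<bar>indicator (cbox l u) x * g x\<bar>)" using gi[OF sub] by simp
      show "AE x in lborel. (\<lambda>m. ?s m x) \<longlonglongrightarrow> indicator (box l u) x * (indicator (cbox l u) x * g x)"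
        by (intro AE_I2 tendsto_mult bump_tendsto tendsto_const)
      show "AE x in lborel. norm (?s m x) \<le> \<bar>indicator (cbox l u) x * g x\<bar>" for m
        using bump_bounds[of l u m] by (auto simp: abs_mult intro!: AE_I2 mult_left_le_one_le)
    qed auto
    moreover have "(LINT x|lborel. ?s m x) = 0" for m
      unfolding eq by (rule z[OF test_function_bump[OF sub]])
    ultimately have "(LINT x|lborel. indicator (box l u) x * (indicator (cbox l u) x * g x)) = 0"
      by (simp only: LIMSEQ_const_iff)
    moreover have "indicator (box l u) x * (indicator (cbox l u) x * g x) = indicator (box l u) x * g x" for x
      using box_subset_cbox[of l u] by (auto simp: indicator_def)
    ultimately show ?thesis by simp
  qed
  \<comment> \<open>Localization to one closed box: \<open>g\<close> is cut to its interior, the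
    intersection of two boxes is again a box, and the faces form a null set.\<close>
  have cb: "AE x in lborel. x \<in> cbox a b \<longrightarrow> g x = 0" if sub: "cbox a b \<subseteq> S" for a b
  proof -
    let ?f = "\<lambda>x. indicator (box a b) x * (indicator (cbox a b) x * g x)"
    have "AE x in lborel. ?f x = 0"
    proof (rule AE_zero_if_box_integrals_zero)
      show "integrable lborel ?f"
        using integrable_real_mult_indicator[OF _ gi[OF sub], of "box a b"] by (simp add: mult.commute)
      fix l u :: 'a
      obtain p q where pq: "box l u \<inter> box a b = box p q" using that[OF box_Int_box] .
      have "(\<lambda>x. indicator (box l u) x * ?f x) = (\<lambda>x. indicator (box p q) x * g x)"
        using box_subset_cbox[of a b] unfolding pq[symmetric] by (auto simp: fun_eq_iff indicator_def)
      moreover have "(LINT x|lborel. indicator (box p q) x * g x) = 0"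
      proof (cases "box p q = {}")
        case False
        have "cbox p q \<subseteq> cbox a b"
          using closure_mono[of "box p q" "box a b"] pq False
          by (metis box_subset_cbox closure_box closure_cbox closure_mono inf_le2 order_trans)
        then show ?thesis using box0 sub by auto
      qed simp
      ultimately show "(LINT x|lborel. indicator (box l u) x * ?f x) = 0" by simp
    qed
    moreover have "cbox a b - box a b \<in> null_sets lborel"
      using negligible_frontier_interval[of a b] by (simp add: negligible_iff_null_sets null_sets_completion_iff)
    then have "AE x in lborel. x \<notin> cbox a b - box a b" by (rule AE_not_in)
    ultimately show ?thesis by eventually_elim (auto simp: indicator_def split: if_splits)
  qed
  obtain \<D> where D: "countable \<D>" "\<D> \<subseteq> Pow S" "\<And>X. X \<in> \<D> \<Longrightarrow> \<exists>a b. X = cbox a b" "\<Union>\<D> = S"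
    using open_countable_Union_open_cbox[OF S] by metis
  have "AE x in lborel. \<forall>X\<in>\<D>. x \<in> X \<longrightarrow> g x = 0"
    unfolding AE_ball_countable[OF D(1)] using D(2,3) cb by (metis PowD subsetD)
  then show ?thesis by (rule eventually_mono) (use D(4) in blast)
qed

lemma loc_integrable_add: "loc_integrable S f \<Longrightarrow> loc_integrable S g \<Longrightarrow> loc_integrable S (\<lambda>x. f x + g x)"
  unfolding loc_integrable_def by (auto intro: set_integral_add)
lemma loc_integrable_cmult: "loc_integrable S f \<Longrightarrow> loc_integrable S (\<lambda>x. c * f x)"
  unfolding loc_integrable_def by auto
lemma loc_integrable_diff: "loc_integrable S f \<Longrightarrow> loc_integrable S g \<Longrightarrow> loc_integrable S (\<lambda>x. f x - g x)"
  unfolding loc_integrable_def by (auto intro: set_integral_diff)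

lemma loc_integrable_mult_continuous:
  fixes S :: "'a::euclidean_space set"
  assumes f: "loc_integrable S f" and c: "continuous_on UNIV a"
  shows "loc_integrable S (\<lambda>x. a x * f x)"
  unfolding loc_integrable_def
proof (intro allI impI)
  fix K assume K: "compact K \<and> K \<subseteq> S"
  have i: "integrable lborel (\<lambda>x. indicator K x * f x)"
    using f K by (auto simp: loc_integrable_def set_integrable_def)
  have [measurable]: "a \<in> borel_measurable borel" using c by (rule borel_measurable_continuous_onI)
  have "compact (a ` K)" using K c by (meson compact_continuous_image continuous_on_subset subset_UNIV)
  then have "bounded (a ` K)" by (rule compact_imp_bounded)
  then obtain B where B: "\<And>x. x \<in> K \<Longrightarrow> \<bar>a x\<bar> \<le> B" by (auto simp: bounded_iff)
  have eq: "(\<lambda>x. indicator K x *\<^sub>R (a x * f x)) = (\<lambda>x. a x * (indicator K x * f x))" by (auto simp: fun_eq_iff)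
  show "set_integrable lborel K (\<lambda>x. a x * f x)" unfolding set_integrable_def eq
  proof (rule Bochner_Integration.integrable_bound)
    show "integrable lborel (\<lambda>x. \<bar>B\<bar> * (indicator K x * f x))" using i by simp
    show "(\<lambda>x. a x * (indicator K x * f x)) \<in> borel_measurable lborel"
      using borel_measurable_integrable[OF i] by simp
    have "\<bar>a x\<bar> \<le> \<bar>B\<bar>" if "x \<in> K" for x using B[OF that] by linarith
    then show "AE x in lborel. norm (a x * (indicator K x * f x)) \<le> norm (\<bar>B\<bar> * (indicator K x * f x))"
      by (auto simp: indicator_def abs_mult intro!: AE_I2 mult_right_mono)
  qed
qed

text \<open>Test functions vanish off \<open>S\<close>, so the pairings may be read as integrals
  over the whole space.\<close>

lemma has_weak_deriv_iff:
  "has_weak_deriv S b f g \<longleftrightarrow> loc_integrable S f \<and> loc_integrable S g \<and>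
     (\<forall>\<psi>. test_function S \<psi> \<longrightarrow>
        (LINT x|lborel. f x * frechet_derivative \<psi> (at x) b) = - (LINT x|lborel. g x * \<psi> x))"
  unfolding has_weak_deriv_def
  by (intro conj_cong refl iff_allI imp_cong) (simp_all add: loc_integrable_test(2) test_function_frechet)

lemma has_weak_derivD:
  assumes "has_weak_deriv S b f g"
  shows "loc_integrable S f" "loc_integrable S g"
    "test_function S \<psi> \<Longrightarrow> (LINT x|lborel. f x * frechet_derivative \<psi> (at x) b) = - (LINT x|lborel. g x * \<psi> x)"
  using assms unfolding has_weak_deriv_iff by simp_all

lemma has_weak_deriv_unique:
  assumes "open S" "has_weak_deriv S b f g" "has_weak_deriv S b f h"
  shows "AE x in lborel. x \<in> S \<longrightarrow> g x = h x"
proof -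
  note g = has_weak_derivD[OF assms(2)] and h = has_weak_derivD[OF assms(3)]
  have "AE x in lborel. x \<in> S \<longrightarrow> g x - h x = 0"
  proof (rule fundamental_lemma[OF assms(1)])
    show "loc_integrable S (\<lambda>x. g x - h x)" using g(2) h(2) by (rule loc_integrable_diff)
    fix \<psi> assume \<psi>: "test_function S \<psi>"
    then have "(LINT x|lborel. g x * \<psi> x) = (LINT x|lborel. h x * \<psi> x)"
      using g(3)[OF \<psi>] h(3)[OF \<psi>] by linarith
    then show "(LINT x|lborel. (g x - h x) * \<psi> x) = 0"
      using Bochner_Integration.integral_diff[OF loc_integrable_test(1)[OF g(2) \<psi>] loc_integrable_test(1)[OF h(2) \<psi>]]
      by (simp add: left_diff_distrib)
  qed
  then show ?thesis by simp
qed

lemma has_weak_deriv_weak_deriv: "has_weak_deriv S b f g \<Longrightarrow> has_weak_deriv S b f (weak_deriv S b f)"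
  unfolding weak_deriv_def by (rule someI[of "has_weak_deriv S b f"])

lemma weak_deriv_AE:
  assumes "open S" "has_weak_deriv S b f g"
  shows "AE x in lborel. x \<in> S \<longrightarrow> weak_deriv S b f x = g x"
  by (rule has_weak_deriv_unique[OF assms(1) has_weak_deriv_weak_deriv[OF assms(2)] assms(2)])

lemma has_weak_deriv_add:
  assumes "has_weak_deriv S b f g" "has_weak_deriv S b f' g'"
  shows "has_weak_deriv S b (\<lambda>x. f x + f' x) (\<lambda>x. g x + g' x)"
  unfolding has_weak_deriv_iff distrib_right
proof (intro conjI allI impI)
  note D = has_weak_derivD[OF assms(1)] has_weak_derivD[OF assms(2)]
  show "loc_integrable S (\<lambda>x. f x + f' x)" "loc_integrable S (\<lambda>x. g x + g' x)"
    using D by (auto intro: loc_integrable_add)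
  fix \<psi> assume \<psi>: "test_function S \<psi>"
  note i = loc_integrable_test(1)[OF _ \<psi>] loc_integrable_test(1)[OF _ test_function_frechet[OF \<psi>]]
  show "(LINT x|lborel. f x * frechet_derivative \<psi> (at x) b + f' x * frechet_derivative \<psi> (at x) b)
      = - (LINT x|lborel. g x * \<psi> x + g' x * \<psi> x)"
    by (subst (1 2) Bochner_Integration.integral_add) (use D(3)[OF \<psi>] D(6)[OF \<psi>] in \<open>simp_all add: i D\<close>)
qed

lemma has_weak_deriv_cmult:
  assumes "has_weak_deriv S b f g" shows "has_weak_deriv S b (\<lambda>x. c * f x) (\<lambda>x. c * g x)"
  unfolding has_weak_deriv_iff mult.assoc
  using has_weak_derivD[OF assms] by (simp add: loc_integrable_cmult)

text \<open>Product rule with a linear factor, because \<open>(x \<bullet> h) * \<psi> x\<close> is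
  again a test function. It serves the divergence constraint, which is stated with the derivatives
  of \<open>r u\<close> and \<open>r w\<close>.\<close>

lemma has_weak_deriv_mult_inner:
  fixes h :: "'a::euclidean_space"
  assumes w: "has_weak_deriv S b f g"
  shows "has_weak_deriv S b (\<lambda>x. (x \<bullet> h) * f x) (\<lambda>x. (b \<bullet> h) * f x + (x \<bullet> h) * g x)"
  unfolding has_weak_deriv_iff
proof (intro conjI allI impI)
  have l: "loc_integrable S f" "loc_integrable S g" using has_weak_derivD[OF w] by blast+
  have c: "continuous_on UNIV (\<lambda>x::'a. x \<bullet> h)" by (intro continuous_intros)
  show "loc_integrable S (\<lambda>x. (x \<bullet> h) * f x)" "loc_integrable S (\<lambda>x. (b \<bullet> h) * f x + (x \<bullet> h) * g x)"
    using l c by (auto intro: loc_integrable_add loc_integrable_mult_continuous loc_integrable_cmult)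
  fix \<psi> assume \<psi>: "test_function S \<psi>"
  then have s: "smooth \<psi>" by (simp add: test_function_def)
  have t: "test_function S (\<lambda>x. (x \<bullet> h) * \<psi> x)" by (rule test_function_mult[OF smooth_inner \<psi>])
  have d: "frechet_derivative (\<lambda>x. (x \<bullet> h) * \<psi> x) (at x) b = (x \<bullet> h) * frechet_derivative \<psi> (at x) b + (b \<bullet> h) * \<psi> x" for x
  proof -
    have "((\<lambda>x. x \<bullet> h) has_derivative (\<lambda>b. b \<bullet> h)) (at x)" by (auto intro!: derivative_eq_intros)
    then show ?thesis using frechet_mult[OF smooth_inner s] by (simp add: frechet_derivative_eqI)
  qed
  have "(LINT x|lborel. f x * ((x \<bullet> h) * frechet_derivative \<psi> (at x) b + (b \<bullet> h) * \<psi> x))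
      = - (LINT x|lborel. g x * ((x \<bullet> h) * \<psi> x))"
    using has_weak_derivD(3)[OF w t] by (simp only: d)
  moreover have "(LINT x|lborel. f x * ((x \<bullet> h) * frechet_derivative \<psi> (at x) b + (b \<bullet> h) * \<psi> x))
      = (LINT x|lborel. f x * ((x \<bullet> h) * frechet_derivative \<psi> (at x) b)) + (LINT x|lborel. f x * ((b \<bullet> h) * \<psi> x))"
    unfolding distrib_left
    by (intro Bochner_Integration.integral_add loc_integrable_test(1)[OF l(1)] test_function_mult smooth_inner
        smooth_const test_function_frechet \<psi>)
  moreover have "(LINT x|lborel. ((b \<bullet> h) * f x + (x \<bullet> h) * g x) * \<psi> x)
      = (LINT x|lborel. f x * ((b \<bullet> h) * \<psi> x)) + (LINT x|lborel. g x * ((x \<bullet> h) * \<psi> x))"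
  proof -
    have "(LINT x|lborel. ((b \<bullet> h) * f x + (x \<bullet> h) * g x) * \<psi> x)
        = (LINT x|lborel. f x * ((b \<bullet> h) * \<psi> x) + g x * ((x \<bullet> h) * \<psi> x))"
      by (intro Bochner_Integration.integral_cong) (auto simp: algebra_simps)
    also have "\<dots> = (LINT x|lborel. f x * ((b \<bullet> h) * \<psi> x)) + (LINT x|lborel. g x * ((x \<bullet> h) * \<psi> x))"
      by (intro Bochner_Integration.integral_add loc_integrable_test(1)[OF l(1)] loc_integrable_test(1)[OF l(2)] t
         test_function_mult smooth_const \<psi>)
    finally show ?thesis .
  qed
  moreover have "(\<lambda>x. (x \<bullet> h) * f x * frechet_derivative \<psi> (at x) b) = (\<lambda>x. f x * ((x \<bullet> h) * frechet_derivative \<psi> (at x) b))"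
    by (auto simp: fun_eq_iff)
  ultimately show "(LINT x|lborel. (x \<bullet> h) * f x * frechet_derivative \<psi> (at x) b) =
      - (LINT x|lborel. ((b \<bullet> h) * f x + (x \<bullet> h) * g x) * \<psi> x)"
    by simp
qed

section \<open>Calculus along lines, inequalities and energy identities in the strip\<close>

section \<open>One-dimensional inequalities\<close>

lemma nn_cauchy_schwarz_set:
  fixes f :: "'a \<Rightarrow> real"
  assumes [measurable]: "f \<in> borel_measurable M" "A \<in> sets M"
  shows "(\<integral>\<^sup>+x. ennreal (\<bar>f x\<bar>) * indicator A x \<partial>M)\<^sup>2
    \<le> emeasure M A * (\<integral>\<^sup>+x. ennreal ((f x)\<^sup>2) * indicator A x \<partial>M)"
proof -
  have "(\<integral>\<^sup>+x. ennreal (\<bar>f x\<bar>) * indicator A x \<partial>M)\<^sup>2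
      = (\<integral>\<^sup>+x. indicator A x * (ennreal (\<bar>f x\<bar>) * indicator A x) \<partial>M)\<^sup>2"
    by (intro arg_cong[where f = "\<lambda>x. x\<^sup>2"] nn_integral_cong) (auto simp: indicator_def)
  also have "\<dots> \<le> (\<integral>\<^sup>+x. (indicator A x)\<^sup>2 \<partial>M) * (\<integral>\<^sup>+x. (ennreal (\<bar>f x\<bar>) * indicator A x)\<^sup>2 \<partial>M)"
    by (rule Cauchy_Schwarz_nn_integral) auto
  also have "(\<integral>\<^sup>+x. (indicator A x)\<^sup>2 \<partial>M) = (\<integral>\<^sup>+x. indicator A x \<partial>M)"
    by (intro nn_integral_cong) (auto simp: indicator_def)
  also have "\<dots> = emeasure M A" by simp
  also have "(\<integral>\<^sup>+x. (ennreal (\<bar>f x\<bar>) * indicator A x)\<^sup>2 \<partial>M) = (\<integral>\<^sup>+x. ennreal ((f x)\<^sup>2) * indicator A x \<partial>M)"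
    by (intro nn_integral_cong) (auto simp: indicator_def ennreal_power)
  finally show ?thesis .
qed

text \<open>Holds for all functions, since a Bochner integral that does not exist has the value
  0.\<close>

lemma ennreal_set_integral_le:
  fixes f :: "'a \<Rightarrow> real"
  shows "ennreal (\<bar>LINT x:A|M. f x\<bar>) \<le> (\<integral>\<^sup>+x. ennreal (\<bar>f x\<bar>) * indicator A x \<partial>M)"
proof (cases "set_integrable M A f")
  case True
  have "ennreal (norm (LINT x:A|M. f x)) \<le> (\<integral>\<^sup>+x. ennreal (norm (indicator A x *\<^sub>R f x)) \<partial>M)"
    unfolding set_lebesgue_integral_def
    by (rule integral_norm_bound_ennreal) (use True in \<open>simp add: set_integrable_def\<close>)
  also have "\<dots> = (\<integral>\<^sup>+x. ennreal (\<bar>f x\<bar>) * indicator A x \<partial>M)"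
    by (intro nn_integral_cong) (auto simp: indicator_def)
  finally show ?thesis by simp
next
  case False
  then show ?thesis by (simp add: set_lebesgue_integral_def set_integrable_def not_integrable_integral_eq)
qed

lemma set_integral_square_le:
  fixes f :: "'a \<Rightarrow> real"
  assumes [measurable]: "f \<in> borel_measurable M" "A \<in> sets M"
  shows "ennreal ((LINT x:A|M. f x)\<^sup>2) \<le> emeasure M A * (\<integral>\<^sup>+x. ennreal ((f x)\<^sup>2) * indicator A x \<partial>M)"
proof -
  have "ennreal ((LINT x:A|M. f x)\<^sup>2) = (ennreal \<bar>LINT x:A|M. f x\<bar>)\<^sup>2" by (simp add: ennreal_power)
  also have "\<dots> \<le> (\<integral>\<^sup>+x. ennreal (\<bar>f x\<bar>) * indicator A x \<partial>M)\<^sup>2"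
    by (intro power_mono ennreal_set_integral_le) auto
  finally show ?thesis using nn_cauchy_schwarz_set[of f M A] by simp
qed

lemma interval_integral_square_le:
  fixes f :: "real \<Rightarrow> real"
  assumes [measurable]: "f \<in> borel_measurable borel" and "a \<le> b"
  shows "ennreal ((LINT x:{a..b}|lborel. f x)\<^sup>2) \<le> ennreal (b - a) * (\<integral>\<^sup>+x. ennreal ((f x)\<^sup>2) * indicator {a..b} x \<partial>lborel)"
  using set_integral_square_le[of f lborel "{a..b}"] assms by simp

text \<open>One of two power integrals behind Hardy's constant: this one is the cost of the
  Cauchy-Schwarz weight, and \<open>nn_integral_powr_tail\<close> is what is left after the
  integrals have been exchanged.\<close>

lemma nn_integral_inverse_sqrt:
  fixes a r :: real
  assumes "a \<le> r"
  shows "(\<integral>\<^sup>+s. ennreal ((s - a) powr (-1/2)) * indicator {a..r} s \<partial>lborel) = ennreal (2 * (r - a) powr (1/2))"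
proof -
  have "(\<integral>\<^sup>+s. ennreal ((s - a) powr (-1/2)) * indicator {a..r} s \<partial>lborel)
      = (\<integral>\<^sup>+s. ennreal (s powr (-1/2)) * indicator {0..r - a} s \<partial>lborel)"
    by (subst nn_integral_real_affine[where c = 1 and t = a])
      (auto simp: indicator_def intro!: nn_integral_cong)
  also have "\<dots> = (\<integral>\<^sup>+s. ennreal (indicator {0..r - a} s * s powr (-1/2)) \<partial>lborel)"
    by (intro nn_integral_cong) (auto simp: indicator_def)
  also have "\<dots> = ennreal (2 * (r - a) powr (1/2))"
  proof (rule nn_integral_has_integral_lborel)
    have "((\<lambda>s. s powr (-1/2)) has_integral ((r - a) powr (-1/2 + 1) / (-1/2 + 1))) {0..r - a}"
      by (rule has_integral_powr_from_0) (use assms in auto)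
    then have "((\<lambda>s. s powr (-1/2)) has_integral (2 * (r - a) powr (1/2))) {0..r - a}" by (simp add: mult.commute)
    then have "((\<lambda>s. if s \<in> {0..r - a} then s powr (-1/2) else 0) has_integral (2 * (r - a) powr (1/2))) UNIV"
      by (subst has_integral_restrict_UNIV)
    then show "((\<lambda>s. indicator {0..r - a} s * s powr (-1/2)) has_integral (2 * (r - a) powr (1/2))) UNIV"
      by (rule has_integral_eq[rotated]) (auto simp: indicator_def)
  qed auto
  finally show ?thesis .
qed

lemma nn_integral_powr_tail:
  fixes a s :: real
  assumes "a < s"
  shows "(\<integral>\<^sup>+r. ennreal ((r - a) powr (-3/2)) * indicator {s..} r \<partial>lborel) = ennreal (2 * (s - a) powr (-1/2))"
proof -
  have "(\<integral>\<^sup>+r. ennreal ((r - a) powr (-3/2)) * indicator {s..} r \<partial>lborel) = ennreal (0 - (- 2 * (s - a) powr (-1/2)))"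
  proof (rule nn_integral_FTC_atLeast)
    show "DERIV (\<lambda>r. - 2 * (r - a) powr (-1/2)) r :> (r - a) powr (-3/2)" if "s \<le> r" for r
      using that assms by (auto intro!: derivative_eq_intros simp: powr_diff)
    have "filterlim (\<lambda>r. r - a) at_top at_top"
      using filterlim_tendsto_add_at_top[OF tendsto_const[of "- a"] filterlim_ident] by simp
    then have "((\<lambda>r. - 2 * (r - a) powr (-1/2)) \<longlongrightarrow> - 2 * 0) at_top"
      by (intro tendsto_intros tendsto_neg_powr) auto
    then show "((\<lambda>r. - 2 * (r - a) powr (-1/2)) \<longlongrightarrow> 0) at_top" by simp
  qed auto
  then show ?thesis by simp
qed

lemma powr_square: "(x powr p)\<^sup>2 = x powr (2 * p)" for x p :: real
  unfolding power2_eq_square by (subst powr_add[symmetric]) simp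

text \<open>The Cauchy--Schwarz weights \<open>(s - a)\<^sup>1\<^sup>/\<^sup>4\<close> turn Hardy's inequality into an exchange of integrals.\<close>

lemma hardy_inequality:
  fixes f g :: "real \<Rightarrow> real"
  assumes [measurable]: "f \<in> borel_measurable borel" "g \<in> borel_measurable borel"
    and fg: "AE r in lborel. a < r \<longrightarrow> ennreal \<bar>f r\<bar> \<le> (\<integral>\<^sup>+s. ennreal \<bar>g s\<bar> * indicator {a..r} s \<partial>lborel)"
  shows "(\<integral>\<^sup>+r. ennreal ((f r / (r - a))\<^sup>2) * indicator {a<..} r \<partial>lborel)
    \<le> 4 * (\<integral>\<^sup>+s. ennreal ((g s)\<^sup>2) * indicator {a<..} s \<partial>lborel)"
proof -
  define G where "G s = ennreal ((g s)\<^sup>2 * (s - a) powr (1/2))" for s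
  have [measurable]: "G \<in> borel_measurable borel" unfolding G_def by measurable
  have cs: "(\<integral>\<^sup>+s. ennreal \<bar>g s\<bar> * indicator {a..r} s \<partial>lborel)\<^sup>2
      \<le> (\<integral>\<^sup>+s. G s * indicator {a<..r} s \<partial>lborel) * ennreal (2 * (r - a) powr (1/2))" if "a < r" for r
  proof -
    have eq: "(\<integral>\<^sup>+s. ennreal \<bar>g s\<bar> * indicator {a..r} s \<partial>lborel)
        = (\<integral>\<^sup>+s. (ennreal (\<bar>g s\<bar> * (s - a) powr (1/4)) * indicator {a<..r} s) * (ennreal ((s - a) powr (-1/4)) * indicator {a<..r} s) \<partial>lborel)"
    proof (intro nn_integral_cong_AE, use AE_lborel_singleton[of a] in eventually_elim)
      fix s assume "s \<noteq> a"
      have "s > a \<Longrightarrow> (s - a) powr (1/4) * (s - a) powr (-1/4) = 1" by (simp flip: powr_add)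
      then have "s > a \<Longrightarrow> ennreal \<bar>g s\<bar> = ennreal (\<bar>g s\<bar> * (s - a) powr (1/4)) * ennreal ((s - a) powr (-1/4))"
        by (subst ennreal_mult[symmetric]) (auto simp: mult.assoc)
      then show "ennreal \<bar>g s\<bar> * indicator {a..r} s = (ennreal (\<bar>g s\<bar> * (s - a) powr (1/4)) * indicator {a<..r} s) * (ennreal ((s - a) powr (-1/4)) * indicator {a<..r} s)"
        using \<open>s \<noteq> a\<close> by (auto simp: indicator_def)
    qed
    have "(\<integral>\<^sup>+s. ennreal \<bar>g s\<bar> * indicator {a..r} s \<partial>lborel)\<^sup>2
      \<le> (\<integral>\<^sup>+s. (ennreal (\<bar>g s\<bar> * (s - a) powr (1/4)) * indicator {a<..r} s)\<^sup>2 \<partial>lborel) *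
        (\<integral>\<^sup>+s. (ennreal ((s - a) powr (-1/4)) * indicator {a<..r} s)\<^sup>2 \<partial>lborel)"
      unfolding eq by (rule Cauchy_Schwarz_nn_integral) auto
    also have "(\<integral>\<^sup>+s. (ennreal (\<bar>g s\<bar> * (s - a) powr (1/4)) * indicator {a<..r} s)\<^sup>2 \<partial>lborel) = (\<integral>\<^sup>+s. G s * indicator {a<..r} s \<partial>lborel)"
    proof (intro nn_integral_cong)
      fix s
      have "s > a \<Longrightarrow> ((s - a) powr (1/4))\<^sup>2 = (s - a) powr (1/2)" by (subst powr_square) simp
      then have "s > a \<Longrightarrow> (ennreal (\<bar>g s\<bar> * (s - a) powr (1/4)))\<^sup>2 = G s"
        unfolding G_def by (subst ennreal_power) (auto simp: power_mult_distrib)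
      then show "(ennreal (\<bar>g s\<bar> * (s - a) powr (1/4)) * indicator {a<..r} s)\<^sup>2 = G s * indicator {a<..r} s"
        by (auto simp: indicator_def)
    qed
    also have "(\<integral>\<^sup>+s. (ennreal ((s - a) powr (-1/4)) * indicator {a<..r} s)\<^sup>2 \<partial>lborel)
        = (\<integral>\<^sup>+s. ennreal ((s - a) powr (-1/2)) * indicator {a..r} s \<partial>lborel)"
    proof (intro nn_integral_cong_AE, use AE_lborel_singleton[of a] in eventually_elim)
      fix s assume "s \<noteq> a"
      have "s > a \<Longrightarrow> ((s - a) powr (-1/4))\<^sup>2 = (s - a) powr (-1/2)" by (subst powr_square) simp
      then have "s > a \<Longrightarrow> (ennreal ((s - a) powr (-1/4)))\<^sup>2 = ennreal ((s - a) powr (-1/2))"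
        by (subst ennreal_power) auto
      then show "(ennreal ((s - a) powr (-1/4)) * indicator {a<..r} s)\<^sup>2 = ennreal ((s - a) powr (-1/2)) * indicator {a..r} s"
        using \<open>s \<noteq> a\<close> by (auto simp: indicator_def)
    qed
    also have "\<dots> = ennreal (2 * (r - a) powr (1/2))" by (rule nn_integral_inverse_sqrt) (use that in simp)
    finally show ?thesis .
  qed
  have "(\<integral>\<^sup>+r. ennreal ((f r / (r - a))\<^sup>2) * indicator {a<..} r \<partial>lborel)
     \<le> (\<integral>\<^sup>+r. (\<integral>\<^sup>+s. 2 * (ennreal ((r - a) powr (-3/2)) * (G s * indicator {a<..r} s)) \<partial>lborel) * indicator {a<..} r \<partial>lborel)"
  proof (intro nn_integral_mono_AE, use fg in eventually_elim)
    fix r assume r: "a < r \<longrightarrow> ennreal \<bar>f r\<bar> \<le> (\<integral>\<^sup>+s. ennreal \<bar>g s\<bar> * indicator {a..r} s \<partial>lborel)"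
    have "ennreal ((f r / (r - a))\<^sup>2) \<le> (\<integral>\<^sup>+s. 2 * (ennreal ((r - a) powr (-3/2)) * (G s * indicator {a<..r} s)) \<partial>lborel)"
      if ar: "a < r"
    proof -
      have "(ennreal \<bar>f r\<bar>)\<^sup>2 \<le> (\<integral>\<^sup>+s. ennreal \<bar>g s\<bar> * indicator {a..r} s \<partial>lborel)\<^sup>2"
        using r ar by (intro power_mono) auto
      also note cs[OF ar]
      finally have 1: "ennreal ((f r)\<^sup>2) \<le> (\<integral>\<^sup>+s. G s * indicator {a<..r} s \<partial>lborel) * ennreal (2 * (r - a) powr (1/2))"
        by (simp add: ennreal_power)
      have "ennreal ((f r / (r - a))\<^sup>2) = ennreal ((r - a) powr (-2)) * ennreal ((f r)\<^sup>2)"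
      proof -
        have "(r - a) powr (-2) = 1 / (r - a)\<^sup>2" using ar by (simp add: powr_minus_divide)
        then show ?thesis by (subst ennreal_mult[symmetric]) (auto simp: power_divide)
      qed
      also have "\<dots> \<le> ennreal ((r - a) powr (-2)) * ((\<integral>\<^sup>+s. G s * indicator {a<..r} s \<partial>lborel) * ennreal (2 * (r - a) powr (1/2)))"
        by (intro mult_left_mono 1) auto
      also have "\<dots> = ennreal ((r - a) powr (-2)) * ennreal (2 * (r - a) powr (1/2)) * (\<integral>\<^sup>+s. G s * indicator {a<..r} s \<partial>lborel)"
        by (simp add: mult_ac)
      also have "ennreal ((r - a) powr (-2)) * ennreal (2 * (r - a) powr (1/2)) = 2 * ennreal ((r - a) powr (-3/2))"
      proof -
        have "(r - a) powr (-2) * (r - a) powr (1/2) = (r - a) powr (-3/2)" by (simp flip: powr_add)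
        then have "(r - a) powr (-2) * (2 * (r - a) powr (1/2)) = 2 * (r - a) powr (-3/2)" by simp
        then have "ennreal ((r - a) powr (-2)) * ennreal (2 * (r - a) powr (1/2)) = ennreal (2 * (r - a) powr (-3/2))"
          by (subst ennreal_mult[symmetric]) auto
        also have "\<dots> = 2 * ennreal ((r - a) powr (-3/2))" by (simp add: ennreal_mult)
        finally show ?thesis .
      qed
      also have "2 * ennreal ((r - a) powr (-3/2)) * (\<integral>\<^sup>+s. G s * indicator {a<..r} s \<partial>lborel)
          = (\<integral>\<^sup>+s. 2 * (ennreal ((r - a) powr (-3/2)) * (G s * indicator {a<..r} s)) \<partial>lborel)"
        by (simp add: nn_integral_cmult mult.assoc)
      finally show ?thesis .
    qed
    then show "ennreal ((f r / (r - a))\<^sup>2) * indicator {a<..} r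
      \<le> (\<integral>\<^sup>+s. 2 * (ennreal ((r - a) powr (-3/2)) * (G s * indicator {a<..r} s)) \<partial>lborel) * indicator {a<..} r"
      by (auto simp: indicator_def)
  qed
  also have "\<dots> = (\<integral>\<^sup>+r. (\<integral>\<^sup>+s. 2 * (G s * indicator {a<..} s) * (ennreal ((r - a) powr (-3/2)) * indicator {s..} r) \<partial>lborel) \<partial>lborel)"
  proof (intro nn_integral_cong)
    fix r
    show "(\<integral>\<^sup>+s. 2 * (ennreal ((r - a) powr (-3/2)) * (G s * indicator {a<..r} s)) \<partial>lborel) * indicator {a<..} r
        = (\<integral>\<^sup>+s. 2 * (G s * indicator {a<..} s) * (ennreal ((r - a) powr (-3/2)) * indicator {s..} r) \<partial>lborel)"
    proof (cases "a < r")
      case True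
      then show ?thesis by (auto intro!: nn_integral_cong simp: indicator_def mult_ac)
    next
      case False
      then have "2 * (G s * indicator {a<..} s) * (ennreal ((r - a) powr (-3/2)) * indicator {s..} r) = 0" for s
        by (auto simp: indicator_def)
      note z = this
      show ?thesis unfolding z using False by simp
    qed
  qed
  also have "\<dots> = (\<integral>\<^sup>+s. (\<integral>\<^sup>+r. 2 * (G s * indicator {a<..} s) * (ennreal ((r - a) powr (-3/2)) * indicator {s..} r) \<partial>lborel) \<partial>lborel)"
  proof (rule lborel_pair.Fubini'[symmetric])
    have "(\<lambda>(r, s). 2 * (G s * indicator {a<..} s) * (ennreal ((r - a) powr (-3/2)) * (indicator {p. snd p \<le> fst p} (r, s)))) \<in> borel_measurable (lborel \<Otimes>\<^sub>M lborel)"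
      by measurable
    then show "(\<lambda>(r, s). 2 * (G s * indicator {a<..} s) * (ennreal ((r - a) powr (-3/2)) * indicator {s..} r)) \<in> borel_measurable (lborel \<Otimes>\<^sub>M lborel)"
      by (simp add: indicator_def)
  qed
  also have "\<dots> = (\<integral>\<^sup>+s. 4 * (ennreal ((g s)\<^sup>2) * indicator {a<..} s) \<partial>lborel)"
  proof (intro nn_integral_cong)
    fix s
    show "(\<integral>\<^sup>+r. 2 * (G s * indicator {a<..} s) * (ennreal ((r - a) powr (-3/2)) * indicator {s..} r) \<partial>lborel)
        = 4 * (ennreal ((g s)\<^sup>2) * indicator {a<..} s)"
    proof (cases "a < s")
      case True
      \<comment> \<open>The weights cancel. The constant 4 is the product of the factors 2 from
        \<open>nn_integral_inverse_sqrt\<close> and \<open>nn_integral_powr_tail\<close>.\<close>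
      have "(s - a) powr (1/2) * (s - a) powr (-1/2) = 1" using True by (simp flip: powr_add)
      then have *: "2 * ((g s)\<^sup>2 * (s - a) powr (1/2)) * (2 * (s - a) powr (-1/2)) = 4 * (g s)\<^sup>2" by simp
      have "(\<integral>\<^sup>+r. 2 * (G s * indicator {a<..} s) * (ennreal ((r - a) powr (-3/2)) * indicator {s..} r) \<partial>lborel)
          = 2 * (G s * indicator {a<..} s) * ennreal (2 * (s - a) powr (-1/2))"
        by (subst nn_integral_cmult) (auto simp: nn_integral_powr_tail[OF True, simplified])
      also have "\<dots> = ennreal (2 * ((g s)\<^sup>2 * (s - a) powr (1/2)) * (2 * (s - a) powr (-1/2)))"
      proof -
        have e: "2 * ennreal x * ennreal y = ennreal (2 * x * y)" if "x \<ge> 0" "y \<ge> 0" for x y :: real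
          using that by (simp add: ennreal_mult)
        show ?thesis using e[of "(g s)\<^sup>2 * (s - a) powr (1/2)" "2 * (s - a) powr (-1/2)"] True by (simp add: G_def)
      qed
      also have "\<dots> = 4 * (ennreal ((g s)\<^sup>2) * indicator {a<..} s)"
        unfolding * using True by (simp add: ennreal_mult)
      finally show ?thesis .
    qed simp
  qed
  also have "\<dots> = 4 * (\<integral>\<^sup>+s. ennreal ((g s)\<^sup>2) * indicator {a<..} s \<partial>lborel)"
    by (intro nn_integral_cmult) auto
  finally show ?thesis .
qed

section \<open>Products of primitives\<close>

lemma integrable_tensor:
  fixes f g :: "real \<Rightarrow> real"
  assumes f: "integrable lborel f" and g: "integrable lborel g"
  shows "integrable (lborel \<Otimes>\<^sub>M lborel) (\<lambda>(x, y). f x * g y)"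
proof (rule lborel_pair.Fubini_integrable)
  have [measurable]: "f \<in> borel_measurable borel" "g \<in> borel_measurable borel" using f g by auto
  show "(\<lambda>(x, y). f x * g y) \<in> borel_measurable (lborel \<Otimes>\<^sub>M lborel)" by measurable
  show "integrable lborel (\<lambda>x. LINT y|lborel. norm (case (x, y) of (x, y) \<Rightarrow> f x * g y))"
    using f g by (simp add: abs_mult)
  show "AE x in lborel. integrable lborel (\<lambda>y. case (x, y) of (x, y) \<Rightarrow> f x * g y)"
    using g by simp
qed

text \<open>Integration by parts without a theory of absolute continuity: the square
  \<open>{a..b} \<times> {a..b}\<close> is split along its diagonal, and Fubini's theorem evaluates
  the integral of \<open>F' s * Q' t\<close> over each triangle. The representations are assumed
  almost everywhere, which is what the sections of a weakly differentiable function provide.\<close>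

lemma product_of_primitives:
  fixes F F' Q Q' :: "real \<Rightarrow> real"
  assumes "a \<le> b"
    and [measurable]: "F \<in> borel_measurable borel" "Q \<in> borel_measurable borel"
    and F': "set_integrable lborel {a..b} F'" and Q': "set_integrable lborel {a..b} Q'"
    and F: "AE t in lborel. t \<in> {a..b} \<longrightarrow> F t = (LINT s:{a..t}|lborel. F' s)"
    and Q: "AE t in lborel. t \<in> {a..b} \<longrightarrow> Q t = c + (LINT s:{a..t}|lborel. Q' s)"
  shows "set_integrable lborel {a..b} (\<lambda>t. F' t * Q t + F t * Q' t)"
    and "(LINT t:{a..b}|lborel. F' t * Q t + F t * Q' t)
      = (LINT s:{a..b}|lborel. F' s) * (c + (LINT s:{a..b}|lborel. Q' s))"
proof -
  define f where "f s = indicator {a..b} s * F' s" for s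
  define q where "q s = indicator {a..b} s * Q' s" for s
  have fi: "integrable lborel f" and qi: "integrable lborel q"
    using F' Q' by (simp_all add: set_integrable_def f_def[abs_def] q_def[abs_def])
  have [measurable]: "f \<in> borel_measurable borel" "q \<in> borel_measurable borel" using fi qi by auto
  \<comment> \<open>The parts below and above the diagonal: integrating \<open>K1\<close> over
    \<open>t\<close> produces \<open>Q s - c\<close>, and integrating \<open>K2\<close> over
    \<open>s\<close> produces \<open>F t\<close>, each times the remaining factor.\<close>
  define K1 where "K1 = (\<lambda>(s::real, t::real). f s * q t * indicator {p. snd p \<le> fst p} (s, t))"
  define K2 where "K2 = (\<lambda>(s::real, t::real). f s * q t * indicator {p. fst p < snd p} (s, t))"
  have [measurable]: "K1 \<in> borel_measurable (lborel \<Otimes>\<^sub>M lborel)" "K2 \<in> borel_measurable (lborel \<Otimes>\<^sub>M lborel)"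
    unfolding K1_def K2_def by measurable
  have ti: "integrable (lborel \<Otimes>\<^sub>M lborel) (\<lambda>(s, t). f s * q t)" by (rule integrable_tensor[OF fi qi])
  have K1i: "integrable (lborel \<Otimes>\<^sub>M lborel) K1" and K2i: "integrable (lborel \<Otimes>\<^sub>M lborel) K2"
    by (rule Bochner_Integration.integrable_bound[OF ti]; auto simp: K1_def K2_def indicator_def)+
  have sum: "(LINT s|lborel. f s) * (LINT t|lborel. q t)
      = (LINT s|lborel. LINT t|lborel. K1 (s, t)) + (LINT t|lborel. LINT s|lborel. K2 (s, t))"
  proof -
    have "(LINT s|lborel. f s) * (LINT t|lborel. q t) = (LINT p|(lborel \<Otimes>\<^sub>M lborel). (case p of (s, t) \<Rightarrow> f s * q t))"
      using lborel_pair.integral_fst'[OF ti] by simp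
    also have "\<dots> = (LINT p|(lborel \<Otimes>\<^sub>M lborel). K1 p + K2 p)"
      by (intro Bochner_Integration.integral_cong) (auto simp: K1_def K2_def indicator_def)
    also have "\<dots> = (LINT p|(lborel \<Otimes>\<^sub>M lborel). K1 p) + (LINT p|(lborel \<Otimes>\<^sub>M lborel). K2 p)"
      using K1i K2i by simp
    also have "(LINT p|(lborel \<Otimes>\<^sub>M lborel). K1 p) = (LINT s|lborel. LINT t|lborel. K1 (s, t))"
      by (rule lborel_pair.integral_fst'[OF K1i, symmetric])
    also have "(LINT p|(lborel \<Otimes>\<^sub>M lborel). K2 p) = (LINT t|lborel. LINT s|lborel. K2 (s, t))"
      using lborel_pair.integral_snd[of "\<lambda>s t. K2 (s, t)"] K2i by simp
    finally show ?thesis .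
  qed
  have k1: "AE s in lborel. (LINT t|lborel. K1 (s, t)) = f s * (Q s - c)"
    using Q
  proof eventually_elim
    fix s assume s: "s \<in> {a..b} \<longrightarrow> Q s = c + (LINT s:{a..s}|lborel. Q' s)"
    have "(LINT t|lborel. K1 (s, t)) = (LINT t|lborel. f s * (indicator {a..s} t * Q' t))"
      by (intro Bochner_Integration.integral_cong) (auto simp: K1_def q_def f_def indicator_def)
    then show "(LINT t|lborel. K1 (s, t)) = f s * (Q s - c)"
      using s by (auto simp: set_lebesgue_integral_def f_def indicator_def)
  qed
  have k2: "AE t in lborel. (LINT s|lborel. K2 (s, t)) = q t * F t"
    using F
  proof eventually_elim
    fix t assume t: "t \<in> {a..b} \<longrightarrow> F t = (LINT s:{a..t}|lborel. F' s)"
    have "(LINT s|lborel. K2 (s, t)) = (LINT s|lborel. q t * (indicator {a..t} s * F' s))"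
    proof (cases "t \<in> {a..b}")
      case True
      have [measurable]: "(\<lambda>s. indicator {a..t} s * F' s) \<in> borel_measurable borel"
      proof -
        have "(\<lambda>s. indicator {a..t} s * F' s) = (\<lambda>s. indicator {a..t} s * f s)"
          using True by (auto simp: f_def indicator_def fun_eq_iff)
        then show ?thesis by simp
      qed
      show ?thesis
      proof (rule integral_cong_AE)
        show "AE s in lborel. K2 (s, t) = q t * (indicator {a..t} s * F' s)"
          using AE_lborel_singleton[of t]
          by eventually_elim (use True in \<open>auto simp: K2_def f_def indicator_def\<close>)
        show "(\<lambda>s. K2 (s, t)) \<in> borel_measurable lborel" unfolding K2_def by simp
      qed simp
    qed (simp add: K2_def q_def)
    then show "(LINT s|lborel. K2 (s, t)) = q t * F t"
      using t by (auto simp: set_lebesgue_integral_def q_def indicator_def)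
  qed
  have i1: "integrable lborel (\<lambda>s. f s * (Q s - c))" 
    using lborel_pair.integrable_fst'[OF K1i] k1 by (subst integrable_cong_AE[OF _ _ k1, symmetric]) auto
  have i2: "integrable lborel (\<lambda>t. q t * F t)"
    using lborel_pair.integrable_snd[of "\<lambda>s t. K2 (s, t)"] K2i
    by (subst integrable_cong_AE[OF _ _ k2, symmetric]) auto
  have i3: "integrable lborel (\<lambda>s. f s * (Q s - c) + c * f s + q s * F s)"
    using i1 i2 fi by simp
  have e: "indicator {a..b} s *\<^sub>R (F' s * Q s + F s * Q' s) = f s * (Q s - c) + c * f s + q s * F s" for s
    by (auto simp: f_def q_def indicator_def algebra_simps)
  show "set_integrable lborel {a..b} (\<lambda>t. F' t * Q t + F t * Q' t)"
    unfolding set_integrable_def e by (rule i3)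
  have "(LINT t:{a..b}|lborel. F' t * Q t + F t * Q' t)
      = (LINT s|lborel. f s * (Q s - c)) + c * (LINT s|lborel. f s) + (LINT s|lborel. q s * F s)"
    unfolding set_lebesgue_integral_def e using i1 i2 fi by simp
  also have "(LINT s|lborel. f s * (Q s - c)) = (LINT s|lborel. LINT t|lborel. K1 (s, t))"
    using k1 by (intro integral_cong_AE) (auto elim: eventually_mono)
  also have "(LINT s|lborel. q s * F s) = (LINT t|lborel. LINT s|lborel. K2 (s, t))"
    using k2 by (intro integral_cong_AE) (auto elim: eventually_mono)
  also have "(LINT s|lborel. LINT t|lborel. K1 (s, t)) + c * (LINT s|lborel. f s) + (LINT t|lborel. LINT s|lborel. K2 (s, t))
     = (LINT s|lborel. f s) * (c + (LINT t|lborel. q t))"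
    using sum by (simp add: algebra_simps)
  also have "\<dots> = (LINT s:{a..b}|lborel. F' s) * (c + (LINT s:{a..b}|lborel. Q' s))"
    by (simp add: set_lebesgue_integral_def f_def q_def)
  finally show "(LINT t:{a..b}|lborel. F' t * Q t + F t * Q' t)
      = (LINT s:{a..b}|lborel. F' s) * (c + (LINT s:{a..b}|lborel. Q' s))" .
qed

text \<open>The end value formula applied on \<open>{a..t}\<close> for almost every
  \<open>t\<close>. The product is thus again a primitive and can be multiplied once more.\<close>

lemma product_is_primitive:
  fixes F F' Q Q' :: "real \<Rightarrow> real"
  assumes "a \<le> b"
    and m: "F \<in> borel_measurable borel" "Q \<in> borel_measurable borel"
    and F': "set_integrable lborel {a..b} F'" and Q': "set_integrable lborel {a..b} Q'"
    and F: "AE t in lborel. t \<in> {a..b} \<longrightarrow> F t = (LINT s:{a..t}|lborel. F' s)"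
    and Q: "AE t in lborel. t \<in> {a..b} \<longrightarrow> Q t = c + (LINT s:{a..t}|lborel. Q' s)"
  shows "AE t in lborel. t \<in> {a..b} \<longrightarrow> F t * Q t = (LINT s:{a..t}|lborel. F' s * Q s + F s * Q' s)"
  using F Q
proof eventually_elim
  fix t assume F1: "t \<in> {a..b} \<longrightarrow> F t = (LINT s:{a..t}|lborel. F' s)"
    and Q1: "t \<in> {a..b} \<longrightarrow> Q t = c + (LINT s:{a..t}|lborel. Q' s)"
  show "t \<in> {a..b} \<longrightarrow> F t * Q t = (LINT s:{a..t}|lborel. F' s * Q s + F s * Q' s)"
  proof
    assume t: "t \<in> {a..b}"
    have "(LINT s:{a..t}|lborel. F' s * Q s + F s * Q' s) = (LINT s:{a..t}|lborel. F' s) * (c + (LINT s:{a..t}|lborel. Q' s))"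
    proof (rule product_of_primitives(2))
      show "set_integrable lborel {a..t} F'" "set_integrable lborel {a..t} Q'"
        using t by (auto intro: set_integrable_subset[OF F'] set_integrable_subset[OF Q'])
      show "AE s in lborel. s \<in> {a..t} \<longrightarrow> F s = (LINT s:{a..s}|lborel. F' s)"
        using F by eventually_elim (use t in auto)
      show "AE s in lborel. s \<in> {a..t} \<longrightarrow> Q s = c + (LINT s:{a..s}|lborel. Q' s)"
        using Q by eventually_elim (use t in auto)
    qed (use t m in auto)
    then show "F t * Q t = (LINT s:{a..t}|lborel. F' s * Q s + F s * Q' s)" using F1 Q1 t by simp
  qed
qed

section \<open>Functions on the strip that are primitives of their derivatives\<close>

lemma measurable_fst_real [measurable]: "fst \<in> borel_measurable (borel :: (real \<times> real) measure)"
  by (intro borel_measurable_continuous_onI continuous_intros)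

lemma measurable_snd_real [measurable]: "snd \<in> borel_measurable (borel :: (real \<times> real) measure)"
  by (intro borel_measurable_continuous_onI continuous_intros)

lemma measurable_lborel2:
  fixes f :: "real \<times> real \<Rightarrow> 'b::topological_space"
  assumes "f \<in> borel_measurable borel" shows "f \<in> borel_measurable (lborel \<Otimes>\<^sub>M lborel)"
  using assms by (simp add: lborel_prod borel_prod)

lemma nn_integral_iterated:
  fixes F :: "real \<times> real \<Rightarrow> ennreal"
  assumes "F \<in> borel_measurable borel"
  shows "(\<integral>\<^sup>+x. F x \<partial>lborel) = (\<integral>\<^sup>+r. \<integral>\<^sup>+z. F (r, z) \<partial>lborel \<partial>lborel)"
    and "(\<integral>\<^sup>+x. F x \<partial>lborel) = (\<integral>\<^sup>+z. \<integral>\<^sup>+r. F (r, z) \<partial>lborel \<partial>lborel)"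
  using lborel.nn_integral_fst[OF measurable_lborel2[OF assms]] lborel_pair.nn_integral_snd[OF measurable_lborel2[OF assms]]
  by (simp_all add: lborel_prod)

lemma AE_iterated:
  fixes P :: "real \<times> real \<Rightarrow> bool"
  assumes "{x. P x} \<in> sets borel" "AE r in lborel. AE z in lborel. P (r, z)"
  shows "AE x in lborel. P x"
proof -
  have "{x. P x} \<in> sets (borel \<Otimes>\<^sub>M borel)" using assms(1) by (simp only: borel_prod)
  then show ?thesis
    unfolding lborel_prod[symmetric] by (intro lborel_pair.AE_pair_measure) (use assms(2) in \<open>simp_all add: space_pair_measure\<close>)
qed

text \<open>Exchanging the two quantifiers requires a measurable exceptional set; this is why
  primitives are repeatedly shown to be measurable jointly in both variables.\<close>

lemma AE_iterated_swap:
  fixes P :: "real \<times> real \<Rightarrow> bool"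
  assumes "{x. P x} \<in> sets borel" "AE z in lborel. AE r in lborel. P (r, z)"
  shows "AE r in lborel. AE z in lborel. P (r, z)"
proof -
  have "{x. P x} \<in> sets (borel \<Otimes>\<^sub>M borel)" using assms(1) by (simp only: borel_prod)
  then show ?thesis
    using lborel_pair.AE_commute[of "\<lambda>r z. P (r, z)"] assms(2) by (simp add: space_pair_measure)
qed

lemma AE_iterated_both:
  fixes P :: "real \<times> real \<Rightarrow> bool"
  assumes "AE x in lborel. P x"
  shows "AE r in lborel. AE z in lborel. P (r, z)" "AE z in lborel. AE r in lborel. P (r, z)"
proof -
  obtain N where N: "{x. \<not> P x} \<subseteq> N" "N \<in> null_sets lborel" using assms by (auto elim!: AE_E2 simp: eventually_ae_filter)
  then have n: "AE x in lborel \<Otimes>\<^sub>M lborel. x \<notin> N" by (simp add: lborel_prod AE_not_in)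
  have NP: "x \<notin> N \<Longrightarrow> P x" for x using N by blast
  have 1: "AE r in lborel. AE z in lborel. (r, z) \<notin> N" using lborel_pair.AE_pair[OF n] .
  have "N \<in> sets borel" using N(2) by auto
  then have "{x. x \<notin> N} \<in> sets borel" by (simp add: Collect_neg_eq)
  then have "AE z in lborel. AE r in lborel. (r, z) \<notin> N"
    using lborel_pair.AE_commute[of "\<lambda>r z. (r, z) \<notin> N"] 1 by (simp add: space_pair_measure borel_prod[symmetric])
  then show "AE z in lborel. AE r in lborel. P (r, z)"
    by (rule eventually_mono) (auto elim: eventually_mono intro: NP)
  show "AE r in lborel. AE z in lborel. P (r, z)"
    by (rule eventually_mono[OF 1]) (auto elim: eventually_mono intro: NP)
qed

lemma set_integrable_square:
  fixes f :: "real \<Rightarrow> real"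
  assumes [measurable]: "f \<in> borel_measurable borel" and fin: "(\<integral>\<^sup>+x. ennreal ((f x)\<^sup>2) \<partial>lborel) < \<infinity>"
  shows "set_integrable lborel {a..b} f"
  unfolding set_integrable_def
proof (rule Bochner_Integration.integrable_bound)
  have "integrable lborel (\<lambda>x. (f x)\<^sup>2)" using fin by (auto simp: integrable_iff_bounded)
  then show "integrable lborel (\<lambda>x. indicator {a..b} x + (f x)\<^sup>2)"
    by (intro Bochner_Integration.integrable_add integrable_real_indicator) (auto simp: emeasure_lborel_Icc_eq)
  have "\<bar>t\<bar> \<le> 1 + t\<^sup>2" for t :: real
    using sum_squares_bound[of 1 "\<bar>t\<bar>"] by simp
  then show "AE x in lborel. norm (indicator {a..b} x *\<^sub>R f x) \<le> norm (indicator {a..b} x + (f x)\<^sup>2)"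
    by (auto simp: indicator_def intro!: AE_I2)
qed simp

abbreviation nn2 :: "(real \<times> real \<Rightarrow> real) \<Rightarrow> ennreal" where
  "nn2 f \<equiv> \<integral>\<^sup>+x. ennreal ((f x)\<^sup>2) \<partial>lborel"

abbreviation nnw :: "(real \<times> real \<Rightarrow> real) \<Rightarrow> ennreal" where
  "nnw f \<equiv> \<integral>\<^sup>+x. ennreal ((f x)\<^sup>2 * fst x) \<partial>lborel"

locale strip =
  fixes \<sigma> L :: real
  assumes sigma_pos: "\<sigma> > 0" and L_pos: "L > 0"
begin

abbreviation S :: "(real \<times> real) set" where "S \<equiv> Om \<sigma> L"

lemma mem_S: "(r, z) \<in> S \<longleftrightarrow> \<sigma> < r \<and> 0 < z \<and> z < L"
  by (auto simp: Om_def)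

lemma open_S: "open S"
  unfolding Om_def by (intro open_Times) auto

lemma S_sets [measurable]: "S \<in> sets borel"
  using open_S by auto

lemma fst_ge: "x \<in> S \<Longrightarrow> \<sigma> < fst x"
  by (auto simp: Om_def)

text \<open>\<open>slice f g h\<close>: on almost every line \<open>f\<close> is the primitive of \<open>g\<close> in \<open>r\<close> and of \<open>h\<close> in \<open>z\<close>
  that starts from zero on the boundary; the zero traces in \<open>V1\<close> amount to this.\<close>

definition slice :: "(real \<times> real \<Rightarrow> real) \<Rightarrow> (real \<times> real \<Rightarrow> real) \<Rightarrow> (real \<times> real \<Rightarrow> real) \<Rightarrow> bool" where
  "slice f g h \<longleftrightarrow> f \<in> borel_measurable borel \<and> g \<in> borel_measurable borel \<and> h \<in> borel_measurable borel \<and>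
    (\<forall>x. x \<notin> S \<longrightarrow> f x = 0 \<and> g x = 0 \<and> h x = 0) \<and>
    nnw g < \<infinity> \<and> nnw h < \<infinity> \<and>
    (AE r in lborel. AE z in lborel. z \<in> {0..L} \<longrightarrow> f (r, z) = (LINT s:{0..z}|lborel. h (r, s))) \<and>
    (AE z in lborel. AE r in lborel. f (r, z) = (LINT s:{\<sigma>..r}|lborel. g (s, z)))"

lemma sliceD:
  assumes "slice f g h"
  shows slice_meas: "f \<in> borel_measurable borel" "g \<in> borel_measurable borel" "h \<in> borel_measurable borel"
    and slice_zero: "\<And>x. x \<notin> S \<Longrightarrow> f x = 0" "\<And>x. x \<notin> S \<Longrightarrow> g x = 0" "\<And>x. x \<notin> S \<Longrightarrow> h x = 0"
    and slice_fin: "nnw g < \<infinity>" "nnw h < \<infinity>"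
    and slice_z: "AE r in lborel. AE z in lborel. z \<in> {0..L} \<longrightarrow> f (r, z) = (LINT s:{0..z}|lborel. h (r, s))"
    and slice_r: "AE z in lborel. AE r in lborel. f (r, z) = (LINT s:{\<sigma>..r}|lborel. g (s, z))"
  using assms unfolding slice_def by auto

text \<open>The weight is at least \<open>\<sigma>\<close> in the strip, so dropping it costs a
  factor \<open>1 / \<sigma>\<close>.\<close>

lemma nn_unweighted:
  assumes [measurable]: "f \<in> borel_measurable borel" and z: "\<And>x. x \<notin> S \<Longrightarrow> f x = 0" and p: "\<And>x. 0 \<le> f x"
  shows "(\<integral>\<^sup>+x. ennreal (f x) \<partial>lborel) \<le> ennreal (1 / \<sigma>) * (\<integral>\<^sup>+x. ennreal (f x * fst x) \<partial>lborel)"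
proof -
  have "(\<integral>\<^sup>+x. ennreal (f x) \<partial>lborel) \<le> (\<integral>\<^sup>+x. ennreal (1 / \<sigma>) * ennreal (f x * fst x) \<partial>lborel)"
  proof (intro nn_integral_mono)
    fix x :: "real \<times> real"
    show "ennreal (f x) \<le> ennreal (1 / \<sigma>) * ennreal (f x * fst x)"
    proof (cases "x \<in> S")
      case True
      then have "f x * \<sigma> \<le> f x * fst x" using fst_ge p by (intro mult_left_mono) (auto simp: less_imp_le)
      then have "f x \<le> 1 / \<sigma> * (f x * fst x)" using sigma_pos by (simp add: field_simps)
      then show ?thesis using sigma_pos fst_ge[OF True] p[of x] by (simp add: ennreal_leI flip: ennreal_mult)
    qed (simp add: z)
  qed
  also have "\<dots> = ennreal (1 / \<sigma>) * (\<integral>\<^sup>+x. ennreal (f x * fst x) \<partial>lborel)"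
    by (intro nn_integral_cmult) measurable
  finally show ?thesis .
qed

lemma slice_fin_unweighted:
  assumes "slice f g h"
  shows "nn2 g < \<infinity>" "nn2 h < \<infinity>"
proof -
  note [measurable] = slice_meas[OF assms]
  show "nn2 g < \<infinity>"
    using nn_unweighted[of "\<lambda>x. (g x)\<^sup>2"] slice_fin(1)[OF assms] slice_zero(2)[OF assms]
    by (auto intro: le_less_trans simp: ennreal_mult_less_top)
  show "nn2 h < \<infinity>"
    using nn_unweighted[of "\<lambda>x. (h x)\<^sup>2"] slice_fin(2)[OF assms] slice_zero(3)[OF assms]
    by (auto intro: le_less_trans simp: ennreal_mult_less_top)
qed

lemma section_finite:
  assumes [measurable]: "g \<in> borel_measurable borel" and z: "\<And>x. x \<notin> S \<Longrightarrow> g x = 0"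
    and f: "nnw g < \<infinity>"
  shows "AE r in lborel. (\<integral>\<^sup>+z. ennreal ((g (r, z))\<^sup>2) \<partial>lborel) < \<infinity>"
    and "AE z in lborel. (\<integral>\<^sup>+r. ennreal ((g (r, z))\<^sup>2) \<partial>lborel) < \<infinity>"
proof -
  have "nn2 g \<le> ennreal (1 / \<sigma>) * nnw g"
    by (rule nn_unweighted) (auto simp: z)
  also have "\<dots> < \<infinity>" using f by (simp add: ennreal_mult_less_top)
  finally have f: "nn2 g < \<infinity>" .
  have "AE r in lborel. (\<integral>\<^sup>+z. ennreal ((g (r, z))\<^sup>2) \<partial>lborel) \<noteq> \<infinity>"
    using f nn_integral_iterated(1)[of "\<lambda>x. ennreal ((g x)\<^sup>2)"]
    by (intro nn_integral_PInf_AE) auto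
  then show "AE r in lborel. (\<integral>\<^sup>+z. ennreal ((g (r, z))\<^sup>2) \<partial>lborel) < \<infinity>" by (simp add: less_top)
  have "AE z in lborel. (\<integral>\<^sup>+r. ennreal ((g (r, z))\<^sup>2) \<partial>lborel) \<noteq> \<infinity>"
    using f nn_integral_iterated(2)[of "\<lambda>x. ennreal ((g x)\<^sup>2)"]
    by (intro nn_integral_PInf_AE) auto
  then show "AE z in lborel. (\<integral>\<^sup>+r. ennreal ((g (r, z))\<^sup>2) \<partial>lborel) < \<infinity>" by (simp add: less_top)
qed

lemma slice_sections:
  assumes "slice f g h"
  shows "AE r in lborel. (\<integral>\<^sup>+z. ennreal ((h (r, z))\<^sup>2) \<partial>lborel) < \<infinity>"
    and "AE z in lborel. (\<integral>\<^sup>+r. ennreal ((g (r, z))\<^sup>2) \<partial>lborel) < \<infinity>"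
  using section_finite(1)[OF slice_meas(3)[OF assms] slice_zero(3)[OF assms] slice_fin(2)[OF assms]]
    section_finite(2)[OF slice_meas(2)[OF assms] slice_zero(2)[OF assms] slice_fin(1)[OF assms]] by auto

text \<open>Cauchy-Schwarz on \<open>{0..z}\<close>. The point is that the bound depends on
  \<open>r\<close> alone.\<close>

lemma slice_sup_z:
  assumes "slice f g h"
  shows "AE r in lborel. AE z in lborel. ennreal ((f (r, z))\<^sup>2) \<le> ennreal L * (\<integral>\<^sup>+s. ennreal ((h (r, s))\<^sup>2) \<partial>lborel)"
proof (rule eventually_mono[OF slice_z[OF assms]])
  note [measurable] = slice_meas[OF assms]
  fix r assume "AE z in lborel. z \<in> {0..L} \<longrightarrow> f (r, z) = (LINT s:{0..z}|lborel. h (r, s))"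
  then show "AE z in lborel. ennreal ((f (r, z))\<^sup>2) \<le> ennreal L * (\<integral>\<^sup>+s. ennreal ((h (r, s))\<^sup>2) \<partial>lborel)"
  proof (rule eventually_mono)
    fix z assume z: "z \<in> {0..L} \<longrightarrow> f (r, z) = (LINT s:{0..z}|lborel. h (r, s))"
    show "ennreal ((f (r, z))\<^sup>2) \<le> ennreal L * (\<integral>\<^sup>+s. ennreal ((h (r, s))\<^sup>2) \<partial>lborel)"
    proof (cases "(r, z) \<in> S")
      case True
      then have zz: "0 < z" "z < L" by (auto simp: mem_S)
      then have "ennreal ((f (r, z))\<^sup>2) \<le> ennreal (z - 0) * (\<integral>\<^sup>+s. ennreal ((h (r, s))\<^sup>2) * indicator {0..z} s \<partial>lborel)"
        using z interval_integral_square_le[of "\<lambda>s. h (r, s)" 0 z] by simp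
      also have "\<dots> \<le> ennreal L * (\<integral>\<^sup>+s. ennreal ((h (r, s))\<^sup>2) \<partial>lborel)"
        by (intro mult_mono nn_integral_mono ennreal_leI) (use zz in \<open>auto simp: indicator_def\<close>)
      finally show ?thesis .
    qed (simp add: slice_zero[OF assms])
  qed
qed

text \<open>One factor \<open>L\<close> comes from Cauchy-Schwarz, the other from integrating the
  resulting bound over \<open>{0..L}\<close>.\<close>

lemma slice_poincare:
  assumes "slice f g h"
  shows "nnw f \<le> ennreal (L\<^sup>2) * nnw h"
proof -
  note [measurable] = slice_meas[OF assms]
  have "nnw f = (\<integral>\<^sup>+r. \<integral>\<^sup>+z. ennreal ((f (r, z))\<^sup>2 * r) \<partial>lborel \<partial>lborel)"
    by (subst nn_integral_iterated(1)) auto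
  also have "\<dots> \<le> (\<integral>\<^sup>+r. ennreal (L\<^sup>2) * (\<integral>\<^sup>+z. ennreal ((h (r, z))\<^sup>2 * r) \<partial>lborel) \<partial>lborel)"
  proof (intro nn_integral_mono_AE, rule eventually_mono[OF slice_sup_z[OF assms]])
    fix r assume r: "AE z in lborel. ennreal ((f (r, z))\<^sup>2) \<le> ennreal L * (\<integral>\<^sup>+s. ennreal ((h (r, s))\<^sup>2) \<partial>lborel)"
    show "(\<integral>\<^sup>+z. ennreal ((f (r, z))\<^sup>2 * r) \<partial>lborel) \<le> ennreal (L\<^sup>2) * (\<integral>\<^sup>+z. ennreal ((h (r, z))\<^sup>2 * r) \<partial>lborel)"
    proof (cases "r > \<sigma>")
      case False
      then have "f (r, z) = 0" for z by (simp add: slice_zero[OF assms] mem_S)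
      then show ?thesis by simp
    next
      case True
      then have r0: "r \<ge> 0" using sigma_pos by simp
      have "(\<integral>\<^sup>+z. ennreal ((f (r, z))\<^sup>2 * r) \<partial>lborel)
          \<le> (\<integral>\<^sup>+z. ennreal L * (\<integral>\<^sup>+s. ennreal ((h (r, s))\<^sup>2) \<partial>lborel) * ennreal r * indicator {0..L} z \<partial>lborel)"
      proof (intro nn_integral_mono_AE, rule eventually_mono[OF r])
        fix z assume z: "ennreal ((f (r, z))\<^sup>2) \<le> ennreal L * (\<integral>\<^sup>+s. ennreal ((h (r, s))\<^sup>2) \<partial>lborel)"
        show "ennreal ((f (r, z))\<^sup>2 * r) \<le> ennreal L * (\<integral>\<^sup>+s. ennreal ((h (r, s))\<^sup>2) \<partial>lborel) * ennreal r * indicator {0..L} z"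
        proof (cases "(r, z) \<in> S")
          case True
          then show ?thesis using mult_right_mono[OF z, of "ennreal r"] r0 by (simp add: mem_S ennreal_mult)
        qed (simp add: slice_zero[OF assms])
      qed
      also have "\<dots> = ennreal L * (\<integral>\<^sup>+s. ennreal ((h (r, s))\<^sup>2) \<partial>lborel) * ennreal r * ennreal L"
        using L_pos by (subst nn_integral_cmult_indicator) auto
      also have "\<dots> = ennreal (L\<^sup>2) * ((\<integral>\<^sup>+s. ennreal ((h (r, s))\<^sup>2) \<partial>lborel) * ennreal r)"
        using L_pos by (simp add: power2_eq_square ennreal_mult mult_ac)
      also have "(\<integral>\<^sup>+s. ennreal ((h (r, s))\<^sup>2) \<partial>lborel) * ennreal r = (\<integral>\<^sup>+z. ennreal ((h (r, z))\<^sup>2 * r) \<partial>lborel)"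
        using r0 by (subst nn_integral_multc[symmetric]) (auto simp: ennreal_mult)
      finally show ?thesis .
    qed
  qed
  also have "\<dots> = ennreal (L\<^sup>2) * (\<integral>\<^sup>+r. \<integral>\<^sup>+z. ennreal ((h (r, z))\<^sup>2 * r) \<partial>lborel \<partial>lborel)"
    by (intro nn_integral_cmult) measurable
  also have "(\<integral>\<^sup>+r. \<integral>\<^sup>+z. ennreal ((h (r, z))\<^sup>2 * r) \<partial>lborel \<partial>lborel) = nnw h"
    by (subst nn_integral_iterated(1)) auto
  finally show ?thesis .
qed

lemma slice_f_fin:
  assumes "slice f g h"
  shows "nnw f < \<infinity>" "nn2 f < \<infinity>"
proof -
  note [measurable] = slice_meas[OF assms]
  show 1: "nnw f < \<infinity>"
    using slice_poincare[OF assms] slice_fin(2)[OF assms] by (auto intro: le_less_trans simp: ennreal_mult_less_top)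
  show "nn2 f < \<infinity>"
    using nn_unweighted[of "\<lambda>x. (f x)\<^sup>2"] 1 slice_zero(1)[OF assms]
    by (auto intro: le_less_trans simp: ennreal_mult_less_top)
qed

text \<open>The counterpart of \<open>slice_sup_z\<close>, with a bound depending on
  \<open>z\<close> alone. On a half-line, Cauchy-Schwarz from \<open>r = \<sigma>\<close> would lose
  the unbounded factor \<open>r - \<sigma>\<close>; instead \<open>f (r, z)\<close> is compared with
  the values on \<open>{r..r+1}\<close> and averaged, at the price of the norm of \<open>f\<close>
  itself.\<close>

lemma slice_sup_r:
  assumes "slice f g h"
  shows "AE z in lborel. AE r in lborel. ennreal ((f (r, z))\<^sup>2)
    \<le> 2 * (\<integral>\<^sup>+s. ennreal ((f (s, z))\<^sup>2) \<partial>lborel) + 2 * (\<integral>\<^sup>+s. ennreal ((g (s, z))\<^sup>2) \<partial>lborel)"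
  using slice_r[OF assms] slice_sections(2)[OF assms]
proof eventually_elim
  note [measurable] = slice_meas[OF assms]
  fix z assume rep: "AE r in lborel. f (r, z) = (LINT s:{\<sigma>..r}|lborel. g (s, z))"
    and fin: "(\<integral>\<^sup>+r. ennreal ((g (r, z))\<^sup>2) \<partial>lborel) < \<infinity>"
  have gi: "set_integrable lborel {a..b} (\<lambda>s. g (s, z))" for a b
    by (rule set_integrable_square[OF _ fin]) measurable
  let ?G = "\<integral>\<^sup>+s. ennreal ((g (s, z))\<^sup>2) \<partial>lborel"
  show "AE r in lborel. ennreal ((f (r, z))\<^sup>2) \<le> 2 * (\<integral>\<^sup>+s. ennreal ((f (s, z))\<^sup>2) \<partial>lborel) + 2 * ?G"
  proof (rule eventually_mono[OF rep])
    fix r assume r: "f (r, z) = (LINT s:{\<sigma>..r}|lborel. g (s, z))"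
    show "ennreal ((f (r, z))\<^sup>2) \<le> 2 * (\<integral>\<^sup>+s. ennreal ((f (s, z))\<^sup>2) \<partial>lborel) + 2 * ?G"
    proof (cases "r > \<sigma>")
      case False
      then show ?thesis by (simp add: slice_zero[OF assms] mem_S)
    next
      case True
      \<comment> \<open>The interval has length 1, so the constant equals its average over
        \<open>b\<close>; between \<open>r\<close> and \<open>b\<close> the primitive changes by an
        integral that Cauchy-Schwarz controls.\<close>
      have "ennreal ((f (r, z))\<^sup>2) = (\<integral>\<^sup>+b. ennreal ((f (r, z))\<^sup>2) * indicator {r..r+1} b \<partial>lborel)"
        by (subst nn_integral_cmult_indicator) auto
      also have "\<dots> \<le> (\<integral>\<^sup>+b. 2 * ennreal ((f (b, z))\<^sup>2) + 2 * ?G * indicator {r..r+1} b \<partial>lborel)"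
      proof (intro nn_integral_mono_AE, rule eventually_mono[OF rep])
        fix b assume b: "f (b, z) = (LINT s:{\<sigma>..b}|lborel. g (s, z))"
        show "ennreal ((f (r, z))\<^sup>2) * indicator {r..r+1} b \<le> 2 * ennreal ((f (b, z))\<^sup>2) + 2 * ?G * indicator {r..r+1} b"
        proof (cases "b \<in> {r..r+1}")
          case b1: True
          define I where "I = (LINT s:{r..b}|lborel. g (s, z))"
          have "(LINT s:{\<sigma>..b}|lborel. g (s, z)) = (LINT s:{\<sigma>..r}|lborel. g (s, z)) + I"
          proof -
            have "{\<sigma>..b} = {\<sigma>..r} \<union> {r<..b}" using True b1 by auto
            then have "(LINT s:{\<sigma>..b}|lborel. g (s, z)) = (LINT s:{\<sigma>..r}|lborel. g (s, z)) + (LINT s:{r<..b}|lborel. g (s, z))"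
              by (simp only:) (intro set_integral_Un set_integrable_subset[OF gi[of r b]] gi; auto)
            also have "(LINT s:{r<..b}|lborel. g (s, z)) = I"
              unfolding I_def set_lebesgue_integral_def
            proof (rule integral_cong_AE)
              show "AE x in lborel. indicator {r<..b} x *\<^sub>R g (x, z) = indicator {r..b} x *\<^sub>R g (x, z)"
                using AE_lborel_singleton[of r] by eventually_elim (auto simp: indicator_def)
            qed auto
            finally show ?thesis .
          qed
          then have "f (r, z) = f (b, z) - I" using r b by simp
          then have "(f (r, z))\<^sup>2 \<le> 2 * (f (b, z))\<^sup>2 + 2 * I\<^sup>2"
            using sum_squares_bound[of "f (b, z)" "- I"] by (simp add: power2_diff)
          then have "ennreal ((f (r, z))\<^sup>2) \<le> ennreal (2 * (f (b, z))\<^sup>2 + 2 * I\<^sup>2)" by (rule ennreal_leI)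
          also have "\<dots> = 2 * ennreal ((f (b, z))\<^sup>2) + 2 * ennreal (I\<^sup>2)" by (simp add: ennreal_mult)
          also have "ennreal (I\<^sup>2) \<le> ennreal (b - r) * (\<integral>\<^sup>+s. ennreal ((g (s, z))\<^sup>2) * indicator {r..b} s \<partial>lborel)"
            unfolding I_def using b1 by (intro interval_integral_square_le) auto
          also have "\<dots> \<le> 1 * ?G"
            by (intro mult_mono nn_integral_mono) (use b1 in \<open>auto simp: indicator_def\<close>)
          finally show ?thesis using b1 by (simp add: mult_left_mono add_left_mono)
        qed simp
      qed
      also have "\<dots> = 2 * (\<integral>\<^sup>+s. ennreal ((f (s, z))\<^sup>2) \<partial>lborel) + 2 * ?G"
        by (subst nn_integral_add) (auto simp: nn_integral_cmult nn_integral_cmult_indicator)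
      finally show ?thesis .
    qed
  qed
qed

text \<open>Ladyzhenskaya's argument: \<open>f^2\<close> is bounded once by a function of
  \<open>r\<close> and once by a function of \<open>z\<close>, so the integral of \<open>f^4\<close>
  is at most a product of two one-dimensional integrals. The weight goes with the factor in
  \<open>r\<close>.\<close>

lemma slice_L4:
  assumes "slice f g h"
  shows "(\<integral>\<^sup>+x. ennreal ((f x)^4 * fst x) \<partial>lborel) \<le>
     ennreal L * nnw h *
     (2 * nn2 f + 2 * nn2 g)"
proof -
  note [measurable] = slice_meas[OF assms]
  define A where "A r = ennreal L * (\<integral>\<^sup>+s. ennreal ((h (r, s))\<^sup>2) \<partial>lborel)" for r
  define B where "B z = 2 * (\<integral>\<^sup>+s. ennreal ((f (s, z))\<^sup>2) \<partial>lborel) + 2 * (\<integral>\<^sup>+s. ennreal ((g (s, z))\<^sup>2) \<partial>lborel)" for z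
  have [measurable]: "A \<in> borel_measurable borel" "B \<in> borel_measurable borel"
    unfolding A_def B_def by measurable
  have a: "AE x in lborel. ennreal ((f x)\<^sup>2) \<le> A (fst x)"
  proof (rule AE_iterated)
    show "{x. ennreal ((f x)\<^sup>2) \<le> A (fst x)} \<in> sets borel" by measurable
  qed (use slice_sup_z[OF assms] in \<open>simp add: A_def\<close>)
  have b: "AE x in lborel. ennreal ((f x)\<^sup>2) \<le> B (snd x)"
  proof (rule AE_iterated)
    show m: "{x. ennreal ((f x)\<^sup>2) \<le> B (snd x)} \<in> sets borel" by measurable
    show "AE r in lborel. AE z in lborel. ennreal ((f (r, z))\<^sup>2) \<le> B (snd (r, z))"
      by (rule AE_iterated_swap[OF m]) (use slice_sup_r[OF assms] in \<open>simp add: B_def\<close>)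
  qed
  have "(\<integral>\<^sup>+x. ennreal ((f x)^4 * fst x) \<partial>lborel) \<le> (\<integral>\<^sup>+x. A (fst x) * ennreal (fst x) * B (snd x) \<partial>lborel)"
  proof (intro nn_integral_mono_AE, use a b in eventually_elim)
    fix x assume ab: "ennreal ((f x)\<^sup>2) \<le> A (fst x)" "ennreal ((f x)\<^sup>2) \<le> B (snd x)"
    show "ennreal ((f x)^4 * fst x) \<le> A (fst x) * ennreal (fst x) * B (snd x)"
    proof (cases "x \<in> S")
      case True
      have e: "(f x)^4 * fst x = (f x)\<^sup>2 * fst x * (f x)\<^sup>2" by (simp add: power2_eq_square power4_eq_xxxx)
      have "ennreal ((f x)^4 * fst x) = ennreal ((f x)\<^sup>2) * ennreal (fst x) * ennreal ((f x)\<^sup>2)"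
        unfolding e using fst_ge[OF True] sigma_pos by (simp add: ennreal_mult)
      also have "\<dots> \<le> A (fst x) * ennreal (fst x) * B (snd x)" by (intro mult_mono ab) auto
      finally show ?thesis .
    qed (simp add: slice_zero[OF assms])
  qed
  also have "\<dots> = (\<integral>\<^sup>+r. (\<integral>\<^sup>+z. A r * ennreal r * B z \<partial>lborel) \<partial>lborel)"
    by (subst nn_integral_iterated(1)) auto
  also have "\<dots> = (\<integral>\<^sup>+r. A r * ennreal r \<partial>lborel) * (\<integral>\<^sup>+z. B z \<partial>lborel)"
    by (simp add: nn_integral_cmult nn_integral_multc)
  also have "(\<integral>\<^sup>+r. A r * ennreal r \<partial>lborel) = ennreal L * nnw h"
  proof -
    have "A r * ennreal r = ennreal L * (\<integral>\<^sup>+s. ennreal ((h (r, s))\<^sup>2 * r) \<partial>lborel)" for r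
    proof (cases "r > \<sigma>")
      case True
      then show ?thesis using sigma_pos
        by (simp add: A_def mult.assoc nn_integral_multc[symmetric] ennreal_mult)
    next
      case False
      then have "h (r, s) = 0" for s by (simp add: slice_zero[OF assms] mem_S)
      then show ?thesis by (simp add: A_def)
    qed
    then show ?thesis by (subst nn_integral_iterated(1)) (auto simp: nn_integral_cmult)
  qed
  also have "(\<integral>\<^sup>+z. B z \<partial>lborel) = 2 * nn2 f + 2 * nn2 g"
    unfolding B_def by (subst (1 2) nn_integral_iterated(2)) (auto simp: nn_integral_add nn_integral_cmult)
  finally show ?thesis .
qed

text \<open>Hardy's inequality on almost every line of constant \<open>z\<close>; the zero boundary
  value at \<open>r = \<sigma>\<close> enters as the starting point of the primitive.\<close>

lemma slice_hardy:
  assumes "slice f g h"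
  shows "(\<integral>\<^sup>+x. ennreal ((f x / (fst x - \<sigma>))\<^sup>2) \<partial>lborel) \<le> 4 * nn2 g"
proof -
  note [measurable] = slice_meas[OF assms]
  have i: "k (r, z) * indicator {\<sigma><..} r = k (r, z)" if "\<And>x. x \<notin> S \<Longrightarrow> k x = 0" for k :: "real \<times> real \<Rightarrow> ennreal" and r z
    using that[of "(r, z)"] by (auto simp: indicator_def mem_S)
  have "(\<integral>\<^sup>+x. ennreal ((f x / (fst x - \<sigma>))\<^sup>2) \<partial>lborel)
      = (\<integral>\<^sup>+z. \<integral>\<^sup>+r. ennreal ((f (r, z) / (r - \<sigma>))\<^sup>2) \<partial>lborel \<partial>lborel)"
    by (subst nn_integral_iterated(2)) auto
  also have "\<dots> \<le> (\<integral>\<^sup>+z. 4 * (\<integral>\<^sup>+r. ennreal ((g (r, z))\<^sup>2) \<partial>lborel) \<partial>lborel)"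
  proof (intro nn_integral_mono_AE, rule eventually_mono[OF slice_r[OF assms]])
    fix z assume z: "AE r in lborel. f (r, z) = (LINT s:{\<sigma>..r}|lborel. g (s, z))"
    have "(\<integral>\<^sup>+r. ennreal ((f (r, z) / (r - \<sigma>))\<^sup>2) * indicator {\<sigma><..} r \<partial>lborel)
        \<le> 4 * (\<integral>\<^sup>+s. ennreal ((g (s, z))\<^sup>2) * indicator {\<sigma><..} s \<partial>lborel)"
    proof (rule hardy_inequality)
      show "AE r in lborel. \<sigma> < r \<longrightarrow> ennreal \<bar>f (r, z)\<bar> \<le> (\<integral>\<^sup>+s. ennreal \<bar>g (s, z)\<bar> * indicator {\<sigma>..r} s \<partial>lborel)"
        using z by eventually_elim (auto intro: ennreal_set_integral_le)
    qed measurable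
    then show "(\<integral>\<^sup>+r. ennreal ((f (r, z) / (r - \<sigma>))\<^sup>2) \<partial>lborel) \<le> 4 * (\<integral>\<^sup>+r. ennreal ((g (r, z))\<^sup>2) \<partial>lborel)"
      using i[of "\<lambda>x. ennreal ((f x / (fst x - \<sigma>))\<^sup>2)"] i[of "\<lambda>x. ennreal ((g x)\<^sup>2)"]
      by (simp add: slice_zero[OF assms])
  qed
  also have "\<dots> = 4 * nn2 g"
    by (subst nn_integral_iterated(2)) (auto simp: nn_integral_cmult)
  finally show ?thesis .
qed

end

section \<open>Weighted integrability and the energy identities\<close>

context strip
begin

text \<open>Vanishing off the strip is built in, so integrals run over the whole plane and the
  weight \<open>fst x\<close>, which may be negative elsewhere, does no harm.\<close>

definition W2 :: "(real \<times> real \<Rightarrow> real) \<Rightarrow> bool" where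
  "W2 f \<longleftrightarrow> f \<in> borel_measurable borel \<and> (\<forall>x. x \<notin> S \<longrightarrow> f x = 0) \<and> integrable lborel (\<lambda>x. (f x)\<^sup>2 * fst x)"

definition W4 :: "(real \<times> real \<Rightarrow> real) \<Rightarrow> bool" where
  "W4 f \<longleftrightarrow> f \<in> borel_measurable borel \<and> (\<forall>x. x \<notin> S \<longrightarrow> f x = 0) \<and> integrable lborel (\<lambda>x. (f x)^4 * fst x)"

lemma W2_meas [measurable_dest]: "W2 f \<Longrightarrow> f \<in> borel_measurable borel" by (simp add: W2_def)
lemma W2_zero: "W2 f \<Longrightarrow> x \<notin> S \<Longrightarrow> f x = 0" unfolding W2_def by blast
lemma weighted_nonneg: "(x \<notin> S \<Longrightarrow> c = 0) \<Longrightarrow> 0 \<le> c \<Longrightarrow> 0 \<le> c * fst x"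
  using fst_ge[of x] sigma_pos by (cases "x \<in> S") auto

lemma W2I:
  assumes [measurable]: "f \<in> borel_measurable borel" and z: "\<And>x. x \<notin> S \<Longrightarrow> f x = 0"
    and "nnw f < \<infinity>"
  shows "W2 f"
  unfolding W2_def
proof (intro conjI allI impI)
  have "(\<integral>\<^sup>+x. ennreal (norm ((f x)\<^sup>2 * fst x)) \<partial>lborel) = nnw f"
    using weighted_nonneg[of _ "(f _)\<^sup>2"] z by (intro nn_integral_cong) simp
  then show "integrable lborel (\<lambda>x. (f x)\<^sup>2 * fst x)"
    using assms(3) by (simp add: integrable_iff_bounded)
qed (use assms in auto)

lemma integrable_weighted_bound:
  assumes [measurable]: "f \<in> borel_measurable borel" and z: "\<And>x. x \<notin> S \<Longrightarrow> f x = 0"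
    and g: "integrable lborel (\<lambda>x. g x * fst x)" and b: "\<And>x. \<bar>f x\<bar> \<le> g x"
  shows "integrable lborel (\<lambda>x. f x * fst x)"
proof (rule Bochner_Integration.integrable_bound[OF g])
  show "AE x in lborel. norm (f x * fst x) \<le> norm (g x * fst x)"
  proof (intro AE_I2)
    fix x show "norm (f x * fst x) \<le> norm (g x * fst x)"
      using b[of x] by (auto simp: abs_mult intro!: mult_right_mono)
  qed
qed simp

lemma W2_mult:
  assumes a: "W2 a" and b: "W2 b"
  shows "integrable lborel (\<lambda>x. a x * b x * fst x)"
proof (rule integrable_weighted_bound)
  show "integrable lborel (\<lambda>x. ((a x)\<^sup>2 + (b x)\<^sup>2) * fst x)"
    using a b by (simp add: W2_def distrib_right)
  show "\<bar>a x * b x\<bar> \<le> (a x)\<^sup>2 + (b x)\<^sup>2" for x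
  proof -
    have "2 * \<bar>a x\<bar> * \<bar>b x\<bar> \<le> \<bar>a x\<bar>\<^sup>2 + \<bar>b x\<bar>\<^sup>2" by (rule sum_squares_bound)
    moreover have "0 \<le> \<bar>a x\<bar> * \<bar>b x\<bar>" by simp
    ultimately have "\<bar>a x\<bar> * \<bar>b x\<bar> \<le> \<bar>a x\<bar>\<^sup>2 + \<bar>b x\<bar>\<^sup>2" by linarith
    then show ?thesis by (simp add: abs_mult)
  qed
qed (use a b in \<open>auto simp: W2_def\<close>)

lemma W4_W4:
  assumes a: "W4 a" and b: "W4 b"
  shows "W2 (\<lambda>x. a x * b x)"
  unfolding W2_def
proof (intro conjI allI impI)
  show "integrable lborel (\<lambda>x. (a x * b x)\<^sup>2 * fst x)"
  proof (rule integrable_weighted_bound)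
    show "integrable lborel (\<lambda>x. ((a x)^4 + (b x)^4) * fst x)"
      using a b by (simp add: W4_def distrib_right)
    show "\<bar>(a x * b x)\<^sup>2\<bar> \<le> (a x)^4 + (b x)^4" for x
    proof -
      have "2 * (a x)\<^sup>2 * (b x)\<^sup>2 \<le> ((a x)\<^sup>2)\<^sup>2 + ((b x)\<^sup>2)\<^sup>2" by (rule sum_squares_bound)
      moreover have "0 \<le> (a x)\<^sup>2 * (b x)\<^sup>2" by simp
      ultimately have "(a x)\<^sup>2 * (b x)\<^sup>2 \<le> ((a x)\<^sup>2)\<^sup>2 + ((b x)\<^sup>2)\<^sup>2" by linarith
      then show ?thesis by (simp add: power_mult_distrib)
    qed
  qed (use a b in \<open>auto simp: W4_def\<close>)
qed (use a b in \<open>auto simp: W4_def\<close>)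

lemma W4_W4_W2:
  assumes "W4 a" "W4 b" "W2 k"
  shows "integrable lborel (\<lambda>x. a x * b x * k x * fst x)"
  by (rule W2_mult[OF W4_W4[OF assms(1,2)] assms(3)])

lemma W2_bounded:
  assumes f: "W2 f" and [measurable]: "m \<in> borel_measurable borel" and B: "\<And>x. x \<in> S \<Longrightarrow> \<bar>m x\<bar> \<le> B"
  shows "W2 (\<lambda>x. m x * f x)"
  unfolding W2_def
proof (intro conjI allI impI)
  have [measurable]: "f \<in> borel_measurable borel" using f by (rule W2_meas)
  show "(\<lambda>x. m x * f x) \<in> borel_measurable borel" by simp
  show "m x * f x = 0" if "x \<notin> S" for x using W2_zero[OF f that] by simp
  show "integrable lborel (\<lambda>x. (m x * f x)\<^sup>2 * fst x)"
  proof (rule integrable_weighted_bound)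
    show "integrable lborel (\<lambda>x. (B\<^sup>2 * (f x)\<^sup>2) * fst x)" using f unfolding W2_def mult.assoc by auto
    show "\<bar>(m x * f x)\<^sup>2\<bar> \<le> B\<^sup>2 * (f x)\<^sup>2" for x
    proof (cases "x \<in> S")
      case True
      then have "(m x)\<^sup>2 \<le> B\<^sup>2" using B by (metis abs_ge_zero power2_abs power_mono)
      then show ?thesis by (simp add: power_mult_distrib mult_right_mono)
    qed (simp add: W2_zero[OF f])
    show "(m x * f x)\<^sup>2 = 0" if "x \<notin> S" for x using W2_zero[OF f that] by simp
  qed measurable
qed

lemma slice_W2:
  assumes "slice f g h" shows "W2 f" "W2 g" "W2 h"
  using slice_meas[OF assms] slice_zero[OF assms] slice_fin[OF assms] slice_f_fin[OF assms] by (auto intro: W2I)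

lemma slice_W4:
  assumes "slice f g h" shows "W4 f"
  unfolding W4_def
proof (intro conjI allI impI)
  note [measurable] = slice_meas[OF assms]
  have "(\<integral>\<^sup>+x. ennreal ((f x)^4 * fst x) \<partial>lborel) < \<infinity>"
    using slice_fin(2)[OF assms] slice_f_fin(2)[OF assms] slice_fin_unweighted(1)[OF assms]
    by (intro le_less_trans[OF slice_L4[OF assms]]) (simp add: ennreal_mult_less_top)
  moreover have "(\<integral>\<^sup>+x. ennreal (norm ((f x)^4 * fst x)) \<partial>lborel) = (\<integral>\<^sup>+x. ennreal ((f x)^4 * fst x) \<partial>lborel)"
    using weighted_nonneg[of _ "(f _)^4"] slice_zero(1)[OF assms] by (intro nn_integral_cong) simp
  ultimately show "integrable lborel (\<lambda>x. (f x)^4 * fst x)" by (simp add: integrable_iff_bounded)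
qed (use slice_meas[OF assms] slice_zero[OF assms] in auto)

lemma integrable_unweighted:
  assumes [measurable]: "f \<in> borel_measurable borel" and z: "\<And>x. x \<notin> S \<Longrightarrow> f x = 0"
    and i: "integrable lborel (\<lambda>x. f x * fst x)"
  shows "integrable lborel f"
proof (rule Bochner_Integration.integrable_bound)
  show "integrable lborel (\<lambda>x. 1 / \<sigma> * (f x * fst x))" using i by simp
  show "AE x in lborel. norm (f x) \<le> norm (1 / \<sigma> * (f x * fst x))"
  proof (intro AE_I2)
    fix x show "norm (f x) \<le> norm (1 / \<sigma> * (f x * fst x))"
    proof (cases "x \<in> S")
      case True
      then have "\<bar>f x\<bar> * \<sigma> \<le> \<bar>f x\<bar> * fst x" using fst_ge by (intro mult_left_mono) (auto simp: less_imp_le)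
      then show ?thesis using sigma_pos fst_ge[OF True] by (simp add: abs_mult field_simps)
    qed (simp add: z)
  qed
qed simp

lemma integral_iterated:
  fixes F :: "real \<times> real \<Rightarrow> real"
  assumes "integrable lborel F"
  shows "(LINT x|lborel. F x) = (LINT r|lborel. LINT z|lborel. F (r, z))"
    and "(LINT x|lborel. F x) = (LINT z|lborel. LINT r|lborel. F (r, z))"
proof -
  have i: "integrable (lborel \<Otimes>\<^sub>M lborel) F" using assms by (simp add: lborel_prod)
  show "(LINT x|lborel. F x) = (LINT r|lborel. LINT z|lborel. F (r, z))"
    using lborel_pair.integral_fst'[OF i] by (simp add: lborel_prod)
  show "(LINT x|lborel. F x) = (LINT z|lborel. LINT r|lborel. F (r, z))"
    using lborel_pair.integral_snd[of "\<lambda>r z. F (r, z)"] i by (simp add: lborel_prod)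
qed

text \<open>The integrand is the \<open>z\<close>-derivative of \<open>r w v^2\<close>. On almost
  every line its integral is the end value of a product of primitives, and this is 0 because
  \<open>w\<close> returns to 0 at \<open>z = L\<close>.\<close>

lemma integral_zero_z:
  assumes w: "slice w wr wz" and v: "slice v vr vz"
    and w_end: "AE r in lborel. (LINT s:{0..L}|lborel. wz (r, s)) = 0"
  shows "(LINT x|lborel. (wz x * (v x * v x) + w x * (vz x * v x + v x * vz x)) * fst x) = 0"
proof -
  note [measurable] = slice_meas[OF w] slice_meas[OF v]
  let ?k = "\<lambda>x. (wz x * (v x * v x) + w x * (vz x * v x + v x * vz x)) * fst x"
  have eq: "?k = (\<lambda>x. v x * v x * wz x * fst x + 2 * (w x * v x * vz x * fst x))" by (auto simp: algebra_simps)
  have int: "integrable lborel ?k"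
    unfolding eq using W4_W4_W2[OF slice_W4[OF v] slice_W4[OF v] slice_W2(3)[OF w]]
      W4_W4_W2[OF slice_W4[OF w] slice_W4[OF v] slice_W2(3)[OF v]] by simp
  have "AE r in lborel. (LINT z|lborel. ?k (r, z)) = 0"
    using slice_z[OF w] slice_z[OF v] slice_sections(1)[OF w] slice_sections(1)[OF v] w_end
  proof eventually_elim
    fix r
    assume W: "AE z in lborel. z \<in> {0..L} \<longrightarrow> w (r, z) = (LINT s:{0..z}|lborel. wz (r, s))"
      and V: "AE z in lborel. z \<in> {0..L} \<longrightarrow> v (r, z) = (LINT s:{0..z}|lborel. vz (r, s))"
      and Wf: "(\<integral>\<^sup>+z. ennreal ((wz (r, z))\<^sup>2) \<partial>lborel) < \<infinity>" and Vf: "(\<integral>\<^sup>+z. ennreal ((vz (r, z))\<^sup>2) \<partial>lborel) < \<infinity>"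
      and e: "(LINT s:{0..L}|lborel. wz (r, s)) = 0"
    have Wi: "set_integrable lborel {0..L} (\<lambda>z. wz (r, z))" by (rule set_integrable_square[OF _ Wf]) measurable
    have Vi: "set_integrable lborel {0..L} (\<lambda>z. vz (r, z))" by (rule set_integrable_square[OF _ Vf]) measurable
    have L0: "0 \<le> L" using L_pos by simp
    have V0: "AE z in lborel. z \<in> {0..L} \<longrightarrow> v (r, z) = 0 + (LINT s:{0..z}|lborel. vz (r, s))" using V by simp
    have vm: "(\<lambda>z. v (r, z)) \<in> borel_measurable borel" "(\<lambda>z. w (r, z)) \<in> borel_measurable borel" by measurable
    \<comment> \<open>The square of \<open>v\<close> is itself a primitive, so that the product rule
      can be applied again with \<open>w\<close>.\<close>
    have V2: "AE z in lborel. z \<in> {0..L} \<longrightarrow>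
        v (r, z) * v (r, z) = 0 + (LINT s:{0..z}|lborel. vz (r, s) * v (r, s) + v (r, s) * vz (r, s))"
      using product_is_primitive[OF L0 vm(1) vm(1) Vi Vi V V0] by simp
    have V2i: "set_integrable lborel {0..L} (\<lambda>s. vz (r, s) * v (r, s) + v (r, s) * vz (r, s))"
      by (rule product_of_primitives(1)[OF L0 vm(1) vm(1) Vi Vi V V0])
    have "(LINT z:{0..L}|lborel. wz (r, z) * (v (r, z) * v (r, z)) + w (r, z) * (vz (r, z) * v (r, z) + v (r, z) * vz (r, z))) = 0"
      by (subst product_of_primitives(2)[OF L0 vm(2) _ Wi V2i W V2]) (simp_all add: e)
    moreover have ke: "?k (r, z) = r * (indicator {0..L} z *\<^sub>R (wz (r, z) * (v (r, z) * v (r, z)) + w (r, z) * (vz (r, z) * v (r, z) + v (r, z) * vz (r, z))))" for z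
      by (cases "(r, z) \<in> S") (auto simp: mem_S slice_zero[OF v] indicator_def)
    ultimately show "(LINT z|lborel. ?k (r, z)) = 0"
      unfolding ke set_lebesgue_integral_def by simp
  qed
  then have "(LINT r|lborel. LINT z|lborel. ?k (r, z)) = 0"
    by (subst integral_cong_AE[where g = "\<lambda>_. 0"]) auto
  then show ?thesis using integral_iterated(1)[OF int] by simp
qed

text \<open>The weight \<open>r\<close> is a primitive of 1 with initial value
  \<open>\<sigma>\<close>, so \<open>r u\<close> is one more case of the product rule.\<close>

lemma radial_primitive:
  assumes u: "(\<lambda>r. u r) \<in> borel_measurable borel" and "\<sigma> \<le> T"
    and ui: "set_integrable lborel {\<sigma>..T} u'"
    and U: "AE t in lborel. t \<in> {\<sigma>..T} \<longrightarrow> u t = (LINT s:{\<sigma>..t}|lborel. u' s)"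
  shows "set_integrable lborel {\<sigma>..T} (\<lambda>r. u' r * r + u r * 1)"
    "AE t in lborel. t \<in> {\<sigma>..T} \<longrightarrow> u t * t = (LINT s:{\<sigma>..t}|lborel. u' s * s + u s * 1)"
proof -
  have m: "(\<lambda>r::real. r) \<in> borel_measurable borel" by measurable
  have i: "set_integrable lborel {\<sigma>..T} (\<lambda>r. 1 :: real)"
    by (simp add: set_integrable_def integrable_real_indicator emeasure_lborel_Icc_eq)
  have e: "AE t in lborel. t \<in> {\<sigma>..T} \<longrightarrow> t = \<sigma> + (LINT s:{\<sigma>..t}|lborel. 1)"
    by (auto simp: set_lebesgue_integral_def)
  show "set_integrable lborel {\<sigma>..T} (\<lambda>r. u' r * r + u r * 1)"
    by (rule product_of_primitives(1)[OF assms(2) u m ui i U e])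
  show "AE t in lborel. t \<in> {\<sigma>..T} \<longrightarrow> u t * t = (LINT s:{\<sigma>..t}|lborel. u' s * s + u s * 1)"
    by (rule product_is_primitive[OF assms(2) u m ui i U e])
qed

text \<open>The integrand is the \<open>r\<close>-derivative of \<open>r u v^2\<close>. No boundary
  condition is available at infinity; but the integral up to \<open>r = T\<close> equals the flux of
  \<open>r u v^2\<close> through \<open>r = T\<close>, which is integrable in \<open>T\<close> and
  has a limit, and so the limit is 0.\<close>

lemma integral_zero_r:
  assumes u: "slice u ur uz" and v: "slice v vr vz"
  shows "(LINT x|lborel. (ur x * fst x + u x * 1) * (v x * v x) + u x * fst x * (vr x * v x + v x * vr x)) = 0"
    and "integrable lborel (\<lambda>x. (ur x * fst x + u x * 1) * (v x * v x) + u x * fst x * (vr x * v x + v x * vr x))"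
proof -
  note [measurable] = slice_meas[OF u] slice_meas[OF v]
  define k where "k x = (ur x * fst x + u x * 1) * (v x * v x) + u x * fst x * (vr x * v x + v x * vr x)" for x
  have [measurable]: "k \<in> borel_measurable borel" unfolding k_def by measurable
  have k0: "k x = 0" if "x \<notin> S" for x using that by (simp add: k_def slice_zero[OF v])
  have keq: "k = (\<lambda>x. v x * v x * ur x * fst x + v x * v x * u x + 2 * (u x * v x * vr x * fst x))"
    by (auto simp: k_def algebra_simps)
  have uvv: "integrable lborel (\<lambda>x. v x * v x * u x * fst x)"
    by (rule W4_W4_W2[OF slice_W4[OF v] slice_W4[OF v] slice_W2(1)[OF u]])
  have int: "integrable lborel k"
    unfolding keq using W4_W4_W2[OF slice_W4[OF v] slice_W4[OF v] slice_W2(2)[OF u]]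
      W4_W4_W2[OF slice_W4[OF u] slice_W4[OF v] slice_W2(2)[OF v]]
      integrable_unweighted[OF _ _ uvv] slice_zero(1)[OF v] by simp
  then show "integrable lborel (\<lambda>x. (ur x * fst x + u x * 1) * (v x * v x) + u x * fst x * (vr x * v x + v x * vr x))"
    by (simp add: k_def[abs_def])
  have prim: "AE z in lborel. AE T in lborel. u (T, z) * T * (v (T, z) * v (T, z)) = (LINT r|lborel. indicator {..T} r * k (r, z))"
    using slice_r[OF u] slice_r[OF v] slice_sections(2)[OF u] slice_sections(2)[OF v]
  proof eventually_elim
    fix z
    assume U: "AE r in lborel. u (r, z) = (LINT s:{\<sigma>..r}|lborel. ur (s, z))"
      and V: "AE r in lborel. v (r, z) = (LINT s:{\<sigma>..r}|lborel. vr (s, z))"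
      and Uf: "(\<integral>\<^sup>+r. ennreal ((ur (r, z))\<^sup>2) \<partial>lborel) < \<infinity>" and Vf: "(\<integral>\<^sup>+r. ennreal ((vr (r, z))\<^sup>2) \<partial>lborel) < \<infinity>"
    have Ui: "set_integrable lborel {\<sigma>..T} (\<lambda>r. ur (r, z))" for T by (rule set_integrable_square[OF _ Uf]) measurable
    have Vi: "set_integrable lborel {\<sigma>..T} (\<lambda>r. vr (r, z))" for T by (rule set_integrable_square[OF _ Vf]) measurable
    have m: "(\<lambda>r. v (r, z)) \<in> borel_measurable borel" "(\<lambda>r. u (r, z)) \<in> borel_measurable borel"
      "(\<lambda>r. v (r, z) * v (r, z)) \<in> borel_measurable borel" "(\<lambda>r. u (r, z) * r) \<in> borel_measurable borel" by measurable
    \<comment> \<open>The product rule works on bounded intervals; those of integer length exhaust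
      the half-line and leave a countable union of null sets.\<close>
    have on: "AE t in lborel. t \<in> {\<sigma>..\<sigma> + real n} \<longrightarrow>
        u (t, z) * t * (v (t, z) * v (t, z)) = (LINT r:{\<sigma>..t}|lborel. k (r, z))" for n
    proof -
      let ?T = "\<sigma> + real n"
      have T: "\<sigma> \<le> ?T" by simp
      have V0: "AE t in lborel. t \<in> {\<sigma>..?T} \<longrightarrow> v (t, z) = 0 + (LINT s:{\<sigma>..t}|lborel. vr (s, z))"
        and V1: "AE t in lborel. t \<in> {\<sigma>..?T} \<longrightarrow> v (t, z) = (LINT s:{\<sigma>..t}|lborel. vr (s, z))"
        and U1: "AE t in lborel. t \<in> {\<sigma>..?T} \<longrightarrow> u (t, z) = (LINT s:{\<sigma>..t}|lborel. ur (s, z))"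
        using U V by (auto elim: eventually_mono)
      have V2: "AE t in lborel. t \<in> {\<sigma>..?T} \<longrightarrow>
          v (t, z) * v (t, z) = 0 + (LINT s:{\<sigma>..t}|lborel. vr (s, z) * v (s, z) + v (s, z) * vr (s, z))"
        using product_is_primitive[OF T m(1) m(1) Vi Vi V1 V0] by simp
      have V2i: "set_integrable lborel {\<sigma>..?T} (\<lambda>s. vr (s, z) * v (s, z) + v (s, z) * vr (s, z))"
        by (rule product_of_primitives(1)[OF T m(1) m(1) Vi Vi V1 V0])
      show ?thesis
        using product_is_primitive[OF T m(4) m(3) radial_primitive(1)[OF m(2) T Ui U1] V2i radial_primitive(2)[OF m(2) T Ui U1] V2]
        by (simp add: k_def)
    qed
    have "AE t in lborel. \<forall>n. t \<in> {\<sigma>..\<sigma> + real n} \<longrightarrow>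
        u (t, z) * t * (v (t, z) * v (t, z)) = (LINT r:{\<sigma>..t}|lborel. k (r, z))"
      by (rule AE_all_countable[THEN iffD2], rule allI, rule on)
    then show "AE T in lborel. u (T, z) * T * (v (T, z) * v (T, z)) = (LINT r|lborel. indicator {..T} r * k (r, z))"
    proof (rule eventually_mono)
      fix t assume t: "\<forall>n. t \<in> {\<sigma>..\<sigma> + real n} \<longrightarrow> u (t, z) * t * (v (t, z) * v (t, z)) = (LINT r:{\<sigma>..t}|lborel. k (r, z))"
      have e: "indicator {..t} r * k (r, z) = indicator {\<sigma>..t} r *\<^sub>R k (r, z)" for r
        by (cases "(r, z) \<in> S") (auto simp: k0 mem_S indicator_def)
      show "u (t, z) * t * (v (t, z) * v (t, z)) = (LINT r|lborel. indicator {..t} r * k (r, z))"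
      proof (cases "\<sigma> \<le> t")
        case True
        obtain n where "t - \<sigma> \<le> real n" using real_arch_simple by blast
        then have "t \<in> {\<sigma>..\<sigma> + real n}" using True by simp
        from t[rule_format, OF this] show ?thesis unfolding e by (simp add: set_lebesgue_integral_def)
      next
        case False
        then have "{\<sigma>..t} = {}" by simp
        then show ?thesis unfolding e using False by (simp add: slice_zero[OF v] mem_S)
      qed
    qed
  qed
  \<comment> \<open>The integral up to radius \<open>T\<close>. It tends to the full integral, and
    for almost every \<open>T\<close> it is the flux through \<open>r = T\<close>.\<close>
  define H where "H T = (LINT x|lborel. indicator {..T} (fst x) * k x)" for T
  have Hi: "integrable lborel (\<lambda>x. indicator {..T} (fst x) * k x)" for T
    by (rule Bochner_Integration.integrable_bound[OF int]) (auto simp: indicator_def)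
  have Heq: "AE T in lborel. H T = (LINT z|lborel. u (T, z) * T * (v (T, z) * v (T, z)))"
  proof -
    have "AE T in lborel. AE z in lborel. u (T, z) * T * (v (T, z) * v (T, z)) = (LINT r|lborel. indicator {..T} r * k (r, z))"
    proof (rule AE_iterated_swap[where P = "\<lambda>(T, z). u (T, z) * T * (v (T, z) * v (T, z)) = (LINT r|lborel. indicator {..T} r * k (r, z))", simplified])
      have [measurable]: "(\<lambda>x. LINT r|lborel. indicator {..fst x} r * k (r, snd x)) \<in> borel_measurable (borel :: (real \<times> real) measure)"
      proof -
        have "(\<lambda>(x, r). (if r \<le> fst x then 1 else 0) * k (r, snd x)) \<in> borel_measurable ((borel :: (real \<times> real) measure) \<Otimes>\<^sub>M lborel)"
          by measurable
        then have "(\<lambda>(x, r). indicator {..fst x} r * k (r, snd x)) \<in> borel_measurable ((borel :: (real \<times> real) measure) \<Otimes>\<^sub>M lborel)"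
          by (rule measurable_cong[THEN iffD1, rotated]) (auto simp: indicator_def)
        then show ?thesis by (rule lborel.borel_measurable_lebesgue_integral)
      qed
      have "{x. u x * fst x * (v x * v x) = (LINT r|lborel. indicator {..fst x} r * k (r, snd x))} \<in> sets borel"
        by measurable
      then show "{(T, z). u (T, z) * T * (v (T, z) * v (T, z)) = (LINT r|lborel. indicator {..T} r * k (r, z))} \<in> sets borel"
        by (simp add: case_prod_unfold)
    qed (use prim in simp)
    then show ?thesis
    proof (rule eventually_mono)
      fix T assume "AE z in lborel. u (T, z) * T * (v (T, z) * v (T, z)) = (LINT r|lborel. indicator {..T} r * k (r, z))"
      then have "(LINT z|lborel. u (T, z) * T * (v (T, z) * v (T, z))) = (LINT z|lborel. LINT r|lborel. indicator {..T} r * k (r, z))"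
        by (intro integral_cong_AE) auto
      also have "\<dots> = H T" unfolding H_def by (subst integral_iterated(2)[OF Hi]) simp
      finally show "H T = (LINT z|lborel. u (T, z) * T * (v (T, z) * v (T, z)))" by simp
    qed
  qed
  have Hlim: "(H \<longlongrightarrow> (LINT x|lborel. k x)) at_top"
    unfolding H_def
  proof (rule integral_dominated_convergence_at_top)
    show "integrable lborel (\<lambda>x. \<bar>k x\<bar>)" using int by simp
    show "\<forall>\<^sub>F T in at_top. AE x in lborel. norm (indicator {..T} (fst x) * k x) \<le> \<bar>k x\<bar>"
      by (auto simp: indicator_def)
    show "AE x in lborel. ((\<lambda>T. indicator {..T} (fst x) * k x) \<longlongrightarrow> k x) at_top"
    proof (intro AE_I2)
      fix x :: "real \<times> real"
      have "\<forall>\<^sub>F T in at_top. indicator {..T} (fst x) * k x = k x"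
        using eventually_ge_at_top[of "fst x"] by eventually_elim (auto simp: indicator_def)
      then show "((\<lambda>T. indicator {..T} (fst x) * k x) \<longlongrightarrow> k x) at_top" by (rule tendsto_eventually)
    qed
  qed auto
  have fin: "(\<integral>\<^sup>+T. ennreal \<bar>LINT z|lborel. u (T, z) * T * (v (T, z) * v (T, z))\<bar> \<partial>lborel) < \<infinity>"
  proof -
    have "(\<integral>\<^sup>+T. ennreal \<bar>LINT z|lborel. u (T, z) * T * (v (T, z) * v (T, z))\<bar> \<partial>lborel)
       \<le> (\<integral>\<^sup>+T. \<integral>\<^sup>+z. ennreal \<bar>u (T, z) * T * (v (T, z) * v (T, z))\<bar> \<partial>lborel \<partial>lborel)"
    proof (rule nn_integral_mono)
      fix T
      show "ennreal \<bar>LINT z|lborel. u (T, z) * T * (v (T, z) * v (T, z))\<bar> \<le> (\<integral>\<^sup>+z. ennreal \<bar>u (T, z) * T * (v (T, z) * v (T, z))\<bar> \<partial>lborel)"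
        using ennreal_set_integral_le[where A = UNIV and M = lborel and f = "\<lambda>z. u (T, z) * T * (v (T, z) * v (T, z))"]
        by (simp add: set_lebesgue_integral_def)
    qed
    also have "\<dots> = (\<integral>\<^sup>+x. ennreal \<bar>u x * fst x * (v x * v x)\<bar> \<partial>lborel)"
      by (subst nn_integral_iterated(1)) auto
    also have "\<dots> = (\<integral>\<^sup>+x. ennreal (norm (v x * v x * u x * fst x)) \<partial>lborel)"
      by (intro nn_integral_cong arg_cong[where f = ennreal]) (simp add: abs_mult)
    also have "\<dots> < \<infinity>" using uvv by (simp add: integrable_iff_bounded)
    finally show ?thesis .
  qed
  have "(LINT x|lborel. k x) = 0"
  proof (rule ccontr)
    let ?c = "LINT x|lborel. k x"
    assume c: "?c \<noteq> 0"
    have "\<forall>\<^sub>F T in at_top. dist (H T) ?c < \<bar>?c\<bar> / 2" using Hlim c by (intro tendstoD) auto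
    then obtain T0 where T0: "\<And>T. T \<ge> T0 \<Longrightarrow> dist (H T) ?c < \<bar>?c\<bar> / 2"
      by (auto simp: eventually_at_top_linorder)
    \<comment> \<open>A nonzero limit would keep the flux away from 0 on a half-line, which has
      infinite measure.\<close>
    have inf: "emeasure lborel {T0..} = \<infinity>"
    proof (rule ccontr)
      assume "emeasure lborel {T0..} \<noteq> \<infinity>"
      then obtain b where b: "b \<ge> 0" "emeasure lborel {T0..} = ennreal b" by (cases "emeasure lborel {T0..}") auto
      have "ennreal (b + 1) = emeasure lborel {T0..T0 + (b + 1)}" using b(1) by simp
      also have "\<dots> \<le> emeasure lborel {T0..}" by (intro emeasure_mono) auto
      finally show False using b by simp
    qed
    have "(\<infinity>::ennreal) = (\<integral>\<^sup>+T. ennreal (\<bar>?c\<bar> / 2) * indicator {T0..} T \<partial>lborel)"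
      using c by (subst nn_integral_cmult_indicator) (auto simp: inf ennreal_mult_top)
    also have "\<dots> \<le> (\<integral>\<^sup>+T. ennreal \<bar>LINT z|lborel. u (T, z) * T * (v (T, z) * v (T, z))\<bar> \<partial>lborel)"
    proof (intro nn_integral_mono_AE, use Heq in eventually_elim)
      fix T assume "H T = (LINT z|lborel. u (T, z) * T * (v (T, z) * v (T, z)))"
      moreover have "T \<ge> T0 \<Longrightarrow> \<bar>?c\<bar> / 2 \<le> \<bar>H T\<bar>" using T0[of T] unfolding dist_real_def by linarith
      ultimately show "ennreal (\<bar>?c\<bar> / 2) * indicator {T0..} T \<le> ennreal \<bar>LINT z|lborel. u (T, z) * T * (v (T, z) * v (T, z))\<bar>"
        by (auto simp: indicator_def intro!: ennreal_leI)
    qed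
    finally show False using fin by simp
  qed
  then show "(LINT x|lborel. (ur x * fst x + u x * 1) * (v x * v x) + u x * fst x * (vr x * v x + v x * vr x)) = 0"
    by (simp add: k_def)
qed

text \<open>The two divergence integrals add up to twice the advection integral plus
  \<open>v^2\<close> times the divergence of \<open>r U\<close>, and the latter vanishes.\<close>

lemma advection_skew:
  assumes u: "slice u ur uz" and w: "slice w wr wz" and v: "slice v vr vz"
    and div: "AE x in lborel. u x + fst x * ur x + fst x * wz x = 0"
    and w_end: "AE r in lborel. (LINT s:{0..L}|lborel. wz (r, s)) = 0"
  shows "(LINT x|lborel. (u x * vr x + w x * vz x) * v x * fst x) = 0"
proof -
  note [measurable] = slice_meas[OF u] slice_meas[OF v] slice_meas[OF w]
  let ?r = "\<lambda>x. (ur x * fst x + u x * 1) * (v x * v x) + u x * fst x * (vr x * v x + v x * vr x)"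
  let ?z = "\<lambda>x. (wz x * (v x * v x) + w x * (vz x * v x + v x * vz x)) * fst x"
  have zi: "integrable lborel ?z"
  proof -
    have "?z = (\<lambda>x. v x * v x * wz x * fst x + 2 * (w x * v x * vz x * fst x))" by (auto simp: algebra_simps)
    then show ?thesis using W4_W4_W2[OF slice_W4[OF v] slice_W4[OF v] slice_W2(3)[OF w]]
      W4_W4_W2[OF slice_W4[OF w] slice_W4[OF v] slice_W2(3)[OF v]] by simp
  qed
  have "0 = (LINT x|lborel. ?r x) + (LINT x|lborel. ?z x)"
    using integral_zero_r(1)[OF u v] integral_zero_z[OF w v w_end] by simp
  also have "\<dots> = (LINT x|lborel. ?r x + ?z x)"
    using integral_zero_r(2)[OF u v] zi by simp
  also have "\<dots> = (LINT x|lborel. 2 * ((u x * vr x + w x * vz x) * v x * fst x))"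
  proof (rule integral_cong_AE)
    show "AE x in lborel. ?r x + ?z x = 2 * ((u x * vr x + w x * vz x) * v x * fst x)"
      using div
    proof eventually_elim
      fix x assume "u x + fst x * ur x + fst x * wz x = 0"
      then have "(u x + fst x * ur x + fst x * wz x) * (v x * v x) = 0" by simp
      then show "?r x + ?z x = 2 * ((u x * vr x + w x * vz x) * v x * fst x)" by (simp add: algebra_simps)
    qed
  qed measurable
  finally show ?thesis by simp
qed

text \<open>\<open>r u v\<close> vanishes at \<open>\<sigma>\<close> and \<open>V\<close> vanishes
  at \<open>T\<close>, so the derivative moves from \<open>V\<close> to \<open>r u v\<close> without
  boundary terms.\<close>

lemma background_by_parts:
  fixes V V' :: "real \<Rightarrow> real"
  assumes u: "slice u ur uz" and v: "slice v vr vz" and T: "\<sigma> \<le> T"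
    and [measurable]: "V \<in> borel_measurable borel" "V' \<in> borel_measurable borel"
    and B: "\<And>r. \<bar>V r\<bar> \<le> B" "\<And>r. \<bar>V' r\<bar> \<le> B"
    and V'i: "set_integrable lborel {\<sigma>..T} V'"
    and V: "\<And>t. t \<in> {\<sigma>..T} \<Longrightarrow> V t = c + (LINT s:{\<sigma>..t}|lborel. V' s)" and VT: "V T = 0"
    and V0: "\<And>r. r > T \<Longrightarrow> V r = 0" "\<And>r. r > T \<Longrightarrow> V' r = 0"
  shows "(LINT x|lborel. V' (fst x) * u x * v x * fst x)
    = - (LINT x|lborel. V (fst x) * (u x * v x + fst x * (ur x * v x + u x * vr x)))"
proof -
  note [measurable] = slice_meas[OF u] slice_meas[OF v]
  have Bf: "W2 (\<lambda>x. V (fst x) * f x)" "W2 (\<lambda>x. V' (fst x) * f x)" if "W2 f" for f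
    using W2_bounded[OF that, of "\<lambda>x. V (fst x)" B] W2_bounded[OF that, of "\<lambda>x. V' (fst x)" B] B by auto
  let ?a = "\<lambda>x. V' (fst x) * u x * v x * fst x"
  let ?b = "\<lambda>x. V (fst x) * (u x * v x + fst x * (ur x * v x + u x * vr x))"
  have ai: "integrable lborel ?a" using W2_mult[OF Bf(2)[OF slice_W2(1)[OF u]] slice_W2(1)[OF v]] .
  have bi: "integrable lborel ?b"
  proof -
    have "integrable lborel (\<lambda>x. V (fst x) * u x * v x)"
      by (rule integrable_unweighted[OF _ _ W2_mult[OF Bf(1)[OF slice_W2(1)[OF u]] slice_W2(1)[OF v]]])
        (auto simp: slice_zero[OF v])
    moreover have "integrable lborel (\<lambda>x. V (fst x) * ur x * v x * fst x)" "integrable lborel (\<lambda>x. V (fst x) * u x * vr x * fst x)"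
      using W2_mult[OF Bf(1)[OF slice_W2(2)[OF u]] slice_W2(1)[OF v]] W2_mult[OF Bf(1)[OF slice_W2(1)[OF u]] slice_W2(2)[OF v]] by auto
    ultimately have "integrable lborel (\<lambda>x. V (fst x) * u x * v x + (V (fst x) * ur x * v x * fst x + V (fst x) * u x * vr x * fst x))"
      by simp
    moreover have "?b = (\<lambda>x. V (fst x) * u x * v x + (V (fst x) * ur x * v x * fst x + V (fst x) * u x * vr x * fst x))"
      by (auto simp: algebra_simps)
    ultimately show ?thesis by simp
  qed
  have "AE z in lborel. (LINT r|lborel. ?a (r, z) + ?b (r, z)) = 0"
    using slice_r[OF u] slice_r[OF v] slice_sections(2)[OF u] slice_sections(2)[OF v]
  proof eventually_elim
    fix z
    assume U: "AE r in lborel. u (r, z) = (LINT s:{\<sigma>..r}|lborel. ur (s, z))"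
      and W: "AE r in lborel. v (r, z) = (LINT s:{\<sigma>..r}|lborel. vr (s, z))"
      and Uf: "(\<integral>\<^sup>+r. ennreal ((ur (r, z))\<^sup>2) \<partial>lborel) < \<infinity>" and Vf: "(\<integral>\<^sup>+r. ennreal ((vr (r, z))\<^sup>2) \<partial>lborel) < \<infinity>"
    have Ui: "set_integrable lborel {\<sigma>..T} (\<lambda>r. ur (r, z))" by (rule set_integrable_square[OF _ Uf]) measurable
    have Vi: "set_integrable lborel {\<sigma>..T} (\<lambda>r. vr (r, z))" by (rule set_integrable_square[OF _ Vf]) measurable
    have m: "(\<lambda>r. v (r, z)) \<in> borel_measurable borel" "(\<lambda>r. u (r, z)) \<in> borel_measurable borel"
      "(\<lambda>r. u (r, z) * r * v (r, z)) \<in> borel_measurable borel" "(\<lambda>r. u (r, z) * r) \<in> borel_measurable borel" by measurable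
    have W0: "AE t in lborel. t \<in> {\<sigma>..T} \<longrightarrow> v (t, z) = 0 + (LINT s:{\<sigma>..t}|lborel. vr (s, z))"
      and U1: "AE t in lborel. t \<in> {\<sigma>..T} \<longrightarrow> u (t, z) = (LINT s:{\<sigma>..t}|lborel. ur (s, z))"
      and Vp: "AE t in lborel. t \<in> {\<sigma>..T} \<longrightarrow> V t = c + (LINT s:{\<sigma>..t}|lborel. V' s)"
      using U W V by (auto elim: eventually_mono)
    note P = radial_primitive[OF m(2) T Ui U1]
    note Q1 = product_of_primitives(1)[OF T m(4) m(1) P(1) Vi P(2) W0]
      and Q2 = product_is_primitive[OF T m(4) m(1) P(1) Vi P(2) W0]
    have "(LINT r:{\<sigma>..T}|lborel. ((ur (r, z) * r + u (r, z) * 1) * v (r, z) + u (r, z) * r * vr (r, z)) * V r + u (r, z) * r * v (r, z) * V' r) = 0"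
      by (subst product_of_primitives(2)[OF T m(3) _ Q1 V'i Q2 Vp]) (use V[of T] VT T in auto)
    moreover have ke: "?a (r, z) + ?b (r, z) = indicator {\<sigma>..T} r *\<^sub>R (((ur (r, z) * r + u (r, z) * 1) * v (r, z) + u (r, z) * r * vr (r, z)) * V r + u (r, z) * r * v (r, z) * V' r)" for r
    proof (cases "(r, z) \<in> S \<and> r \<le> T")
      case True
      then show ?thesis by (simp add: mem_S algebra_simps)
    next
      case False
      then have "(r, z) \<notin> S \<or> r > T" by auto
      then show ?thesis by (auto simp: slice_zero[OF v] slice_zero[OF u] V0 mem_S)
    qed
    ultimately show "(LINT r|lborel. ?a (r, z) + ?b (r, z)) = 0" unfolding ke set_lebesgue_integral_def by simp
  qed
  then have "(LINT z|lborel. LINT r|lborel. ?a (r, z) + ?b (r, z)) = 0"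
    by (subst integral_cong_AE[where g = "\<lambda>_. 0"]) auto
  then have "(LINT x|lborel. ?a x + ?b x) = 0"
    using integral_iterated(2)[of "\<lambda>x. ?a x + ?b x"] ai bi by simp
  then show ?thesis using ai bi by simp
qed

end

section \<open>Local strong approximation and weak continuity of trilinear integrals\<close>

section \<open>Approximation by cell averages\<close>

text \<open>The part of the primitive between \<open>c0\<close> and the smaller of the two points
  cancels in the difference, so only the energy inside \<open>{c..<d}\<close> enters.\<close>

lemma primitive_oscillation:
  fixes h :: "real \<Rightarrow> real"
  assumes [measurable]: "h \<in> borel_measurable borel" and fin: "(\<integral>\<^sup>+s. ennreal ((h s)\<^sup>2) \<partial>lborel) < \<infinity>"
    and c0: "c0 \<le> c" and t: "t \<in> {c..<d}" and t': "t' \<in> {c..<d}"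
  shows "ennreal (((LINT s:{c0..t}|lborel. h s) - (LINT s:{c0..t'}|lborel. h s))\<^sup>2)
    \<le> ennreal (d - c) * (\<integral>\<^sup>+s. ennreal ((h s)\<^sup>2) * indicator {c..<d} s \<partial>lborel)"
  using t t'
proof (induction t t' rule: linorder_wlog)
  case (sym a b)
  then show ?case by (simp add: power2_commute)
next
  case (le a b)
  have hi: "set_integrable lborel {p..q} h" for p q by (rule set_integrable_square[OF _ fin]) measurable
  have "{c0..b} = {c0..a} \<union> {a<..b}" using le c0 by auto
  then have "(LINT s:{c0..b}|lborel. h s) = (LINT s:{c0..a}|lborel. h s) + (LINT s:{a<..b}|lborel. h s)"
    by (simp only:) (intro set_integral_Un set_integrable_subset[OF hi[of a b]] hi; auto)
  also have "(LINT s:{a<..b}|lborel. h s) = (LINT s:{a..b}|lborel. h s)"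
    unfolding set_lebesgue_integral_def
  proof (rule integral_cong_AE)
    show "AE x in lborel. indicator {a<..b} x *\<^sub>R h x = indicator {a..b} x *\<^sub>R h x"
      using AE_lborel_singleton[of a] by eventually_elim (auto simp: indicator_def)
  qed auto
  finally have "((LINT s:{c0..a}|lborel. h s) - (LINT s:{c0..b}|lborel. h s))\<^sup>2 = (LINT s:{a..b}|lborel. h s)\<^sup>2"
    by simp
  also have "ennreal \<dots> \<le> ennreal (b - a) * (\<integral>\<^sup>+s. ennreal ((h s)\<^sup>2) * indicator {a..b} s \<partial>lborel)"
    using le by (intro interval_integral_square_le) auto
  also have "\<dots> \<le> ennreal (d - c) * (\<integral>\<^sup>+s. ennreal ((h s)\<^sup>2) * indicator {c..<d} s \<partial>lborel)"
    using le by (intro mult_mono nn_integral_mono ennreal_leI) (auto simp: indicator_def)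
  finally show ?case .
qed

context strip
begin

text \<open>Two points of the cell are joined by a path with one leg in \<open>z\<close> and one leg
  in \<open>r\<close>. The first leg costs a function of \<open>r\<close> alone, the second a
  function of \<open>z'\<close> alone, so integrating over all pairs of points separates the
  variables.\<close>

lemma cell_poincare:
  fixes a b c d :: real
  defines "Q \<equiv> {a..<b} \<times> {c..<d}"
  assumes s: "slice f g h" and ab: "\<sigma> \<le> a" "a < b" and cd: "0 \<le> c" "c < d" "d \<le> L"
    and m: "m = (LINT y:Q|lborel. f y) / ((b - a) * (d - c))"
  shows "(\<integral>\<^sup>+x. ennreal ((f x - m)\<^sup>2) * indicator Q x \<partial>lborel) \<le>
    ennreal (2 * (d - c)\<^sup>2) * (\<integral>\<^sup>+x. ennreal ((h x)\<^sup>2) * indicator Q x \<partial>lborel) +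
    ennreal (2 * (b - a)\<^sup>2) * (\<integral>\<^sup>+x. ennreal ((g x)\<^sup>2) * indicator Q x \<partial>lborel)"
proof -
  note [measurable] = slice_meas[OF s]
  let ?I = "{a..<b}" and ?J = "{c..<d}"
  define H where "H r = (\<integral>\<^sup>+s. ennreal ((h (r, s))\<^sup>2) * indicator ?J s \<partial>lborel)" for r
  define G where "G z = (\<integral>\<^sup>+s. ennreal ((g (s, z))\<^sup>2) * indicator ?I s \<partial>lborel)" for z
  have [measurable]: "H \<in> borel_measurable borel" "G \<in> borel_measurable borel" unfolding H_def G_def by measurable
  have Q[measurable]: "Q \<in> sets borel" unfolding Q_def
    by (metis atLeastLessThan_borel borel_prod pair_measureI)
  have Qm: "emeasure lborel Q = ennreal ((b - a) * (d - c))"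
  proof -
    have "emeasure lborel Q = emeasure (lborel \<Otimes>\<^sub>M lborel) (?I \<times> ?J)" by (simp add: Q_def lborel_prod)
    also have "\<dots> = ennreal (b - a) * ennreal (d - c)"
      using ab cd by (subst lborel.emeasure_pair_measure_Times) (auto simp: emeasure_lborel_Ico)
    finally show ?thesis using ab cd by (simp add: ennreal_mult)
  qed
  have QI: "indicator Q (r, z) = (indicator ?I r * indicator ?J z :: ennreal)" for r z
    by (auto simp: Q_def indicator_def)
  let ?q = "(b - a) * (d - c)"
  have q: "?q > 0" using ab cd by simp
  have fi: "set_integrable lborel Q f"
    unfolding set_integrable_def
  proof (rule Bochner_Integration.integrable_bound)
    have "integrable lborel (\<lambda>x. (f x)\<^sup>2)" using slice_f_fin(2)[OF s] by (auto simp: integrable_iff_bounded)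
    moreover have "integrable lborel (indicator Q :: real \<times> real \<Rightarrow> real)"
      using Qm by (intro integrable_real_indicator) auto
    ultimately show "integrable lborel (\<lambda>x. indicator Q x + (f x)\<^sup>2)" by (rule Bochner_Integration.integrable_add[rotated])
    have "\<bar>t\<bar> \<le> 1 + t\<^sup>2" for t :: real using sum_squares_bound[of 1 "\<bar>t\<bar>"] by simp
    then show "AE x in lborel. norm (indicator Q x *\<^sub>R f x) \<le> norm (indicator Q x + (f x)\<^sup>2)"
      by (auto simp: indicator_def intro!: AE_I2)
  qed simp
  \<comment> \<open>\<open>f x - m\<close> is the average of \<open>f x - f y\<close> over
    \<open>y\<close>, so only differences of \<open>f\<close> remain.\<close>
  have jensen: "ennreal ((f x - m)\<^sup>2) \<le> ennreal (1 / ?q) * (\<integral>\<^sup>+y. ennreal ((f x - f y)\<^sup>2) * indicator Q y \<partial>lborel)" for x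
  proof -
    have ci: "set_integrable lborel Q (\<lambda>_. f x)"
      using Qm by (auto simp: set_integrable_def)
    have mQ: "measure lborel Q = ?q" using Qm q by (simp add: measure_def)
    have "(LINT y:Q|lborel. f x - f y) = f x * ?q - (LINT y:Q|lborel. f y)"
      using set_integral_diff(2)[OF ci fi] mQ Qm by (simp add: set_lebesgue_integral_def mult.commute)
    then have "f x - m = (LINT y:Q|lborel. f x - f y) / ?q"
      using q by (simp add: m field_simps)
    then have "ennreal ((f x - m)\<^sup>2) = ennreal ((1 / ?q)\<^sup>2) * ennreal ((LINT y:Q|lborel. f x - f y)\<^sup>2)"
      by (simp add: power_divide flip: ennreal_mult)
    also have "\<dots> \<le> ennreal ((1 / ?q)\<^sup>2) * (emeasure lborel Q * (\<integral>\<^sup>+y. ennreal ((f x - f y)\<^sup>2) * indicator Q y \<partial>lborel))"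
      by (intro mult_left_mono set_integral_square_le) auto
    also have "\<dots> = ennreal ((1 / ?q)\<^sup>2) * ennreal ?q * (\<integral>\<^sup>+y. ennreal ((f x - f y)\<^sup>2) * indicator Q y \<partial>lborel)"
      by (simp add: Qm mult.assoc)
    also have "ennreal ((1 / ?q)\<^sup>2) * ennreal ?q = ennreal (1 / ?q)"
    proof -
      have "(1 / ?q)\<^sup>2 * ?q = 1 / ?q" using q by (simp add: power2_eq_square)
      then show ?thesis using q by (subst ennreal_mult[symmetric]) auto
    qed
    finally show ?thesis .
  qed
  let ?P1 = "\<lambda>x. snd x \<in> {0..L} \<longrightarrow> f x = (LINT s:{0..snd x}|lborel. h (fst x, s))"
  let ?P2 = "\<lambda>x. f x = (LINT s:{\<sigma>..fst x}|lborel. g (s, snd x))"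
  have P2: "AE r in lborel. AE z in lborel. ?P2 (r, z)"
  proof (rule AE_iterated_swap)
    have [measurable]: "(\<lambda>x. LINT s:{\<sigma>..fst x}|lborel. g (s, snd x)) \<in> borel_measurable (borel :: (real \<times> real) measure)"
    proof -
      have "(\<lambda>(x, s). (if \<sigma> \<le> s \<and> s \<le> fst x then 1 else 0) *\<^sub>R g (s, snd x)) \<in> borel_measurable ((borel :: (real \<times> real) measure) \<Otimes>\<^sub>M lborel)"
        by measurable
      then have "(\<lambda>(x, s). indicator {\<sigma>..fst x} s *\<^sub>R g (s, snd x)) \<in> borel_measurable ((borel :: (real \<times> real) measure) \<Otimes>\<^sub>M lborel)"
        by (rule measurable_cong[THEN iffD1, rotated]) (auto simp: indicator_def)
      then show ?thesis unfolding set_lebesgue_integral_def by (rule lborel.borel_measurable_lebesgue_integral)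
    qed
    show "{x. ?P2 x} \<in> sets borel" by measurable
  qed (use slice_r[OF s] in simp)
  have P2': "AE r in lborel. AE z in lborel. ?P2 (r, z)" by (rule P2)
  \<comment> \<open>The corner of the path is \<open>(r, z')\<close>. Each representation holds on
    almost every line only, hence the four nested quantifiers.\<close>
  have bound: "AE r in lborel. AE z in lborel. AE r' in lborel. AE z' in lborel.
      r \<in> ?I \<and> z \<in> ?J \<and> r' \<in> ?I \<and> z' \<in> ?J \<longrightarrow>
      ennreal ((f (r, z) - f (r', z'))\<^sup>2) \<le> 2 * (ennreal (d - c) * H r) + 2 * (ennreal (b - a) * G z')"
    using slice_z[OF s] P2 slice_sections(1)[OF s]
  proof eventually_elim
    fix r assume r1: "AE z in lborel. z \<in> {0..L} \<longrightarrow> f (r, z) = (LINT s:{0..z}|lborel. h (r, s))"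
      and r2: "AE z in lborel. ?P2 (r, z)" and hf: "(\<integral>\<^sup>+z. ennreal ((h (r, z))\<^sup>2) \<partial>lborel) < \<infinity>"
    show "AE z in lborel. AE r' in lborel. AE z' in lborel.
      r \<in> ?I \<and> z \<in> ?J \<and> r' \<in> ?I \<and> z' \<in> ?J \<longrightarrow>
      ennreal ((f (r, z) - f (r', z'))\<^sup>2) \<le> 2 * (ennreal (d - c) * H r) + 2 * (ennreal (b - a) * G z')"
    proof (rule eventually_mono[OF r1])
      fix z assume z1: "z \<in> {0..L} \<longrightarrow> f (r, z) = (LINT s:{0..z}|lborel. h (r, s))"
      show "AE r' in lborel. AE z' in lborel.
        r \<in> ?I \<and> z \<in> ?J \<and> r' \<in> ?I \<and> z' \<in> ?J \<longrightarrow>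
        ennreal ((f (r, z) - f (r', z'))\<^sup>2) \<le> 2 * (ennreal (d - c) * H r) + 2 * (ennreal (b - a) * G z')"
      proof (rule eventually_mono[OF P2'])
        fix r' assume r'2: "AE z in lborel. ?P2 (r', z)"
        show "AE z' in lborel. r \<in> ?I \<and> z \<in> ?J \<and> r' \<in> ?I \<and> z' \<in> ?J \<longrightarrow>
          ennreal ((f (r, z) - f (r', z'))\<^sup>2) \<le> 2 * (ennreal (d - c) * H r) + 2 * (ennreal (b - a) * G z')"
          using r1 r2 r'2 slice_sections(2)[OF s]
        proof eventually_elim
          fix z' assume z'1: "z' \<in> {0..L} \<longrightarrow> f (r, z') = (LINT s:{0..z'}|lborel. h (r, s))"
            and z'2: "?P2 (r, z')" and z'3: "?P2 (r', z')"
            and gf: "(\<integral>\<^sup>+r. ennreal ((g (r, z'))\<^sup>2) \<partial>lborel) < \<infinity>"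
          show "r \<in> ?I \<and> z \<in> ?J \<and> r' \<in> ?I \<and> z' \<in> ?J \<longrightarrow>
            ennreal ((f (r, z) - f (r', z'))\<^sup>2) \<le> 2 * (ennreal (d - c) * H r) + 2 * (ennreal (b - a) * G z')"
          proof (intro impI, elim conjE)
            assume i: "r \<in> ?I" "z \<in> ?J" "r' \<in> ?I" "z' \<in> ?J"
            have "ennreal ((f (r, z) - f (r, z'))\<^sup>2) \<le> ennreal (d - c) * H r"
              unfolding H_def using z1 z'1 i cd primitive_oscillation[of "\<lambda>s. h (r, s)" 0 c z d z'] hf by simp
            moreover have "ennreal ((f (r, z') - f (r', z'))\<^sup>2) \<le> ennreal (b - a) * G z'"
              unfolding G_def using z'2 z'3 i ab primitive_oscillation[of "\<lambda>s. g (s, z')" \<sigma> a r b r'] gf by simp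
            moreover have "(f (r, z) - f (r', z'))\<^sup>2 \<le> 2 * (f (r, z) - f (r, z'))\<^sup>2 + 2 * (f (r, z') - f (r', z'))\<^sup>2"
              using sum_squares_bound[of "f (r, z) - f (r, z')" "f (r, z') - f (r', z')"]
                power2_sum[of "f (r, z) - f (r, z')" "f (r, z') - f (r', z')"] by simp
            then have "ennreal ((f (r, z) - f (r', z'))\<^sup>2) \<le> ennreal (2 * (f (r, z) - f (r, z'))\<^sup>2 + 2 * (f (r, z') - f (r', z'))\<^sup>2)"
              by (rule ennreal_leI)
            then have "ennreal ((f (r, z) - f (r', z'))\<^sup>2) \<le> 2 * ennreal ((f (r, z) - f (r, z'))\<^sup>2) + 2 * ennreal ((f (r, z') - f (r', z'))\<^sup>2)"
              by (simp add: ennreal_mult)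
            ultimately show "ennreal ((f (r, z) - f (r', z'))\<^sup>2) \<le> 2 * (ennreal (d - c) * H r) + 2 * (ennreal (b - a) * G z')"
              by (meson add_mono mult_left_mono order_trans zero_le)
          qed
        qed
      qed
    qed
  qed
  \<comment> \<open>After integration over all pairs, a leg contributes the cube of its side times
    the other side; dividing by the area leaves the square of the side.\<close>
  have gen: "1 / (p * k) * (2 * k^3 * p) = 2 * k\<^sup>2" "1 / (p * k) * (2 * p^3 * k) = 2 * p\<^sup>2"
    if "p > 0" "k > 0" for p k :: real
    using that by (simp_all add: field_simps power2_eq_square power3_eq_cube)
  have "(\<integral>\<^sup>+x. ennreal ((f x - m)\<^sup>2) * indicator Q x \<partial>lborel)
      \<le> (\<integral>\<^sup>+x. ennreal (1 / ?q) * ((\<integral>\<^sup>+y. ennreal ((f x - f y)\<^sup>2) * indicator Q y \<partial>lborel) * indicator Q x) \<partial>lborel)"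
    using jensen by (intro nn_integral_mono) (auto simp: indicator_def)
  also have "\<dots> = ennreal (1 / ?q) * (\<integral>\<^sup>+x. (\<integral>\<^sup>+y. ennreal ((f x - f y)\<^sup>2) * indicator Q y \<partial>lborel) * indicator Q x \<partial>lborel)"
    by (intro nn_integral_cmult) measurable
  also have "(\<integral>\<^sup>+x. (\<integral>\<^sup>+y. ennreal ((f x - f y)\<^sup>2) * indicator Q y \<partial>lborel) * indicator Q x \<partial>lborel)
      = (\<integral>\<^sup>+r. \<integral>\<^sup>+z. \<integral>\<^sup>+r'. \<integral>\<^sup>+z'. ennreal ((f (r, z) - f (r', z'))\<^sup>2) * (indicator ?I r' * indicator ?J z') * (indicator ?I r * indicator ?J z) \<partial>lborel \<partial>lborel \<partial>lborel \<partial>lborel)"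
    by (subst nn_integral_iterated(1), measurable, subst nn_integral_iterated(1))
      (auto simp: QI nn_integral_multc)
  also have "\<dots> \<le> (\<integral>\<^sup>+r. \<integral>\<^sup>+z. \<integral>\<^sup>+r'. \<integral>\<^sup>+z'.
      (2 * (ennreal (d - c) * H r) + 2 * (ennreal (b - a) * G z')) * (indicator ?I r' * indicator ?J z') * (indicator ?I r * indicator ?J z) \<partial>lborel \<partial>lborel \<partial>lborel \<partial>lborel)"
    using bound
    apply (intro nn_integral_mono_AE)
    apply (elim eventually_mono)
    apply (intro nn_integral_mono_AE)
    apply (elim eventually_mono)
    apply (intro nn_integral_mono_AE)
    apply (elim eventually_mono)
    apply (intro nn_integral_mono_AE)
    apply (elim eventually_mono)
    apply (auto simp: indicator_def)
    done
  also have "\<dots> = ennreal (2 * (d - c)^3 * (b - a)) * (\<integral>\<^sup>+r. H r * indicator ?I r \<partial>lborel)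
      + ennreal (2 * (b - a)^3 * (d - c)) * (\<integral>\<^sup>+z. G z * indicator ?J z \<partial>lborel)" (is "_ = ?rhs")
  proof -
    have sp: "(2 * (ennreal (d - c) * H r) + 2 * (ennreal (b - a) * G z')) * (indicator ?I r' * indicator ?J z') * (indicator ?I r * indicator ?J z)
       = indicator ?I r' * (indicator ?J z * (indicator ?J z' * (ennreal (2 * (d - c)) * (H r * indicator ?I r))))
       + indicator ?I r' * (indicator ?J z * ((G z' * indicator ?J z') * (ennreal (2 * (b - a)) * indicator ?I r)))" for r z r' z'
    proof -
      have e2: "ennreal (2 * t) = 2 * ennreal t" if "t \<ge> 0" for t using that by (simp add: ennreal_mult)
      have "ennreal (2 * (d - c)) = 2 * ennreal (d - c)" "ennreal (2 * (b - a)) = 2 * ennreal (b - a)"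
        using ab cd by (intro e2; simp)+
      then show ?thesis by (simp only:) (simp add: indicator_def mult_ac)
    qed
    have e: "emeasure lborel ?I = ennreal (b - a)" "emeasure lborel ?J = ennreal (d - c)"
      using ab cd by (simp_all add: emeasure_lborel_Ico)
    have "(\<integral>\<^sup>+r. \<integral>\<^sup>+z. \<integral>\<^sup>+r'. \<integral>\<^sup>+z'.
      (2 * (ennreal (d - c) * H r) + 2 * (ennreal (b - a) * G z')) * (indicator ?I r' * indicator ?J z') * (indicator ?I r * indicator ?J z) \<partial>lborel \<partial>lborel \<partial>lborel \<partial>lborel)
      = ennreal (b - a) * (ennreal (d - c) * (ennreal (d - c) * (ennreal (2 * (d - c)) * (\<integral>\<^sup>+r. H r * indicator ?I r \<partial>lborel))))
      + ennreal (b - a) * (ennreal (d - c) * ((\<integral>\<^sup>+z. G z * indicator ?J z \<partial>lborel) * (ennreal (2 * (b - a)) * ennreal (b - a))))"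
      unfolding sp by (simp add: nn_integral_add nn_integral_cmult nn_integral_multc e)
    also have "\<dots> = ?rhs"
    proof -
      have g1: "ennreal p * (ennreal k * (ennreal k * (ennreal (2 * k) * X))) = ennreal (2 * k^3 * p) * X"
        and g2: "ennreal p * (ennreal k * (X * (ennreal (2 * p) * ennreal p))) = ennreal (2 * p^3 * k) * X"
        if "p \<ge> 0" "k \<ge> 0" for p k X
        using that by (simp_all add: ennreal_mult power3_eq_cube mult_ac)
      show ?thesis by (subst g1, use ab cd in simp, use ab cd in simp, subst g2) (use ab cd in auto)
    qed
    finally show ?thesis .
  qed
  also have "(\<integral>\<^sup>+r. H r * indicator ?I r \<partial>lborel) = (\<integral>\<^sup>+x. ennreal ((h x)\<^sup>2) * indicator Q x \<partial>lborel)"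
    unfolding H_def by (subst nn_integral_iterated(1)) (auto simp: QI nn_integral_cmult[symmetric] mult_ac)
  also have "(\<integral>\<^sup>+z. G z * indicator ?J z \<partial>lborel) = (\<integral>\<^sup>+x. ennreal ((g x)\<^sup>2) * indicator Q x \<partial>lborel)"
    unfolding G_def by (subst nn_integral_iterated(2)) (auto simp: QI nn_integral_cmult[symmetric] mult_ac)
  finally have "(\<integral>\<^sup>+x. ennreal ((f x - m)\<^sup>2) * indicator Q x \<partial>lborel) \<le>
    ennreal (1 / ?q) * (ennreal (2 * (d - c)^3 * (b - a)) * (\<integral>\<^sup>+x. ennreal ((h x)\<^sup>2) * indicator Q x \<partial>lborel)
      + ennreal (2 * (b - a)^3 * (d - c)) * (\<integral>\<^sup>+x. ennreal ((g x)\<^sup>2) * indicator Q x \<partial>lborel))"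
    by (simp add: mult_left_mono)
  also have "\<dots> = ennreal (1 / ?q) * ennreal (2 * (d - c)^3 * (b - a)) * (\<integral>\<^sup>+x. ennreal ((h x)\<^sup>2) * indicator Q x \<partial>lborel)
      + ennreal (1 / ?q) * ennreal (2 * (b - a)^3 * (d - c)) * (\<integral>\<^sup>+x. ennreal ((g x)\<^sup>2) * indicator Q x \<partial>lborel)"
    by (simp add: distrib_left mult.assoc)
  also have "ennreal (1 / ?q) * ennreal (2 * (d - c)^3 * (b - a)) = ennreal (2 * (d - c)\<^sup>2)"
  proof -
    have "1 / ?q * (2 * (d - c)^3 * (b - a)) = 2 * (d - c)\<^sup>2" using ab cd by (intro gen) auto
    then show ?thesis using ab cd q by (subst ennreal_mult[symmetric]) auto
  qed
  also have "ennreal (1 / ?q) * ennreal (2 * (b - a)^3 * (d - c)) = ennreal (2 * (b - a)\<^sup>2)"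
  proof -
    have "1 / ?q * (2 * (b - a)^3 * (d - c)) = 2 * (b - a)\<^sup>2" using ab cd by (intro gen) auto
    then show ?thesis using ab cd q by (subst ennreal_mult[symmetric]) auto
  qed
  finally show ?thesis .
qed

end

section \<open>Weighted functions as elements of the Hilbert space\<close>

text \<open>Continuity of uniform limits, in the form that suits integrals approximated with an
  error independent of the argument.\<close>

lemma continuous_map_real_approx:
  fixes G :: "'a \<Rightarrow> real"
  assumes "\<And>e. e > 0 \<Longrightarrow> \<exists>F. continuous_map X euclideanreal F \<and> (\<forall>x\<in>topspace X. \<bar>F x - G x\<bar> \<le> e)"
  shows "continuous_map X euclideanreal G"
proof -
  have "\<exists>F. continuous_map X euclideanreal F \<and> (\<forall>x\<in>topspace X. \<bar>F x - G x\<bar> \<le> inverse (Suc n))" for n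
    by (rule assms) simp
  then obtain F where F: "\<And>n. continuous_map X euclideanreal (F n)"
    "\<And>n x. x \<in> topspace X \<Longrightarrow> \<bar>F n x - G x\<bar> \<le> inverse (Suc n)" by metis
  show ?thesis
  proof (rule Met_TC.continuous_map_uniform_limit_alt[where F = sequentially and f = F, simplified])
    show "\<forall>\<^sub>F n in sequentially. \<forall>x\<in>topspace X. dist (F n x) (G x) < e" if "0 < e" for e
    proof -
      obtain N where N: "inverse (real (Suc N)) < e" using reals_Archimedean[OF \<open>0 < e\<close>] by blast
      have "dist (F n x) (G x) < e" if "n \<ge> N" "x \<in> topspace X" for n x
      proof -
        have "inverse (real (Suc n)) \<le> inverse (real (Suc N))" using that by simp
        then show ?thesis using F(2)[OF that(2), of n] N unfolding dist_real_def by linarith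
      qed
      then show ?thesis by (auto simp: eventually_sequentially)
    qed
  qed (use F in auto)
qed

context strip
begin

lemma W2_add: "W2 f \<Longrightarrow> W2 g \<Longrightarrow> W2 (\<lambda>x. f x + g x)"
proof -
  assume f: "W2 f" and g: "W2 g"
  have "integrable lborel (\<lambda>x. (f x + g x)\<^sup>2 * fst x)"
  proof (rule integrable_weighted_bound)
    show "integrable lborel (\<lambda>x. (2 * (f x)\<^sup>2 + 2 * (g x)\<^sup>2) * fst x)"
      using f g unfolding W2_def by (simp add: distrib_right mult.assoc)
    show "\<bar>(f x + g x)\<^sup>2\<bar> \<le> 2 * (f x)\<^sup>2 + 2 * (g x)\<^sup>2" for x
    proof -
      have "(f x + g x)\<^sup>2 \<le> 2 * (f x)\<^sup>2 + 2 * (g x)\<^sup>2"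
        using sum_squares_bound[of "f x" "g x"] by (simp add: power2_sum)
      then show ?thesis by simp
    qed
    show "(\<lambda>x. (f x + g x)\<^sup>2) \<in> borel_measurable borel" using f g by (auto simp: W2_def)
  qed (simp add: W2_zero[OF f] W2_zero[OF g])
  then show ?thesis using f g unfolding W2_def by auto
qed

lemma W2_scale: "W2 f \<Longrightarrow> W2 (\<lambda>x. c * f x)"
  using W2_bounded[of f "\<lambda>_. c" "\<bar>c\<bar>"] by simp

lemma W2_diff: "W2 f \<Longrightarrow> W2 g \<Longrightarrow> W2 (\<lambda>x. f x - g x)"
  using W2_add[OF _ W2_scale, of f g "-1"] by simp

text \<open>Functions with weight \<open>r\<close> on the strip are embedded into the unweighted \<open>L\<^sup>2\<close> of the plane by
  \<open>f \<mapsto> \<surd>r f\<close>; \<open>fn\<close> inverts this on the strip and discards the values elsewhere.\<close>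

definition em :: "(real \<times> real \<Rightarrow> real) \<Rightarrow> real \<times> real \<Rightarrow> real" where
  "em f x = sqrt (fst x) * f x"

definition cls :: "(real \<times> real \<Rightarrow> real) \<Rightarrow> (real \<times> real) l2" where
  "cls f = abs_l2 (em f)"

definition fn :: "(real \<times> real) l2 \<Rightarrow> real \<times> real \<Rightarrow> real" where
  "fn c x = indicator S x * rep_l2 c x / sqrt (fst x)"

lemma em_square: "W2 f \<Longrightarrow> (em f x)\<^sup>2 = (f x)\<^sup>2 * fst x"
  using W2_zero[of f x] fst_ge[of x] sigma_pos by (cases "x \<in> S") (auto simp: em_def power_mult_distrib)

lemma sq_int_em: "W2 f \<Longrightarrow> sq_int (em f)"
  unfolding sq_int_def em_square
  by (auto simp: W2_def em_def[abs_def] intro: borel_measurable_times)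

lemma fn_measurable [measurable]: "fn c \<in> borel_measurable borel"
proof -
  have [measurable]: "rep_l2 c \<in> borel_measurable borel" using sq_int_rep_l2 by (rule sq_int_measurable)
  show ?thesis unfolding fn_def[abs_def] by measurable
qed

lemma W2_fn: "W2 (fn c)"
proof (rule W2I)
  have "nnw (fn c) \<le> nn2 (rep_l2 c)"
  proof (intro nn_integral_mono ennreal_leI)
    fix x show "(fn c x)\<^sup>2 * fst x \<le> (rep_l2 c x)\<^sup>2"
      using fst_ge[of x] sigma_pos by (cases "x \<in> S") (auto simp: fn_def power_divide)
  qed
  also have "\<dots> < \<infinity>" using sq_int_rep_l2[of c] by (simp add: sq_int_iff_nn)
  finally show "nnw (fn c) < \<infinity>" .
qed (auto simp: fn_def)

lemma fn_cls: assumes "W2 f" shows "AE x in lborel. fn (cls f) x = f x"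
  using rep_abs_l2[OF sq_int_em[OF assms]]
proof eventually_elim
  fix x assume "rep_l2 (abs_l2 (em f)) x = em f x"
  then show "fn (cls f) x = f x"
    using fst_ge[of x] sigma_pos W2_zero[OF assms, of x] by (cases "x \<in> S") (auto simp: fn_def cls_def em_def)
qed

text \<open>\<open>c\<close> need not come from the strip, but its values outside are invisible to
  \<open>cls g\<close>.\<close>

lemma inner_cls_right: assumes "W2 g" shows "inner c (cls g) = (LINT x|lborel. fn c x * g x * fst x)"
proof -
  have "inner c (cls g) = (LINT x|lborel. rep_l2 c x * em g x)"
    using inner_abs_l2[OF sq_int_rep_l2 sq_int_em[OF assms], of c] by (simp add: abs_rep_l2 cls_def)
  also have "\<dots> = (LINT x|lborel. fn c x * g x * fst x)"
  proof (rule Bochner_Integration.integral_cong[OF refl])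
    fix x show "rep_l2 c x * em g x = fn c x * g x * fst x"
    proof (cases "x \<in> S")
      case True
      then have "sqrt (fst x) * sqrt (fst x) = fst x" "sqrt (fst x) \<noteq> 0" using fst_ge[OF True] sigma_pos by auto
      then show ?thesis using True by (simp add: fn_def em_def field_simps)
    qed (simp add: em_def W2_zero[OF assms])
  qed
  finally show ?thesis .
qed

lemma inner_cls: assumes "W2 f" "W2 g" shows "inner (cls f) (cls g) = (LINT x|lborel. f x * g x * fst x)"
proof -
  have [measurable]: "f \<in> borel_measurable borel" "g \<in> borel_measurable borel" using assms by (auto simp: W2_def)
  show ?thesis unfolding inner_cls_right[OF assms(2)]
    using fn_cls[OF assms(1)] by (intro integral_cong_AE) (auto elim: eventually_mono)
qed

lemma norm_cls: "W2 f \<Longrightarrow> (norm (cls f))\<^sup>2 = (LINT x|lborel. (f x)\<^sup>2 * fst x)"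
  unfolding power2_norm_eq_inner by (simp add: inner_cls power2_eq_square)

lemma nn_norm_cls: "W2 f \<Longrightarrow> nnw f = ennreal ((norm (cls f))\<^sup>2)"
  unfolding cls_def by (subst norm_abs_l2[OF sq_int_em]) (simp_all add: em_square)

lemma cls_eq_iff: assumes "W2 f" "W2 g" shows "cls f = cls g \<longleftrightarrow> (AE x in lborel. f x = g x)"
proof
  assume "cls f = cls g"
  then show "AE x in lborel. f x = g x"
    using fn_cls[OF assms(1)] fn_cls[OF assms(2)] by (auto elim: eventually_elim2)
next
  assume "AE x in lborel. f x = g x"
  then have "AE x in lborel. em f x = em g x" by (auto simp: em_def elim: eventually_mono)
  then show "cls f = cls g" unfolding cls_def using abs_l2_eq_iff[OF sq_int_em[OF assms(1)] sq_int_em[OF assms(2)]] by simp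
qed

lemma cls_add: assumes "W2 f" "W2 g" shows "cls (\<lambda>x. f x + g x) = cls f + cls g"
proof -
  have "em (\<lambda>x. f x + g x) = (\<lambda>x. em f x + em g x)" by (auto simp: em_def algebra_simps)
  then show ?thesis by (simp add: cls_def abs_l2_add sq_int_em assms)
qed

lemma cls_scale: assumes "W2 f" shows "cls (\<lambda>x. c * f x) = c *\<^sub>R cls f"
proof -
  have "em (\<lambda>x. c * f x) = (\<lambda>x. c * em f x)" by (auto simp: em_def)
  then show ?thesis by (simp add: cls_def abs_l2_scale sq_int_em assms)
qed

lemma cls_diff: assumes "W2 f" "W2 g" shows "cls (\<lambda>x. f x - g x) = cls f - cls g"
proof -
  have "em (\<lambda>x. f x - g x) = (\<lambda>x. em f x - em g x)" by (auto simp: em_def algebra_simps)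
  then show ?thesis by (simp add: cls_def abs_l2_diff sq_int_em assms)
qed

lemma weighted_cauchy_schwarz:
  assumes "W2 f" "W2 g" shows "\<bar>LINT x|lborel. f x * g x * fst x\<bar> \<le> norm (cls f) * norm (cls g)"
  using Cauchy_Schwarz_ineq2[of "cls f" "cls g"] by (simp add: inner_cls[OF assms])

section \<open>Weak continuity of quadratic integrals\<close>

text \<open>\<open>R\<close> bounds the squares of the weighted norms of both derivatives. The
  derivatives are hidden so that a family of functions can share one bound.\<close>

definition slice_bound :: "real \<Rightarrow> (real \<times> real \<Rightarrow> real) \<Rightarrow> bool" where
  "slice_bound R f \<longleftrightarrow> (\<exists>g h. slice f g h \<and> nnw g \<le> ennreal R \<and>
      nnw h \<le> ennreal R)"

lemma sum_sum_ennreal: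
  "(\<And>i j. 0 \<le> f i j) \<Longrightarrow> (\<Sum>i<n. \<Sum>j<k. ennreal (f i j)) = ennreal (\<Sum>i<n. \<Sum>j<k. f i j)"
  by (simp add: sum_nonneg)

lemma nn_integral_sum_sum:
  "(\<And>i j. T i j \<in> borel_measurable M) \<Longrightarrow>
    (\<integral>\<^sup>+x. (\<Sum>i<n. \<Sum>j<k. T i j x) \<partial>M) = (\<Sum>i<n. \<Sum>j<k. (\<integral>\<^sup>+x. T i j x \<partial>M))"
  by (simp add: nn_integral_sum)

lemma sum_indicator_cells:
  fixes a h t :: real assumes "h \<ge> 0"
  shows "(\<Sum>i<n. indicator {a + real i * h..<a + real (Suc i) * h} t) = (indicator {a..<a + real n * h} t :: real)"
proof (induction n)
  case (Suc n)
  have "0 \<le> real n * h" using assms by simp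
  have "(\<Sum>i<Suc n. indicator {a + real i * h..<a + real (Suc i) * h} t :: real)
      = indicator {a..<a + real n * h} t + indicator {a + real n * h..<a + real (Suc n) * h} t"
    by (simp only: sum.lessThan_Suc Suc.IH)
  also have "\<dots> = indicator {a..<a + real (Suc n) * h} t"
  proof -
    have "a \<le> a + real n * h" "a + real n * h \<le> a + real (Suc n) * h"
      using \<open>0 \<le> real n * h\<close> assms by (auto simp: distrib_right)
    then show ?thesis by (auto simp: indicator_def simp del: of_nat_Suc)
  qed
  finally show ?case .
qed simp

lemma slice_bound_unweighted:
  assumes s: "slice f g h" and R: "R \<ge> 0"
    and "nnw g \<le> ennreal R" "nnw h \<le> ennreal R"
  shows "nn2 g \<le> ennreal (R / \<sigma>)" "nn2 h \<le> ennreal (R / \<sigma>)"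
    "nn2 f \<le> ennreal (L\<^sup>2 * R / \<sigma>)"
proof -
  note [measurable] = slice_meas[OF s]
  have e: "ennreal (1 / \<sigma>) * ennreal c = ennreal (c / \<sigma>)" if "c \<ge> 0" for c
    using sigma_pos that by (simp flip: ennreal_mult)
  have u: "nn2 k \<le> ennreal (c / \<sigma>)"
    if "k \<in> borel_measurable borel" "\<And>x. x \<notin> S \<Longrightarrow> k x = 0" "nnw k \<le> ennreal c" "c \<ge> 0" for k c
  proof -
    have "nn2 k \<le> ennreal (1 / \<sigma>) * nnw k"
      by (rule nn_unweighted) (use that in auto)
    also have "\<dots> \<le> ennreal (1 / \<sigma>) * ennreal c" by (intro mult_left_mono that) auto
    finally show ?thesis using e[OF that(4)] by simp
  qed
  show "nn2 g \<le> ennreal (R / \<sigma>)" "nn2 h \<le> ennreal (R / \<sigma>)"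
    using assms slice_zero[OF s] by (auto intro!: u)
  have "nnw f \<le> ennreal (L\<^sup>2) * ennreal R"
    by (rule order_trans[OF slice_poincare[OF s]]) (intro mult_left_mono assms, auto)
  then show "nn2 f \<le> ennreal (L\<^sup>2 * R / \<sigma>)"
    using R slice_zero[OF s] by (intro u) (auto simp: ennreal_mult)
qed

text \<open>On the support of \<open>m\<close>, \<open>F U\<close> is replaced by its averages over
  \<open>n\<close> times \<open>n\<close> cells. Averages are continuous linear functionals, so the
  approximating integral is a finite sum of products of weakly continuous functions; the Poincare
  inequality on the cells makes the error small for all \<open>U\<close> at once. Strong
  approximation of one of the two factors is enough, the other being bounded in norm.\<close>

lemma weak_cont_bounded:
  fixes X :: "'a topology" and F H :: "'a \<Rightarrow> real \<times> real \<Rightarrow> real"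
  assumes p: "\<And>c. continuous_map X euclideanreal (\<lambda>U. inner (cls (F U)) c)"
    and q: "\<And>c. continuous_map X euclideanreal (\<lambda>U. inner (cls (H U)) c)"
    and F: "\<And>U. U \<in> topspace X \<Longrightarrow> slice_bound R (F U)" and R: "R \<ge> 0"
    and H: "\<And>U. U \<in> topspace X \<Longrightarrow> W2 (H U) \<and> (norm (cls (H U)))\<^sup>2 \<le> R2"
    and m[measurable]: "m \<in> borel_measurable borel" and mB: "\<And>x. \<bar>m x\<bar> \<le> B" and N: "N > 0"
    and mN: "\<And>x. fst x \<ge> \<sigma> + N \<Longrightarrow> m x = 0"
  shows "continuous_map X euclideanreal (\<lambda>U. LINT x|lborel. F U x * H U x * m x * fst x)"
proof (rule continuous_map_real_approx)
  fix e :: real assume e: "e > 0"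
  \<comment> \<open>\<open>t\<close> is the parameter of Young's inequality: it leaves at most
    \<open>e / 2\<close> for the term with \<open>H\<close>. Afterwards \<open>n\<close> is taken so
    large that the term with \<open>F\<close>, of size \<open>C / n^2\<close>, is at most
    \<open>e / 2\<close> as well.\<close>
  define t where "t = e / (2 * (\<bar>R2\<bar> + 1))"
  have t: "t > 0" using e by (simp add: t_def)
  define C where "C = (\<sigma> + N) * B\<^sup>2 / t * (2 * (L\<^sup>2 + N\<^sup>2) * (R / \<sigma>))"
  have C0: "C \<ge> 0" unfolding C_def using sigma_pos N t R by (intro mult_nonneg_nonneg divide_nonneg_pos) auto
  obtain n0 :: nat where n0: "2 * C / e \<le> real n0" using real_arch_simple by blast
  define n where "n = Suc n0"
  have n: "n > 0" "C / (real n)\<^sup>2 \<le> e / 2"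
  proof -
    show "n > 0" by (simp add: n_def)
    have "real n * 1 \<le> real n * real n" by (intro mult_left_mono) (auto simp: n_def)
    moreover have "2 * C / e \<le> real n" using n0 by (simp add: n_def)
    ultimately have "2 * C / e \<le> (real n)\<^sup>2" by (simp add: power2_eq_square)
    then show "C / (real n)\<^sup>2 \<le> e / 2" using e \<open>n > 0\<close> by (simp add: field_simps)
  qed
  define hr where "hr = N / real n"
  define hz where "hz = L / real n"
  have hrz: "hr > 0" "hz > 0" using N L_pos n(1) by (simp_all add: hr_def hz_def)
  have hn: "real n * hr = N" "real n * hz = L" using n(1) by (simp_all add: hr_def hz_def)
  define I where "I i = {\<sigma> + real i * hr..<\<sigma> + real (Suc i) * hr}" for i :: nat
  \<comment> \<open>The summand 0 gives both families of intervals the form of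
    \<open>sum_indicator_cells\<close>.\<close>
  define J where "J j = {0 + real j * hz..<0 + real (Suc j) * hz}" for j :: nat
  define Q where "Q i j = I i \<times> J j" for i j
  have Qb [measurable]: "Q i j \<in> sets borel" for i j unfolding Q_def I_def J_def
    by (metis atLeastLessThan_borel borel_prod pair_measureI)
  have QI: "indicator (Q i j) x = (indicator (I i) (fst x) * indicator (J j) (snd x) :: real)" for i j x
    by (cases x) (auto simp: Q_def indicator_def)
  define D where "D = {\<sigma>..<\<sigma> + N} \<times> {0..<L}"
  have sumQ: "(\<Sum>i<n. \<Sum>j<n. indicator (Q i j) x) = (indicator D x :: real)" for x
  proof -
    have "(\<Sum>i<n. \<Sum>j<n. indicator (Q i j) x) = (\<Sum>i<n. indicator (I i) (fst x)) * (\<Sum>j<n. indicator (J j) (snd x) :: real)"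
      by (simp add: QI sum_product)
    also have "\<dots> = indicator {\<sigma>..<\<sigma> + N} (fst x) * indicator {0..<0 + L} (snd x)"
      unfolding I_def J_def using hrz sum_indicator_cells[of hr \<sigma> "fst x" n] sum_indicator_cells[of hz 0 "snd x" n]
      by (simp only: hn less_imp_le)
    also have "\<dots> = indicator D x" by (cases x) (auto simp: D_def indicator_def)
    finally show ?thesis .
  qed
  define a where "a i j U = (LINT y:Q i j|lborel. F U y) / (hr * hz)" for i j U
  define fb where "fb U x = (\<Sum>i<n. \<Sum>j<n. a i j U * indicator (Q i j) x)" for U x
  define G where "G U = (\<Sum>i<n. \<Sum>j<n. a i j U * (LINT x|lborel. H U x * (indicator (Q i j) x * m x * indicator S x) * fst x))" for U
  have disj: "indicator (Q i j) x * indicator (Q i' j') x = (if i = i' \<and> j = j' then indicator (Q i j) x else (0::real))" for i j i' j' x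
  proof -
    have "i = i'" if "s \<in> I i" "s \<in> I i'" for s i i'
    proof (rule ccontr)
      assume "i \<noteq> i'"
      then consider "Suc i \<le> i'" | "Suc i' \<le> i" by linarith
      then show False
      proof cases
        case 1
        then have "real (Suc i) * hr \<le> real i' * hr" using hrz by (intro mult_right_mono) auto
        then show False using that by (auto simp: I_def)
      next
        case 2
        then have "real (Suc i') * hr \<le> real i * hr" using hrz by (intro mult_right_mono) auto
        then show False using that by (auto simp: I_def)
      qed
    qed
    moreover have "j = j'" if "s \<in> J j" "s \<in> J j'" for s j j'
    proof (rule ccontr)
      assume "j \<noteq> j'"
      then consider "Suc j \<le> j'" | "Suc j' \<le> j" by linarith
      then show False
      proof cases
        case 1
        then have "real (Suc j) * hz \<le> real j' * hz" using hrz by (intro mult_right_mono) auto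
        then show False using that by (auto simp: J_def)
      next
        case 2
        then have "real (Suc j') * hz \<le> real j * hz" using hrz by (intro mult_right_mono) auto
        then show False using that by (auto simp: J_def)
      qed
    qed
    ultimately show ?thesis by (auto simp: Q_def indicator_def)
  qed
  have QD: "emeasure lborel (Q i j) < \<infinity>" for i j
  proof -
    have "emeasure lborel (Q i j) = emeasure (lborel \<Otimes>\<^sub>M lborel) (I i \<times> J j)" by (simp add: Q_def lborel_prod)
    also have "\<dots> = emeasure lborel (I i) * emeasure lborel (J j)"
      by (rule lborel.emeasure_pair_measure_Times) (auto simp: I_def J_def)
    also have "\<dots> < \<infinity>" using hrz unfolding I_def J_def by (simp add: emeasure_lborel_Ico ennreal_mult_less_top)
    finally show ?thesis .
  qed
  have W2Q: "W2 (\<lambda>x. indicator (Q i j) x * k x * indicator S x)" if [measurable]: "k \<in> borel_measurable borel" and k: "\<And>x. x \<in> S \<Longrightarrow> \<bar>k x\<bar> \<le> K" for i j k K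
  proof (rule W2I)
    show "(\<lambda>x. indicator (Q i j) x * k x * indicator S x) \<in> borel_measurable borel" by measurable
    have "(\<integral>\<^sup>+x. ennreal ((indicator (Q i j) x * k x * indicator S x)\<^sup>2 * fst x) \<partial>lborel)
      \<le> (\<integral>\<^sup>+x. ennreal (K\<^sup>2 * (\<sigma> + real (Suc i) * hr)) * indicator (Q i j) x \<partial>lborel)"
    proof (intro nn_integral_mono)
      fix x
      show "ennreal ((indicator (Q i j) x * k x * indicator S x)\<^sup>2 * fst x) \<le> ennreal (K\<^sup>2 * (\<sigma> + real (Suc i) * hr)) * indicator (Q i j) x"
      proof (cases "x \<in> Q i j \<and> x \<in> S")
        case True
        then have "(k x)\<^sup>2 \<le> K\<^sup>2" using k[of x] by (metis abs_ge_zero power2_abs power_mono)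
        moreover have "fst x \<le> \<sigma> + real (Suc i) * hr" using True by (auto simp: Q_def I_def)
        moreover have "0 \<le> fst x" using fst_ge[of x] True sigma_pos by auto
        ultimately show ?thesis using True by (auto intro!: ennreal_leI mult_mono)
      qed (auto simp: indicator_def)
    qed
    also have "\<dots> = ennreal (K\<^sup>2 * (\<sigma> + real (Suc i) * hr)) * emeasure lborel (Q i j)"
      by (rule nn_integral_cmult_indicator) simp
    also have "\<dots> < \<infinity>" using QD by (simp add: ennreal_mult_less_top)
    finally show "(\<integral>\<^sup>+x. ennreal ((indicator (Q i j) x * k x * indicator S x)\<^sup>2 * fst x) \<partial>lborel) < \<infinity>" .
  qed auto
  have mW: "W2 (\<lambda>x. indicator (Q i j) x * m x * indicator S x)" for i j
    by (rule W2Q[OF m mB])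
  \<comment> \<open>The factor \<open>1 / fst x\<close> undoes the weight, so the plain average over
    a cell becomes an inner product with a fixed class.\<close>
  have rW: "W2 (\<lambda>x. indicator (Q i j) x * (1 / fst x) * indicator S x)" for i j
  proof (rule W2Q[where K = "1 / \<sigma>"])
    fix x assume "x \<in> S"
    then have "\<sigma> < fst x" by (rule fst_ge)
    then show "\<bar>1 / fst x\<bar> \<le> 1 / \<sigma>" using sigma_pos by (simp add: frac_le)
  qed measurable
  have aeq: "a i j U = inner (cls (F U)) (cls (\<lambda>x. indicator (Q i j) x * (1 / fst x) * indicator S x)) / (hr * hz)"
    if U: "U \<in> topspace X" for i j U
  proof -
    obtain g h where s: "slice (F U) g h" using F[OF U] by (auto simp: slice_bound_def)
    have "inner (cls (F U)) (cls (\<lambda>x. indicator (Q i j) x * (1 / fst x) * indicator S x))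
      = (LINT x|lborel. F U x * (indicator (Q i j) x * (1 / fst x) * indicator S x) * fst x)"
      by (rule inner_cls[OF slice_W2(1)[OF s] rW])
    also have "\<dots> = (LINT y:Q i j|lborel. F U y)"
      unfolding set_lebesgue_integral_def
    proof (rule Bochner_Integration.integral_cong[OF refl])
      fix x show "F U x * (indicator (Q i j) x * (1 / fst x) * indicator S x) * fst x = indicator (Q i j) x *\<^sub>R F U x"
        using fst_ge[of x] sigma_pos slice_zero(1)[OF s, of x] by (cases "x \<in> S") auto
    qed
    finally show ?thesis by (simp add: a_def)
  qed
  have "continuous_map X euclideanreal (\<lambda>U. \<Sum>i<n. \<Sum>j<n.
      inner (cls (F U)) (cls (\<lambda>x. indicator (Q i j) x * (1 / fst x) * indicator S x)) / (hr * hz) *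
      inner (cls (H U)) (cls (\<lambda>x. indicator (Q i j) x * m x * indicator S x)))"
    using hrz by (intro continuous_map_sum continuous_map_real_mult continuous_map_real_divide p q continuous_intros) auto
  then have Gc: "continuous_map X euclideanreal G"
  proof (rule continuous_map_eq)
    fix U assume U: "U \<in> topspace X"
    show "(\<Sum>i<n. \<Sum>j<n. inner (cls (F U)) (cls (\<lambda>x. indicator (Q i j) x * (1 / fst x) * indicator S x)) / (hr * hz) *
      inner (cls (H U)) (cls (\<lambda>x. indicator (Q i j) x * m x * indicator S x))) = G U"
      using H[OF U] by (simp add: G_def aeq[OF U] inner_cls mW)
  qed
  have "\<bar>G U - (LINT x|lborel. F U x * H U x * m x * fst x)\<bar> \<le> e" if U: "U \<in> topspace X" for U
  proof -
    obtain g h where s: "slice (F U) g h" and gR: "nnw g \<le> ennreal R"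
      and hR: "nnw h \<le> ennreal R" using F[OF U] by (auto simp: slice_bound_def)
    have HU: "W2 (H U)" "(norm (cls (H U)))\<^sup>2 \<le> R2" using H[OF U] by auto
    note [measurable] = slice_meas[OF s] W2_meas[OF HU(1)]
    have [measurable]: "fb U \<in> borel_measurable borel" unfolding fb_def by measurable
    have i1: "integrable lborel (\<lambda>x. H U x * (indicator (Q i j) x * m x * indicator S x) * fst x)" for i j
      by (rule W2_mult[OF HU(1) mW])
    have fbx: "(\<Sum>i<n. \<Sum>j<n. a i j U * (H U x * (indicator (Q i j) x * m x * indicator S x) * fst x)) = fb U x * H U x * m x * fst x" for x
    proof -
      have e: "a i j U * (H U x * (indicator (Q i j) x * m x * indicator S x) * fst x) = a i j U * indicator (Q i j) x * (H U x * m x * fst x)" for i j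
        using W2_zero[OF HU(1), of x] by (cases "x \<in> S") auto
      show ?thesis by (simp only: e) (simp only: fb_def sum_distrib_right mult.assoc)
    qed
    have Gfb: "G U = (LINT x|lborel. fb U x * H U x * m x * fst x)"
    proof -
      have "G U = (LINT x|lborel. (\<Sum>i<n. \<Sum>j<n. a i j U * (H U x * (indicator (Q i j) x * m x * indicator S x) * fst x)))"
        unfolding G_def using i1 by (simp add: Bochner_Integration.integral_sum)
      then show ?thesis by (simp only: fbx)
    qed
    have fbi: "integrable lborel (\<lambda>x. fb U x * H U x * m x * fst x)"
      unfolding fbx[symmetric] using i1 by simp
    have fi: "integrable lborel (\<lambda>x. F U x * H U x * m x * fst x)"
      using W2_mult[OF W2_bounded[OF slice_W2(1)[OF s] m mB] HU(1)] by (simp add: mult_ac)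
    \<comment> \<open>Young's inequality pointwise, using that the weight is at most
      \<open>\<sigma> + N\<close> where \<open>m\<close> does not vanish.\<close>
    have pw: "ennreal (\<bar>fb U x * H U x * m x * fst x - F U x * H U x * m x * fst x\<bar>)
       \<le> ennreal ((\<sigma> + N) * B\<^sup>2 / t) * (ennreal ((F U x - fb U x)\<^sup>2) * indicator D x) + ennreal t * ennreal ((H U x)\<^sup>2 * fst x)" for x
    proof (cases "x \<in> S \<and> fst x < \<sigma> + N")
      case True
      then have x: "x \<in> D" "0 < fst x" "fst x \<le> \<sigma> + N" using sigma_pos by (auto simp: D_def Om_def)
      let ?d = "F U x - fb U x"
      have "2 * (\<bar>?d * m x\<bar> / sqrt t) * (sqrt t * \<bar>H U x\<bar>) \<le> (\<bar>?d * m x\<bar> / sqrt t)\<^sup>2 + (sqrt t * \<bar>H U x\<bar>)\<^sup>2"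
        by (rule sum_squares_bound)
      then have "2 * (\<bar>?d * m x\<bar> * \<bar>H U x\<bar>) \<le> (?d * m x)\<^sup>2 / t + t * (H U x)\<^sup>2"
        using t by (simp add: power_divide power_mult_distrib)
      moreover have "0 \<le> \<bar>?d * m x\<bar> * \<bar>H U x\<bar>" by simp
      ultimately have "\<bar>?d * m x\<bar> * \<bar>H U x\<bar> \<le> (?d * m x)\<^sup>2 / t + t * (H U x)\<^sup>2" by linarith
      moreover have "(?d * m x)\<^sup>2 \<le> ?d\<^sup>2 * B\<^sup>2"
      proof -
        have "(m x)\<^sup>2 \<le> B\<^sup>2" using mB[of x] by (metis abs_ge_zero power2_abs power_mono)
        then show ?thesis by (simp add: power_mult_distrib mult_left_mono)
      qed
      ultimately have "\<bar>?d * m x\<bar> * \<bar>H U x\<bar> \<le> ?d\<^sup>2 * B\<^sup>2 / t + t * (H U x)\<^sup>2"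
        using t by (meson add_right_mono divide_right_mono less_imp_le order_trans)
      then have "\<bar>?d * m x\<bar> * \<bar>H U x\<bar> * fst x \<le> (?d\<^sup>2 * B\<^sup>2 / t + t * (H U x)\<^sup>2) * fst x"
        using x by (intro mult_right_mono) auto
      also have "\<dots> = ?d\<^sup>2 * B\<^sup>2 / t * fst x + t * ((H U x)\<^sup>2 * fst x)" by (simp add: distrib_right)
      also have "\<dots> \<le> ?d\<^sup>2 * B\<^sup>2 / t * (\<sigma> + N) + t * ((H U x)\<^sup>2 * fst x)"
        using x t by (intro add_right_mono mult_left_mono) auto
      also have "\<dots> = (\<sigma> + N) * B\<^sup>2 / t * ?d\<^sup>2 + t * ((H U x)\<^sup>2 * fst x)" by simp
      finally have 1: "\<bar>?d * m x\<bar> * \<bar>H U x\<bar> * fst x \<le> (\<sigma> + N) * B\<^sup>2 / t * ?d\<^sup>2 + t * ((H U x)\<^sup>2 * fst x)" .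
      have "fb U x * H U x * m x * fst x - F U x * H U x * m x * fst x = - (?d * m x) * H U x * fst x"
        by (simp add: algebra_simps)
      then have "\<bar>fb U x * H U x * m x * fst x - F U x * H U x * m x * fst x\<bar> = \<bar>?d * m x\<bar> * \<bar>H U x\<bar> * fst x"
        using x by (simp add: abs_mult)
      then have "ennreal (\<bar>fb U x * H U x * m x * fst x - F U x * H U x * m x * fst x\<bar>) \<le> ennreal ((\<sigma> + N) * B\<^sup>2 / t * ?d\<^sup>2 + t * ((H U x)\<^sup>2 * fst x))"
        using 1 by (simp add: ennreal_leI)
      also have "\<dots> = ennreal ((\<sigma> + N) * B\<^sup>2 / t) * (ennreal (?d\<^sup>2) * indicator D x) + ennreal t * ennreal ((H U x)\<^sup>2 * fst x)"
        using x t sigma_pos N by (simp add: ennreal_mult[symmetric] ennreal_plus[symmetric] del: ennreal_plus)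
      finally show ?thesis .
    next
      case False
      then have "H U x * m x = 0" using W2_zero[OF HU(1), of x] mN[of x] by auto
      then have "fb U x * H U x * m x * fst x = 0" "F U x * H U x * m x * fst x = 0" by auto
      note z = this
      show ?thesis unfolding z by simp
    qed
    \<comment> \<open>The cells are disjoint, so the local estimates sum up to the global energy
      times the squared side lengths \<open>L / n\<close> and \<open>N / n\<close>.\<close>
    have cells: "(\<integral>\<^sup>+x. ennreal ((F U x - fb U x)\<^sup>2) * indicator D x \<partial>lborel) \<le> ennreal (2 * (L\<^sup>2 + N\<^sup>2) * (R / \<sigma>) / (real n)\<^sup>2)"
    proof -
      have "ennreal ((F U x - fb U x)\<^sup>2) * indicator D x = (\<Sum>i<n. \<Sum>j<n. ennreal ((F U x - a i j U)\<^sup>2) * indicator (Q i j) x)" for x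
      proof -
        have 1: "indicator (Q i j) x * (F U x - fb U x)\<^sup>2 = indicator (Q i j) x * (F U x - a i j U)\<^sup>2" if "i < n" "j < n" for i j
        proof (cases "x \<in> Q i j")
          case True
          have "fb U x = indicator (Q i j) x * fb U x" using True by simp
          also have "\<dots> = (\<Sum>i'<n. \<Sum>j'<n. a i' j' U * (indicator (Q i j) x * indicator (Q i' j') x))"
            unfolding fb_def sum_distrib_left by (intro sum.cong refl mult.left_commute)
          also have "\<dots> = (\<Sum>i'<n. \<Sum>j'<n. if i' = i then if j' = j then a i j U else 0 else 0)"
            unfolding disj using True by (intro sum.cong) auto
          also have "\<dots> = (\<Sum>i'<n. if i' = i then a i j U else 0)"
            using that by (intro sum.cong refl) (simp add: sum.delta)
          also have "\<dots> = a i j U" using that by (simp add: sum.delta)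
          finally show ?thesis by simp
        qed simp
        have "(F U x - fb U x)\<^sup>2 * indicator D x = (\<Sum>i<n. \<Sum>j<n. indicator (Q i j) x) * (F U x - fb U x)\<^sup>2"
          unfolding sumQ by (rule mult.commute)
        also have "\<dots> = (\<Sum>i<n. \<Sum>j<n. indicator (Q i j) x * (F U x - fb U x)\<^sup>2)"
          by (simp only: sum_distrib_right)
        also have "\<dots> = (\<Sum>i<n. \<Sum>j<n. indicator (Q i j) x * (F U x - a i j U)\<^sup>2)"
          by (intro sum.cong refl 1) auto
        finally have "ennreal ((F U x - fb U x)\<^sup>2 * indicator D x) = ennreal (\<Sum>i<n. \<Sum>j<n. indicator (Q i j) x * (F U x - a i j U)\<^sup>2)" by simp
        also have "\<dots> = (\<Sum>i<n. \<Sum>j<n. ennreal (indicator (Q i j) x * (F U x - a i j U)\<^sup>2))"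
          by (rule sum_sum_ennreal[symmetric]) simp
        also have "\<dots> = (\<Sum>i<n. \<Sum>j<n. ennreal ((F U x - a i j U)\<^sup>2) * indicator (Q i j) x)"
          by (intro sum.cong refl) (auto simp: indicator_def)
        finally have e: "ennreal ((F U x - fb U x)\<^sup>2 * indicator D x) = (\<Sum>i<n. \<Sum>j<n. ennreal ((F U x - a i j U)\<^sup>2) * indicator (Q i j) x)" .
        show ?thesis unfolding e[symmetric] by (simp add: indicator_def)
      qed
      then have "(\<integral>\<^sup>+x. ennreal ((F U x - fb U x)\<^sup>2) * indicator D x \<partial>lborel)
          = (\<Sum>i<n. \<Sum>j<n. (\<integral>\<^sup>+x. ennreal ((F U x - a i j U)\<^sup>2) * indicator (Q i j) x \<partial>lborel))"
        by (simp only:) (rule nn_integral_sum_sum, measurable)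
      also have "\<dots> \<le> (\<Sum>i<n. \<Sum>j<n. (\<integral>\<^sup>+x. (ennreal (2 * hz\<^sup>2) * ennreal ((h x)\<^sup>2) + ennreal (2 * hr\<^sup>2) * ennreal ((g x)\<^sup>2)) * indicator (Q i j) x \<partial>lborel))"
      proof (intro sum_mono)
        fix i j assume ij: "i \<in> {..<n}" "j \<in> {..<n}"
        have d: "\<sigma> + real (Suc i) * hr - (\<sigma> + real i * hr) = hr" "0 + real (Suc j) * hz - (0 + real j * hz) = hz"
          by (simp_all add: algebra_simps)
        have "real (Suc j) * hz \<le> real n * hz" using ij hrz by (intro mult_right_mono) auto
        then have jL: "0 + real (Suc j) * hz \<le> L" using hn by simp
        have "(\<integral>\<^sup>+x. ennreal ((F U x - a i j U)\<^sup>2) * indicator (Q i j) x \<partial>lborel)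
           \<le> ennreal (2 * hz\<^sup>2) * (\<integral>\<^sup>+x. ennreal ((h x)\<^sup>2) * indicator (Q i j) x \<partial>lborel) +
             ennreal (2 * hr\<^sup>2) * (\<integral>\<^sup>+x. ennreal ((g x)\<^sup>2) * indicator (Q i j) x \<partial>lborel)"
          using cell_poincare[OF s, of "\<sigma> + real i * hr" "\<sigma> + real (Suc i) * hr" "0 + real j * hz" "0 + real (Suc j) * hz" "a i j U"] hrz jL
          unfolding d by (simp add: Q_def I_def J_def a_def)
        also have "\<dots> = (\<integral>\<^sup>+x. (ennreal (2 * hz\<^sup>2) * ennreal ((h x)\<^sup>2) + ennreal (2 * hr\<^sup>2) * ennreal ((g x)\<^sup>2)) * indicator (Q i j) x \<partial>lborel)"
          by (simp add: distrib_right nn_integral_add nn_integral_cmult mult.assoc)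
        finally show "(\<integral>\<^sup>+x. ennreal ((F U x - a i j U)\<^sup>2) * indicator (Q i j) x \<partial>lborel) \<le> \<dots>" .
      qed
      also have "\<dots> = (\<integral>\<^sup>+x. (ennreal (2 * hz\<^sup>2) * ennreal ((h x)\<^sup>2) + ennreal (2 * hr\<^sup>2) * ennreal ((g x)\<^sup>2)) * (\<Sum>i<n. \<Sum>j<n. indicator (Q i j) x) \<partial>lborel)"
        unfolding sum_distrib_left by (rule nn_integral_sum_sum[symmetric]) measurable
      also have "\<dots> \<le> (\<integral>\<^sup>+x. (ennreal (2 * hz\<^sup>2) * ennreal ((h x)\<^sup>2) + ennreal (2 * hr\<^sup>2) * ennreal ((g x)\<^sup>2)) * 1 \<partial>lborel)"
      proof (intro nn_integral_mono mult_left_mono)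
        fix x
        have "(\<Sum>i<n. \<Sum>j<n. indicator (Q i j) x :: ennreal) = ennreal (\<Sum>i<n. \<Sum>j<n. indicator (Q i j) x)"
          by (subst sum_sum_ennreal[symmetric]) (auto simp: ennreal_indicator)
        then show "(\<Sum>i<n. \<Sum>j<n. indicator (Q i j) x :: ennreal) \<le> 1" unfolding sumQ by (simp add: indicator_def)
      qed auto
      also have "\<dots> = ennreal (2 * hz\<^sup>2) * nn2 h + ennreal (2 * hr\<^sup>2) * nn2 g"
        by (simp add: nn_integral_add nn_integral_cmult)
      also have "\<dots> \<le> ennreal (2 * hz\<^sup>2) * ennreal (R / \<sigma>) + ennreal (2 * hr\<^sup>2) * ennreal (R / \<sigma>)"
        by (intro add_mono mult_left_mono slice_bound_unweighted[OF s R gR hR]) auto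
      also have "\<dots> = ennreal (2 * hz\<^sup>2 * (R / \<sigma>) + 2 * hr\<^sup>2 * (R / \<sigma>))"
        using R sigma_pos by (simp add: ennreal_mult[symmetric] ennreal_plus[symmetric] del: ennreal_plus)
      also have "2 * hz\<^sup>2 * (R / \<sigma>) + 2 * hr\<^sup>2 * (R / \<sigma>) = 2 * (L\<^sup>2 + N\<^sup>2) * (R / \<sigma>) / (real n)\<^sup>2"
        by (simp add: hr_def hz_def power_divide algebra_simps add_divide_distrib)
      finally show ?thesis .
    qed
    have "ennreal \<bar>G U - (LINT x|lborel. F U x * H U x * m x * fst x)\<bar>
        = ennreal \<bar>LINT x|lborel. fb U x * H U x * m x * fst x - F U x * H U x * m x * fst x\<bar>"
      unfolding Gfb using fbi fi by simp
    also have "\<dots> \<le> (\<integral>\<^sup>+x. ennreal (\<bar>fb U x * H U x * m x * fst x - F U x * H U x * m x * fst x\<bar>) \<partial>lborel)"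
      using integral_norm_bound_ennreal[of lborel "\<lambda>x. fb U x * H U x * m x * fst x - F U x * H U x * m x * fst x"] fbi fi by simp
    also have "\<dots> \<le> (\<integral>\<^sup>+x. ennreal ((\<sigma> + N) * B\<^sup>2 / t) * (ennreal ((F U x - fb U x)\<^sup>2) * indicator D x) + ennreal t * ennreal ((H U x)\<^sup>2 * fst x) \<partial>lborel)"
      by (intro nn_integral_mono pw)
    also have "\<dots> = ennreal ((\<sigma> + N) * B\<^sup>2 / t) * (\<integral>\<^sup>+x. ennreal ((F U x - fb U x)\<^sup>2) * indicator D x \<partial>lborel) + ennreal t * nnw (H U)"
    proof -
      have [measurable]: "D \<in> sets borel" unfolding D_def by (metis atLeastLessThan_borel borel_prod pair_measureI)
      show ?thesis by (simp add: nn_integral_add nn_integral_cmult)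
    qed
    also have "\<dots> \<le> ennreal ((\<sigma> + N) * B\<^sup>2 / t) * ennreal (2 * (L\<^sup>2 + N\<^sup>2) * (R / \<sigma>) / (real n)\<^sup>2) + ennreal t * ennreal (\<bar>R2\<bar> + 1)"
    proof (intro add_mono mult_left_mono cells)
      have "(norm (cls (H U)))\<^sup>2 \<le> \<bar>R2\<bar> + 1" using HU(2) by linarith
      then show "nnw (H U) \<le> ennreal (\<bar>R2\<bar> + 1)"
        unfolding nn_norm_cls[OF HU(1)] by (rule ennreal_leI)
    qed auto
    also have "\<dots> = ennreal (C / (real n)\<^sup>2 + e / 2)"
    proof -
      have e1: "t * (\<bar>R2\<bar> + 1) = e / 2" by (simp add: t_def field_simps)
      have e2: "(\<sigma> + N) * B\<^sup>2 / t * (2 * (L\<^sup>2 + N\<^sup>2) * (R / \<sigma>) / (real n)\<^sup>2) = C / (real n)\<^sup>2" by (simp add: C_def)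
      have e3: "ennreal t * ennreal (\<bar>R2\<bar> + 1) = ennreal (t * (\<bar>R2\<bar> + 1))"
        "ennreal ((\<sigma> + N) * B\<^sup>2 / t) * ennreal (2 * (L\<^sup>2 + N\<^sup>2) * (R / \<sigma>) / (real n)\<^sup>2)
         = ennreal ((\<sigma> + N) * B\<^sup>2 / t * (2 * (L\<^sup>2 + N\<^sup>2) * (R / \<sigma>) / (real n)\<^sup>2))"
      proof -
        have "0 \<le> (\<sigma> + N) * B\<^sup>2 / t" "0 \<le> 2 * (L\<^sup>2 + N\<^sup>2) * (R / \<sigma>) / (real n)\<^sup>2"
          using t sigma_pos N R by (auto intro!: divide_nonneg_nonneg mult_nonneg_nonneg)
        then show "ennreal ((\<sigma> + N) * B\<^sup>2 / t) * ennreal (2 * (L\<^sup>2 + N\<^sup>2) * (R / \<sigma>) / (real n)\<^sup>2)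
         = ennreal ((\<sigma> + N) * B\<^sup>2 / t * (2 * (L\<^sup>2 + N\<^sup>2) * (R / \<sigma>) / (real n)\<^sup>2))"
          by (rule ennreal_mult[symmetric])
        show "ennreal t * ennreal (\<bar>R2\<bar> + 1) = ennreal (t * (\<bar>R2\<bar> + 1))"
          by (rule ennreal_mult[symmetric]) (use t in auto)
      qed
      have "ennreal ((\<sigma> + N) * B\<^sup>2 / t) * ennreal (2 * (L\<^sup>2 + N\<^sup>2) * (R / \<sigma>) / (real n)\<^sup>2) = ennreal (C / (real n)\<^sup>2)"
        "ennreal t * ennreal (\<bar>R2\<bar> + 1) = ennreal (e / 2)" by (simp_all only: e1 e2 e3)
      then show ?thesis using C0 e by (simp add: ennreal_plus[symmetric] del: ennreal_plus)
    qed
    also have "\<dots> \<le> ennreal e" using n(2) by (intro ennreal_leI) linarith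
    finally show ?thesis using e by (simp add: ennreal_le_iff)
  qed
  then show "\<exists>G. continuous_map X euclideanreal G \<and> (\<forall>U\<in>topspace X. \<bar>G U - (LINT x|lborel. F U x * H U x * m x * fst x)\<bar> \<le> e)"
    using Gc by blast
qed

lemma slice_bound_L4:
  assumes "slice_bound R f" and R: "R \<ge> 0"
  shows "(\<integral>\<^sup>+x. ennreal ((f x)^4 * fst x) \<partial>lborel) \<le> ennreal (L * R * (2 * (L\<^sup>2 * R / \<sigma>) + 2 * (R / \<sigma>)))"
proof -
  obtain g h where s: "slice f g h" and gR: "nnw g \<le> ennreal R"
      and hR: "nnw h \<le> ennreal R" using assms by (auto simp: slice_bound_def)
  note u = slice_bound_unweighted[OF s R gR hR]
  have "(\<integral>\<^sup>+x. ennreal ((f x)^4 * fst x) \<partial>lborel) \<le>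
     ennreal L * ennreal R * (2 * ennreal (L\<^sup>2 * R / \<sigma>) + 2 * ennreal (R / \<sigma>))"
    by (rule order_trans[OF slice_L4[OF s]]) (intro mult_mono add_mono u hR order_refl mult_left_mono; simp)
  also have "\<dots> = ennreal (L * R * (2 * (L\<^sup>2 * R / \<sigma>) + 2 * (R / \<sigma>)))"
  proof -
    have e: "ennreal L * ennreal R * (2 * ennreal a + 2 * ennreal b) = ennreal (L * R * (2 * a + 2 * b))"
      if "a \<ge> 0" "b \<ge> 0" for a b
      using that L_pos R by (simp add: ennreal_mult)
    show ?thesis by (rule e) (use R sigma_pos in auto)
  qed
  finally show ?thesis .
qed

text \<open>Truncating the fixed factor \<open>k\<close> in size and in \<open>r\<close> brings it
  into the scope of \<open>weak_cont_bounded\<close>. The remainder of \<open>k\<close> is small in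
  the weighted L2 norm, in which \<open>F U * H U\<close> is bounded uniformly in \<open>U\<close>
  by the L4 estimate.\<close>

lemma weak_cont_trilinear:
  fixes X :: "'a topology" and F H :: "'a \<Rightarrow> real \<times> real \<Rightarrow> real"
  assumes p: "\<And>c. continuous_map X euclideanreal (\<lambda>U. inner (cls (F U)) c)"
    and q: "\<And>c. continuous_map X euclideanreal (\<lambda>U. inner (cls (H U)) c)"
    and F: "\<And>U. U \<in> topspace X \<Longrightarrow> slice_bound R (F U)" and R: "R \<ge> 0"
    and H: "\<And>U. U \<in> topspace X \<Longrightarrow> slice_bound R (H U)"
    and k: "W2 k"
  shows "continuous_map X euclideanreal (\<lambda>U. LINT x|lborel. F U x * H U x * k x * fst x)"
proof (rule continuous_map_real_approx)
  fix e :: real assume e: "e > 0"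
  have [measurable]: "k \<in> borel_measurable borel" using k by (rule W2_meas)
  define C where "C = L * R * (2 * (L\<^sup>2 * R / \<sigma>) + 2 * (R / \<sigma>))"
  have C0: "C \<ge> 0" unfolding C_def using L_pos sigma_pos R by (intro mult_nonneg_nonneg add_nonneg_nonneg divide_nonneg_pos) auto
  \<comment> \<open>\<open>Suc n\<close> keeps the length of the cut-off region positive, also for
    \<open>n = 0\<close>.\<close>
  define A where "A n = {x. \<bar>k x\<bar> \<le> real n \<and> fst x < \<sigma> + real (Suc n)}" for n
  have [measurable]: "A n \<in> sets borel" for n unfolding A_def by measurable
  define m where "m n x = indicator (A n) x * k x" for n x
  have [measurable]: "m n \<in> borel_measurable borel" for n unfolding m_def by measurable
  have mW: "W2 (m n)" for n
    unfolding m_def[abs_def] by (rule W2_bounded[OF k, where B = 1]) (auto simp: indicator_def)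
  have "(\<lambda>n. LINT x|lborel. (k x - m n x)\<^sup>2 * fst x) \<longlonglongrightarrow> (LINT x|(lborel :: (real \<times> real) measure). 0)"
  proof (rule integral_dominated_convergence)
    show "integrable lborel (\<lambda>x. (k x)\<^sup>2 * fst x)" using k by (simp add: W2_def)
    show "AE x in lborel. (\<lambda>n. (k x - m n x)\<^sup>2 * fst x) \<longlonglongrightarrow> 0"
    proof (intro AE_I2)
      fix x
      obtain N :: nat where N: "\<bar>k x\<bar> + \<bar>fst x - \<sigma>\<bar> \<le> real N" using real_arch_simple by blast
      have "\<forall>\<^sub>F n in sequentially. (k x - m n x)\<^sup>2 * fst x = 0"
        using eventually_ge_at_top[of N]
      proof eventually_elim
        fix n assume "n \<ge> N"
        then have "\<bar>k x\<bar> + \<bar>fst x - \<sigma>\<bar> \<le> real n" using N by linarith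
        then have "\<bar>k x\<bar> \<le> real n" "fst x < \<sigma> + real (Suc n)" by auto
        then have "x \<in> A n" by (simp add: A_def)
        then show "(k x - m n x)\<^sup>2 * fst x = 0" by (simp add: m_def)
      qed
      then show "(\<lambda>n. (k x - m n x)\<^sup>2 * fst x) \<longlonglongrightarrow> 0" by (rule tendsto_eventually)
    qed
    show "AE x in lborel. norm ((k x - m n x)\<^sup>2 * fst x) \<le> (k x)\<^sup>2 * fst x" for n
    proof (intro AE_I2)
      fix x
      have "0 \<le> (k x)\<^sup>2 * fst x" using weighted_nonneg[of x "(k x)\<^sup>2"] W2_zero[OF k] by auto
      then show "norm ((k x - m n x)\<^sup>2 * fst x) \<le> (k x)\<^sup>2 * fst x"
        by (auto simp: m_def indicator_def)
    qed
  qed measurable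
  then have lim: "(\<lambda>n. (norm (cls (\<lambda>x. k x - m n x)))\<^sup>2) \<longlonglongrightarrow> 0"
    by (simp add: norm_cls W2_diff[OF k mW])
  \<comment> \<open>\<open>2 * C\<close> will bound the squared norm of \<open>F U * H U\<close>;
    since \<open>2 * C \<le> (2 * C + 1)^2\<close>, an error \<open>d\<close> in \<open>k\<close>
    costs at most \<open>e\<close>.\<close>
  define d where "d = e / (2 * C + 1)"
  have d: "d > 0" "2 * C * d\<^sup>2 \<le> e\<^sup>2"
  proof -
    show "d > 0" using e C0 by (simp add: d_def)
    have "2 * C * 1 \<le> (2 * C + 1)\<^sup>2" using C0 by (simp add: power2_eq_square algebra_simps)
    then have "2 * C / (2 * C + 1)\<^sup>2 \<le> 1" using C0 by (simp add: field_simps)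
    then have "2 * C / (2 * C + 1)\<^sup>2 * e\<^sup>2 \<le> 1 * e\<^sup>2" by (intro mult_right_mono) auto
    then show "2 * C * d\<^sup>2 \<le> e\<^sup>2" by (simp add: d_def power_divide)
  qed
  have "d\<^sup>2 > 0" using d by simp
  from order_tendstoD(2)[OF lim this] obtain n where n: "(norm (cls (\<lambda>x. k x - m n x)))\<^sup>2 < d\<^sup>2"
    by (auto simp: eventually_sequentially)
  have cont: "continuous_map X euclideanreal (\<lambda>U. LINT x|lborel. F U x * H U x * m n x * fst x)"
  proof (rule weak_cont_bounded[OF p q F R])
    show "W2 (H U) \<and> (norm (cls (H U)))\<^sup>2 \<le> L\<^sup>2 * R" if U: "U \<in> topspace X" for U
    proof -
      obtain g h where s: "slice (H U) g h" and hR: "nnw h \<le> ennreal R"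
        using H[OF U] by (auto simp: slice_bound_def)
      have "ennreal ((norm (cls (H U)))\<^sup>2) \<le> ennreal (L\<^sup>2) * ennreal R"
        unfolding nn_norm_cls[OF slice_W2(1)[OF s], symmetric]
        by (rule order_trans[OF slice_poincare[OF s]]) (intro mult_left_mono hR, simp)
      also have "\<dots> = ennreal (L\<^sup>2 * R)" using R by (simp add: ennreal_mult)
      finally have "(norm (cls (H U)))\<^sup>2 \<le> L\<^sup>2 * R" using R by (simp add: ennreal_le_iff)
      then show ?thesis using slice_W2(1)[OF s] by simp
    qed
    show "\<bar>m n x\<bar> \<le> real n" for x by (auto simp: m_def A_def indicator_def)
    show "m n x = 0" if "fst x \<ge> \<sigma> + real (Suc n)" for x using that by (simp add: m_def A_def indicator_def)
  qed auto
  have "\<bar>(LINT x|lborel. F U x * H U x * m n x * fst x) - (LINT x|lborel. F U x * H U x * k x * fst x)\<bar> \<le> e"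
    if U: "U \<in> topspace X" for U
  proof -
    obtain g h g' h' where s: "slice (F U) g h" "slice (H U) g' h'"
      using F[OF U] H[OF U] by (auto simp: slice_bound_def)
    note w4 = slice_W4[OF s(1)] slice_W4[OF s(2)]
    have W: "W2 (\<lambda>x. F U x * H U x)" by (rule W4_W4[OF w4])
    have [measurable]: "F U \<in> borel_measurable borel" "H U \<in> borel_measurable borel" using w4 by (auto simp: W4_def)
    have "ennreal ((norm (cls (\<lambda>x. F U x * H U x)))\<^sup>2) = (\<integral>\<^sup>+x. ennreal ((F U x * H U x)\<^sup>2 * fst x) \<partial>lborel)"
      by (rule nn_norm_cls[OF W, symmetric])
    also have "\<dots> \<le> (\<integral>\<^sup>+x. ennreal ((F U x)^4 * fst x) + ennreal ((H U x)^4 * fst x) \<partial>lborel)"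
    proof (rule nn_integral_mono)
      fix x
      show "ennreal ((F U x * H U x)\<^sup>2 * fst x) \<le> ennreal ((F U x)^4 * fst x) + ennreal ((H U x)^4 * fst x)"
      proof (cases "x \<in> S")
        case True
        then have f0: "0 \<le> fst x" using fst_ge[OF True] sigma_pos by simp
        have "2 * (F U x)\<^sup>2 * (H U x)\<^sup>2 \<le> ((F U x)\<^sup>2)\<^sup>2 + ((H U x)\<^sup>2)\<^sup>2" by (rule sum_squares_bound)
        moreover have "0 \<le> (F U x)\<^sup>2 * (H U x)\<^sup>2" by simp
        ultimately have "(F U x)\<^sup>2 * (H U x)\<^sup>2 \<le> ((F U x)\<^sup>2)\<^sup>2 + ((H U x)\<^sup>2)\<^sup>2" by linarith
        then have "(F U x * H U x)\<^sup>2 * fst x \<le> ((F U x)^4 + (H U x)^4) * fst x"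
          using f0 by (intro mult_right_mono) (auto simp: power_mult_distrib)
        then have "ennreal ((F U x * H U x)\<^sup>2 * fst x) \<le> ennreal ((F U x)^4 * fst x + (H U x)^4 * fst x)"
          by (intro ennreal_leI) (simp add: distrib_right)
        then show ?thesis using f0 by simp
      qed (simp add: slice_zero[OF s(1)])
    qed
    also have "\<dots> = (\<integral>\<^sup>+x. ennreal ((F U x)^4 * fst x) \<partial>lborel) + (\<integral>\<^sup>+x. ennreal ((H U x)^4 * fst x) \<partial>lborel)"
      by (intro nn_integral_add) auto
    also have "\<dots> \<le> ennreal C + ennreal C"
      unfolding C_def by (intro add_mono slice_bound_L4 F[OF U] H[OF U] R)
    also have "\<dots> = ennreal (2 * C)" using C0 by (simp flip: ennreal_plus)
    finally have FH: "(norm (cls (\<lambda>x. F U x * H U x)))\<^sup>2 \<le> 2 * C" using C0 by (simp add: ennreal_le_iff)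
    have "(LINT x|lborel. F U x * H U x * m n x * fst x) - (LINT x|lborel. F U x * H U x * k x * fst x)
       = - (LINT x|lborel. F U x * H U x * (k x - m n x) * fst x)"
    proof -
      have "F U x * H U x * (k x - m n x) * fst x = F U x * H U x * k x * fst x - F U x * H U x * m n x * fst x" for x
        by (simp add: algebra_simps)
      then show ?thesis using W2_mult[OF W k] W2_mult[OF W mW[of n]] by simp
    qed
    then have "\<bar>(LINT x|lborel. F U x * H U x * m n x * fst x) - (LINT x|lborel. F U x * H U x * k x * fst x)\<bar>
       \<le> norm (cls (\<lambda>x. F U x * H U x)) * norm (cls (\<lambda>x. k x - m n x))" (is "?l \<le> ?a * ?b")
      using weighted_cauchy_schwarz[OF W W2_diff[OF k mW[of n]]] by simp
    moreover have "?a * ?b \<le> e"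
    proof (rule power2_le_imp_le)
      have "(?a * ?b)\<^sup>2 \<le> 2 * C * d\<^sup>2"
        unfolding power_mult_distrib using FH n C0 by (intro mult_mono) auto
      then show "(?a * ?b)\<^sup>2 \<le> e\<^sup>2" using d(2) by linarith
    qed (use e in simp)
    ultimately show ?thesis by linarith
  qed
  then show "\<exists>G. continuous_map X euclideanreal G \<and> (\<forall>U\<in>topspace X. \<bar>G U - (LINT x|lborel. F U x * H U x * k x * fst x)\<bar> \<le> e)"
    using cont by blast
qed

end

section \<open>From zero traces to primitives; the closed space of jets\<close>

section \<open>Zero traces and the spaces V1 and V2\<close>

text \<open>Smooth functions satisfy the fundamental theorem of calculus on every line. For an
  approximation \<open>\<Psi>\<close> with small values at \<open>t = p\<close>, the defect of the
  formula for \<open>f\<close> is controlled by the approximation errors; it is thus arbitrarily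
  small in L2 and vanishes almost everywhere. The base point \<open>p\<close> is left free in order
  to treat boundary values at either end.\<close>

lemma primitive_of_approximation:
  fixes f h :: "real \<times> real \<Rightarrow> real" and Y :: "real set"
  assumes f[measurable]: "f \<in> borel_measurable borel" and h[measurable]: "h \<in> borel_measurable borel"
    and [measurable]: "Y \<in> sets borel" and ab: "a < b" and p: "p \<in> {a..b}"
    and fin: "AE y in lborel. (\<integral>\<^sup>+t. ennreal ((h (y, t))\<^sup>2) \<partial>lborel) < \<infinity>"
    and app: "\<And>e. e > 0 \<Longrightarrow> \<exists>\<Psi> \<Psi>'. \<Psi> \<in> borel_measurable borel \<and> \<Psi>' \<in> borel_measurable borel \<and>
      (\<forall>y t. ((\<lambda>t. \<Psi> (y, t)) has_real_derivative \<Psi>' (y, t)) (at t)) \<and> (\<forall>y. continuous_on UNIV (\<lambda>t. \<Psi>' (y, t))) \<and>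
      (\<integral>\<^sup>+y. (\<integral>\<^sup>+t. ennreal ((\<Psi> (y, t) - f (y, t))\<^sup>2 + (\<Psi>' (y, t) - h (y, t))\<^sup>2) * indicator {a<..<b} t \<partial>lborel) * indicator Y y \<partial>lborel) \<le> ennreal e \<and>
      (\<integral>\<^sup>+y. ennreal ((\<Psi> (y, p))\<^sup>2) * indicator Y y \<partial>lborel) \<le> ennreal e"
  shows "AE y in lborel. y \<in> Y \<longrightarrow> (AE t in lborel. t \<in> {a..b} \<longrightarrow>
     f (y, t) = (LINT s:{a..t}|lborel. h (y, s)) - (LINT s:{a..p}|lborel. h (y, s)))"
proof -
  define D where "D x = f x - ((LINT s:{a..snd x}|lborel. h (fst x, s)) - (LINT s:{a..p}|lborel. h (fst x, s)))" for x
  have Im: "(\<lambda>x. LINT s:{a..q (snd x)}|lborel. h (fst x, s)) \<in> borel_measurable (borel :: (real \<times> real) measure)"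
    if [measurable]: "q \<in> borel_measurable borel" for q :: "real \<Rightarrow> real"
  proof -
    have "(\<lambda>(x, s). (if a \<le> s \<and> s \<le> q (snd x) then 1 else 0) *\<^sub>R h (fst x, s)) \<in> borel_measurable ((borel :: (real \<times> real) measure) \<Otimes>\<^sub>M lborel)"
      by measurable
    then have "(\<lambda>(x, s). indicator {a..q (snd x)} s *\<^sub>R h (fst x, s)) \<in> borel_measurable ((borel :: (real \<times> real) measure) \<Otimes>\<^sub>M lborel)"
      by (rule measurable_cong[THEN iffD1, rotated]) (auto simp: indicator_def)
    then show ?thesis unfolding set_lebesgue_integral_def by (rule lborel.borel_measurable_lebesgue_integral)
  qed
  have Dm[measurable]: "D \<in> borel_measurable (borel :: (real \<times> real) measure)"
    unfolding D_def using Im[of "\<lambda>t. t"] Im[of "\<lambda>_. p"] by measurable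
  let ?N = "\<integral>\<^sup>+y. (\<integral>\<^sup>+t. ennreal ((D (y, t))\<^sup>2) * indicator {a<..<b} t \<partial>lborel) * indicator Y y \<partial>lborel"
  have sq4: "(x1 + x2 + x3 + x4)\<^sup>2 \<le> 4 * x1\<^sup>2 + 4 * x2\<^sup>2 + 8 * x3\<^sup>2 + 8 * x4\<^sup>2" for x1 x2 x3 x4 :: real
  proof -
    have "4 * x1\<^sup>2 + 4 * x2\<^sup>2 + 8 * x3\<^sup>2 + 8 * x4\<^sup>2 - (x1 + x2 + x3 + x4)\<^sup>2
      = (x1 - x2)\<^sup>2 + (x1 - x3)\<^sup>2 + (x1 - x4)\<^sup>2 + (x2 - x3)\<^sup>2 + (x2 - x4)\<^sup>2 + (x3 - x4)\<^sup>2 + 4 * x3\<^sup>2 + 4 * x4\<^sup>2"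
      by (simp add: power2_eq_square algebra_simps)
    also have "\<dots> \<ge> 0" by (intro add_nonneg_nonneg) simp_all
    finally show ?thesis by simp
  qed
  have dist: "(4 * x + y * z) * d = (4 * d) * x + (y * d) * z" for x y z d :: ennreal
    by (simp only: distrib_right distrib_left mult_ac)
  \<comment> \<open>4 stems from the error in \<open>f\<close>, \<open>4 * (b - a)\<close> from the
    values at \<open>p\<close>, and 16 = 8 + 8 from the two integrals of the derivative error, each
    with one \<open>b - a\<close> from Cauchy-Schwarz and one from integrating over
    \<open>t\<close>.\<close>
  define C where "C = 4 + 4 * (b - a) + 16 * (b - a)\<^sup>2"
  have C: "C > 0" using ab by (simp add: C_def add_pos_nonneg)
  have bound: "?N \<le> ennreal (C * e)" if e: "e > 0" for e
  proof -
    obtain \<Psi> \<Psi>' where P[measurable]: "\<Psi> \<in> borel_measurable borel" "\<Psi>' \<in> borel_measurable borel"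
      and der: "\<And>y t. ((\<lambda>t. \<Psi> (y, t)) has_real_derivative \<Psi>' (y, t)) (at t)" and cont: "\<And>y. continuous_on UNIV (\<lambda>t. \<Psi>' (y, t))"
      and e1: "(\<integral>\<^sup>+y. (\<integral>\<^sup>+t. ennreal ((\<Psi> (y, t) - f (y, t))\<^sup>2 + (\<Psi>' (y, t) - h (y, t))\<^sup>2) * indicator {a<..<b} t \<partial>lborel) * indicator Y y \<partial>lborel) \<le> ennreal e"
      and e2: "(\<integral>\<^sup>+y. ennreal ((\<Psi> (y, p))\<^sup>2) * indicator Y y \<partial>lborel) \<le> ennreal e"
      using app[OF e] by blast
    define A where "A y = (\<integral>\<^sup>+t. ennreal ((\<Psi> (y, t) - f (y, t))\<^sup>2) * indicator {a<..<b} t \<partial>lborel)" for y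
    define B where "B y = (\<integral>\<^sup>+t. ennreal ((\<Psi>' (y, t) - h (y, t))\<^sup>2) * indicator {a<..<b} t \<partial>lborel)" for y
    have [measurable]: "A \<in> borel_measurable borel" "B \<in> borel_measurable borel" unfolding A_def B_def by measurable
    have AB: "(\<integral>\<^sup>+t. ennreal ((\<Psi> (y, t) - f (y, t))\<^sup>2 + (\<Psi>' (y, t) - h (y, t))\<^sup>2) * indicator {a<..<b} t \<partial>lborel) = A y + B y" for y
      unfolding A_def B_def by (simp add: distrib_right nn_integral_add)
    have "?N \<le> (\<integral>\<^sup>+y. (4 * A y + ennreal (4 * (b - a)) * ennreal ((\<Psi> (y, p))\<^sup>2) + ennreal (16 * (b - a)\<^sup>2) * B y) * indicator Y y \<partial>lborel)"
    proof (intro nn_integral_mono_AE, rule eventually_mono[OF fin])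
      fix y assume hf: "(\<integral>\<^sup>+t. ennreal ((h (y, t))\<^sup>2) \<partial>lborel) < \<infinity>"
      have hi: "set_integrable lborel {a..t} (\<lambda>s. h (y, s))" for t
        by (rule set_integrable_square[OF _ hf]) measurable
      have Pi: "set_integrable lborel {a..t} (\<lambda>s. \<Psi>' (y, s))" for t
        using cont[of y] by (intro borel_integrable_atLeastAtMost') (auto intro: continuous_on_subset)
      have ftc: "(LINT s:{a..t}|lborel. \<Psi>' (y, s)) = \<Psi> (y, t) - \<Psi> (y, a)" if "t \<ge> a" for t
      proof -
        have "(LBINT x. \<Psi>' (y, x) * indicator {a..t} x) = \<Psi> (y, t) - \<Psi> (y, a)"
          using that der cont[of y] by (intro integral_FTC_Icc_real) (simp_all add: continuous_on_eq_continuous_at[OF open_UNIV])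
        then show ?thesis by (simp add: set_lebesgue_integral_def mult.commute)
      qed
      have osc: "ennreal ((LINT s:{a..t}|lborel. \<Psi>' (y, s) - h (y, s))\<^sup>2) \<le> ennreal (b - a) * B y" if t: "t \<in> {a..b}" for t
      proof -
        have "ennreal ((LINT s:{a..t}|lborel. \<Psi>' (y, s) - h (y, s))\<^sup>2)
            \<le> ennreal (t - a) * (\<integral>\<^sup>+s. ennreal ((\<Psi>' (y, s) - h (y, s))\<^sup>2) * indicator {a..t} s \<partial>lborel)"
          using t by (intro interval_integral_square_le) auto
        also have "\<dots> \<le> ennreal (b - a) * B y"
          unfolding B_def
        proof (intro mult_mono ennreal_leI nn_integral_mono_AE)
          show "AE s in lborel. ennreal ((\<Psi>' (y, s) - h (y, s))\<^sup>2) * indicator {a..t} s \<le> ennreal ((\<Psi>' (y, s) - h (y, s))\<^sup>2) * indicator {a<..<b} s"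
            using AE_lborel_singleton[of a] AE_lborel_singleton[of b]
            by eventually_elim (use t in \<open>auto simp: indicator_def\<close>)
        qed (use t in auto)
        finally show ?thesis .
      qed
      have pt: "ennreal ((D (y, t))\<^sup>2) \<le> 4 * ennreal ((\<Psi> (y, t) - f (y, t))\<^sup>2) + 4 * ennreal ((\<Psi> (y, p))\<^sup>2) + ennreal (16 * (b - a)) * B y"
        if t: "t \<in> {a<..<b}" for t
      proof -
        let ?I = "\<lambda>t. LINT s:{a..t}|lborel. \<Psi>' (y, s) - h (y, s)"
        have I: "?I q = \<Psi> (y, q) - \<Psi> (y, a) - (LINT s:{a..q}|lborel. h (y, s))" if "q \<in> {a..b}" for q
          using set_integral_diff(2)[OF Pi hi, of q] ftc[of q] that by simp
        \<comment> \<open>The defect splits into the error in \<open>f\<close>, the value of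
          \<open>\<Psi>\<close> at \<open>p\<close> and two integrals of the derivative error; the
          value of \<open>\<Psi>\<close> at \<open>a\<close> cancels.\<close>
        have "D (y, t) = - (\<Psi> (y, t) - f (y, t)) + \<Psi> (y, p) + ?I t + (- ?I p)"
          using I[of t] I[of p] t p by (simp add: D_def)
        then have "(D (y, t))\<^sup>2 \<le> 4 * (- (\<Psi> (y, t) - f (y, t)))\<^sup>2 + 4 * (\<Psi> (y, p))\<^sup>2 + 8 * (?I t)\<^sup>2 + 8 * (- ?I p)\<^sup>2"
          by (simp only: sq4)
        then have "ennreal ((D (y, t))\<^sup>2) \<le> ennreal (4 * (\<Psi> (y, t) - f (y, t))\<^sup>2 + 4 * (\<Psi> (y, p))\<^sup>2 + 8 * (?I t)\<^sup>2 + 8 * (?I p)\<^sup>2)"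
          by (intro ennreal_leI) (simp add: power2_commute)
        also have "\<dots> = 4 * ennreal ((\<Psi> (y, t) - f (y, t))\<^sup>2) + 4 * ennreal ((\<Psi> (y, p))\<^sup>2) + (8 * ennreal ((?I t)\<^sup>2) + 8 * ennreal ((?I p)\<^sup>2))"
          by (simp add: ennreal_mult add.assoc)
        also have "\<dots> \<le> 4 * ennreal ((\<Psi> (y, t) - f (y, t))\<^sup>2) + 4 * ennreal ((\<Psi> (y, p))\<^sup>2) + (8 * (ennreal (b - a) * B y) + 8 * (ennreal (b - a) * B y))"
          by (intro add_mono mult_left_mono order_refl osc) (use t p in auto)
        also have "8 * (ennreal (b - a) * B y) + 8 * (ennreal (b - a) * B y) = ennreal (16 * (b - a)) * B y"
        proof -
          have "ennreal (16 * (b - a)) = 8 * ennreal (b - a) + 8 * ennreal (b - a)"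
          proof -
            have "8 * ennreal (b - a) = ennreal (8 * (b - a))" using ab by (subst ennreal_mult) auto
            moreover have "ennreal (8 * (b - a)) + ennreal (8 * (b - a)) = ennreal (8 * (b - a) + 8 * (b - a))"
              using ab by (intro ennreal_plus[symmetric]) auto
            ultimately show ?thesis by simp
          qed
          then show ?thesis by (simp only: distrib_right mult.assoc)
        qed
        finally show ?thesis .
      qed
      have "(\<integral>\<^sup>+t. ennreal ((D (y, t))\<^sup>2) * indicator {a<..<b} t \<partial>lborel)
         \<le> (\<integral>\<^sup>+t. 4 * (ennreal ((\<Psi> (y, t) - f (y, t))\<^sup>2) * indicator {a<..<b} t) + (4 * ennreal ((\<Psi> (y, p))\<^sup>2) + ennreal (16 * (b - a)) * B y) * indicator {a<..<b} t \<partial>lborel)"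
        using pt by (intro nn_integral_mono) (auto simp: indicator_def add.assoc)
      also have "\<dots> = 4 * A y + (4 * ennreal ((\<Psi> (y, p))\<^sup>2) + ennreal (16 * (b - a)) * B y) * ennreal (b - a)"
        unfolding A_def using ab
        by (subst nn_integral_add) (auto simp: nn_integral_cmult nn_integral_cmult_indicator)
      also have "(4 * ennreal ((\<Psi> (y, p))\<^sup>2) + ennreal (16 * (b - a)) * B y) * ennreal (b - a)
         = ennreal (4 * (b - a)) * ennreal ((\<Psi> (y, p))\<^sup>2) + ennreal (16 * (b - a)\<^sup>2) * B y"
      proof -
        have "ennreal (4 * (b - a)) = 4 * ennreal (b - a)" using ab by (subst ennreal_mult) auto
        moreover have "ennreal (16 * (b - a)\<^sup>2) = ennreal (16 * (b - a)) * ennreal (b - a)"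
          using ab by (subst ennreal_mult[symmetric]) (auto simp: power2_eq_square mult.assoc)
        ultimately show ?thesis by (simp only: dist)
      qed
      finally show "(\<integral>\<^sup>+t. ennreal ((D (y, t))\<^sup>2) * indicator {a<..<b} t \<partial>lborel) * indicator Y y
        \<le> (4 * A y + ennreal (4 * (b - a)) * ennreal ((\<Psi> (y, p))\<^sup>2) + ennreal (16 * (b - a)\<^sup>2) * B y) * indicator Y y"
        by (simp add: mult_right_mono add.assoc)
    qed
    also have "\<dots> = 4 * (\<integral>\<^sup>+y. A y * indicator Y y \<partial>lborel) + ennreal (4 * (b - a)) * (\<integral>\<^sup>+y. ennreal ((\<Psi> (y, p))\<^sup>2) * indicator Y y \<partial>lborel)
        + ennreal (16 * (b - a)\<^sup>2) * (\<integral>\<^sup>+y. B y * indicator Y y \<partial>lborel)"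
      by (simp add: distrib_right nn_integral_add nn_integral_cmult mult.assoc)
    also have "\<dots> \<le> 4 * ennreal e + ennreal (4 * (b - a)) * ennreal e + ennreal (16 * (b - a)\<^sup>2) * ennreal e"
    proof (intro add_mono mult_left_mono e2)
      show "(\<integral>\<^sup>+y. A y * indicator Y y \<partial>lborel) \<le> ennreal e"
        by (rule order_trans[OF _ e1[unfolded AB]]) (auto intro!: nn_integral_mono mult_right_mono)
      show "(\<integral>\<^sup>+y. B y * indicator Y y \<partial>lborel) \<le> ennreal e"
        by (rule order_trans[OF _ e1[unfolded AB]]) (auto intro!: nn_integral_mono mult_right_mono)
    qed auto
    also have "\<dots> = ennreal (C * e)"
    proof -
      have "4 * ennreal e = ennreal (4 * e)" using e by (simp add: ennreal_mult)
      moreover have "ennreal (4 * (b - a)) * ennreal e = ennreal (4 * (b - a) * e)"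
        "ennreal (16 * (b - a)\<^sup>2) * ennreal e = ennreal (16 * (b - a)\<^sup>2 * e)"
        using e ab by (simp_all only: ennreal_mult mult_nonneg_nonneg diff_ge_0_iff_ge less_imp_le zero_le_power2 zero_le_numeral)
      moreover have "ennreal (4 * e) + ennreal (4 * (b - a) * e) + ennreal (16 * (b - a)\<^sup>2 * e) = ennreal (C * e)"
        using e ab by (subst ennreal_plus[symmetric], simp, simp, subst ennreal_plus[symmetric]) (auto simp: C_def distrib_right)
      ultimately show ?thesis by (simp only:)
    qed
    finally show ?thesis .
  qed
  have N0: "?N = 0"
  proof -
    have "?N \<le> ennreal e" if "e > 0" for e
      using bound[of "e / C"] that C by simp
    then have "?N \<le> 0 + ennreal e" if "e > 0" for e using that by (simp only: add_0_left)
    then have "?N \<le> 0" by (rule ennreal_le_epsilon)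
    then show ?thesis by (simp only: le_zero_eq)
  qed
  have "AE y in lborel. (\<integral>\<^sup>+t. ennreal ((D (y, t))\<^sup>2) * indicator {a<..<b} t \<partial>lborel) * indicator Y y = 0"
    using N0 by (subst (asm) nn_integral_0_iff_AE) auto
  then show ?thesis
  proof (rule eventually_mono, intro impI)
    fix y assume "(\<integral>\<^sup>+t. ennreal ((D (y, t))\<^sup>2) * indicator {a<..<b} t \<partial>lborel) * indicator Y y = 0" and y: "y \<in> Y"
    then have "(\<integral>\<^sup>+t. ennreal ((D (y, t))\<^sup>2) * indicator {a<..<b} t \<partial>lborel) = 0" by simp
    then have "AE t in lborel. ennreal ((D (y, t))\<^sup>2) * indicator {a<..<b} t = 0"
      by (subst (asm) nn_integral_0_iff_AE) auto
    then show "AE t in lborel. t \<in> {a..b} \<longrightarrow> f (y, t) = (LINT s:{a..t}|lborel. h (y, s)) - (LINT s:{a..p}|lborel. h (y, s))"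
      using AE_lborel_singleton[of a] AE_lborel_singleton[of b]
      by eventually_elim (auto simp: D_def indicator_def ennreal_eq_0_iff)
  qed
qed

context strip
begin

text \<open>Members of \<open>V1\<close> and chosen weak derivatives have arbitrary values outside
  the strip. Setting them to 0 makes \<open>W2\<close> and \<open>slice\<close> applicable.\<close>

definition cut :: "(real \<times> real \<Rightarrow> real) \<Rightarrow> real \<times> real \<Rightarrow> real" where
  "cut f x = indicator S x * f x"

lemma cut_simps: "x \<in> S \<Longrightarrow> cut f x = f x" "x \<notin> S \<Longrightarrow> cut f x = 0"
  by (auto simp: cut_def)

text \<open>Local integrability gives measurability on compact subsets only; boxes exhausting the
  strip extend it to the function cut to the strip.\<close>

lemma cut_measurable: assumes "loc_integrable S f" shows "cut f \<in> borel_measurable borel"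
proof -
  define K where "K n = cbox (\<sigma> + inverse (Suc n), inverse (Suc n)) (\<sigma> + real (Suc n), L - inverse (Suc n))" for n :: nat
  have KS: "K n \<subseteq> S" for n
  proof
    fix x assume "x \<in> K n"
    then have "(fst x, snd x) \<in> {\<sigma> + inverse (Suc n)..\<sigma> + real (Suc n)} \<times> {inverse (Suc n)..L - inverse (Suc n)}"
      by (simp only: K_def cbox_Pair_eq cbox_interval[where ?'a=real] prod.collapse)
    then have "\<sigma> + inverse (Suc n) \<le> fst x" "inverse (Suc n) \<le> snd x" "snd x \<le> L - inverse (Suc n)"
      by (simp_all only: mem_Times_iff fst_conv snd_conv atLeastAtMost_iff)
    moreover have "0 < inverse (real (Suc n))" by simp
    ultimately have "\<sigma> < fst x" "0 < snd x" "snd x < L" by linarith+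
    then show "x \<in> S" by (cases x) (simp add: mem_S)
  qed
  have m: "(\<lambda>x. indicator (K n) x * f x) \<in> borel_measurable borel" for n
  proof -
    have "set_integrable lborel (K n) f" using assms KS[of n] unfolding loc_integrable_def K_def by auto
    then have "integrable lborel (\<lambda>x. indicator (K n) x * f x)" by (simp add: set_integrable_def)
    then show ?thesis by auto
  qed
  show ?thesis
  proof (rule borel_measurable_LIMSEQ_real[OF _ m])
    fix x
    show "(\<lambda>n. indicator (K n) x * f x) \<longlonglongrightarrow> cut f x"
    proof (cases "x \<in> S")
      case False
      then have "x \<notin> K n" for n using KS by blast
      then show ?thesis using False by (simp add: cut_def)
    next
      case True
      then have x: "0 < fst x - \<sigma>" "0 < snd x" "0 < L - snd x" by (auto simp: Om_def)
      then obtain N1 N2 N3 where N: "inverse (real (Suc N1)) < fst x - \<sigma>" "inverse (real (Suc N2)) < snd x" "inverse (real (Suc N3)) < L - snd x"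
        using reals_Archimedean by metis
      obtain N4 :: nat where N4: "fst x - \<sigma> \<le> real N4" using real_arch_simple by blast
      have "\<forall>\<^sub>F n in sequentially. indicator (K n) x * f x = cut f x"
        using eventually_ge_at_top[of "N1 + N2 + N3 + N4"]
      proof eventually_elim
        fix n assume n: "n \<ge> N1 + N2 + N3 + N4"
        have "inverse (real (Suc n)) \<le> inverse (real (Suc N1))" "inverse (real (Suc n)) \<le> inverse (real (Suc N2))"
          "inverse (real (Suc n)) \<le> inverse (real (Suc N3))" using n by simp_all
        then have "\<sigma> + inverse (real (Suc n)) \<le> fst x" "inverse (real (Suc n)) \<le> snd x" "snd x \<le> L - inverse (real (Suc n))" "fst x \<le> \<sigma> + real (Suc n)"
          using N N4 n by linarith+
        then have "x \<in> K n" by (cases x) (simp add: K_def cbox_Pair_eq)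
        then show "indicator (K n) x * f x = cut f x" using True by (simp add: cut_def)
      qed
      then show ?thesis by (rule tendsto_eventually)
    qed
  qed
qed

definition locnorm :: "real \<Rightarrow> (real \<times> real \<Rightarrow> real) \<Rightarrow> (real \<times> real \<Rightarrow> real) \<Rightarrow> (real \<times> real \<Rightarrow> real) \<Rightarrow> ennreal" where
  "locnorm R p q s = (\<integral>\<^sup>+x\<in>S \<inter> ball 0 R. ennreal ((p x)\<^sup>2 + (q x)\<^sup>2 + (s x)\<^sup>2) \<partial>lborel)"

definition bdnorm :: "(real \<Rightarrow> real \<times> real) \<Rightarrow> real set \<Rightarrow> real \<Rightarrow> (real \<times> real \<Rightarrow> real) \<Rightarrow> ennreal" where
  "bdnorm c I R \<psi> = (\<integral>\<^sup>+s\<in>{s \<in> I. c s \<in> ball 0 R}. ennreal ((\<psi> (c s))\<^sup>2) \<partial>lborel)"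

abbreviation dr :: "(real \<times> real \<Rightarrow> real) \<Rightarrow> real \<times> real \<Rightarrow> real" where
  "dr \<equiv> d_r \<sigma> L"

abbreviation dz :: "(real \<times> real \<Rightarrow> real) \<Rightarrow> real \<times> real \<Rightarrow> real" where
  "dz \<equiv> d_z \<sigma> L"

abbreviation Dr :: "(real \<times> real \<Rightarrow> real) \<Rightarrow> real \<times> real \<Rightarrow> real" where
  "Dr \<psi> x \<equiv> frechet_derivative \<psi> (at x) (1, 0)"

abbreviation Dz :: "(real \<times> real \<Rightarrow> real) \<Rightarrow> real \<times> real \<Rightarrow> real" where
  "Dz \<psi> x \<equiv> frechet_derivative \<psi> (at x) (0, 1)"

abbreviation sdist :: "real \<Rightarrow> (real \<times> real \<Rightarrow> real) \<Rightarrow> (real \<times> real \<Rightarrow> real) \<Rightarrow> ennreal" where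
  "sdist R \<psi> f \<equiv> locnorm R (\<lambda>x. \<psi> x - f x) (\<lambda>x. Dr \<psi> x - dr f x) (\<lambda>x. Dz \<psi> x - dz f x)"

text \<open>One approximation per radius and accuracy replaces the sequence. Conversely, radius
  \<open>n + 1\<close> with accuracy \<open>1 / (n + 1)\<close> gives a sequence that serves every
  \<open>R\<close>, because both quantities grow with the radius.\<close>

lemma has_trace_zero_iff:
  "has_trace S c I f (\<lambda>_. 0) \<longleftrightarrow> (\<forall>R>0. \<forall>e>0. \<exists>\<psi>. smooth \<psi> \<and>
     sdist R \<psi> f \<le> ennreal e \<and>
     bdnorm c I R \<psi> \<le> ennreal e)" (is "_ \<longleftrightarrow> ?rhs")
proof
  assume "has_trace S c I f (\<lambda>_. 0)"
  then obtain \<psi> :: "nat \<Rightarrow> real \<times> real \<Rightarrow> real" where s: "\<And>n. smooth (\<psi> n)"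
    and l: "\<And>R. R > 0 \<Longrightarrow> (\<lambda>n. sdist R (\<psi> n) f) \<longlonglongrightarrow> 0"
    and b: "\<And>R. R > 0 \<Longrightarrow> (\<lambda>n. bdnorm c I R (\<psi> n)) \<longlonglongrightarrow> 0"
    unfolding has_trace_def locnorm_def bdnorm_def d_r_def d_z_def by auto
  show ?rhs
  proof (intro allI impI)
    fix R e :: real assume "R > 0" "e > 0"
    then have "\<forall>\<^sub>F n in sequentially. sdist R (\<psi> n) f < ennreal e"
      "\<forall>\<^sub>F n in sequentially. bdnorm c I R (\<psi> n) < ennreal e"
      using order_tendstoD(2)[OF l] order_tendstoD(2)[OF b] by simp_all
    then have "\<forall>\<^sub>F n in sequentially. sdist R (\<psi> n) f < ennreal e
      \<and> bdnorm c I R (\<psi> n) < ennreal e" by (rule eventually_conj)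
    then obtain n where "sdist R (\<psi> n) f < ennreal e
      \<and> bdnorm c I R (\<psi> n) < ennreal e" by (auto simp: eventually_sequentially)
    then show "\<exists>\<psi>. smooth \<psi> \<and> sdist R \<psi> f \<le> ennreal e \<and> bdnorm c I R \<psi> \<le> ennreal e"
      using s by (intro exI[of _ "\<psi> n"]) auto
  qed
next
  assume rhs: ?rhs
  have "\<exists>\<psi>. smooth \<psi> \<and> sdist (real (Suc n)) \<psi> f \<le> ennreal (inverse (real (Suc n))) \<and>
     bdnorm c I (real (Suc n)) \<psi> \<le> ennreal (inverse (real (Suc n)))" for n
    by (rule rhs[rule_format]) auto
  note ex = this
  have "\<exists>\<psi>. \<forall>n. smooth (\<psi> n) \<and> sdist (real (Suc n)) (\<psi> n) f \<le> ennreal (inverse (real (Suc n))) \<and>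
     bdnorm c I (real (Suc n)) (\<psi> n) \<le> ennreal (inverse (real (Suc n)))" by (rule choice, rule allI, rule ex)
  then obtain \<psi> where s: "\<And>n. smooth (\<psi> n)"
    and l: "\<And>n. sdist (real (Suc n)) (\<psi> n) f \<le> ennreal (inverse (real (Suc n)))"
    and b: "\<And>n. bdnorm c I (real (Suc n)) (\<psi> n) \<le> ennreal (inverse (real (Suc n)))" by blast
  have lim: "(\<lambda>n. ennreal (inverse (real (Suc n)))) \<longlonglongrightarrow> 0"
    using tendsto_ennrealI[OF LIMSEQ_inverse_real_of_nat] by simp
  have to0: "F \<longlonglongrightarrow> 0" if "\<forall>\<^sub>F n in sequentially. F n \<le> ennreal (inverse (real (Suc n)))" for F
    by (rule tendsto_sandwich[OF _ that tendsto_const lim]) auto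
  have ev: "\<forall>\<^sub>F n in sequentially. R \<le> real (Suc n)" for R :: real
  proof -
    obtain N :: nat where "R \<le> real N" using real_arch_simple by blast
    then show ?thesis unfolding eventually_sequentially by (intro exI[of _ N]) auto
  qed
  have "(\<lambda>n. sdist R (\<psi> n) f) \<longlonglongrightarrow> 0" for R
  proof (rule to0, rule eventually_mono[OF ev[of R]])
    fix n assume "R \<le> real (Suc n)"
    then show "sdist R (\<psi> n) f \<le> ennreal (inverse (real (Suc n)))"
      by (intro order_trans[OF _ l]) (auto simp: locnorm_def intro!: nn_integral_mono split: split_indicator)
  qed
  moreover have "(\<lambda>n. bdnorm c I R (\<psi> n)) \<longlonglongrightarrow> 0" for R
  proof (rule to0, rule eventually_mono[OF ev[of R]])
    fix n assume "R \<le> real (Suc n)"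
    then show "bdnorm c I R (\<psi> n) \<le> ennreal (inverse (real (Suc n)))"
      by (intro order_trans[OF _ b]) (auto simp: bdnorm_def intro!: nn_integral_mono split: split_indicator)
  qed
  ultimately show "has_trace S c I f (\<lambda>_. 0)"
    unfolding has_trace_def using s by (auto simp: locnorm_def bdnorm_def d_r_def d_z_def intro!: exI[of _ \<psi>])
qed

lemma locnorm_eq:
  assumes "AE x in lborel. x \<in> S \<longrightarrow> p x = p' x \<and> q x = q' x \<and> s x = s' x"
  shows "locnorm R p q s = locnorm R p' q' s'"
  unfolding locnorm_def using assms
  by (intro nn_integral_cong_AE) (auto simp: indicator_def elim!: eventually_mono)

lemma locnorm_add:
  assumes [measurable]: "cut p \<in> borel_measurable borel" "cut q \<in> borel_measurable borel" "cut s \<in> borel_measurable borel"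
    "cut p' \<in> borel_measurable borel" "cut q' \<in> borel_measurable borel" "cut s' \<in> borel_measurable borel"
  shows "locnorm R (\<lambda>x. p x + p' x) (\<lambda>x. q x + q' x) (\<lambda>x. s x + s' x) \<le> 2 * locnorm R p q s + 2 * locnorm R p' q' s'"
proof -
  have [measurable]: "S \<inter> ball 0 R \<in> sets borel" using open_S by auto
  have "locnorm R (\<lambda>x. p x + p' x) (\<lambda>x. q x + q' x) (\<lambda>x. s x + s' x)
    \<le> (\<integral>\<^sup>+x. 2 * (ennreal ((cut p x)\<^sup>2 + (cut q x)\<^sup>2 + (cut s x)\<^sup>2) * indicator (S \<inter> ball 0 R) x)
       + 2 * (ennreal ((cut p' x)\<^sup>2 + (cut q' x)\<^sup>2 + (cut s' x)\<^sup>2) * indicator (S \<inter> ball 0 R) x) \<partial>lborel)"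
    unfolding locnorm_def
  proof (intro nn_integral_mono)
    fix x
    have e: "(a + b)\<^sup>2 \<le> 2 * a\<^sup>2 + 2 * b\<^sup>2" for a b :: real using sum_squares_bound[of a b] by (simp add: power2_sum)
    have "(p x + p' x)\<^sup>2 + (q x + q' x)\<^sup>2 + (s x + s' x)\<^sup>2 \<le> 2 * ((p x)\<^sup>2 + (q x)\<^sup>2 + (s x)\<^sup>2) + 2 * ((p' x)\<^sup>2 + (q' x)\<^sup>2 + (s' x)\<^sup>2)"
      using e[of "p x" "p' x"] e[of "q x" "q' x"] e[of "s x" "s' x"] by (simp add: algebra_simps)
    then have "ennreal ((p x + p' x)\<^sup>2 + (q x + q' x)\<^sup>2 + (s x + s' x)\<^sup>2)
       \<le> ennreal (2 * ((p x)\<^sup>2 + (q x)\<^sup>2 + (s x)\<^sup>2) + 2 * ((p' x)\<^sup>2 + (q' x)\<^sup>2 + (s' x)\<^sup>2))" by (rule ennreal_leI)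
    also have "\<dots> = 2 * ennreal ((p x)\<^sup>2 + (q x)\<^sup>2 + (s x)\<^sup>2) + 2 * ennreal ((p' x)\<^sup>2 + (q' x)\<^sup>2 + (s' x)\<^sup>2)"
      by (subst ennreal_plus) (auto simp: ennreal_mult)
    finally show "ennreal ((p x + p' x)\<^sup>2 + (q x + q' x)\<^sup>2 + (s x + s' x)\<^sup>2) * indicator (S \<inter> ball 0 R) x
      \<le> 2 * (ennreal ((cut p x)\<^sup>2 + (cut q x)\<^sup>2 + (cut s x)\<^sup>2) * indicator (S \<inter> ball 0 R) x)
       + 2 * (ennreal ((cut p' x)\<^sup>2 + (cut q' x)\<^sup>2 + (cut s' x)\<^sup>2) * indicator (S \<inter> ball 0 R) x)"
      by (cases "x \<in> S \<inter> ball 0 R") (auto simp: cut_simps)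
  qed
  also have "\<dots> = 2 * (\<integral>\<^sup>+x. ennreal ((cut p x)\<^sup>2 + (cut q x)\<^sup>2 + (cut s x)\<^sup>2) * indicator (S \<inter> ball 0 R) x \<partial>lborel)
       + 2 * (\<integral>\<^sup>+x. ennreal ((cut p' x)\<^sup>2 + (cut q' x)\<^sup>2 + (cut s' x)\<^sup>2) * indicator (S \<inter> ball 0 R) x \<partial>lborel)"
    by (subst nn_integral_add) (auto simp: nn_integral_cmult)
  also have "(\<integral>\<^sup>+x. ennreal ((cut p x)\<^sup>2 + (cut q x)\<^sup>2 + (cut s x)\<^sup>2) * indicator (S \<inter> ball 0 R) x \<partial>lborel) = locnorm R p q s"
    unfolding locnorm_def by (intro nn_integral_cong) (auto simp: cut_simps split: split_indicator)
  also have "(\<integral>\<^sup>+x. ennreal ((cut p' x)\<^sup>2 + (cut q' x)\<^sup>2 + (cut s' x)\<^sup>2) * indicator (S \<inter> ball 0 R) x \<partial>lborel) = locnorm R p' q' s'"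
    unfolding locnorm_def by (intro nn_integral_cong) (auto simp: cut_simps split: split_indicator)
  finally show ?thesis .
qed

lemma bdnorm_add:
  assumes c: "c \<in> borel_measurable borel" and [measurable]: "I \<in> sets borel" and s: "smooth \<psi>" "smooth \<eta>"
  shows "bdnorm c I R (\<lambda>x. \<psi> x + \<eta> x) \<le> 2 * bdnorm c I R \<psi> + 2 * bdnorm c I R \<eta>"
proof -
  note [measurable] = c
  have [measurable]: "(\<lambda>x. \<psi> (c x)) \<in> borel_measurable borel" "(\<lambda>x. \<eta> (c x)) \<in> borel_measurable borel"
    using measurable_compose[OF c smooth_measurable] s by auto
  have [measurable]: "{s \<in> I. c s \<in> ball 0 R} \<in> sets borel"
  proof -
    have "c -` ball 0 R \<inter> space borel \<in> sets borel" using c by (rule measurable_sets) auto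
    then have "I \<inter> c -` ball 0 R \<in> sets borel" by auto
    then show ?thesis by (simp add: Collect_conj_eq vimage_def)
  qed
  have "bdnorm c I R (\<lambda>x. \<psi> x + \<eta> x) \<le> (\<integral>\<^sup>+t. 2 * (ennreal ((\<psi> (c t))\<^sup>2) * indicator {s \<in> I. c s \<in> ball 0 R} t) + 2 * (ennreal ((\<eta> (c t))\<^sup>2) * indicator {s \<in> I. c s \<in> ball 0 R} t) \<partial>lborel)"
    unfolding bdnorm_def
  proof (intro nn_integral_mono)
    fix t
    have "(\<psi> (c t) + \<eta> (c t))\<^sup>2 \<le> 2 * (\<psi> (c t))\<^sup>2 + 2 * (\<eta> (c t))\<^sup>2"
      using sum_squares_bound[of "\<psi> (c t)" "\<eta> (c t)"] by (simp add: power2_sum)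
    then have "ennreal ((\<psi> (c t) + \<eta> (c t))\<^sup>2) \<le> ennreal (2 * (\<psi> (c t))\<^sup>2 + 2 * (\<eta> (c t))\<^sup>2)" by (rule ennreal_leI)
    also have "\<dots> = 2 * ennreal ((\<psi> (c t))\<^sup>2) + 2 * ennreal ((\<eta> (c t))\<^sup>2)" by (simp add: ennreal_mult)
    finally show "ennreal ((\<psi> (c t) + \<eta> (c t))\<^sup>2) * indicator {s \<in> I. c s \<in> ball 0 R} t
       \<le> 2 * (ennreal ((\<psi> (c t))\<^sup>2) * indicator {s \<in> I. c s \<in> ball 0 R} t) + 2 * (ennreal ((\<eta> (c t))\<^sup>2) * indicator {s \<in> I. c s \<in> ball 0 R} t)"
      by (auto split: split_indicator)
  qed
  also have "\<dots> = 2 * bdnorm c I R \<psi> + 2 * bdnorm c I R \<eta>"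
    unfolding bdnorm_def by (subst nn_integral_add) (auto simp: nn_integral_cmult)
  finally show ?thesis .
qed

end

section \<open>Functions in V1 on lines\<close>

lemma smooth_section_derivative:
  assumes "smooth (\<psi> :: real \<times> real \<Rightarrow> real)"
  shows "((\<lambda>t. \<psi> (y, t)) has_real_derivative frechet_derivative \<psi> (at (y, t)) (0, 1)) (at t)"
    and "((\<lambda>t. \<psi> (t, y)) has_real_derivative frechet_derivative \<psi> (at (t, y)) (1, 0)) (at t)"
proof -
  have lin: "linear (frechet_derivative \<psi> (at x))" for x
    using smooth_has_derivative[OF assms] by (rule has_derivative_linear)
  have 1: "frechet_derivative \<psi> (at x) (0, s) = s * frechet_derivative \<psi> (at x) (0, 1)" for x s
    using linear_cmul[OF lin[of x], of s "(0, 1)"] by simp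
  have 2: "frechet_derivative \<psi> (at x) (s, 0) = s * frechet_derivative \<psi> (at x) (1, 0)" for x s
    using linear_cmul[OF lin[of x], of s "(1, 0)"] by simp
  have "((\<lambda>t. \<psi> (y, t)) has_derivative (\<lambda>s. frechet_derivative \<psi> (at (y, t)) (0, s))) (at t)"
    by (rule has_derivative_compose[OF _ smooth_has_derivative[OF assms]]) (auto intro!: derivative_eq_intros)
  then show "((\<lambda>t. \<psi> (y, t)) has_real_derivative frechet_derivative \<psi> (at (y, t)) (0, 1)) (at t)"
    unfolding has_field_derivative_def
    by (rule has_derivative_eq_rhs) (rule ext, subst 1, rule mult.commute)
  have "((\<lambda>t. \<psi> (t, y)) has_derivative (\<lambda>s. frechet_derivative \<psi> (at (t, y)) (s, 0))) (at t)"
    by (rule has_derivative_compose[OF _ smooth_has_derivative[OF assms]]) (auto intro!: derivative_eq_intros)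
  then show "((\<lambda>t. \<psi> (t, y)) has_real_derivative frechet_derivative \<psi> (at (t, y)) (1, 0)) (at t)"
    unfolding has_field_derivative_def
    by (rule has_derivative_eq_rhs) (rule ext, subst 2, rule mult.commute)
qed

lemma smooth_section_continuous:
  assumes "smooth (\<psi> :: real \<times> real \<Rightarrow> real)"
  shows "continuous_on A (\<lambda>t. frechet_derivative \<psi> (at (y, t)) b)" "continuous_on A (\<lambda>t. frechet_derivative \<psi> (at (t, y)) b)"
proof -
  note c = continuous_on_compose2[OF smooth_continuous[OF smooth_frechet[OF assms]] _ subset_UNIV]
  show "continuous_on A (\<lambda>t. frechet_derivative \<psi> (at (y, t)) b)" "continuous_on A (\<lambda>t. frechet_derivative \<psi> (at (t, y)) b)"
    by (rule c, intro continuous_on_Pair continuous_on_const continuous_on_id)+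
qed

lemma set_integral_singleton: "(LINT s:{a..a}|lborel. f s) = 0" for a :: real and f :: "real \<Rightarrow> real"
  unfolding set_lebesgue_integral_def
  by (rule integral_eq_zero_AE, rule eventually_mono[OF AE_lborel_singleton[of a]]) auto

context strip
begin

lemma W2_nn_finite: "W2 g \<Longrightarrow> nnw g < \<infinity>"
  by (simp add: nn_norm_cls)

lemma V1_weak_deriv:
  assumes "v \<in> V1 \<sigma> L"
  shows "has_weak_deriv S (1, 0) v (dr v)" "has_weak_deriv S (0, 1) v (dz v)"
  using assms has_weak_deriv_weak_deriv unfolding V1_def d_r_def d_z_def by auto

lemma V1_measurable [measurable_dest]:
  assumes "v \<in> V1 \<sigma> L"
  shows "cut v \<in> borel_measurable borel" "cut (dr v) \<in> borel_measurable borel" "cut (dz v) \<in> borel_measurable borel"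
  using V1_weak_deriv[OF assms] by (auto intro: cut_measurable dest: has_weak_derivD)

lemma V1_finite:
  assumes v: "v \<in> V1 \<sigma> L"
  shows "W2 (cut (dr v))" "W2 (cut (dz v))"
proof -
  note [measurable] = V1_measurable[OF v]
  have "set_integrable lborel S (\<lambda>(r, z). ((dr v (r, z))\<^sup>2 + (dz v (r, z))\<^sup>2) * r)"
    using v by (simp add: V1_def)
  then have "integrable lborel (\<lambda>x. indicator S x * (((dr v x)\<^sup>2 + (dz v x)\<^sup>2) * fst x))"
    by (simp add: set_integrable_def case_prod_unfold)
  also have "(\<lambda>x. indicator S x * (((dr v x)\<^sup>2 + (dz v x)\<^sup>2) * fst x)) = (\<lambda>x. ((cut (dr v) x)\<^sup>2 + (cut (dz v) x)\<^sup>2) * fst x)"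
    by (auto simp: cut_def fun_eq_iff indicator_def)
  finally have i: "integrable lborel (\<lambda>x. ((cut (dr v) x)\<^sup>2 + (cut (dz v) x)\<^sup>2) * fst x)" .
  show "W2 (cut (dr v))" "W2 (cut (dz v))"
    unfolding W2_def by (auto simp: cut_simps intro!: integrable_weighted_bound[OF _ _ i])
qed

lemma norm_pair_less: "norm (a, b) < R" if "\<bar>a\<bar> + \<bar>b\<bar> < R" for a b R :: real
  using that sqrt_sum_squares_le_sum_abs[of a b] by (simp add: norm_Pair)

text \<open>\<open>primitive_of_approximation\<close> on lines parallel to the
  \<open>z\<close>-axis. The height \<open>p\<close> is 0 for the condition in \<open>V1\<close> and
  \<open>L\<close> for the additional one in \<open>V2\<close>.\<close>

lemma trace_primitive_z:
  assumes v: "v \<in> V1 \<sigma> L" and p: "p \<in> {0..L}" and tr: "has_trace S (\<lambda>r. (r, p)) {\<sigma>..} v (\<lambda>_. 0)"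
  shows "AE r in lborel. AE z in lborel. z \<in> {0..L} \<longrightarrow>
    cut v (r, z) = (LINT s:{0..z}|lborel. cut (dz v) (r, s)) - (LINT s:{0..p}|lborel. cut (dz v) (r, s))"
proof -
  note [measurable] = V1_measurable[OF v]
  have T: "AE r in lborel. r \<in> {\<sigma><..<real T} \<longrightarrow> (AE z in lborel. z \<in> {0..L} \<longrightarrow>
    cut v (r, z) = (LINT s:{0..z}|lborel. cut (dz v) (r, s)) - (LINT s:{0..p}|lborel. cut (dz v) (r, s)))" for T :: nat
  proof (rule primitive_of_approximation)
    show "AE y in lborel. (\<integral>\<^sup>+t. ennreal ((cut (dz v) (y, t))\<^sup>2) \<partial>lborel) < \<infinity>"
      using V1_finite(2)[OF v] by (intro section_finite W2_nn_finite) (auto simp: cut_simps)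
    fix e :: real assume e: "e > 0"
    \<comment> \<open>The norm is at most the sum of the coordinates, so the ball of radius
      \<open>R\<close> contains the box up to \<open>r = T\<close> and the boundary piece at height
      \<open>p\<close>.\<close>
    define R where "R = T + L + 1"
    have R: "R > 0" using L_pos by (simp add: R_def)
    obtain \<psi> where s: "smooth \<psi>" and l: "sdist R \<psi> v \<le> ennreal e"
      and b: "bdnorm (\<lambda>r. (r, p)) {\<sigma>..} R \<psi> \<le> ennreal e"
      using tr R e unfolding has_trace_zero_iff by blast
    note [measurable] = smooth_measurable[OF s] frechet_measurable[OF s]
    have [measurable]: "{\<sigma><..<real T} \<times> {0<..<L} \<in> sets borel" by (rule borel_Times) simp_all
    have "(\<integral>\<^sup>+y. (\<integral>\<^sup>+t. ennreal ((\<psi> (y, t) - cut v (y, t))\<^sup>2 + (Dz \<psi> (y, t) - cut (dz v) (y, t))\<^sup>2) * indicator {0<..<L} t \<partial>lborel) * indicator {\<sigma><..<real T} y \<partial>lborel)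
       = (\<integral>\<^sup>+y. (\<integral>\<^sup>+t. ennreal ((\<psi> (y, t) - cut v (y, t))\<^sup>2 + (Dz \<psi> (y, t) - cut (dz v) (y, t))\<^sup>2) * indicator ({\<sigma><..<real T} \<times> {0<..<L}) (y, t) \<partial>lborel) \<partial>lborel)"
      by (intro nn_integral_cong, subst nn_integral_multc[symmetric]) (auto intro!: nn_integral_cong simp: indicator_def)
    also have "\<dots> = (\<integral>\<^sup>+x. ennreal ((\<psi> x - cut v x)\<^sup>2 + (Dz \<psi> x - cut (dz v) x)\<^sup>2) * indicator ({\<sigma><..<real T} \<times> {0<..<L}) x \<partial>lborel)"
      by (rule nn_integral_iterated(1)[symmetric]) measurable
    also have "\<dots> \<le> sdist R \<psi> v"
      unfolding locnorm_def
    proof (intro nn_integral_mono)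
      fix x :: "real \<times> real"
      show "ennreal ((\<psi> x - cut v x)\<^sup>2 + (Dz \<psi> x - cut (dz v) x)\<^sup>2) * indicator ({\<sigma><..<real T} \<times> {0<..<L}) x
        \<le> ennreal ((\<psi> x - v x)\<^sup>2 + (Dr \<psi> x - dr v x)\<^sup>2 + (Dz \<psi> x - dz v x)\<^sup>2) * indicator (S \<inter> ball 0 R) x"
      proof (cases "x \<in> {\<sigma><..<real T} \<times> {0<..<L}")
        case True
        then have "x \<in> S" by (auto simp: Om_def)
        moreover have "norm (fst x, snd x) < R"
          by (rule norm_pair_less) (use True sigma_pos in \<open>auto simp: R_def\<close>)
        ultimately show ?thesis using True by (auto simp: cut_simps intro!: ennreal_leI)
      qed simp
    qed
    finally have 1: "(\<integral>\<^sup>+y. (\<integral>\<^sup>+t. ennreal ((\<psi> (y, t) - cut v (y, t))\<^sup>2 + (Dz \<psi> (y, t) - cut (dz v) (y, t))\<^sup>2) * indicator {0<..<L} t \<partial>lborel) * indicator {\<sigma><..<real T} y \<partial>lborel)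
       \<le> ennreal e" using l by (rule order_trans)
    have "(\<integral>\<^sup>+y. ennreal ((\<psi> (y, p))\<^sup>2) * indicator {\<sigma><..<real T} y \<partial>lborel) \<le> bdnorm (\<lambda>r. (r, p)) {\<sigma>..} R \<psi>"
      unfolding bdnorm_def
    proof (intro nn_integral_mono mult_left_mono)
      fix y :: real
      have "norm (y, p) < R" if "y \<in> {\<sigma><..<real T}"
        by (rule norm_pair_less) (use that p sigma_pos in \<open>auto simp: R_def\<close>)
      then show "indicator {\<sigma><..<real T} y \<le> (indicator {s \<in> {\<sigma>..}. (s, p) \<in> ball 0 R} y :: ennreal)"
        by (auto simp: indicator_def)
    qed simp
    then have 2: "(\<integral>\<^sup>+y. ennreal ((\<psi> (y, p))\<^sup>2) * indicator {\<sigma><..<real T} y \<partial>lborel) \<le> ennreal e" using b by (rule order_trans)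
    show "\<exists>\<Psi> \<Psi>'. \<Psi> \<in> borel_measurable borel \<and> \<Psi>' \<in> borel_measurable borel \<and>
      (\<forall>y t. ((\<lambda>t. \<Psi> (y, t)) has_real_derivative \<Psi>' (y, t)) (at t)) \<and> (\<forall>y. continuous_on UNIV (\<lambda>t. \<Psi>' (y, t))) \<and>
      (\<integral>\<^sup>+y. (\<integral>\<^sup>+t. ennreal ((\<Psi> (y, t) - cut v (y, t))\<^sup>2 + (\<Psi>' (y, t) - cut (dz v) (y, t))\<^sup>2) * indicator {0<..<L} t \<partial>lborel) * indicator {\<sigma><..<real T} y \<partial>lborel) \<le> ennreal e \<and>
      (\<integral>\<^sup>+y. ennreal ((\<Psi> (y, p))\<^sup>2) * indicator {\<sigma><..<real T} y \<partial>lborel) \<le> ennreal e"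
      by (rule exI[of _ \<psi>], rule exI[of _ "\<lambda>x. Dz \<psi> x"])
        (intro conjI allI 1 2 smooth_section_derivative smooth_section_continuous smooth_measurable frechet_measurable s)
  qed (use p L_pos in auto)
  \<comment> \<open>Countably many bounded ranges of \<open>r\<close> exhaust the half-line.\<close>
  have "AE r in lborel. \<forall>T::nat. r \<in> {\<sigma><..<real T} \<longrightarrow> (AE z in lborel. z \<in> {0..L} \<longrightarrow>
    cut v (r, z) = (LINT s:{0..z}|lborel. cut (dz v) (r, s)) - (LINT s:{0..p}|lborel. cut (dz v) (r, s)))"
    using T by (simp only: AE_all_countable) blast
  then show ?thesis
  proof (rule eventually_mono)
    fix r assume *: "\<forall>T::nat. r \<in> {\<sigma><..<real T} \<longrightarrow> (AE z in lborel. z \<in> {0..L} \<longrightarrow>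
      cut v (r, z) = (LINT s:{0..z}|lborel. cut (dz v) (r, s)) - (LINT s:{0..p}|lborel. cut (dz v) (r, s)))"
    show "AE z in lborel. z \<in> {0..L} \<longrightarrow>
      cut v (r, z) = (LINT s:{0..z}|lborel. cut (dz v) (r, s)) - (LINT s:{0..p}|lborel. cut (dz v) (r, s))"
    proof (cases "r > \<sigma>")
      case True
      obtain T :: nat where "r < real T" using reals_Archimedean2 by blast
      then show ?thesis using * True by (meson greaterThanLessThan_iff)
    next
      case False
      then have "cut g (r, s) = 0" for g s by (simp add: cut_simps mem_S)
      then show ?thesis by (simp add: set_lebesgue_integral_def)
    qed
  qed
qed

text \<open>The same in the \<open>r\<close>-direction: the terms \<open>snd (z, r)\<close> and
  \<open>fst (z, r)\<close> exchange the coordinates, so that the general lemma, whose lines have a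
  constant first coordinate, applies to lines of constant \<open>z\<close>.\<close>

lemma trace_primitive_r:
  assumes v: "v \<in> V1 \<sigma> L"
  shows "AE z in lborel. AE r in lborel. cut v (r, z) = (LINT s:{\<sigma>..r}|lborel. cut (dr v) (s, z))"
proof -
  note [measurable] = V1_measurable[OF v]
  have tr: "has_trace S (\<lambda>z. (\<sigma>, z)) {0..L} v (\<lambda>_. 0)" using v by (simp add: V1_def)
  have sw[measurable]: "(\<lambda>x. (snd x, fst x)) \<in> borel \<rightarrow>\<^sub>M (borel :: (real \<times> real) measure)" by measurable
  have T: "AE z in lborel. z \<in> {0<..<L} \<longrightarrow> (AE r in lborel. r \<in> {\<sigma>..\<sigma> + real (Suc T)} \<longrightarrow>
    cut v (snd (z, r), fst (z, r)) = (LINT s:{\<sigma>..r}|lborel. cut (dr v) (snd (z, s), fst (z, s)))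
       - (LINT s:{\<sigma>..\<sigma>}|lborel. cut (dr v) (snd (z, s), fst (z, s))))" for T :: nat
  proof (rule primitive_of_approximation)
    show "AE y in lborel. (\<integral>\<^sup>+t. ennreal ((cut (dr v) (snd (y, t), fst (y, t)))\<^sup>2) \<partial>lborel) < \<infinity>"
      unfolding fst_conv snd_conv
      using V1_finite(1)[OF v] by (intro section_finite W2_nn_finite) (auto simp: cut_simps)
    fix e :: real assume e: "e > 0"
    define R where "R = \<sigma> + Suc T + L + 1"
    have R: "R > 0" using L_pos sigma_pos by (simp add: R_def)
    obtain \<psi> where s: "smooth \<psi>" and l: "sdist R \<psi> v \<le> ennreal e"
      and b: "bdnorm (\<lambda>z. (\<sigma>, z)) {0..L} R \<psi> \<le> ennreal e"
      using tr R e unfolding has_trace_zero_iff by blast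
    note [measurable] = smooth_measurable[OF s] frechet_measurable[OF s]
    have [measurable]: "{\<sigma><..<\<sigma> + real (Suc T)} \<times> {0<..<L} \<in> sets borel" by (rule borel_Times) simp_all
    have "(\<integral>\<^sup>+y. (\<integral>\<^sup>+t. ennreal ((\<psi> (snd (y, t), fst (y, t)) - cut v (snd (y, t), fst (y, t)))\<^sup>2 + (Dr \<psi> (snd (y, t), fst (y, t)) - cut (dr v) (snd (y, t), fst (y, t)))\<^sup>2) * indicator {\<sigma><..<\<sigma> + real (Suc T)} t \<partial>lborel) * indicator {0<..<L} y \<partial>lborel)
       = (\<integral>\<^sup>+y. (\<integral>\<^sup>+t. ennreal ((\<psi> (t, y) - cut v (t, y))\<^sup>2 + (Dr \<psi> (t, y) - cut (dr v) (t, y))\<^sup>2) * indicator ({\<sigma><..<\<sigma> + real (Suc T)} \<times> {0<..<L}) (t, y) \<partial>lborel) \<partial>lborel)"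
      by (intro nn_integral_cong, subst nn_integral_multc[symmetric]) (auto intro!: nn_integral_cong simp: indicator_def)
    also have "\<dots> = (\<integral>\<^sup>+x. ennreal ((\<psi> x - cut v x)\<^sup>2 + (Dr \<psi> x - cut (dr v) x)\<^sup>2) * indicator ({\<sigma><..<\<sigma> + real (Suc T)} \<times> {0<..<L}) x \<partial>lborel)"
      by (rule nn_integral_iterated(2)[symmetric]) measurable
    also have "\<dots> \<le> sdist R \<psi> v"
      unfolding locnorm_def
    proof (intro nn_integral_mono)
      fix x :: "real \<times> real"
      show "ennreal ((\<psi> x - cut v x)\<^sup>2 + (Dr \<psi> x - cut (dr v) x)\<^sup>2) * indicator ({\<sigma><..<\<sigma> + real (Suc T)} \<times> {0<..<L}) x
        \<le> ennreal ((\<psi> x - v x)\<^sup>2 + (Dr \<psi> x - dr v x)\<^sup>2 + (Dz \<psi> x - dz v x)\<^sup>2) * indicator (S \<inter> ball 0 R) x"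
      proof (cases "x \<in> {\<sigma><..<\<sigma> + real (Suc T)} \<times> {0<..<L}")
        case True
        then have "x \<in> S" by (auto simp: Om_def)
        moreover have "norm (fst x, snd x) < R"
          by (rule norm_pair_less) (use True sigma_pos in \<open>auto simp: R_def\<close>)
        ultimately show ?thesis using True by (auto simp: cut_simps intro!: ennreal_leI)
      qed simp
    qed
    finally have 1: "(\<integral>\<^sup>+y. (\<integral>\<^sup>+t. ennreal ((\<psi> (snd (y, t), fst (y, t)) - cut v (snd (y, t), fst (y, t)))\<^sup>2 + (Dr \<psi> (snd (y, t), fst (y, t)) - cut (dr v) (snd (y, t), fst (y, t)))\<^sup>2) * indicator {\<sigma><..<\<sigma> + real (Suc T)} t \<partial>lborel) * indicator {0<..<L} y \<partial>lborel)
       \<le> ennreal e" using l by (rule order_trans)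
    have "(\<integral>\<^sup>+y. ennreal ((\<psi> (snd (y, \<sigma>), fst (y, \<sigma>)))\<^sup>2) * indicator {0<..<L} y \<partial>lborel) \<le> bdnorm (\<lambda>z. (\<sigma>, z)) {0..L} R \<psi>"
      unfolding bdnorm_def fst_conv snd_conv
    proof (intro nn_integral_mono mult_left_mono)
      fix y :: real
      have "norm (\<sigma>, y) < R" if "y \<in> {0<..<L}"
        by (rule norm_pair_less) (use that sigma_pos in \<open>auto simp: R_def\<close>)
      then show "indicator {0<..<L} y \<le> (indicator {s \<in> {0..L}. (\<sigma>, s) \<in> ball 0 R} y :: ennreal)"
        by (auto simp: indicator_def)
    qed simp
    then have 2: "(\<integral>\<^sup>+y. ennreal ((\<psi> (snd (y, \<sigma>), fst (y, \<sigma>)))\<^sup>2) * indicator {0<..<L} y \<partial>lborel) \<le> ennreal e" using b by (rule order_trans)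
    have 3: "(\<lambda>x. \<psi> (snd x, fst x)) \<in> borel_measurable borel" "(\<lambda>x. Dr \<psi> (snd x, fst x)) \<in> borel_measurable borel"
      using measurable_compose[OF sw smooth_measurable[OF s]] measurable_compose[OF sw frechet_measurable[OF s]] by auto
    have 4: "((\<lambda>t. \<psi> (snd (y, t), fst (y, t))) has_real_derivative Dr \<psi> (snd (y, t), fst (y, t))) (at t)"
      "continuous_on UNIV (\<lambda>t. Dr \<psi> (snd (y, t), fst (y, t)))" for y t
      unfolding fst_conv snd_conv by (rule smooth_section_derivative[OF s] smooth_section_continuous[OF s])+
    show "\<exists>\<Psi> \<Psi>'. \<Psi> \<in> borel_measurable borel \<and> \<Psi>' \<in> borel_measurable borel \<and>
      (\<forall>y t. ((\<lambda>t. \<Psi> (y, t)) has_real_derivative \<Psi>' (y, t)) (at t)) \<and> (\<forall>y. continuous_on UNIV (\<lambda>t. \<Psi>' (y, t))) \<and>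
      (\<integral>\<^sup>+y. (\<integral>\<^sup>+t. ennreal ((\<Psi> (y, t) - cut v (snd (y, t), fst (y, t)))\<^sup>2 + (\<Psi>' (y, t) - cut (dr v) (snd (y, t), fst (y, t)))\<^sup>2) * indicator {\<sigma><..<\<sigma> + real (Suc T)} t \<partial>lborel) * indicator {0<..<L} y \<partial>lborel) \<le> ennreal e \<and>
      (\<integral>\<^sup>+y. ennreal ((\<Psi> (y, \<sigma>))\<^sup>2) * indicator {0<..<L} y \<partial>lborel) \<le> ennreal e"
      by (rule exI[of _ "\<lambda>x. \<psi> (snd x, fst x)"], rule exI[of _ "\<lambda>x. Dr \<psi> (snd x, fst x)"])
        (intro conjI allI 1 2 3 4)
  qed auto
  have "AE z in lborel. \<forall>T::nat. z \<in> {0<..<L} \<longrightarrow> (AE r in lborel. r \<in> {\<sigma>..\<sigma> + real (Suc T)} \<longrightarrow>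
    cut v (r, z) = (LINT s:{\<sigma>..r}|lborel. cut (dr v) (s, z)))"
    using T unfolding AE_all_countable fst_conv snd_conv set_integral_singleton diff_zero by blast
  then show ?thesis
  proof (rule eventually_mono)
    fix z assume *: "\<forall>T::nat. z \<in> {0<..<L} \<longrightarrow> (AE r in lborel. r \<in> {\<sigma>..\<sigma> + real (Suc T)} \<longrightarrow>
      cut v (r, z) = (LINT s:{\<sigma>..r}|lborel. cut (dr v) (s, z)))"
    show "AE r in lborel. cut v (r, z) = (LINT s:{\<sigma>..r}|lborel. cut (dr v) (s, z))"
    proof (cases "z \<in> {0<..<L}")
      case True
      then have "AE r in lborel. \<forall>T. r \<in> {\<sigma>..\<sigma> + real (Suc T)} \<longrightarrow> cut v (r, z) = (LINT s:{\<sigma>..r}|lborel. cut (dr v) (s, z))"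
        using * by (simp only: AE_all_countable) blast
      then show ?thesis
      proof (rule eventually_mono)
        fix r assume r: "\<forall>T. r \<in> {\<sigma>..\<sigma> + real (Suc T)} \<longrightarrow> cut v (r, z) = (LINT s:{\<sigma>..r}|lborel. cut (dr v) (s, z))"
        show "cut v (r, z) = (LINT s:{\<sigma>..r}|lborel. cut (dr v) (s, z))"
        proof (cases "r \<ge> \<sigma>")
          case True
          obtain T :: nat where "r - \<sigma> < real T" using reals_Archimedean2 by blast
          then have "r \<in> {\<sigma>..\<sigma> + real (Suc T)}" using True by simp
          then show ?thesis using r by blast
        next
          case False
          then show ?thesis by (simp add: cut_simps mem_S set_lebesgue_integral_def)
        qed
      qed
    next
      case False
      then have "cut g (s, z) = 0" for g s by (simp add: cut_simps mem_S)
      then show ?thesis by (simp add: set_lebesgue_integral_def)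
    qed
  qed
qed

text \<open>From here on the estimates use the representation on lines. Traces themselves return for
  \<open>V2_end\<close> and for the linearity and closedness of the spaces.\<close>

lemma V1_slice:
  assumes v: "v \<in> V1 \<sigma> L"
  shows "slice (cut v) (cut (dr v)) (cut (dz v))"
proof -
  have tr: "has_trace S (\<lambda>r. (r, 0)) {\<sigma>..} v (\<lambda>_. 0)" using v by (simp add: V1_def)
  have "AE r in lborel. AE z in lborel. z \<in> {0..L} \<longrightarrow> cut v (r, z) = (LINT s:{0..z}|lborel. cut (dz v) (r, s))"
    using trace_primitive_z[OF v _ tr] L_pos unfolding set_integral_singleton diff_zero by simp
  then show ?thesis
    unfolding slice_def using V1_measurable[OF v] trace_primitive_r[OF v] V1_finite[OF v, THEN W2_nn_finite]
    by (simp add: cut_simps)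
qed

text \<open>The primitives based at \<open>z = 0\<close> and at \<open>z = L\<close> represent the
  same function. Their difference is the integral over \<open>{0..L}\<close>, constant along the
  line, and it vanishes for almost every \<open>z\<close> in an interval of positive length.\<close>

lemma V2_end:
  assumes "(u, w) \<in> V2 \<sigma> L"
  shows "AE r in lborel. (LINT s:{0..L}|lborel. cut (dz w) (r, s)) = 0"
proof -
  have w: "w \<in> V1 \<sigma> L" and tr: "has_trace S (\<lambda>r. (r, L)) {\<sigma>..} w (\<lambda>_. 0)" using assms by (auto simp: V2_def)
  have "L \<in> {0..L}" using L_pos by simp
  from trace_primitive_z[OF w this tr] show ?thesis
    using slice_z[OF V1_slice[OF w]]
  proof eventually_elim
    case (elim r)
    have "AE z in lborel. z \<in> {0..L} \<longrightarrow> (LINT s:{0..L}|lborel. cut (dz w) (r, s)) = 0"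
      using elim by eventually_elim simp
    then have "(LINT s:{0..L}|lborel. cut (dz w) (r, s)) \<noteq> 0 \<longrightarrow> (AE z in lborel. z \<notin> {0..L})"
      by (intro impI) (erule eventually_mono, blast)
    moreover have "\<not> (AE z in lborel. z \<notin> {0..L})"
    proof
      assume "AE z in lborel. z \<notin> {0..L}"
      then have "emeasure lborel {0..L} = 0" by (subst (asm) AE_iff_measurable[where N = "{0..L}"]) auto
      then show False using L_pos by (simp add: ennreal_eq_0_iff)
    qed
    ultimately show ?case by blast
  qed
qed

section \<open>Linearity and closedness of the trace conditions\<close>

lemma cut_add: "cut (\<lambda>x. f x + g x) = (\<lambda>x. cut f x + cut g x)"
  and cut_scale: "cut (\<lambda>x. k * f x) = (\<lambda>x. k * cut f x)"
  and cut_diff: "cut (\<lambda>x. f x - g x) = (\<lambda>x. cut f x - cut g x)"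
  by (auto simp: cut_def fun_eq_iff algebra_simps)

lemma cut_borel: "f \<in> borel_measurable borel \<Longrightarrow> cut f \<in> borel_measurable borel"
  unfolding cut_def by measurable

lemma cut_id: "(\<And>x. x \<notin> S \<Longrightarrow> f x = 0) \<Longrightarrow> cut f = f"
  by (auto simp: cut_def fun_eq_iff indicator_def)

text \<open>\<open>dr\<close> and \<open>dz\<close> are choices by \<open>SOME\<close>; this records
  that a weak derivative existed to be chosen.\<close>

definition wd :: "(real \<times> real \<Rightarrow> real) \<Rightarrow> bool" where
  "wd f \<longleftrightarrow> has_weak_deriv S (1, 0) f (dr f) \<and> has_weak_deriv S (0, 1) f (dz f)"

lemma wdI:
  assumes "has_weak_deriv S (1, 0) f g" "has_weak_deriv S (0, 1) f h"
  shows "wd f" "AE x in lborel. x \<in> S \<longrightarrow> dr f x = g x" "AE x in lborel. x \<in> S \<longrightarrow> dz f x = h x"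
  using has_weak_deriv_weak_deriv[OF assms(1)] has_weak_deriv_weak_deriv[OF assms(2)]
    weak_deriv_AE[OF open_S assms(1)] weak_deriv_AE[OF open_S assms(2)]
  unfolding wd_def d_r_def d_z_def by auto

lemma V1_wd: "v \<in> V1 \<sigma> L \<Longrightarrow> wd v"
  using V1_weak_deriv unfolding wd_def by blast

lemma wd_measurable:
  assumes "wd f"
  shows "cut f \<in> borel_measurable borel" "cut (dr f) \<in> borel_measurable borel" "cut (dz f) \<in> borel_measurable borel"
  using assms has_weak_derivD(1,2) cut_measurable unfolding wd_def by blast+

lemma wd_combine:
  assumes "wd f" "wd g"
  shows "wd (\<lambda>x. f x + k * g x)"
    and "AE x in lborel. x \<in> S \<longrightarrow> dr (\<lambda>x. f x + k * g x) x = dr f x + k * dr g x"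
    and "AE x in lborel. x \<in> S \<longrightarrow> dz (\<lambda>x. f x + k * g x) x = dz f x + k * dz g x"
proof -
  have "has_weak_deriv S (1, 0) (\<lambda>x. f x + k * g x) (\<lambda>x. dr f x + k * dr g x)"
    "has_weak_deriv S (0, 1) (\<lambda>x. f x + k * g x) (\<lambda>x. dz f x + k * dz g x)"
    using assms unfolding wd_def by (auto intro: has_weak_deriv_add[OF _ has_weak_deriv_cmult])
  note * = wdI[OF this]
  show "wd (\<lambda>x. f x + k * g x)" by (rule *(1))
  show "AE x in lborel. x \<in> S \<longrightarrow> dr (\<lambda>x. f x + k * g x) x = dr f x + k * dr g x" by (rule *(2))
  show "AE x in lborel. x \<in> S \<longrightarrow> dz (\<lambda>x. f x + k * g x) x = dz f x + k * dz g x" by (rule *(3))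
qed

lemma locnorm_scale:
  assumes [measurable]: "cut p \<in> borel_measurable borel" "cut q \<in> borel_measurable borel" "cut s \<in> borel_measurable borel"
  shows "locnorm R (\<lambda>x. k * p x) (\<lambda>x. k * q x) (\<lambda>x. k * s x) = ennreal (k\<^sup>2) * locnorm R p q s"
proof -
  have [measurable]: "S \<inter> ball 0 R \<in> sets borel" using open_S by auto
  have "locnorm R (\<lambda>x. k * p x) (\<lambda>x. k * q x) (\<lambda>x. k * s x)
    = (\<integral>\<^sup>+x. ennreal (k\<^sup>2) * (ennreal ((cut p x)\<^sup>2 + (cut q x)\<^sup>2 + (cut s x)\<^sup>2) * indicator (S \<inter> ball 0 R) x) \<partial>lborel)"
    unfolding locnorm_def
  proof (intro nn_integral_cong)
    fix x
    have "ennreal ((k * p x)\<^sup>2 + (k * q x)\<^sup>2 + (k * s x)\<^sup>2) = ennreal (k\<^sup>2 * ((p x)\<^sup>2 + (q x)\<^sup>2 + (s x)\<^sup>2))"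
      by (simp add: power_mult_distrib distrib_left)
    also have "\<dots> = ennreal (k\<^sup>2) * ennreal ((p x)\<^sup>2 + (q x)\<^sup>2 + (s x)\<^sup>2)" by (rule ennreal_mult) auto
    finally show "ennreal ((k * p x)\<^sup>2 + (k * q x)\<^sup>2 + (k * s x)\<^sup>2) * indicator (S \<inter> ball 0 R) x
      = ennreal (k\<^sup>2) * (ennreal ((cut p x)\<^sup>2 + (cut q x)\<^sup>2 + (cut s x)\<^sup>2) * indicator (S \<inter> ball 0 R) x)"
      by (cases "x \<in> S \<inter> ball 0 R") (auto simp: cut_simps)
  qed
  also have "\<dots> = ennreal (k\<^sup>2) * (\<integral>\<^sup>+x. ennreal ((cut p x)\<^sup>2 + (cut q x)\<^sup>2 + (cut s x)\<^sup>2) * indicator (S \<inter> ball 0 R) x \<partial>lborel)"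
    by (rule nn_integral_cmult) measurable
  also have "(\<integral>\<^sup>+x. ennreal ((cut p x)\<^sup>2 + (cut q x)\<^sup>2 + (cut s x)\<^sup>2) * indicator (S \<inter> ball 0 R) x \<partial>lborel) = locnorm R p q s"
    unfolding locnorm_def by (intro nn_integral_cong) (auto simp: cut_simps split: split_indicator)
  finally show ?thesis .
qed

lemma bdnorm_scale:
  assumes c: "c \<in> borel_measurable borel" and [measurable]: "I \<in> sets borel" and s: "smooth \<psi>"
  shows "bdnorm c I R (\<lambda>x. k * \<psi> x) = ennreal (k\<^sup>2) * bdnorm c I R \<psi>"
proof -
  have [measurable]: "(\<lambda>x. \<psi> (c x)) \<in> borel_measurable borel"
    using measurable_compose[OF c smooth_measurable] s by auto
  have [measurable]: "{s \<in> I. c s \<in> ball 0 R} \<in> sets borel"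
  proof -
    have "c -` ball 0 R \<inter> space borel \<in> sets borel" using c by (rule measurable_sets) auto
    then have "I \<inter> c -` ball 0 R \<in> sets borel" by auto
    then show ?thesis by (simp add: Collect_conj_eq vimage_def)
  qed
  show ?thesis
    unfolding bdnorm_def power_mult_distrib ennreal_mult[OF zero_le_power2 zero_le_power2] mult.assoc
    by (rule nn_integral_cmult) measurable
qed

text \<open>Smooth approximations of \<open>f\<close> and \<open>g\<close> combine linearly. The
  form \<open>f + k g\<close> covers sums and scalar multiples together.\<close>

lemma trace_combine:
  assumes c: "c \<in> borel_measurable borel" and I: "I \<in> sets borel" and f: "wd f" and g: "wd g"
    and tf: "has_trace S c I f (\<lambda>_. 0)" and tg: "has_trace S c I g (\<lambda>_. 0)"
  shows "has_trace S c I (\<lambda>x. f x + k * g x) (\<lambda>_. 0)"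
  unfolding has_trace_zero_iff
proof (intro allI impI)
  fix R e :: real assume R: "R > 0" and e: "e > 0"
  \<comment> \<open>Chosen so that \<open>2 * (1 + k^2) * e'\<close> equals
    \<open>e / 2\<close>.\<close>
  define e' where "e' = (e / 4) / (1 + k\<^sup>2)"
  have k: "0 < 1 + k\<^sup>2" by (simp add: add_pos_nonneg)
  have e': "e' > 0" using e k by (simp add: e'_def)
  obtain p where p: "smooth p" "sdist R p f \<le> ennreal e'"
    "bdnorm c I R p \<le> ennreal e'" using tf R e' unfolding has_trace_zero_iff by blast
  obtain q where q: "smooth q" "sdist R q g \<le> ennreal e'"
    "bdnorm c I R q \<le> ennreal e'" using tg R e' unfolding has_trace_zero_iff by blast
  let ?h = "\<lambda>x. p x + k * q x"
  have kq: "smooth (\<lambda>x. k * q x)" by (rule smooth_mult[OF smooth_const q(1)])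
  have h: "smooth ?h" by (rule smooth_add[OF p(1) kq])
  have D: "frechet_derivative ?h (at x) b = frechet_derivative p (at x) b + k * frechet_derivative q (at x) b" for x b
    using frechet_add[OF p(1) kq] frechet_mult[OF smooth_const[of k] q(1)] by (simp add: frechet_derivative_const)
  note [measurable] = wd_measurable[OF f] wd_measurable[OF g] cut_borel[OF smooth_measurable[OF p(1)]] cut_borel[OF smooth_measurable[OF q(1)]]
    cut_borel[OF frechet_measurable[OF p(1)]] cut_borel[OF frechet_measurable[OF q(1)]]
  have sum: "2 * ennreal e' + 2 * (ennreal (k\<^sup>2) * ennreal e') \<le> ennreal e"
  proof -
    have "2 * ennreal e' = ennreal (2 * e')" "ennreal (k\<^sup>2) * ennreal e' = ennreal (k\<^sup>2 * e')"
      using e' by (simp_all add: ennreal_mult)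
    moreover have "2 * ennreal (k\<^sup>2 * e') = ennreal (2 * (k\<^sup>2 * e'))" using e' by (simp add: ennreal_mult)
    moreover have "ennreal (2 * e') + ennreal (2 * (k\<^sup>2 * e')) = ennreal (2 * e' + 2 * (k\<^sup>2 * e'))"
      using e' by (intro ennreal_plus[symmetric]) auto
    moreover have "2 * e' + 2 * (k\<^sup>2 * e') = 2 * ((1 + k\<^sup>2) * e')" by (simp add: algebra_simps)
    moreover have "(1 + k\<^sup>2) * e' = e / 4"
    proof -
      have gen: "y * (x / y) = x" if "y > 0" for x y :: real using that by simp
      show ?thesis unfolding e'_def by (rule gen[OF k])
    qed
    moreover have "ennreal (2 * (e / 4)) \<le> ennreal e" using e by (intro ennreal_leI) simp
    ultimately show ?thesis by simp
  qed
  have "locnorm R (\<lambda>x. ?h x - (f x + k * g x)) (\<lambda>x. Dr ?h x - dr (\<lambda>x. f x + k * g x) x) (\<lambda>x. Dz ?h x - dz (\<lambda>x. f x + k * g x) x)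
     = locnorm R (\<lambda>x. (p x - f x) + k * (q x - g x)) (\<lambda>x. (Dr p x - dr f x) + k * (Dr q x - dr g x)) (\<lambda>x. (Dz p x - dz f x) + k * (Dz q x - dz g x))"
    by (rule locnorm_eq, rule eventually_elim2[OF wd_combine(2,3)[OF f g, of k]]) (simp add: D algebra_simps)
  also have "\<dots> \<le> 2 * sdist R p f
      + 2 * locnorm R (\<lambda>x. k * (q x - g x)) (\<lambda>x. k * (Dr q x - dr g x)) (\<lambda>x. k * (Dz q x - dz g x))"
    by (rule locnorm_add) (simp_all only: cut_scale cut_diff, measurable)
  also have "\<dots> = 2 * sdist R p f
      + 2 * (ennreal (k\<^sup>2) * sdist R q g)"
    by (subst locnorm_scale) (simp_all only: cut_diff, measurable)
  also have "\<dots> \<le> 2 * ennreal e' + 2 * (ennreal (k\<^sup>2) * ennreal e')"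
    by (intro add_mono mult_left_mono p q) auto
  finally have 1: "locnorm R (\<lambda>x. ?h x - (f x + k * g x)) (\<lambda>x. Dr ?h x - dr (\<lambda>x. f x + k * g x) x) (\<lambda>x. Dz ?h x - dz (\<lambda>x. f x + k * g x) x) \<le> ennreal e"
    using sum by (rule order_trans)
  have "bdnorm c I R ?h \<le> 2 * bdnorm c I R p + 2 * bdnorm c I R (\<lambda>x. k * q x)"
    by (rule bdnorm_add[OF c I p(1) kq])
  also have "\<dots> = 2 * bdnorm c I R p + 2 * (ennreal (k\<^sup>2) * bdnorm c I R q)"
    by (simp only: bdnorm_scale[OF c I q(1)])
  also have "\<dots> \<le> 2 * ennreal e' + 2 * (ennreal (k\<^sup>2) * ennreal e')"
    by (intro add_mono mult_left_mono p q) auto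
  finally have 2: "bdnorm c I R ?h \<le> ennreal e" using sum by (rule order_trans)
  show "\<exists>\<psi>. smooth \<psi> \<and>
       locnorm R (\<lambda>x. \<psi> x - (f x + k * g x)) (\<lambda>x. Dr \<psi> x - dr (\<lambda>x. f x + k * g x) x) (\<lambda>x. Dz \<psi> x - dz (\<lambda>x. f x + k * g x) x) \<le> ennreal e \<and>
       bdnorm c I R \<psi> \<le> ennreal e"
    by (rule exI[of _ ?h]) (intro conjI h 1 2)
qed

text \<open>Triangle inequality: a smooth approximation of \<open>g\<close> with small boundary
  values also approximates \<open>f\<close>. Closeness of \<open>g\<close> to \<open>f\<close> is
  measured in the interior only, the boundary values being those of the smooth function, so no trace
  inequality enters.\<close>

lemma trace_closed:
  assumes f: "wd f"
    and app: "\<And>R e. R > 0 \<Longrightarrow> e > 0 \<Longrightarrow> \<exists>g. wd g \<and> has_trace S c I g (\<lambda>_. 0) \<and>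
      locnorm R (\<lambda>x. g x - f x) (\<lambda>x. dr g x - dr f x) (\<lambda>x. dz g x - dz f x) \<le> ennreal e"
  shows "has_trace S c I f (\<lambda>_. 0)"
  unfolding has_trace_zero_iff
proof (intro allI impI)
  fix R e :: real assume R: "R > 0" and e: "e > 0"
  define e' where "e' = e / 4"
  have e': "e' > 0" using e by (simp add: e'_def)
  obtain g where g: "wd g" and tg: "has_trace S c I g (\<lambda>_. 0)"
    and gf: "locnorm R (\<lambda>x. g x - f x) (\<lambda>x. dr g x - dr f x) (\<lambda>x. dz g x - dz f x) \<le> ennreal e'"
    using app[OF R e'] by blast
  obtain q where q: "smooth q" "sdist R q g \<le> ennreal e'"
    "bdnorm c I R q \<le> ennreal e'" using tg R e' unfolding has_trace_zero_iff by blast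
  note [measurable] = wd_measurable[OF f] wd_measurable[OF g] cut_borel[OF smooth_measurable[OF q(1)]]
    cut_borel[OF frechet_measurable[OF q(1)]]
  have "sdist R q f
    = locnorm R (\<lambda>x. (q x - g x) + (g x - f x)) (\<lambda>x. (Dr q x - dr g x) + (dr g x - dr f x)) (\<lambda>x. (Dz q x - dz g x) + (dz g x - dz f x))"
    by simp
  also have "\<dots> \<le> 2 * sdist R q g
    + 2 * locnorm R (\<lambda>x. g x - f x) (\<lambda>x. dr g x - dr f x) (\<lambda>x. dz g x - dz f x)"
    by (rule locnorm_add) (simp_all only: cut_diff, measurable)
  also have "\<dots> \<le> 2 * ennreal e' + 2 * ennreal e'"
    by (intro add_mono mult_left_mono q gf) auto
  also have "\<dots> = ennreal e"
  proof -
    have "2 * ennreal e' = ennreal (2 * e')" using e' by (simp add: ennreal_mult)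
    moreover have "ennreal (2 * e') + ennreal (2 * e') = ennreal (2 * e' + 2 * e')" using e' by (intro ennreal_plus[symmetric]) auto
    ultimately show ?thesis by (simp add: e'_def)
  qed
  finally have 1: "sdist R q f \<le> ennreal e" .
  have 2: "bdnorm c I R q \<le> ennreal e" using q(3) by (rule order_trans) (use e in \<open>simp add: e'_def ennreal_leI\<close>)
  show "\<exists>\<psi>. smooth \<psi> \<and> sdist R \<psi> f \<le> ennreal e \<and> bdnorm c I R \<psi> \<le> ennreal e"
    using q(1) 1 2 by blast
qed

lemma has_trace_zero: "has_trace S c I (\<lambda>_. 0) (\<lambda>_. 0)" if "wd (\<lambda>_. 0)"
    "AE x in lborel. x \<in> S \<longrightarrow> dr (\<lambda>_. 0) x = 0" "AE x in lborel. x \<in> S \<longrightarrow> dz (\<lambda>_. 0) x = 0"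
  unfolding has_trace_zero_iff
proof (intro allI impI exI[of _ "\<lambda>_. 0"] conjI)
  fix R e :: real assume "R > 0" "e > 0"
  have "locnorm R (\<lambda>x. 0 - 0) (\<lambda>x. Dr (\<lambda>_. 0) x - dr (\<lambda>_. 0) x) (\<lambda>x. Dz (\<lambda>_. 0) x - dz (\<lambda>_. 0) x) = locnorm R (\<lambda>_. 0) (\<lambda>_. 0) (\<lambda>_. 0)"
    by (rule locnorm_eq, rule eventually_elim2[OF that(2,3)]) (simp add: frechet_derivative_const)
  then show "locnorm R (\<lambda>x. 0 - 0) (\<lambda>x. Dr (\<lambda>_. 0) x - dr (\<lambda>_. 0) x) (\<lambda>x. Dz (\<lambda>_. 0) x - dz (\<lambda>_. 0) x) \<le> ennreal e"
    by (simp add: locnorm_def)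
  show "bdnorm c I R (\<lambda>_. 0) \<le> ennreal e" by (simp add: bdnorm_def)
qed (rule smooth_const)

lemma has_weak_deriv_zero: "has_weak_deriv S b (\<lambda>_. 0) (\<lambda>_. 0)"
  by (simp add: has_weak_deriv_def loc_integrable_def set_integrable_def set_lebesgue_integral_def)

lemma V1I:
  assumes f: "wd f" and "W2 (cut (dr f))" "W2 (cut (dz f))"
    and "has_trace S (\<lambda>r. (r, 0)) {\<sigma>..} f (\<lambda>_. 0)" "has_trace S (\<lambda>z. (\<sigma>, z)) {0..L} f (\<lambda>_. 0)"
  shows "f \<in> V1 \<sigma> L"
proof -
  have "integrable lborel (\<lambda>x. (cut (dr f) x)\<^sup>2 * fst x + (cut (dz f) x)\<^sup>2 * fst x)"
    using assms(2,3) unfolding W2_def by (intro Bochner_Integration.integrable_add) auto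
  also have "(\<lambda>x. (cut (dr f) x)\<^sup>2 * fst x + (cut (dz f) x)\<^sup>2 * fst x)
     = (\<lambda>x. indicator S x *\<^sub>R (case x of (r, z) \<Rightarrow> ((dr f (r, z))\<^sup>2 + (dz f (r, z))\<^sup>2) * r))"
    by (auto simp: cut_def fun_eq_iff indicator_def algebra_simps)
  finally have "set_integrable lborel S (\<lambda>(r, z). ((dr f (r, z))\<^sup>2 + (dz f (r, z))\<^sup>2) * r)"
    by (simp only: set_integrable_def)
  then show ?thesis using assms(1,4,5) unfolding V1_def wd_def by blast
qed

lemma V1_traces:
  assumes "v \<in> V1 \<sigma> L"
  shows "has_trace S (\<lambda>r. (r, 0)) {\<sigma>..} v (\<lambda>_. 0)" "has_trace S (\<lambda>z. (\<sigma>, z)) {0..L} v (\<lambda>_. 0)"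
  using assms by (simp_all add: V1_def)

lemma curve_measurable: "(\<lambda>r. (r, p)) \<in> borel_measurable (borel :: real measure)" "(\<lambda>z. (q, z)) \<in> borel_measurable (borel :: real measure)" for p q :: real
  by measurable

text \<open>Weak derivatives are determined up to null sets; this transfers square integrability and
  the class to the chosen representative.\<close>

lemma W2_cut_cong:
  assumes f: "W2 g" and "cut f \<in> borel_measurable borel" and "AE x in lborel. x \<in> S \<longrightarrow> f x = g x"
  shows "W2 (cut f)" "cls (cut f) = cls g"
proof -
  have ae: "AE x in lborel. cut f x = g x"
    using assms(3) by eventually_elim (use W2_zero[OF f] in \<open>auto simp: cut_def indicator_def\<close>)
  show W: "W2 (cut f)"
  proof (rule W2I[OF assms(2)])
    have "nnw (cut f) = nnw g"
      using ae by (intro nn_integral_cong_AE) auto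
    then show "nnw (cut f) < \<infinity>" using W2_nn_finite[OF f] by simp
  qed (simp add: cut_simps)
  show "cls (cut f) = cls g" using cls_eq_iff[OF W f] ae by simp
qed

text \<open>Values and weak gradient as classes, so that the norm of a jet is the weighted H1 norm.
  By the Poincare inequality this is equivalent to the norm of \<open>V1\<close>.\<close>

definition jet :: "(real \<times> real \<Rightarrow> real) \<Rightarrow> (real \<times> real) l2 \<times> (real \<times> real) l2 \<times> (real \<times> real) l2" where
  "jet f = (cls (cut f), cls (cut (dr f)), cls (cut (dz f)))"

lemma V1_combine:
  assumes f: "f \<in> V1 \<sigma> L" and g: "g \<in> V1 \<sigma> L"
  shows "(\<lambda>x. f x + k * g x) \<in> V1 \<sigma> L" "jet (\<lambda>x. f x + k * g x) = jet f + k *\<^sub>R jet g"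
proof -
  note c = wd_combine[OF V1_wd[OF f] V1_wd[OF g], of k]
  note m = wd_measurable[OF c(1)]
  note wf = slice_W2[OF V1_slice[OF f]] and wg = slice_W2[OF V1_slice[OF g]]
  have r: "W2 (\<lambda>x. cut (dr f) x + k * cut (dr g) x)" by (rule W2_add[OF wf(2) W2_scale[OF wg(2)]])
  have z: "W2 (\<lambda>x. cut (dz f) x + k * cut (dz g) x)" by (rule W2_add[OF wf(3) W2_scale[OF wg(3)]])
  have ar: "AE x in lborel. x \<in> S \<longrightarrow> dr (\<lambda>x. f x + k * g x) x = cut (dr f) x + k * cut (dr g) x"
    using c(2) by eventually_elim (simp add: cut_simps)
  have az: "AE x in lborel. x \<in> S \<longrightarrow> dz (\<lambda>x. f x + k * g x) x = cut (dz f) x + k * cut (dz g) x"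
    using c(3) by eventually_elim (simp add: cut_simps)
  note R = W2_cut_cong[OF r m(2) ar] and Z = W2_cut_cong[OF z m(3) az]
  show "(\<lambda>x. f x + k * g x) \<in> V1 \<sigma> L"
    by (rule V1I[OF c(1) R(1) Z(1)
        trace_combine[OF curve_measurable(1) _ V1_wd[OF f] V1_wd[OF g] V1_traces(1)[OF f] V1_traces(1)[OF g]]
        trace_combine[OF curve_measurable(2) _ V1_wd[OF f] V1_wd[OF g] V1_traces(2)[OF f] V1_traces(2)[OF g]]]) simp_all
  show "jet (\<lambda>x. f x + k * g x) = jet f + k *\<^sub>R jet g"
    unfolding jet_def R(2) Z(2) cut_add cut_scale
    by (simp add: cls_add cls_scale wf wg W2_scale)
qed

lemma zero_V1: "(\<lambda>_. 0) \<in> V1 \<sigma> L" "jet (\<lambda>_. 0) = 0" "has_trace S c I (\<lambda>_. 0) (\<lambda>_. 0)"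
proof -
  note z = wdI[OF has_weak_deriv_zero has_weak_deriv_zero]
  show t: "has_trace S c I (\<lambda>_. 0) (\<lambda>_. 0)" for c I by (rule has_trace_zero[OF z])
  have W0: "W2 (\<lambda>_. 0)" by (simp add: W2_def)
  note R = W2_cut_cong[OF W0 wd_measurable(2)[OF z(1)] z(2)] and Z = W2_cut_cong[OF W0 wd_measurable(3)[OF z(1)] z(3)]
  show V: "(\<lambda>_. 0) \<in> V1 \<sigma> L" by (rule V1I[OF z(1) R(1) Z(1) t t])
  have "cut (\<lambda>_. 0) = (\<lambda>_. 0)" by (simp add: cut_def fun_eq_iff)
  moreover have "cls (\<lambda>_. 0) = 0" using cls_scale[OF W0, of 0] by simp
  ultimately show "jet (\<lambda>_. 0) = 0" by (simp add: jet_def R Z zero_prod_def)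
qed

section \<open>The closed subspace of jets\<close>

lemma W2_indicator_compact:
  assumes "compact K" "K \<subseteq> S" shows "W2 (indicator K)"
proof (unfold W2_def, intro conjI allI impI)
  have "integrable lborel (\<lambda>x. indicator K x *\<^sub>R fst x)"
    using assms(1) by (intro borel_integrable_compact continuous_intros)
  also have "(\<lambda>x. indicator K x *\<^sub>R fst x) = (\<lambda>x. (indicator K x)\<^sup>2 * fst x)"
    by (auto simp: indicator_def fun_eq_iff)
  finally show "integrable lborel (\<lambda>x. (indicator K x)\<^sup>2 * fst x)" .
qed (use assms in \<open>auto simp: indicator_def compact_imp_closed borel_closed\<close>)

lemma inverse_fst_bound: "x \<in> S \<Longrightarrow> \<bar>1 / fst x\<bar> \<le> 1 / \<sigma>"
  using fst_ge[of x] sigma_pos by (simp add: frac_le del: divide_le_cancel)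

lemma W2_div: "W2 f \<Longrightarrow> W2 (\<lambda>x. 1 / fst x * f x)"
  by (rule W2_bounded[OF _ _ inverse_fst_bound]) measurable

lemma W2_loc_integrable:
  assumes f: "W2 f" shows "loc_integrable S f"
  unfolding loc_integrable_def
proof (intro allI impI)
  fix K assume K: "compact K \<and> K \<subseteq> S"
  then have "W2 (\<lambda>x. 1 / fst x * indicator K x)" by (intro W2_div W2_indicator_compact) auto
  then have "integrable lborel (\<lambda>x. f x * (1 / fst x * indicator K x) * fst x)" by (rule W2_mult[OF f])
  moreover have "f x * (1 / fst x * indicator K x) * fst x = indicator K x *\<^sub>R f x" for x
    using K fst_ge[of x] sigma_pos by (auto simp: indicator_def)
  ultimately show "set_integrable lborel K f" by (simp add: set_integrable_def)
qed

lemma W2_test: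
  assumes "test_function S \<psi>" shows "W2 \<psi>"
proof -
  obtain K where K: "compact K" "K \<subseteq> S" "\<And>x. x \<notin> K \<Longrightarrow> \<psi> x = 0" and s: "smooth \<psi>"
    using assms by (auto simp: test_function_def)
  have "bounded (\<psi> ` K)" using K(1) by (intro compact_imp_bounded compact_continuous_image smooth_continuous s)
  then obtain B where B: "\<And>x. x \<in> K \<Longrightarrow> \<bar>\<psi> x\<bar> \<le> B" by (auto simp: bounded_iff)
  have "W2 (\<lambda>x. \<psi> x * indicator K x)"
  proof (rule W2_bounded[OF W2_indicator_compact[OF K(1,2)] smooth_measurable[OF s]])
    fix x show "\<bar>\<psi> x\<bar> \<le> \<bar>B\<bar>" using B[of x] K(3)[of x] by (cases "x \<in> K") auto
  qed
  moreover have "(\<lambda>x. \<psi> x * indicator K x) = \<psi>" using K(3) by (auto simp: fun_eq_iff indicator_def)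
  ultimately show ?thesis by simp
qed

lemma inner_cls_test:
  assumes "W2 f" "test_function S \<psi>"
  shows "inner (cls f) (cls (\<lambda>x. 1 / fst x * \<psi> x)) = (LINT x|lborel. f x * \<psi> x)"
proof -
  have "inner (cls f) (cls (\<lambda>x. 1 / fst x * \<psi> x)) = (LINT x|lborel. f x * (1 / fst x * \<psi> x) * fst x)"
    by (rule inner_cls[OF assms(1) W2_div[OF W2_test[OF assms(2)]]])
  also have "(\<lambda>x. f x * (1 / fst x * \<psi> x) * fst x) = (\<lambda>x. f x * \<psi> x)"
  proof
    fix x show "f x * (1 / fst x * \<psi> x) * fst x = f x * \<psi> x"
      using W2_zero[OF assms(1), of x] fst_ge[of x] sigma_pos by (cases "x \<in> S") auto
  qed
  finally show ?thesis .
qed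

text \<open>A general element of the L2 space of the plane may live outside the strip and is then
  not recovered from \<open>fn\<close>. A limit of classes from the strip is:
  \<open>a - cls (fn a)\<close> is orthogonal to all such classes, hence to their limit
  \<open>a\<close>, and finally to itself.\<close>

lemma cls_fn_limit:
  assumes W: "\<And>n. W2 (f n)" and l: "(\<lambda>n. cls (f n)) \<longlonglongrightarrow> a"
  shows "cls (fn a) = a"
proof -
  have i: "inner (cls (fn a)) (cls g) = inner a (cls g)" if "W2 g" for g
    by (rule trans[OF inner_cls[OF W2_fn that] inner_cls_right[OF that, symmetric]])
  have "(\<lambda>n. inner (a - cls (fn a)) (cls (f n))) \<longlonglongrightarrow> inner (a - cls (fn a)) a"
    by (intro tendsto_intros l)
  moreover have "inner (a - cls (fn a)) (cls (f n)) = 0" for n using i[OF W] by (simp add: inner_diff_left)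
  ultimately have "inner (a - cls (fn a)) a = 0" by (simp add: LIMSEQ_const_iff)
  moreover have "inner (a - cls (fn a)) (cls (fn a)) = 0" using i[OF W2_fn] by (simp add: inner_diff_left)
  ultimately have "inner (a - cls (fn a)) (a - cls (fn a)) = 0" by (simp add: inner_diff_right)
  then show ?thesis by simp
qed

text \<open>The defining identity pairs \<open>f n\<close> and \<open>g n\<close> with fixed
  elements, so it passes to the limit; \<open>1 / fst x\<close> compensates the weight in the inner
  product.\<close>

lemma weak_deriv_limit:
  assumes f: "\<And>n. has_weak_deriv S b (f n) (g n)" and W: "\<And>n. W2 (cut (f n))" "\<And>n. W2 (cut (g n))"
    and l: "(\<lambda>n. cls (cut (f n))) \<longlonglongrightarrow> p" "(\<lambda>n. cls (cut (g n))) \<longlonglongrightarrow> q"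
  shows "has_weak_deriv S b (fn p) (fn q)"
  unfolding has_weak_deriv_iff
proof (intro conjI allI impI W2_loc_integrable W2_fn)
  fix \<psi> assume t: "test_function S \<psi>"
  let ?d = "\<lambda>x. frechet_derivative \<psi> (at x) b"
  have t': "test_function S ?d" by (rule test_function_frechet[OF t])
  have c: "(LINT x|lborel. cut h x * \<eta> x) = (LINT x|lborel. h x * \<eta> x)" if "test_function S \<eta>" for h \<eta>
  proof -
    have "\<eta> x = 0" if "x \<notin> S" for x using \<open>test_function S \<eta>\<close> that unfolding test_function_def by blast
    then have "cut h x * \<eta> x = h x * \<eta> x" for x by (cases "x \<in> S") (auto simp: cut_simps)
    then show ?thesis by (simp only:)
  qed
  have e: "inner (cls (cut (f n))) (cls (\<lambda>x. 1 / fst x * ?d x)) = - inner (cls (cut (g n))) (cls (\<lambda>x. 1 / fst x * \<psi> x))" for n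
    using has_weak_derivD(3)[OF f t, of n] by (simp only: inner_cls_test[OF W(1) t'] inner_cls_test[OF W(2) t] c[OF t] c[OF t'])
  have "(\<lambda>n. inner (cls (cut (f n))) (cls (\<lambda>x. 1 / fst x * ?d x))) \<longlonglongrightarrow> inner p (cls (\<lambda>x. 1 / fst x * ?d x))"
    by (intro tendsto_intros l)
  moreover have "(\<lambda>n. - inner (cls (cut (g n))) (cls (\<lambda>x. 1 / fst x * \<psi> x))) \<longlonglongrightarrow> - inner q (cls (\<lambda>x. 1 / fst x * \<psi> x))"
    by (intro tendsto_intros l)
  ultimately have "inner p (cls (\<lambda>x. 1 / fst x * ?d x)) = - inner q (cls (\<lambda>x. 1 / fst x * \<psi> x))"
    unfolding e by (rule LIMSEQ_unique)
  then show "(LINT x|lborel. fn p x * ?d x) = - (LINT x|lborel. fn q x * \<psi> x)"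
    using inner_cls_test[OF W2_fn t', of p] inner_cls_test[OF W2_fn t, of q]
    unfolding cls_fn_limit[OF W(1) l(1)] cls_fn_limit[OF W(2) l(2)] by (simp only:)
qed

text \<open>Completeness of the space: the limits are represented by \<open>fn\<close>, the weak
  derivatives pass to the limit, and so do the traces by \<open>trace_closed\<close>. Every zero
  trace shared by the sequence is inherited, which includes the one at \<open>z = L\<close>.\<close>

lemma jet_limit:
  assumes f: "\<And>n. f n \<in> V1 \<sigma> L" and l: "(\<lambda>n. jet (f n)) \<longlonglongrightarrow> U"
  shows "\<exists>g\<in>V1 \<sigma> L. jet g = U \<and> (\<forall>c I. (\<forall>n. has_trace S c I (f n) (\<lambda>_. 0)) \<longrightarrow> has_trace S c I g (\<lambda>_. 0))"
proof -
  obtain p q s where U: "U = (p, q, s)" by (cases U) auto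
  note W = slice_W2[OF V1_slice[OF f]]
  have lp: "(\<lambda>n. cls (cut (f n))) \<longlonglongrightarrow> p" and lq: "(\<lambda>n. cls (cut (dr (f n)))) \<longlonglongrightarrow> q"
    and ls: "(\<lambda>n. cls (cut (dz (f n)))) \<longlonglongrightarrow> s"
    using tendsto_fst[OF l] tendsto_fst[OF tendsto_snd[OF l]] tendsto_snd[OF tendsto_snd[OF l]] by (simp_all add: jet_def U)
  have pq: "has_weak_deriv S (1, 0) (fn p) (fn q)"
    by (rule weak_deriv_limit[OF V1_weak_deriv(1)[OF f] W(1) W(2) lp lq])
  have ps: "has_weak_deriv S (0, 1) (fn p) (fn s)"
    by (rule weak_deriv_limit[OF V1_weak_deriv(2)[OF f] W(1) W(3) lp ls])
  note g = wdI[OF pq ps] and m = wd_measurable[OF wdI(1)[OF pq ps]]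
  have fnz: "cut (fn a) = fn a" for a by (rule cut_id) (rule W2_zero[OF W2_fn])
  note R = W2_cut_cong[OF W2_fn m(2) g(2)] and Z = W2_cut_cong[OF W2_fn m(3) g(3)]
  note cp = cls_fn_limit[OF W(1) lp] and cq = cls_fn_limit[OF W(2) lq] and cs = cls_fn_limit[OF W(3) ls]
  have j: "jet (fn p) = U" unfolding jet_def U R Z fnz cp cq cs ..
  have tr: "has_trace S c I (fn p) (\<lambda>_. 0)" if t: "\<And>n. has_trace S c I (f n) (\<lambda>_. 0)" for c I
  proof (rule trace_closed[OF g(1)])
    fix R e :: real assume R: "R > 0" and e: "e > 0"
    have "(\<lambda>n. (norm (cls (cut (f n)) - p))\<^sup>2 + (norm (cls (cut (dr (f n))) - q))\<^sup>2 + (norm (cls (cut (dz (f n))) - s))\<^sup>2)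
       \<longlonglongrightarrow> (norm (p - p))\<^sup>2 + (norm (q - q))\<^sup>2 + (norm (s - s))\<^sup>2"
      by (intro tendsto_intros lp lq ls)
    \<comment> \<open>The factor \<open>\<sigma>\<close> pays for dropping the weight by
      \<open>nn_unweighted\<close>.\<close>
    then have "\<forall>\<^sub>F n in sequentially. (norm (cls (cut (f n)) - p))\<^sup>2 + (norm (cls (cut (dr (f n))) - q))\<^sup>2 + (norm (cls (cut (dz (f n))) - s))\<^sup>2 < \<sigma> * e"
      by (rule order_tendstoD) (use e sigma_pos in simp)
    then obtain n where n: "(norm (cls (cut (f n)) - p))\<^sup>2 + (norm (cls (cut (dr (f n))) - q))\<^sup>2 + (norm (cls (cut (dz (f n))) - s))\<^sup>2 < \<sigma> * e"
      by (auto simp: eventually_sequentially)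
    define P where "P = (\<lambda>x. cut (f n) x - fn p x)"
    define Q where "Q = (\<lambda>x. cut (dr (f n)) x - fn q x)"
    define Z where "Z = (\<lambda>x. cut (dz (f n)) x - fn s x)"
    have WP: "W2 P" "W2 Q" "W2 Z" unfolding P_def Q_def Z_def
      by (rule W2_diff[OF W(1) W2_fn] W2_diff[OF W(2) W2_fn] W2_diff[OF W(3) W2_fn])+
    note [measurable] = W2_meas[OF WP(1)] W2_meas[OF WP(2)] W2_meas[OF WP(3)]
    have cP: "cls P = cls (cut (f n)) - p" "cls Q = cls (cut (dr (f n))) - q" "cls Z = cls (cut (dz (f n))) - s"
      unfolding P_def Q_def Z_def by (simp_all only: cls_diff W W2_fn cp cq cs)
    have "locnorm R (\<lambda>x. f n x - fn p x) (\<lambda>x. dr (f n) x - dr (fn p) x) (\<lambda>x. dz (f n) x - dz (fn p) x)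
       = locnorm R P Q Z"
      by (rule locnorm_eq, rule eventually_elim2[OF g(2,3)]) (auto simp: P_def Q_def Z_def cut_simps)
    also have "\<dots> \<le> (\<integral>\<^sup>+x. ennreal ((P x)\<^sup>2 + (Q x)\<^sup>2 + (Z x)\<^sup>2) \<partial>lborel)"
      unfolding locnorm_def by (intro nn_integral_mono) (auto simp: indicator_def)
    also have "\<dots> \<le> ennreal (1 / \<sigma>) * (\<integral>\<^sup>+x. ennreal (((P x)\<^sup>2 + (Q x)\<^sup>2 + (Z x)\<^sup>2) * fst x) \<partial>lborel)"
      by (rule nn_unweighted) (auto simp: W2_zero[OF WP(1)] W2_zero[OF WP(2)] W2_zero[OF WP(3)])
    also have "(\<integral>\<^sup>+x. ennreal (((P x)\<^sup>2 + (Q x)\<^sup>2 + (Z x)\<^sup>2) * fst x) \<partial>lborel)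
       = (\<integral>\<^sup>+x. ennreal ((P x)\<^sup>2 * fst x) + ennreal ((Q x)\<^sup>2 * fst x) + ennreal ((Z x)\<^sup>2 * fst x) \<partial>lborel)"
    proof (intro nn_integral_cong)
      fix x
      have w: "0 \<le> (F x)\<^sup>2 * fst x" if "W2 F" for F
        by (rule weighted_nonneg) (use W2_zero[OF that, of x] in auto)
      show "ennreal (((P x)\<^sup>2 + (Q x)\<^sup>2 + (Z x)\<^sup>2) * fst x) = ennreal ((P x)\<^sup>2 * fst x) + ennreal ((Q x)\<^sup>2 * fst x) + ennreal ((Z x)\<^sup>2 * fst x)"
        using w[OF WP(1)] w[OF WP(2)] w[OF WP(3)] by (simp add: distrib_right)
    qed
    also have "\<dots> = nnw P + nnw Q + nnw Z"
      by (simp add: nn_integral_add)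
    also have "\<dots> = ennreal ((norm (cls P))\<^sup>2 + (norm (cls Q))\<^sup>2 + (norm (cls Z))\<^sup>2)"
      by (simp add: nn_norm_cls WP)
    also have "ennreal (1 / \<sigma>) * \<dots> \<le> ennreal (1 / \<sigma>) * ennreal (\<sigma> * e)"
      unfolding cP using n by (intro mult_left_mono ennreal_leI) auto
    also have "\<dots> = ennreal e" using sigma_pos e by (simp add: ennreal_mult[symmetric])
    finally show "\<exists>g. wd g \<and> has_trace S c I g (\<lambda>_. 0) \<and>
      locnorm R (\<lambda>x. g x - fn p x) (\<lambda>x. dr g x - dr (fn p) x) (\<lambda>x. dz g x - dz (fn p) x) \<le> ennreal e"
      using V1_wd[OF f[of n]] t[of n] by blast
  qed
  have "fn p \<in> V1 \<sigma> L"
    by (rule V1I[OF g(1) R(1) Z(1) tr tr]) (rule V1_traces[OF f])+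
  then show ?thesis using j tr by blast
qed

definition V1_top :: "(real \<times> real \<Rightarrow> real) set" where
  "V1_top = {w \<in> V1 \<sigma> L. has_trace S (\<lambda>r. (r, L)) {\<sigma>..} w (\<lambda>_. 0)}"

lemma jets_closed: "closed (jet ` V1 \<sigma> L)" "closed (jet ` V1_top)"
proof -
  show "closed (jet ` V1 \<sigma> L)"
    unfolding closed_sequential_limits
  proof (intro allI impI)
    fix F U assume *: "(\<forall>n. F n \<in> jet ` V1 \<sigma> L) \<and> F \<longlonglongrightarrow> U"
    then have "\<forall>n. \<exists>f. f \<in> V1 \<sigma> L \<and> F n = jet f" by blast
    then obtain f where f: "\<And>n. f n \<in> V1 \<sigma> L" and F: "F = (\<lambda>n. jet (f n))" using choice[of "\<lambda>n f. f \<in> V1 \<sigma> L \<and> F n = jet f"] by blast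
    show "U \<in> jet ` V1 \<sigma> L" using jet_limit[where f = f and U = U, OF f] * unfolding F by blast
  qed
  show "closed (jet ` V1_top)"
    unfolding closed_sequential_limits
  proof (intro allI impI)
    fix F U assume *: "(\<forall>n. F n \<in> jet ` V1_top) \<and> F \<longlonglongrightarrow> U"
    then have "\<forall>n. \<exists>f. f \<in> V1_top \<and> F n = jet f" by blast
    then obtain f where f: "\<And>n. f n \<in> V1_top" and F: "F = (\<lambda>n. jet (f n))" using choice[of "\<lambda>n f. f \<in> V1_top \<and> F n = jet f"] by blast
    have "f n \<in> V1 \<sigma> L" "has_trace S (\<lambda>r. (r, L)) {\<sigma>..} (f n) (\<lambda>_. 0)" for n using f[of n] by (auto simp: V1_top_def)
    then show "U \<in> jet ` V1_top" using jet_limit[where f = f and U = U] * unfolding F V1_top_def by blast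
  qed
qed

lemma jets_subspace: "subspace (jet ` V1 \<sigma> L)" "subspace (jet ` V1_top)"
proof -
  have t: "(\<lambda>x. f x + k * g x) \<in> V1_top" if "f \<in> V1_top" "g \<in> V1_top" for f g k
  proof -
    have f: "f \<in> V1 \<sigma> L" and g: "g \<in> V1 \<sigma> L" and tf: "has_trace S (\<lambda>r. (r, L)) {\<sigma>..} f (\<lambda>_. 0)" and tg: "has_trace S (\<lambda>r. (r, L)) {\<sigma>..} g (\<lambda>_. 0)"
      using that by (auto simp: V1_top_def)
    have "has_trace S (\<lambda>r. (r, L)) {\<sigma>..} (\<lambda>x. f x + k * g x) (\<lambda>_. 0)"
      by (rule trace_combine[OF curve_measurable(1) _ V1_wd[OF f] V1_wd[OF g] tf tg]) simp
    then show ?thesis using V1_combine(1)[OF f g] by (simp add: V1_top_def)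
  qed
  have sub: "subspace (jet ` A)" if A: "A \<subseteq> V1 \<sigma> L" "(\<lambda>_. 0) \<in> A" and c: "\<And>f g k. f \<in> A \<Longrightarrow> g \<in> A \<Longrightarrow> (\<lambda>x. f x + k * g x) \<in> A" for A
    unfolding subspace_def
  proof (intro conjI ballI allI)
    show "0 \<in> jet ` A" by (rule image_eqI[where x = "\<lambda>_. 0"]) (simp_all only: zero_V1(2) A(2))
    fix U assume "U \<in> jet ` A"
    then obtain f where f: "f \<in> A" "U = jet f" by blast
    have e: "jet (\<lambda>x. 0 + k * f x) = k *\<^sub>R U" for k
      using V1_combine(2)[OF zero_V1(1), of f k] f A(1) zero_V1(2) by auto
    show "k *\<^sub>R U \<in> jet ` A" for k
      by (rule image_eqI[where x = "\<lambda>x. 0 + k * f x"]) (simp_all only: e c[OF A(2) f(1)])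
    fix W assume "W \<in> jet ` A"
    then obtain g where g: "g \<in> A" "W = jet g" by blast
    have e: "jet (\<lambda>x. f x + 1 * g x) = U + W" using V1_combine(2)[of f g 1] f g A(1) by auto
    show "U + W \<in> jet ` A" 
      by (rule image_eqI[where x = "\<lambda>x. f x + 1 * g x"]) (simp_all only: e c[OF f(1) g(1)])
  qed
  show "subspace (jet ` V1 \<sigma> L)" by (rule sub) (auto intro: zero_V1(1) V1_combine(1))
  show "subspace (jet ` V1_top)" by (rule sub[OF _ _ t]) (auto simp: V1_top_def zero_V1)
qed

text \<open>Divided by \<open>r\<close>, the constraint says that an element \<open>E\<close> of
  \<open>W2\<close> is 0, equivalently that it is orthogonal to all classes \<open>cls k\<close>. In
  this form it is a family of continuous linear equations on jets and so defines a closed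
  subspace.\<close>

lemma div_jet:
  assumes a: "W2 a" and b: "W2 b" and c: "W2 c"
  shows "(AE x in lborel. a x + fst x * b x + fst x * c x = 0) \<longleftrightarrow>
    (\<forall>k. W2 k \<longrightarrow> inner (cls a) (cls (\<lambda>x. 1 / fst x * k x)) + inner (cls b) (cls k) + inner (cls c) (cls k) = 0)"
proof -
  define E where "E = (\<lambda>x. (1 / fst x * a x + b x) + c x)"
  have W: "W2 E" unfolding E_def by (intro W2_add W2_div a b c)
  have cE: "cls E = cls (\<lambda>x. 1 / fst x * a x) + cls b + cls c"
    unfolding E_def by (simp only: cls_add W2_add W2_div a b c)
  have i: "inner (cls a) (cls (\<lambda>x. 1 / fst x * k x)) = inner (cls (\<lambda>x. 1 / fst x * a x)) (cls k)" if k: "W2 k" for k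
    unfolding inner_cls[OF a W2_div[OF k]] inner_cls[OF W2_div[OF a] k] by (simp add: mult_ac)
  have "inner (cls a) (cls (\<lambda>x. 1 / fst x * k x)) + inner (cls b) (cls k) + inner (cls c) (cls k) = inner (cls E) (cls k)" if "W2 k" for k
    unfolding cE i[OF that] by (simp add: inner_add_left)
  then have "(\<forall>k. W2 k \<longrightarrow> inner (cls a) (cls (\<lambda>x. 1 / fst x * k x)) + inner (cls b) (cls k) + inner (cls c) (cls k) = 0)
     \<longleftrightarrow> (\<forall>k. W2 k \<longrightarrow> inner (cls E) (cls k) = 0)" by simp
  also have "\<dots> \<longleftrightarrow> cls E = 0" using W by force
  also have "\<dots> \<longleftrightarrow> (AE x in lborel. E x = 0)"
  proof -
    have W0: "W2 (\<lambda>_. 0)" by (simp add: W2_def)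
    have "cls (\<lambda>_. 0) = 0" using cls_scale[OF W0, of 0] by simp
    then show ?thesis using cls_eq_iff[OF W W0] by simp
  qed
  also have "\<dots> \<longleftrightarrow> (AE x in lborel. a x + fst x * b x + fst x * c x = 0)"
  proof -
    have "E x = 0 \<longleftrightarrow> a x + fst x * b x + fst x * c x = 0" for x
    proof (cases "x \<in> S")
      case True
      then have p: "fst x > 0" using fst_ge[OF True] sigma_pos by simp
      have "a x + fst x * b x + fst x * c x = fst x * E x" using p by (simp add: E_def distrib_left)
      then show ?thesis using p by simp
    qed (simp add: E_def W2_zero[OF a] W2_zero[OF b] W2_zero[OF c])
    then show ?thesis by simp
  qed
  finally show ?thesis ..
qed

text \<open>Product rule for \<open>r u\<close> in the \<open>r\<close>-direction, whereas
  \<open>r\<close> is constant in the \<open>z\<close>-direction. The values of the derivatives of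
  \<open>r u\<close> and \<open>r w\<close> are choices as well, so the comparison is one almost
  everywhere.\<close>

lemma V2_iff:
  "(u, w) \<in> V2 \<sigma> L \<longleftrightarrow> u \<in> V1 \<sigma> L \<and> w \<in> V1_top \<and>
    (AE x in lborel. cut u x + fst x * cut (dr u) x + fst x * cut (dz w) x = 0)"
proof -
  have "(AE x in lborel. x \<in> S \<longrightarrow> dr (\<lambda>(r, z). r * u (r, z)) x + dz (\<lambda>(r, z). r * w (r, z)) x = 0)
     \<longleftrightarrow> (AE x in lborel. cut u x + fst x * cut (dr u) x + fst x * cut (dz w) x = 0)"
    if u: "u \<in> V1 \<sigma> L" and w: "w \<in> V1 \<sigma> L"
  proof -
    have f: "(\<lambda>(r, z). r * h (r, z)) = (\<lambda>x. (x \<bullet> (1, 0)) * h x)" for h :: "real \<times> real \<Rightarrow> real" by (auto simp: fun_eq_iff)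
    have "AE x in lborel. x \<in> S \<longrightarrow> dr (\<lambda>(r, z). r * u (r, z)) x = u x + fst x * dr u x"
      using weak_deriv_AE[OF open_S has_weak_deriv_mult_inner[OF V1_weak_deriv(1)[OF u], of "(1, 0)"]]
      unfolding f by (simp add: d_r_def inner_prod_def)
    moreover have "AE x in lborel. x \<in> S \<longrightarrow> dz (\<lambda>(r, z). r * w (r, z)) x = fst x * dz w x"
      using weak_deriv_AE[OF open_S has_weak_deriv_mult_inner[OF V1_weak_deriv(2)[OF w], of "(1, 0)"]]
      unfolding f by (simp add: d_z_def inner_prod_def)
    ultimately have "AE x in lborel. (x \<in> S \<longrightarrow> dr (\<lambda>(r, z). r * u (r, z)) x + dz (\<lambda>(r, z). r * w (r, z)) x = 0)
      \<longleftrightarrow> cut u x + fst x * cut (dr u) x + fst x * cut (dz w) x = 0"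
      by eventually_elim (auto simp: cut_def indicator_def)
    then show ?thesis by (rule eventually_subst)
  qed
  then show ?thesis unfolding V2_def V1_top_def mem_Collect_eq case_prod_conv by blast
qed

type_synonym jets = "(real \<times> real) l2 \<times> (real \<times> real) l2 \<times> (real \<times> real) l2"

text \<open>The divergence constraint, tested against \<open>k\<close>.\<close>

definition divf :: "(real \<times> real \<Rightarrow> real) \<Rightarrow> jets \<times> jets \<times> jets \<Rightarrow> real" where
  "divf k U = inner (fst (fst U)) (cls (\<lambda>x. 1 / fst x * k x)) + inner (fst (snd (fst U))) (cls k)
       + inner (snd (snd (snd (snd U)))) (cls k)"

lemma divf_linear: "linear (divf k)"
  by (rule linearI) (simp_all add: divf_def inner_add_left distrib_left)

definition M :: "(jets \<times> jets \<times> jets) set" where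
  "M = (jet ` V1 \<sigma> L \<times> jet ` V1 \<sigma> L \<times> jet ` V1_top) \<inter> {U. \<forall>k. W2 k \<longrightarrow> divf k U = 0}"

lemma M_subspace: "subspace M"
  unfolding M_def
proof (rule subspace_inter)
  show "subspace (jet ` V1 \<sigma> L \<times> jet ` V1 \<sigma> L \<times> jet ` V1_top)"
    by (intro subspace_Times jets_subspace)
  show "subspace {U. \<forall>k. W2 k \<longrightarrow> divf k U = 0}"
    unfolding subspace_def by (simp add: linear_0[OF divf_linear] linear_add[OF divf_linear] linear_cmul[OF divf_linear])
qed

lemma M_closed: "closed M"
proof -
  have "closed {U. \<forall>k. W2 k \<longrightarrow> divf k U = 0}"
    unfolding divf_def
    by (intro closed_Collect_all closed_Collect_imp closed_Collect_eq continuous_intros) simp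
  then show ?thesis unfolding M_def by (intro closed_Int closed_Times jets_closed)
qed

lemma M_iff:
  "U \<in> M \<longleftrightarrow> (\<exists>u v w. (u, w) \<in> V2 \<sigma> L \<and> v \<in> V1 \<sigma> L \<and> U = (jet u, jet v, jet w))"
proof -
  have "(jet u, jet v, jet w) \<in> M \<longleftrightarrow> (AE x in lborel. cut u x + fst x * cut (dr u) x + fst x * cut (dz w) x = 0)"
    if "u \<in> V1 \<sigma> L" "v \<in> V1 \<sigma> L" "w \<in> V1_top" for u v w
  proof -
    have w: "w \<in> V1 \<sigma> L" using that by (simp add: V1_top_def)
    have mem: "jet u \<in> jet ` V1 \<sigma> L" "jet v \<in> jet ` V1 \<sigma> L" "jet w \<in> jet ` V1_top" using that by blast+
    have j: "fst (jet u) = cls (cut u)" "fst (snd (jet u)) = cls (cut (dr u))" "snd (snd (jet w)) = cls (cut (dz w))"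
      by (simp_all add: jet_def)
    show ?thesis
      unfolding div_jet[OF slice_W2(1)[OF V1_slice[OF that(1)]] slice_W2(2)[OF V1_slice[OF that(1)]] slice_W2(3)[OF V1_slice[OF w]]]
      by (simp only: M_def Int_iff mem_Sigma_iff mem mem_Collect_eq divf_def fst_conv snd_conv j simp_thms)
  qed
  note * = this
  show ?thesis
  proof
    assume U: "U \<in> M"
    then obtain u v w where "u \<in> V1 \<sigma> L" "v \<in> V1 \<sigma> L" "w \<in> V1_top" and "U = (jet u, jet v, jet w)"
      by (auto simp: M_def)
    then show "\<exists>u v w. (u, w) \<in> V2 \<sigma> L \<and> v \<in> V1 \<sigma> L \<and> U = (jet u, jet v, jet w)"
      using *[of u v w] U unfolding V2_iff by blast
  next
    assume "\<exists>u v w. (u, w) \<in> V2 \<sigma> L \<and> v \<in> V1 \<sigma> L \<and> U = (jet u, jet v, jet w)"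
    then show "U \<in> M" using * unfolding V2_iff by blast
  qed
qed

end

section \<open>The background flow, the operator of the weak form and its estimates\<close>

section \<open>The background flow\<close>

text \<open>Two bounds of different nature: \<open>B\<close> is an arbitrary bound that secures
  integrability, whereas \<open>E\<close> will be a multiple of \<open>\<epsilon>\<close> and
  carries the smallness. The support ends before \<open>\<sigma> + 2\<close> because
  \<open>\<delta> + \<delta>^2 / 2 < 2\<close>.\<close>

locale strip_flow = strip +
  fixes V V' :: "real \<Rightarrow> real" and B E :: real
  assumes V_meas [measurable]: "V \<in> borel_measurable borel" "V' \<in> borel_measurable borel"
    and V_bound: "\<bar>V r\<bar> \<le> B" "\<bar>V' r\<bar> \<le> B"
    and V_decay: "r > \<sigma> \<Longrightarrow> \<bar>V r\<bar> * (r - \<sigma>) \<le> E" and E_nonneg: "E \<ge> 0"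
    and V_support: "r > \<sigma> + 2 \<Longrightarrow> V r = 0" "r > \<sigma> + 2 \<Longrightarrow> V' r = 0" "V (\<sigma> + 2) = 0"
    and V_primitive: "t \<in> {\<sigma>..\<sigma> + 2} \<Longrightarrow> V t = V \<sigma> + (LINT s:{\<sigma>..t}|lborel. V' s)"
    and V'_integrable: "set_integrable lborel {\<sigma>..\<sigma> + 2} V'"

context strip
begin

text \<open>On the range of the cut-off, \<open>\<bar>\<theta> r\<bar> (r - \<sigma>)\<close> is bounded by \<open>\<epsilon>\<close> times the distance to the
  outer end, by the mean value theorem; no bound on \<open>\<theta>\<close> itself is needed.\<close>

lemma background:
  obtains C where "C \<ge> 0"
    and "\<And>\<epsilon> \<theta>. 0 < \<epsilon> \<Longrightarrow> \<epsilon> < 1 \<Longrightarrow> cutoff \<sigma> \<epsilon> \<theta> \<Longrightarrow> \<exists>V V' B. strip_flow \<sigma> L V V' B (C * \<epsilon>) \<and>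
      (\<forall>r\<ge>\<sigma>. V r = v_bg \<sigma> \<gamma> \<theta> r \<and> V' r = dv_bg \<sigma> \<gamma> \<theta> r)"
proof -
  define k where "k = \<gamma> / (2 * pi)"
  define l where "l = \<bar>ln \<sigma>\<bar> + \<bar>ln (\<sigma> + 2)\<bar>"
  \<comment> \<open>The first term comes from \<open>\<theta>' ln r\<close>, where
    \<open>|\<theta>'| (r - \<sigma>) \<le> \<epsilon>\<close>; the second from
    \<open>\<theta> / r\<close>, where \<open>|\<theta>| (r - \<sigma>) \<le> 2 \<epsilon>\<close>
    and \<open>r > \<sigma>\<close>.\<close>
  define C where "C = \<bar>k\<bar> * l + 2 * \<bar>k\<bar> / \<sigma>"
  have l: "\<bar>ln r\<bar> \<le> l" if "\<sigma> \<le> r" "r \<le> \<sigma> + 2" for r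
  proof -
    have "ln \<sigma> \<le> ln r" "ln r \<le> ln (\<sigma> + 2)" using that sigma_pos by simp_all
    then show ?thesis unfolding l_def by linarith
  qed
  have C: "C \<ge> 0" using sigma_pos by (simp add: C_def l_def)
  show ?thesis
  proof (rule that[OF C])
    fix \<epsilon> \<theta> assume e: "0 < \<epsilon>" "\<epsilon> < 1" and cu: "cutoff \<sigma> \<epsilon> \<theta>"
    define \<delta> where "\<delta> = exp (- 1 / \<epsilon>)"
    define a where "a = \<sigma> + \<delta>\<^sup>2 / 2"
    define b where "b = \<sigma> + \<delta> + \<delta>\<^sup>2 / 2"
    obtain p q where t1: "\<And>r. r \<ge> \<sigma> \<Longrightarrow> (\<theta> has_real_derivative p r) (at r within {\<sigma>..})"
      and t2: "\<And>r. r \<ge> \<sigma> \<Longrightarrow> (p has_real_derivative q r) (at r within {\<sigma>..})"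
      and qc: "continuous_on {\<sigma>..} q"
      and pb: "\<And>r. r \<in> {a..b} \<Longrightarrow> \<bar>p r\<bar> \<le> \<epsilon> / (r - \<sigma>)"
      and th1: "\<And>r. r \<in> {\<sigma>..a} \<Longrightarrow> \<theta> r = 1" and th0: "\<And>r. r \<ge> b \<Longrightarrow> \<theta> r = 0"
      using cu unfolding cutoff_def Let_def \<delta>_def[symmetric] a_def[symmetric] b_def[symmetric] by blast
    have d0: "\<delta> > 0" by (simp add: \<delta>_def)
    \<comment> \<open>From \<open>x \<le> exp x\<close> at \<open>x = 1 / \<epsilon>\<close>. It
      makes the zone next to the wall on which \<open>\<theta> = 1\<close> no wider than
      \<open>\<epsilon>\<close>.\<close>
    have de: "\<delta> \<le> \<epsilon>"
    proof -
      have "1 / \<epsilon> \<le> exp (1 / \<epsilon>)" using exp_ge_add_one_self[of "1 / \<epsilon>"] by linarith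
      then have "inverse (exp (1 / \<epsilon>)) \<le> inverse (1 / \<epsilon>)" using e by (intro le_imp_inverse_le) auto
      then show ?thesis by (simp add: \<delta>_def exp_minus)
    qed
    have d2: "\<delta>\<^sup>2 \<le> \<delta>" using d0 de e by (simp add: power2_eq_square mult_le_cancel_left1)
    have ord: "\<sigma> < a" "a < b" "b < \<sigma> + 2" "a - \<sigma> \<le> \<epsilon>" "b - \<sigma> \<le> 2"
      using d0 d2 de e by (simp_all add: a_def b_def)
    have atw: "at r within {\<sigma>..} = at r" if "r > \<sigma>" for r
      by (rule at_within_interior) (use that in \<open>simp add: interior_real_atLeast\<close>)
    have p0: "p r = 0" if "\<sigma> < r \<and> r < a \<or> b < r" for r
    proof -
      have r: "r > \<sigma>" using that ord by linarith
      have D: "(\<theta> has_real_derivative p r) (at r)" using t1[of r] r atw[OF r] by simp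
      from that show ?thesis
      proof
        assume r: "\<sigma> < r \<and> r < a"
        have "((\<lambda>_. 1) has_real_derivative p r) (at r)"
          by (rule has_field_derivative_transform_within_open[OF D, of "{\<sigma><..<a}"]) (use r th1 in auto)
        then show ?thesis using DERIV_unique[OF _ DERIV_const] by blast
      next
        assume r: "b < r"
        have "((\<lambda>_. 0) has_real_derivative p r) (at r)"
          by (rule has_field_derivative_transform_within_open[OF D, of "{b<..}"]) (use r th0 in auto)
        then show ?thesis using DERIV_unique[OF _ DERIV_const] by blast
      qed
    qed
    have q0: "q r = 0" if r: "b < r" for r
    proof -
      have r': "r > \<sigma>" using r ord by linarith
      have D: "(p has_real_derivative q r) (at r)" using t2[of r] r' atw[OF r'] by simp
      have "((\<lambda>_. 0) has_real_derivative q r) (at r)"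
        by (rule has_field_derivative_transform_within_open[OF D, of "{b<..}"]) (use r p0 in auto)
      then show ?thesis using DERIV_unique[OF _ DERIV_const] by blast
    qed
    define W where "W r = k * (p r * ln r + \<theta> r / r)" for r
    define W' where "W' r = k * (q r * ln r + p r / r + (p r * r - \<theta> r) / r\<^sup>2)" for r
    \<comment> \<open>The derivatives at \<open>\<sigma>\<close> are one-sided;
      \<open>vector_derivative\<close> is determined there because \<open>\<sigma>\<close> is a
      limit point of the half-line.\<close>
    have nb: "at r within {\<sigma>..} \<noteq> bot" if "r \<ge> \<sigma>" for r
    proof -
      have "r islimpt {\<sigma>..}"
      proof (rule connected_imp_perfect)
        show "{\<sigma>..} \<noteq> {x}" for x
        proof
          assume "{\<sigma>..} = {x}"
          then have "\<sigma> \<in> {x}" "\<sigma> + 1 \<in> {x}" by (metis atLeast_iff order_refl, metis atLeast_iff less_add_one less_imp_le)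
          then show False by simp
        qed
      qed (use that in auto)
      then show ?thesis by (simp add: trivial_limit_within)
    qed
    have vb: "v_bg \<sigma> \<gamma> \<theta> r = W r" if r: "r \<ge> \<sigma>" for r
    proof -
      have r0: "r > 0" using r sigma_pos by linarith
      have "((\<lambda>s. \<theta> s * phi \<gamma> s) has_real_derivative (- W r)) (at r within {\<sigma>..})"
      proof -
        have ph: "(phi \<gamma> has_real_derivative (- k * (1 / r))) (at r within {\<sigma>..})"
          unfolding phi_def k_def
          by (rule DERIV_cmult, rule DERIV_subset[OF DERIV_ln_divide]) (use r0 in auto)
        have "((\<lambda>s. \<theta> s * phi \<gamma> s) has_real_derivative (p r * phi \<gamma> r + (- k * (1 / r)) * \<theta> r)) (at r within {\<sigma>..})"
          by (rule DERIV_mult[OF t1[OF r] ph])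
        also have "p r * phi \<gamma> r + (- k * (1 / r)) * \<theta> r = - W r"
          by (simp add: phi_def W_def k_def distrib_left)
        finally show ?thesis .
      qed
      then have "((\<lambda>s. \<theta> s * phi \<gamma> s) has_vector_derivative (- W r)) (at r within {\<sigma>..})"
        by (simp only: has_real_derivative_iff_has_vector_derivative)
      then have "vector_derivative (\<lambda>s. \<theta> s * phi \<gamma> s) (at r within {\<sigma>..}) = - W r"
        by (rule vector_derivative_within[OF nb[OF r]])
      then show ?thesis by (simp add: v_bg_def)
    qed
    have WD: "(W has_vector_derivative W' r) (at r within {\<sigma>..})" if r: "r \<ge> \<sigma>" for r
    proof -
      have r0: "r > 0" using r sigma_pos by linarith
      have "(W has_real_derivative W' r) (at r within {\<sigma>..})"
      proof -
        have ln: "(ln has_real_derivative (1 / r)) (at r within {\<sigma>..})"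
          by (rule DERIV_subset[OF DERIV_ln_divide]) (use r0 in auto)
        have "((\<lambda>r. k * (p r * ln r + \<theta> r / r)) has_real_derivative
          k * ((q r * ln r + 1 / r * p r) + (p r * r - \<theta> r * 1) / (r * r))) (at r within {\<sigma>..})"
          using r0 by (intro DERIV_cmult DERIV_add DERIV_mult DERIV_divide t1[OF r] t2[OF r] ln DERIV_ident) auto
        also have "k * ((q r * ln r + 1 / r * p r) + (p r * r - \<theta> r * 1) / (r * r)) = W' r"
          by (simp add: W'_def power2_eq_square)
        finally show ?thesis unfolding W_def .
      qed
      then show ?thesis by (simp only: has_real_derivative_iff_has_vector_derivative)
    qed
    have dvb: "dv_bg \<sigma> \<gamma> \<theta> r = W' r" if r: "r \<ge> \<sigma>" for r
    proof -
      have "(v_bg \<sigma> \<gamma> \<theta> has_vector_derivative W' r) (at r within {\<sigma>..})"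
        by (rule has_vector_derivative_transform[OF _ _ WD[OF r]]) (use r vb in auto)
      then show ?thesis unfolding dv_bg_def by (rule vector_derivative_within[OF nb[OF r]])
    qed
    have Wc: "continuous_on {\<sigma>..} W" using WD by (auto simp: continuous_on_eq_continuous_within intro: has_vector_derivative_continuous)
    have pc: "continuous_on {\<sigma>..} p" using t2 by (auto simp: continuous_on_eq_continuous_within intro: DERIV_continuous)
    have tc: "continuous_on {\<sigma>..} \<theta>" using t1 by (auto simp: continuous_on_eq_continuous_within intro: DERIV_continuous)
    have W'c: "continuous_on {\<sigma>..} W'"
      unfolding W'_def by (intro continuous_intros pc qc tc) (use sigma_pos in auto)
    have sub: "{\<sigma>..t} \<subseteq> {\<sigma>..}" for t by auto
    \<comment> \<open>Below \<open>\<sigma>\<close> the cut-off is unconstrained, so the flow is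
      replaced by 0 there to be measurable and bounded on the whole line.\<close>
    define V where "V r = indicator {\<sigma>..\<sigma> + 2} r *\<^sub>R W r" for r
    define V' where "V' r = indicator {\<sigma>..\<sigma> + 2} r *\<^sub>R W' r" for r
    have W0: "W r = 0" "W' r = 0" if "r > b" for r
      using that p0[of r] q0[of r] th0[of r] by (simp_all add: W_def W'_def)
    have Vm: "V \<in> borel_measurable borel" "V' \<in> borel_measurable borel"
      unfolding V_def V'_def
      by (rule borel_measurable_continuous_on_indicator, simp, rule continuous_on_subset[OF Wc sub] continuous_on_subset[OF W'c sub])+
    have VW: "V r = W r" "V' r = W' r" if "r \<ge> \<sigma>" for r
      using W0[of r] ord that by (auto simp: V_def V'_def indicator_def)
    have "bounded (W ` {\<sigma>..\<sigma> + 2})" "bounded (W' ` {\<sigma>..\<sigma> + 2})"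
      by (auto intro!: compact_imp_bounded compact_continuous_image continuous_on_subset[OF Wc] continuous_on_subset[OF W'c])
    then obtain B1 B2 where B: "\<And>r. r \<in> {\<sigma>..\<sigma> + 2} \<Longrightarrow> \<bar>W r\<bar> \<le> B1" "\<And>r. r \<in> {\<sigma>..\<sigma> + 2} \<Longrightarrow> \<bar>W' r\<bar> \<le> B2"
      unfolding bounded_iff by (metis imageI real_norm_def)
    have Vb: "\<bar>V r\<bar> \<le> \<bar>B1\<bar> + \<bar>B2\<bar> \<and> \<bar>V' r\<bar> \<le> \<bar>B1\<bar> + \<bar>B2\<bar>" for r
    proof (cases "r \<in> {\<sigma>..\<sigma> + 2}")
      case True
      then have "V r = W r" "V' r = W' r" by (simp_all add: V_def V'_def)
      then show ?thesis using B(1)[OF True] B(2)[OF True] by linarith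
    qed (simp add: V_def V'_def)
    have Vh: "\<bar>V r\<bar> * (r - \<sigma>) \<le> C * \<epsilon>" if r: "r > \<sigma>" for r
    proof -
      have r0: "r > 0" using r sigma_pos by linarith
      have Wb: "\<bar>W r\<bar> * (r - \<sigma>) \<le> \<bar>k\<bar> * (\<bar>p r\<bar> * (r - \<sigma>) * \<bar>ln r\<bar>) + \<bar>k\<bar> * (\<bar>\<theta> r\<bar> * (r - \<sigma>) / \<sigma>)"
      proof -
        have "\<bar>\<theta> r / r\<bar> \<le> \<bar>\<theta> r\<bar> / \<sigma>" using r sigma_pos r0 by (simp add: abs_divide frac_le)
        then have "\<bar>p r * ln r + \<theta> r / r\<bar> \<le> \<bar>p r\<bar> * \<bar>ln r\<bar> + \<bar>\<theta> r\<bar> / \<sigma>"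
          using abs_triangle_ineq[of "p r * ln r" "\<theta> r / r"] by (simp add: abs_mult)
        then have est: "\<bar>k\<bar> * \<bar>p r * ln r + \<theta> r / r\<bar> * (r - \<sigma>) \<le> \<bar>k\<bar> * (\<bar>p r\<bar> * \<bar>ln r\<bar> + \<bar>\<theta> r\<bar> / \<sigma>) * (r - \<sigma>)"
          using r by (intro mult_right_mono mult_left_mono) auto
        have e1: "\<bar>k\<bar> * \<bar>p r * ln r + \<theta> r / r\<bar> * (r - \<sigma>) = \<bar>W r\<bar> * (r - \<sigma>)" by (simp only: W_def abs_mult)
        have e2: "\<bar>k\<bar> * (\<bar>p r\<bar> * \<bar>ln r\<bar> + \<bar>\<theta> r\<bar> / \<sigma>) * (r - \<sigma>) = \<bar>k\<bar> * (\<bar>p r\<bar> * (r - \<sigma>) * \<bar>ln r\<bar>) + \<bar>k\<bar> * (\<bar>\<theta> r\<bar> * (r - \<sigma>) / \<sigma>)"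
          by (simp add: algebra_simps)
        show ?thesis using est unfolding e1 e2 .
      qed
      have "\<bar>k\<bar> * (\<bar>p r\<bar> * (r - \<sigma>) * \<bar>ln r\<bar>) \<le> \<bar>k\<bar> * (\<epsilon> * l)" "\<bar>\<theta> r\<bar> * (r - \<sigma>) \<le> 2 * \<epsilon>" if rb: "r \<le> b"
      proof -
        have "\<bar>p r\<bar> * (r - \<sigma>) \<le> \<epsilon>"
        proof (cases "r < a")
          case True
          then show ?thesis using p0[of r] r e by simp
        next
          case False
          then have "\<bar>p r\<bar> \<le> \<epsilon> / (r - \<sigma>)" using pb rb by auto
          then show ?thesis using r by (simp add: pos_le_divide_eq)
        qed
        moreover have "\<bar>ln r\<bar> \<le> l" using l[of r] r rb ord by simp
        ultimately show "\<bar>k\<bar> * (\<bar>p r\<bar> * (r - \<sigma>) * \<bar>ln r\<bar>) \<le> \<bar>k\<bar> * (\<epsilon> * l)"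
          using r e by (intro mult_left_mono mult_mono) auto
        show "\<bar>\<theta> r\<bar> * (r - \<sigma>) \<le> 2 * \<epsilon>"
        proof (cases "r < a")
          case True
          then have "\<theta> r = 1" using th1[of r] r by simp
          then show ?thesis using True ord e by simp
        next
          case False
          have "norm (\<theta> r - \<theta> b) \<le> \<epsilon> / (r - \<sigma>) * norm (r - b)"
          proof (rule field_differentiable_bound[where S = "{r..b}" and f' = p])
            fix s assume s: "s \<in> {r..b}"
            show "(\<theta> has_real_derivative p s) (at s within {r..b})"
              by (rule has_field_derivative_subset[OF t1]) (use s r in auto)
            have "\<bar>p s\<bar> \<le> \<epsilon> / (s - \<sigma>)" using pb[of s] s False by simp
            also have "\<dots> \<le> \<epsilon> / (r - \<sigma>)" using s r e by (intro divide_left_mono) auto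
            finally show "norm (p s) \<le> \<epsilon> / (r - \<sigma>)" by simp
          qed (use rb in auto)
          then have "\<bar>\<theta> r\<bar> \<le> \<epsilon> / (r - \<sigma>) * (b - r)" using rb th0[of b] by simp
          then have "\<bar>\<theta> r\<bar> * (r - \<sigma>) \<le> \<epsilon> / (r - \<sigma>) * (b - r) * (r - \<sigma>)" using r by (intro mult_right_mono) auto
          also have "\<dots> = \<epsilon> * (b - r)" using r by simp
          also have "\<dots> \<le> \<epsilon> * 2" using ord r e by (intro mult_left_mono) auto
          finally show ?thesis by simp
        qed
      qed
      note est = this
      show ?thesis
      proof (cases "r \<le> b")
        case True
        have "\<bar>k\<bar> * (\<bar>\<theta> r\<bar> * (r - \<sigma>) / \<sigma>) \<le> \<bar>k\<bar> * (2 * \<epsilon> / \<sigma>)"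
          using est(2)[OF True] sigma_pos by (intro mult_left_mono divide_right_mono) auto
        then have "\<bar>W r\<bar> * (r - \<sigma>) \<le> \<bar>k\<bar> * (\<epsilon> * l) + \<bar>k\<bar> * (2 * \<epsilon> / \<sigma>)" using Wb est(1)[OF True] by linarith
        then show ?thesis using r by (simp add: VW C_def algebra_simps)
      next
        case False
        then show ?thesis using W0[of r] r C e by (simp add: VW)
      qed
    qed
    have FTC: "V t = V \<sigma> + (LINT s:{\<sigma>..t}|lborel. V' s)" if t: "t \<in> {\<sigma>..\<sigma> + 2}" for t
    proof -
      have "(LBINT x. indicator {\<sigma>..t} x *\<^sub>R W' x) = W t - W \<sigma>"
      proof (rule integral_FTC_Icc)
        fix x assume "\<sigma> \<le> x" "x \<le> t"
        then show "(W has_vector_derivative W' x) (at x within {\<sigma>..t})"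
          by (intro has_vector_derivative_within_subset[OF WD]) auto
      qed (use t in \<open>auto intro: continuous_on_subset[OF W'c]\<close>)
      also have "(LBINT x. indicator {\<sigma>..t} x *\<^sub>R W' x) = (LINT s:{\<sigma>..t}|lborel. V' s)"
        unfolding set_lebesgue_integral_def by (intro Bochner_Integration.integral_cong) (auto simp: indicator_def VW)
      finally show ?thesis using t by (simp add: VW)
    qed
    have Vi: "set_integrable lborel {\<sigma>..\<sigma> + 2} V'"
    proof -
      have "set_integrable lborel {\<sigma>..\<sigma> + 2} W'"
        by (rule borel_integrable_atLeastAtMost'[OF continuous_on_subset[OF W'c sub]])
      then show ?thesis unfolding set_integrable_def
        by (rule Bochner_Integration.integrable_cong[OF refl, THEN iffD1, rotated]) (auto simp: indicator_def VW)
    qed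
    have VT: "V (\<sigma> + 2) = 0" using W0(1)[of "\<sigma> + 2"] ord VW(1)[of "\<sigma> + 2"] by simp
    have "strip_flow \<sigma> L V V' (\<bar>B1\<bar> + \<bar>B2\<bar>) (C * \<epsilon>)"
    proof
      show "V r = 0" "V' r = 0" if "r > \<sigma> + 2" for r using that by (simp_all add: V_def V'_def)
      show "C * \<epsilon> \<ge> 0" using C e by simp
    qed (use Vm Vb Vh VT FTC Vi in blast)+
    moreover have "\<forall>r\<ge>\<sigma>. V r = v_bg \<sigma> \<gamma> \<theta> r \<and> V' r = dv_bg \<sigma> \<gamma> \<theta> r"
      using VW vb dvb by simp
    ultimately show "\<exists>V V' B. strip_flow \<sigma> L V V' B (C * \<epsilon>) \<and> (\<forall>r\<ge>\<sigma>. V r = v_bg \<sigma> \<gamma> \<theta> r \<and> V' r = dv_bg \<sigma> \<gamma> \<theta> r)"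
      by blast
  qed
qed

end

section \<open>The weak form as an operator\<close>

context strip
begin

lemma W2_mult_bounded:
  assumes "W2 f" "m \<in> borel_measurable borel" "\<And>r. \<bar>m r\<bar> \<le> B" shows "W2 (\<lambda>x. m (fst x) * f x)"
  by (rule W2_bounded[OF assms(1) _ assms(3)]) (use assms(2) in measurable)

lemma inner_multiplier:
  assumes "W2 f" "W2 (\<lambda>x. m x * f x)" "W2 (\<lambda>x. m x * fn c x)"
  shows "inner (cls (\<lambda>x. m x * f x)) c = inner (cls f) (cls (\<lambda>x. m x * fn c x))"
  unfolding inner_commute[of _ c] inner_cls_right[OF assms(2)] inner_cls[OF assms(1,3)] by (simp add: mult_ac)

text \<open>Integrability is recorded along with the value: nonintegrable functions have Bochner
  integral 0, so values alone would not add up.\<close>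

definition cyl :: "(real \<times> real \<Rightarrow> real) \<Rightarrow> real \<Rightarrow> bool" where
  "cyl h a \<longleftrightarrow> integrable lborel (\<lambda>x. cut h x * fst x) \<and> cyl_integral \<sigma> L h = a"

lemma cyl_integral_cut: "cyl_integral \<sigma> L h = (LINT x|lborel. cut h x * fst x)"
  unfolding cyl_integral_def set_lebesgue_integral_def cut_def by (simp add: mult.assoc)

lemma cyl_eq: "cyl h a \<Longrightarrow> cyl_integral \<sigma> L h = a" by (simp add: cyl_def)

lemma cyl_mult:
  assumes "W2 f" "W2 g" "\<And>x. x \<in> S \<Longrightarrow> h x = f x * g x" "a = inner (cls f) (cls g)"
  shows "cyl h a"
proof -
  have "cut h x * fst x = f x * g x * fst x" for x
    using assms(3)[of x] W2_zero[OF assms(1), of x] by (cases "x \<in> S") (auto simp: cut_simps)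
  then have e: "(\<lambda>x. cut h x * fst x) = (\<lambda>x. f x * g x * fst x)" by (rule ext)
  show ?thesis
    using W2_mult[OF assms(1,2)] inner_cls[OF assms(1,2)] assms(4) unfolding cyl_def cyl_integral_cut e by simp
qed

lemma cyl_add:
  assumes "cyl f a" "cyl g b" "\<And>x. x \<in> S \<Longrightarrow> h x = f x + g x" "c = a + b"
  shows "cyl h c"
proof -
  have "cut h x * fst x = cut f x * fst x + cut g x * fst x" for x
    using assms(3)[of x] by (cases "x \<in> S") (auto simp: cut_simps distrib_right)
  then have e: "(\<lambda>x. cut h x * fst x) = (\<lambda>x. cut f x * fst x + cut g x * fst x)" by (rule ext)
  show ?thesis using assms(1,2,4) unfolding cyl_def cyl_integral_cut e by simp
qed

text \<open>The trilinear advection form of \<open>(u, w)\<close>, \<open>f\<close> and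
  \<open>g\<close>, arranged so that the undifferentiated factors form one argument of the inner
  product and the gradient of \<open>f\<close> the other.\<close>

definition adv where
  "adv u w f g = inner (cls (\<lambda>x. cut u x * cut g x)) (cls (cut (dr f))) + inner (cls (\<lambda>x. cut w x * cut g x)) (cls (cut (dz f)))"

lemma V2_V1: "(u, w) \<in> V2 \<sigma> L \<Longrightarrow> u \<in> V1 \<sigma> L" "(u, w) \<in> V2 \<sigma> L \<Longrightarrow> w \<in> V1 \<sigma> L"
  by (simp_all add: V2_def)

lemma V1_W2_mult: "f \<in> V1 \<sigma> L \<Longrightarrow> g \<in> V1 \<sigma> L \<Longrightarrow> W2 (\<lambda>x. cut f x * cut g x)"
  by (intro W4_W4 slice_W4[OF V1_slice])

lemmas V1_W2 = slice_W2[OF V1_slice]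

lemma adv_self:
  assumes uw: "(u, w) \<in> V2 \<sigma> L" and f: "f \<in> V1 \<sigma> L"
  shows "adv u w f f = 0"
proof -
  note u = V2_V1(1)[OF uw] and w = V2_V1(2)[OF uw]
  have "adv u w f f = (LINT x|lborel. cut u x * cut f x * cut (dr f) x * fst x) + (LINT x|lborel. cut w x * cut f x * cut (dz f) x * fst x)"
    unfolding adv_def by (simp only: inner_cls V1_W2_mult u w f V1_W2)
  also have "\<dots> = (LINT x|lborel. cut u x * cut f x * cut (dr f) x * fst x + cut w x * cut f x * cut (dz f) x * fst x)"
    by (rule Bochner_Integration.integral_add[symmetric])
      (rule W2_mult[OF V1_W2_mult[OF u f] V1_W2(2)[OF f]], rule W2_mult[OF V1_W2_mult[OF w f] V1_W2(3)[OF f]])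
  also have "\<dots> = (LINT x|lborel. (cut u x * cut (dr f) x + cut w x * cut (dz f) x) * cut f x * fst x)"
    by (simp add: algebra_simps)
  also have "\<dots> = 0"
    by (rule advection_skew[OF V1_slice[OF u] V1_slice[OF w] V1_slice[OF f] _ V2_end[OF uw]])
      (use uw in \<open>simp add: V2_iff\<close>)
  finally show ?thesis .
qed

text \<open>Polarization of \<open>adv_self\<close>; it moves the derivative onto the test
  function.\<close>

lemma adv_flip:
  assumes uw: "(u, w) \<in> V2 \<sigma> L" and f: "f \<in> V1 \<sigma> L" and g: "g \<in> V1 \<sigma> L"
  shows "adv u w f g = - adv u w g f"
proof -
  note u = V2_V1(1)[OF uw] and w = V2_V1(2)[OF uw]
  let ?h = "\<lambda>x. f x + 1 * g x"
  have h: "?h \<in> V1 \<sigma> L" and j: "jet ?h = jet f + 1 *\<^sub>R jet g" using V1_combine[OF f g] by blast+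
  have d: "cls (cut (dr ?h)) = cls (cut (dr f)) + cls (cut (dr g))"
    "cls (cut (dz ?h)) = cls (cut (dz f)) + cls (cut (dz g))"
    using j unfolding jet_def by simp_all
  have p: "cls (\<lambda>x. cut k x * cut ?h x) = cls (\<lambda>x. cut k x * cut f x) + cls (\<lambda>x. cut k x * cut g x)" if k: "k \<in> V1 \<sigma> L" for k
    unfolding cut_add cut_scale mult_1 distrib_left by (rule cls_add[OF V1_W2_mult[OF k f] V1_W2_mult[OF k g]])
  have "adv u w ?h ?h = adv u w f f + adv u w f g + adv u w g f + adv u w g g"
    unfolding adv_def d p[OF u] p[OF w] by (simp add: inner_add_left inner_add_right)
  then show ?thesis using adv_self[OF uw f] adv_self[OF uw g] adv_self[OF uw h] by simp
qed

text \<open>\<open>V\<close> depends on \<open>r\<close> alone and does not vanish outside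
  \<open>0 < z < L\<close>. Multiplied by this indicator of a part of the strip that carries its
  support, it becomes a member of \<open>W2\<close>.\<close>

definition bgbox :: "real \<times> real \<Rightarrow> real" where
  "bgbox = indicator ({\<sigma><..\<sigma> + 2} \<times> {0<..<L})"

lemma W2_box: "W2 bgbox"
proof (rule W2I)
  show [measurable]: "bgbox \<in> borel_measurable borel" unfolding bgbox_def
    by (rule borel_measurable_indicator) (rule borel_Times, simp_all)
  show "x \<notin> S \<Longrightarrow> bgbox x = 0" for x by (cases x) (auto simp: bgbox_def mem_S indicator_def)
  have "nnw bgbox \<le> (\<integral>\<^sup>+x. ennreal (\<sigma> + 2) * indicator (cbox (\<sigma>, 0) (\<sigma> + 2, L)) x \<partial>lborel)"
  proof (intro nn_integral_mono)
    fix x :: "real \<times> real"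
    show "ennreal ((bgbox x)\<^sup>2 * fst x) \<le> ennreal (\<sigma> + 2) * indicator (cbox (\<sigma>, 0) (\<sigma> + 2, L)) x"
      by (cases "x \<in> {\<sigma><..\<sigma> + 2} \<times> {0<..<L}") (auto simp: bgbox_def cbox_Pair_eq intro!: ennreal_leI)
  qed
  also have "\<dots> = ennreal (\<sigma> + 2) * emeasure lborel (cbox (\<sigma>, 0) (\<sigma> + 2, L))"
    by (rule nn_integral_cmult_indicator) simp
  also have "\<dots> < \<infinity>" using emeasure_bounded_finite[OF bounded_cbox, of "(\<sigma>, 0)" "(\<sigma> + 2, L)"] by (simp add: ennreal_mult_less_top)
  finally show "nnw bgbox < \<infinity>" .
qed

lemma poincare_norm: "f \<in> V1 \<sigma> L \<Longrightarrow> norm (cls (cut f)) \<le> L * norm (cls (cut (dz f)))"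
proof -
  assume f: "f \<in> V1 \<sigma> L"
  have "ennreal ((norm (cls (cut f)))\<^sup>2) \<le> ennreal (L\<^sup>2) * ennreal ((norm (cls (cut (dz f))))\<^sup>2)"
    using slice_poincare[OF V1_slice[OF f]] by (simp only: nn_norm_cls V1_W2[OF f])
  then have "(norm (cls (cut f)))\<^sup>2 \<le> (L * norm (cls (cut (dz f))))\<^sup>2"
    by (simp add: ennreal_mult[symmetric] power_mult_distrib)
  then show ?thesis by (rule power2_le_imp_le) (use L_pos in simp)
qed

end

context strip_flow
begin

abbreviation dvr :: "(real \<times> real \<Rightarrow> real) \<Rightarrow> real \<times> real \<Rightarrow> real" where
  "dvr f \<equiv> \<lambda>x. 1 / fst x * f x"
abbreviation mV :: "(real \<times> real \<Rightarrow> real) \<Rightarrow> real \<times> real \<Rightarrow> real" where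
  "mV f \<equiv> \<lambda>x. V (fst x) * f x"
abbreviation mV' :: "(real \<times> real \<Rightarrow> real) \<Rightarrow> real \<times> real \<Rightarrow> real" where
  "mV' f \<equiv> \<lambda>x. V' (fst x) * f x"

lemma W2_mV: "W2 f \<Longrightarrow> W2 (mV f)" and W2_mV': "W2 f \<Longrightarrow> W2 (mV' f)"
  by (rule W2_mult_bounded, assumption, rule V_meas, rule V_bound)+

lemma V_box: "x \<in> S \<Longrightarrow> V (fst x) * bgbox x = V (fst x)" "x \<in> S \<Longrightarrow> V' (fst x) * bgbox x = V' (fst x)"
  by (cases "\<sigma> + 2 < fst x"; auto simp: V_support bgbox_def indicator_def Om_def)+

text \<open>Write \<open>V f\<close> as \<open>V (r - \<sigma>)\<close> times
  \<open>f / (r - \<sigma>)\<close>: the first factor is at most \<open>E\<close>, the second is the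
  one in Hardy's inequality. The 2 is the root of Hardy's constant. As that inequality is
  unweighted, the weight is bounded by \<open>\<sigma> + 2\<close> on the support and restored at
  the cost of \<open>1 / \<sigma>\<close>.\<close>

lemma mV_norm:
  assumes f: "f \<in> V1 \<sigma> L"
  shows "norm (cls (mV (cut f))) \<le> 2 * sqrt ((\<sigma> + 2) / \<sigma>) * E * norm (cls (cut (dr f)))"
proof -
  let ?g = "cut (dr f)"
  note s = V1_slice[OF f] and W = V1_W2[OF f]
  note [measurable] = W2_meas[OF W(1)] W2_meas[OF W(2)]
  have "ennreal ((norm (cls (mV (cut f))))\<^sup>2) = nnw (mV (cut f))"
    by (rule nn_norm_cls[OF W2_mV[OF W(1)], symmetric])
  also have "\<dots> \<le> (\<integral>\<^sup>+x. ennreal ((\<sigma> + 2) * E\<^sup>2) * ennreal ((cut f x / (fst x - \<sigma>))\<^sup>2) \<partial>lborel)"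
  proof (intro nn_integral_mono)
    fix x
    show "ennreal ((mV (cut f) x)\<^sup>2 * fst x) \<le> ennreal ((\<sigma> + 2) * E\<^sup>2) * ennreal ((cut f x / (fst x - \<sigma>))\<^sup>2)"
    proof (cases "x \<in> S \<and> fst x \<le> \<sigma> + 2")
      case True
      then have r: "fst x > \<sigma>" "fst x \<le> \<sigma> + 2" using fst_ge by blast+
      define y where "y = cut f x / (fst x - \<sigma>)"
      have y: "cut f x = y * (fst x - \<sigma>)" using r by (simp add: y_def)
      have "(V (fst x) * (fst x - \<sigma>))\<^sup>2 \<le> E\<^sup>2"
      proof -
        have "\<bar>V (fst x) * (fst x - \<sigma>)\<bar> \<le> \<bar>E\<bar>" using V_decay[OF r(1)] r E_nonneg by (simp add: abs_mult)
        then show ?thesis by (simp only: abs_le_square_iff)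
      qed
      then have "(V (fst x) * (fst x - \<sigma>))\<^sup>2 * y\<^sup>2 * fst x \<le> E\<^sup>2 * y\<^sup>2 * (\<sigma> + 2)"
        using r sigma_pos by (intro mult_mono) auto
      then have "(mV (cut f) x)\<^sup>2 * fst x \<le> (\<sigma> + 2) * E\<^sup>2 * y\<^sup>2" unfolding y by (simp add: power_mult_distrib mult_ac)
      then have "ennreal ((mV (cut f) x)\<^sup>2 * fst x) \<le> ennreal ((\<sigma> + 2) * E\<^sup>2 * y\<^sup>2)" by (rule ennreal_leI)
      also have "\<dots> = ennreal ((\<sigma> + 2) * E\<^sup>2) * ennreal (y\<^sup>2)" using sigma_pos by (intro ennreal_mult) auto
      finally show ?thesis by (simp only: y_def)
    next
      case False
      then have z: "mV (cut f) x = 0" using V_support(1)[of "fst x"] by (cases "x \<in> S") (auto simp: cut_simps)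
      show ?thesis unfolding z by simp
    qed
  qed
  also have "\<dots> = ennreal ((\<sigma> + 2) * E\<^sup>2) * (\<integral>\<^sup>+x. ennreal ((cut f x / (fst x - \<sigma>))\<^sup>2) \<partial>lborel)"
    by (rule nn_integral_cmult) measurable
  also have "\<dots> \<le> ennreal ((\<sigma> + 2) * E\<^sup>2) * (4 * (ennreal (1 / \<sigma>) * nnw ?g))"
  proof (intro mult_left_mono order_trans[OF slice_hardy[OF s]])
    show "nn2 ?g \<le> ennreal (1 / \<sigma>) * nnw ?g"
      by (rule nn_unweighted) (auto simp: W2_zero[OF W(2)])
  qed auto
  also have "\<dots> = ennreal ((\<sigma> + 2) * E\<^sup>2) * (4 * (ennreal (1 / \<sigma>) * ennreal ((norm (cls ?g))\<^sup>2)))"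
    by (simp only: nn_norm_cls[OF W(2)])
  also have "\<dots> = ennreal (((\<sigma> + 2) * E\<^sup>2) * (4 * (1 / \<sigma> * (norm (cls ?g))\<^sup>2)))"
  proof -
    have g: "ennreal a * (4 * (ennreal b * ennreal c)) = ennreal (a * (4 * (b * c)))" if "0 \<le> a" "0 \<le> b" "0 \<le> c" for a b c
      using that by (simp add: ennreal_mult)
    show ?thesis by (rule g) (use sigma_pos in auto)
  qed
  finally have "(norm (cls (mV (cut f))))\<^sup>2 \<le> ((\<sigma> + 2) * E\<^sup>2) * (4 * (1 / \<sigma> * (norm (cls ?g))\<^sup>2))"
    by (rule ennreal_le_iff[THEN iffD1, rotated]) (use sigma_pos in simp)
  also have "\<dots> = (2 * sqrt ((\<sigma> + 2) / \<sigma>) * E * norm (cls ?g))\<^sup>2"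
  proof -
    have "(sqrt ((\<sigma> + 2) / \<sigma>))\<^sup>2 = (\<sigma> + 2) / \<sigma>" using sigma_pos by (intro real_sqrt_pow2) simp
    then show ?thesis by (simp only: power_mult_distrib) simp
  qed
  finally show ?thesis by (rule power2_le_imp_le) (use sigma_pos E_nonneg in simp)
qed

text \<open>The Riesz representative of the weak form with all terms on one side: each triple is
  paired with the values, the \<open>r\<close>-derivatives and the \<open>z\<close>-derivatives of
  \<open>u1\<close>, \<open>v1\<close> and \<open>w1\<close>. Advection appears with a minus sign in
  the derivative slots because of \<open>adv_flip\<close>. Terms in the background alone carry
  \<open>bgbox\<close> to be members of \<open>W2\<close>, and the axial equation has no term of
  order zero.\<close>

definition op :: "real \<Rightarrow> (real \<times> real \<Rightarrow> real) \<Rightarrow> (real \<times> real \<Rightarrow> real) \<Rightarrow> (real \<times> real \<Rightarrow> real) \<Rightarrow> jets \<times> jets \<times> jets" where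
  "op \<nu> u v w =
    ((\<nu> *\<^sub>R cls (dvr (dvr (cut u))) - cls (dvr (\<lambda>x. cut v x * cut v x)) - 2 *\<^sub>R cls (mV (dvr (cut v))) - cls (mV (mV (dvr bgbox))),
      \<nu> *\<^sub>R cls (cut (dr u)) - cls (\<lambda>x. cut u x * cut u x),
      \<nu> *\<^sub>R cls (cut (dz u)) - cls (\<lambda>x. cut w x * cut u x)),
     (cls (dvr (\<lambda>x. cut u x * cut v x)) + cls (mV' (cut u)) + cls (mV (dvr (cut u))) + \<nu> *\<^sub>R cls (dvr (dvr (cut v))) + \<nu> *\<^sub>R cls (mV (dvr (dvr bgbox))),
      \<nu> *\<^sub>R cls (cut (dr v)) - cls (\<lambda>x. cut u x * cut v x) + \<nu> *\<^sub>R cls (mV' bgbox),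
      \<nu> *\<^sub>R cls (cut (dz v)) - cls (\<lambda>x. cut w x * cut v x)),
     (0,
      \<nu> *\<^sub>R cls (cut (dr w)) - cls (\<lambda>x. cut u x * cut w x),
      \<nu> *\<^sub>R cls (cut (dz w)) - cls (\<lambda>x. cut w x * cut w x)))"

text \<open>A test jet with vanishing swirl component isolates this equation. Each integral is
  identified with an inner product of classes, which also proves that it exists, and
  \<open>adv_flip\<close> returns the derivatives from the test functions to the solution.\<close>

lemma op_momentum:
  assumes uw: "(u, w) \<in> V2 \<sigma> L" and v: "v \<in> V1 \<sigma> L" and uw1: "(u1, w1) \<in> V2 \<sigma> L"
    and z: "inner (op \<nu> u v w) (jet u1, 0, jet w1) = 0"
    and bg: "\<And>r. r \<ge> \<sigma> \<Longrightarrow> V r = vb r"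
  shows "cyl_integral \<sigma> L (\<lambda>x. (u x * dr u x + w x * dz u x) * u1 x
                            + (u x * dr w x + w x * dz w x) * w1 x)
        - cyl_integral \<sigma> L (\<lambda>(r, z). (v (r, z) + vb r)\<^sup>2 / r * u1 (r, z))
        = - \<nu> * cyl_integral \<sigma> L (\<lambda>x. grad \<sigma> L u x \<bullet> grad \<sigma> L u1 x + grad \<sigma> L w x \<bullet> grad \<sigma> L w1 x)
          - \<nu> * cyl_integral \<sigma> L (\<lambda>(r, z). u (r, z) * u1 (r, z) / r\<^sup>2)"
proof -
  note u = V2_V1(1)[OF uw] and w = V2_V1(2)[OF uw] and u1 = V2_V1(1)[OF uw1] and w1 = V2_V1(2)[OF uw1]
  note W = V1_W2[OF u] V1_W2[OF v] V1_W2[OF w] V1_W2[OF u1] V1_W2[OF w1]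
  note P = V1_W2_mult
  have Sp: "x \<in> S \<Longrightarrow> fst x > 0" for x using fst_ge[of x] sigma_pos by simp
  have adv: "cyl (\<lambda>x. (u x * dr f x + w x * dz f x) * g x) (adv u w f g)" if f: "f \<in> V1 \<sigma> L" and g: "g \<in> V1 \<sigma> L" for f g
    unfolding adv_def
    by (rule cyl_add[OF cyl_mult[OF P[OF u g] V1_W2(2)[OF f] refl refl] cyl_mult[OF P[OF w g] V1_W2(3)[OF f] refl refl]])
      (simp_all add: cut_simps algebra_simps)
  have A: "cyl_integral \<sigma> L (\<lambda>x. (u x * dr u x + w x * dz u x) * u1 x + (u x * dr w x + w x * dz w x) * w1 x)
      = adv u w u u1 + adv u w w w1"
    by (rule cyl_eq, rule cyl_add[OF adv[OF u u1] adv[OF w w1]]) simp_all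
  have Bc: "cyl_integral \<sigma> L (\<lambda>(r, z). (v (r, z) + vb r)\<^sup>2 / r * u1 (r, z))
     = inner (cls (dvr (\<lambda>x. cut v x * cut v x)) + 2 *\<^sub>R cls (mV (dvr (cut v))) + cls (mV (mV (dvr bgbox)))) (cls (cut u1))"
  proof (rule cyl_eq, rule cyl_mult)
    have W1: "W2 (dvr (\<lambda>x. cut v x * cut v x))" "W2 (mV (dvr (cut v)))" "W2 (mV (mV (dvr bgbox)))"
      by (intro W2_div W2_mV P v W W2_box)+
    show "W2 (\<lambda>x. (dvr (\<lambda>x. cut v x * cut v x) x + 2 * mV (dvr (cut v)) x) + mV (mV (dvr bgbox)) x)"
      by (rule W2_add[OF W2_add[OF W1(1) W2_scale[OF W1(2)]] W1(3)])
    show "inner (cls (dvr (\<lambda>x. cut v x * cut v x)) + 2 *\<^sub>R cls (mV (dvr (cut v))) + cls (mV (mV (dvr bgbox)))) (cls (cut u1))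
      = inner (cls (\<lambda>x. (dvr (\<lambda>x. cut v x * cut v x) x + 2 * mV (dvr (cut v)) x) + mV (mV (dvr bgbox)) x)) (cls (cut u1))"
      by (simp only: cls_add[OF W2_add[OF W1(1) W2_scale[OF W1(2)]] W1(3)] cls_add[OF W1(1) W2_scale[OF W1(2)]] cls_scale[OF W1(2)])
    fix x assume x: "x \<in> S"
    \<comment> \<open>Inside the strip the indicator is absorbed by \<open>V\<close>.\<close>
    have b: "V (fst x) * (V (fst x) * (1 / fst x * bgbox x)) = V (fst x) * (1 / fst x * V (fst x))"
      using V_box(1)[OF x] by (simp add: mult_ac)
    show "(case x of (r, z) \<Rightarrow> (v (r, z) + vb r)\<^sup>2 / r * u1 (r, z))
      = ((dvr (\<lambda>x. cut v x * cut v x) x + 2 * mV (dvr (cut v)) x) + mV (mV (dvr bgbox)) x) * cut u1 x"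
      unfolding b using x bg[of "fst x"] fst_ge[OF x]
      by (simp add: cut_simps case_prod_unfold power2_eq_square divide_inverse algebra_simps)
  qed (rule W)
  have g2: "cyl (\<lambda>x. grad \<sigma> L f x \<bullet> grad \<sigma> L g x) (inner (cls (cut (dr f))) (cls (cut (dr g))) + inner (cls (cut (dz f))) (cls (cut (dz g))))"
    if f: "f \<in> V1 \<sigma> L" and g: "g \<in> V1 \<sigma> L" for f g
    by (rule cyl_add[OF cyl_mult[OF V1_W2(2)[OF f] V1_W2(2)[OF g] refl refl] cyl_mult[OF V1_W2(3)[OF f] V1_W2(3)[OF g] refl refl]])
      (simp_all add: cut_simps grad_def)
  have Cc: "cyl_integral \<sigma> L (\<lambda>x. grad \<sigma> L u x \<bullet> grad \<sigma> L u1 x + grad \<sigma> L w x \<bullet> grad \<sigma> L w1 x)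
     = (inner (cls (cut (dr u))) (cls (cut (dr u1))) + inner (cls (cut (dz u))) (cls (cut (dz u1))))
     + (inner (cls (cut (dr w))) (cls (cut (dr w1))) + inner (cls (cut (dz w))) (cls (cut (dz w1))))"
    by (rule cyl_eq, rule cyl_add[OF g2[OF u u1] g2[OF w w1] refl refl])
  have Dc: "cyl_integral \<sigma> L (\<lambda>(r, z). u (r, z) * u1 (r, z) / r\<^sup>2) = inner (cls (dvr (dvr (cut u)))) (cls (cut u1))"
    by (rule cyl_eq, rule cyl_mult[OF W2_div[OF W2_div[OF V1_W2(1)[OF u]]] V1_W2(1)[OF u1] _ refl])
      (simp add: cut_simps case_prod_unfold power2_eq_square)
  show ?thesis
    unfolding A Bc Cc Dc adv_flip[OF uw u u1] adv_flip[OF uw w w1] using z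
    unfolding adv_def op_def jet_def
    by (simp add: inner_add_left inner_diff_left algebra_simps)
qed

text \<open>As for \<open>op_momentum\<close>, with a test jet that has a swirl component
  only.\<close>

lemma op_swirl:
  assumes uw: "(u, w) \<in> V2 \<sigma> L" and v: "v \<in> V1 \<sigma> L" and v1: "v1 \<in> V1 \<sigma> L"
    and z: "inner (op \<nu> u v w) (0, jet v1, 0) = 0"
    and bg: "\<And>r. r \<ge> \<sigma> \<Longrightarrow> V r = vb r" "\<And>r. r \<ge> \<sigma> \<Longrightarrow> V' r = vb' r"
  shows "cyl_integral \<sigma> L (\<lambda>x. (u x * dr v x + w x * dz v x) * v1 x)
        + cyl_integral \<sigma> L (\<lambda>(r, z). u (r, z) * vb' r * v1 (r, z))
        + cyl_integral \<sigma> L (\<lambda>(r, z). u (r, z) * (v (r, z) + vb r) / r * v1 (r, z))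
        = - \<nu> * cyl_integral \<sigma> L (\<lambda>x. grad \<sigma> L v x \<bullet> grad \<sigma> L v1 x)
          - \<nu> * cyl_integral \<sigma> L (\<lambda>(r, z). (vb' r, 0) \<bullet> grad \<sigma> L v1 (r, z))
          - \<nu> * cyl_integral \<sigma> L (\<lambda>(r, z). (v (r, z) + vb r) * v1 (r, z) / r\<^sup>2)"
proof -
  note u = V2_V1(1)[OF uw] and w = V2_V1(2)[OF uw]
  note P = V1_W2_mult
  note Wu = V1_W2[OF u] and Wv = V1_W2[OF v] and Wv1 = V1_W2[OF v1]
  have A: "cyl_integral \<sigma> L (\<lambda>x. (u x * dr v x + w x * dz v x) * v1 x) = adv u w v v1"
    unfolding adv_def
    by (rule cyl_eq, rule cyl_add[OF cyl_mult[OF P[OF u v1] V1_W2(2)[OF v] refl refl] cyl_mult[OF P[OF w v1] V1_W2(3)[OF v] refl refl]])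
      (simp_all add: cut_simps algebra_simps)
  have Bc: "cyl_integral \<sigma> L (\<lambda>(r, z). u (r, z) * vb' r * v1 (r, z)) = inner (cls (mV' (cut u))) (cls (cut v1))"
    by (rule cyl_eq, rule cyl_mult[OF W2_mV'[OF Wu(1)] Wv1(1) _ refl])
      (use fst_ge bg in \<open>force simp: cut_simps case_prod_unfold\<close>)
  have Cc: "cyl_integral \<sigma> L (\<lambda>(r, z). u (r, z) * (v (r, z) + vb r) / r * v1 (r, z))
     = inner (cls (dvr (\<lambda>x. cut u x * cut v x)) + cls (mV (dvr (cut u)))) (cls (cut v1))"
  proof (rule cyl_eq, rule cyl_mult[OF W2_add[OF W2_div[OF P[OF u v]] W2_mV[OF W2_div[OF Wu(1)]]] Wv1(1)])
    fix x assume x: "x \<in> S"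
    show "(case x of (r, z) \<Rightarrow> u (r, z) * (v (r, z) + vb r) / r * v1 (r, z))
      = (dvr (\<lambda>x. cut u x * cut v x) x + mV (dvr (cut u)) x) * cut v1 x"
      using x bg(1)[of "fst x"] fst_ge[OF x]
      by (simp add: cut_simps case_prod_unfold divide_inverse algebra_simps)
  qed (simp only: cls_add[OF W2_div[OF P[OF u v]] W2_mV[OF W2_div[OF Wu(1)]]])
  have Dc: "cyl_integral \<sigma> L (\<lambda>x. grad \<sigma> L v x \<bullet> grad \<sigma> L v1 x)
     = inner (cls (cut (dr v))) (cls (cut (dr v1))) + inner (cls (cut (dz v))) (cls (cut (dz v1)))"
    by (rule cyl_eq, rule cyl_add[OF cyl_mult[OF Wv(2) Wv1(2) refl refl] cyl_mult[OF Wv(3) Wv1(3) refl refl]])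
      (simp_all add: cut_simps grad_def)
  have Ec: "cyl_integral \<sigma> L (\<lambda>(r, z). (vb' r, 0) \<bullet> grad \<sigma> L v1 (r, z)) = inner (cls (mV' bgbox)) (cls (cut (dr v1)))"
  proof (rule cyl_eq, rule cyl_mult[OF W2_mV'[OF W2_box] Wv1(2) _ refl])
    fix x assume x: "x \<in> S"
    show "(case x of (r, z) \<Rightarrow> (vb' r, 0) \<bullet> grad \<sigma> L v1 (r, z)) = mV' bgbox x * cut (dr v1) x"
      unfolding V_box(2)[OF x] using x bg(2)[of "fst x"] fst_ge[OF x] by (simp add: cut_simps case_prod_unfold grad_def)
  qed
  have Fc: "cyl_integral \<sigma> L (\<lambda>(r, z). (v (r, z) + vb r) * v1 (r, z) / r\<^sup>2)
     = inner (cls (dvr (dvr (cut v))) + cls (mV (dvr (dvr bgbox)))) (cls (cut v1))"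
  proof (rule cyl_eq, rule cyl_mult[OF W2_add[OF W2_div[OF W2_div[OF Wv(1)]] W2_mV[OF W2_div[OF W2_div[OF W2_box]]]] Wv1(1)])
    fix x assume x: "x \<in> S"
    have b: "V (fst x) * (1 / fst x * (1 / fst x * bgbox x)) = 1 / fst x * (1 / fst x * V (fst x))"
      using V_box(1)[OF x] by (simp add: mult_ac)
    show "(case x of (r, z) \<Rightarrow> (v (r, z) + vb r) * v1 (r, z) / r\<^sup>2)
      = (dvr (dvr (cut v)) x + mV (dvr (dvr bgbox)) x) * cut v1 x"
      unfolding b using x bg(1)[of "fst x"] fst_ge[OF x]
      by (simp add: cut_simps case_prod_unfold power2_eq_square divide_inverse algebra_simps)
  qed (simp only: cls_add[OF W2_div[OF W2_div[OF Wv(1)]] W2_mV[OF W2_div[OF W2_div[OF W2_box]]]])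
  show ?thesis
    unfolding A Bc Cc Dc Ec Fc adv_flip[OF uw v v1] using z
    unfolding adv_def op_def jet_def
    by (simp add: inner_add_left inner_diff_left algebra_simps)
qed

end

section \<open>Coercivity and weak continuity\<close>

lemma norm_component_le:
  fixes p :: "'a::real_normed_vector \<times> 'b::real_normed_vector"
  shows "norm (fst p) \<le> norm p" "norm (snd p) \<le> norm p"
  using norm_fst_le[of "fst p" "snd p"] norm_snd_le[of "snd p" "fst p"] by simp_all

context strip
begin

lemma dvr_norm:
  assumes f: "W2 f" shows "norm (cls (\<lambda>x. 1 / fst x * f x)) \<le> 1 / \<sigma> * norm (cls f)"
proof -
  have "(norm (cls (\<lambda>x. 1 / fst x * f x)))\<^sup>2 = (LINT x|lborel. (1 / fst x * f x)\<^sup>2 * fst x)"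
    by (rule norm_cls[OF W2_div[OF f]])
  also have "\<dots> \<le> (LINT x|lborel. (1 / \<sigma>)\<^sup>2 * ((f x)\<^sup>2 * fst x))"
  proof (rule integral_mono)
    show "integrable lborel (\<lambda>x. (1 / fst x * f x)\<^sup>2 * fst x)" using W2_div[OF f] unfolding W2_def by blast
    show "integrable lborel (\<lambda>x. (1 / \<sigma>)\<^sup>2 * ((f x)\<^sup>2 * fst x))" using f unfolding W2_def by (intro integrable_mult_right) blast
    fix x
    show "(1 / fst x * f x)\<^sup>2 * fst x \<le> (1 / \<sigma>)\<^sup>2 * ((f x)\<^sup>2 * fst x)"
    proof (cases "x \<in> S")
      case True
      then have r: "fst x > 0" using fst_ge[OF True] sigma_pos by simp
      have "(1 / fst x)\<^sup>2 \<le> (1 / \<sigma>)\<^sup>2" 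
        by (rule power_mono) (use inverse_fst_bound[OF True] r in auto)
      then have "(1 / fst x)\<^sup>2 * ((f x)\<^sup>2 * fst x) \<le> (1 / \<sigma>)\<^sup>2 * ((f x)\<^sup>2 * fst x)"
        using r by (intro mult_right_mono) auto
      then show ?thesis by (simp only: power_mult_distrib mult.assoc)
    qed (simp add: W2_zero[OF f])
  qed
  also have "\<dots> = (1 / \<sigma> * norm (cls f))\<^sup>2"
    by (simp only: power_mult_distrib norm_cls[OF f] Bochner_Integration.integral_mult_right_zero)
  finally show ?thesis by (rule power2_le_imp_le) (use sigma_pos in simp)
qed

text \<open>The square appears because \<open>slice_bound\<close> bounds integrals of
  squares.\<close>

lemma V1_slice_bound:
  assumes f: "f \<in> V1 \<sigma> L" and b: "norm (jet f) \<le> R"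
  shows "slice_bound (R\<^sup>2) (cut f)"
proof -
  note W = V1_W2[OF f]
  have R: "R \<ge> 0" using b norm_ge_zero order_trans by blast
  have "norm (cls (cut (dr f))) \<le> R" "norm (cls (cut (dz f))) \<le> R"
    using order_trans[OF norm_snd_le b[unfolded jet_def]] order_trans[OF norm_fst_le] order_trans[OF norm_snd_le] by blast+
  then have "(norm (cls (cut (dr f))))\<^sup>2 \<le> R\<^sup>2" "(norm (cls (cut (dz f))))\<^sup>2 \<le> R\<^sup>2"
    using R by (auto intro!: power_mono)
  then show ?thesis
    unfolding slice_bound_def using V1_slice[OF f]
    by (intro exI[of _ "cut (dr f)"] exI[of _ "cut (dz f)"]) (simp add: nn_norm_cls W ennreal_leI)
qed

end

context strip_flow
begin

text \<open>\<open>background_by_parts\<close> in terms of classes. \<open>V'\<close> contains the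
  second derivative of the cut-off, for which no small bound is available; the right-hand side
  contains \<open>V\<close> only, to which \<open>mV_norm\<close> applies.\<close>

lemma cross_identity:
  assumes u: "u \<in> V1 \<sigma> L" and v: "v \<in> V1 \<sigma> L"
  shows "inner (cls (mV' (cut u))) (cls (cut v)) = - inner (cls (mV (cut u))) (cls (dvr (cut v)))
     - inner (cls (mV (cut v))) (cls (cut (dr u))) - inner (cls (mV (cut u))) (cls (cut (dr v)))"
proof -
  note Wu = V1_W2[OF u] and Wv = V1_W2[OF v]
  note i = W2_mult[OF W2_mV[OF Wu(1)] W2_div[OF Wv(1)]] W2_mult[OF W2_mV[OF Wv(1)] Wu(2)] W2_mult[OF W2_mV[OF Wu(1)] Wv(2)]
  have "inner (cls (mV' (cut u))) (cls (cut v)) = (LINT x|lborel. V' (fst x) * cut u x * cut v x * fst x)"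
    by (rule inner_cls[OF W2_mV'[OF Wu(1)] Wv(1)])
  also have "\<dots> = - (LINT x|lborel. V (fst x) * (cut u x * cut v x + fst x * (cut (dr u) x * cut v x + cut u x * cut (dr v) x)))"
    by (rule background_by_parts[OF V1_slice[OF u] V1_slice[OF v], where T = "\<sigma> + 2" and B = B and c = "V \<sigma>"])
      (simp, rule V_meas, rule V_meas, rule V_bound, rule V_bound, rule V'_integrable, erule V_primitive, rule V_support, erule V_support, erule V_support)
  also have "(\<lambda>x. V (fst x) * (cut u x * cut v x + fst x * (cut (dr u) x * cut v x + cut u x * cut (dr v) x)))
    = (\<lambda>x. mV (cut u) x * dvr (cut v) x * fst x + mV (cut v) x * cut (dr u) x * fst x + mV (cut u) x * cut (dr v) x * fst x)"
  proof
    fix x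
    show "V (fst x) * (cut u x * cut v x + fst x * (cut (dr u) x * cut v x + cut u x * cut (dr v) x))
      = mV (cut u) x * dvr (cut v) x * fst x + mV (cut v) x * cut (dr u) x * fst x + mV (cut u) x * cut (dr v) x * fst x"
      using fst_ge[of x] sigma_pos by (cases "x \<in> S") (simp_all add: cut_simps algebra_simps)
  qed
  also have "(LINT x|lborel. mV (cut u) x * dvr (cut v) x * fst x + mV (cut v) x * cut (dr u) x * fst x + mV (cut u) x * cut (dr v) x * fst x)
    = inner (cls (mV (cut u))) (cls (dvr (cut v))) + inner (cls (mV (cut v))) (cls (cut (dr u))) + inner (cls (mV (cut u))) (cls (cut (dr v)))"
    unfolding inner_cls[OF W2_mV[OF Wu(1)] W2_div[OF Wv(1)]] inner_cls[OF W2_mV[OF Wv(1)] Wu(2)] inner_cls[OF W2_mV[OF Wu(1)] Wv(2)]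
    by (simp only: Bochner_Integration.integral_add Bochner_Integration.integrable_add i)
  finally show ?thesis by simp
qed

text \<open>The size of the part of \<open>op\<close> independent of the unknowns: the centrifugal
  term of the background and its two viscous terms.\<close>

definition force_bound :: "real \<Rightarrow> real" where
  "force_bound \<nu> = norm (cls (mV (mV (dvr bgbox)))) + \<nu> * norm (cls (mV (dvr (dvr bgbox)))) + \<nu> * norm (cls (mV' bgbox))"

text \<open>Advection drops out by \<open>adv_self\<close>, the two quadratic swirl terms cancel,
  and the viscous terms with \<open>1 / r^2\<close> have the good sign. What remains comes from the
  background: terms quadratic in \<open>U\<close>, absorbed by half of the viscosity thanks to the
  smallness of \<open>E\<close>, and a force linear in \<open>U\<close>.\<close>

lemma op_coercive:
  assumes uw: "(u, w) \<in> V2 \<sigma> L" and v: "v \<in> V1 \<sigma> L" and \<nu>: "\<nu> > 0"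
    and E: "2 * sqrt ((\<sigma> + 2) / \<sigma>) * E * (2 * (L / \<sigma>) + 2) \<le> \<nu> / 2"
  defines "U \<equiv> (jet u, jet v, jet w)"
  shows "inner (op \<nu> u v w) U \<ge> \<nu> / 2 / (1 + L\<^sup>2) * (norm U)\<^sup>2 - force_bound \<nu> * norm U"
proof -
  note u = V2_V1(1)[OF uw] and w = V2_V1(2)[OF uw]
  note Wu = V1_W2[OF u] and Wv = V1_W2[OF v] and Ww = V1_W2[OF w]
  define a where "a = norm (cls (cut (dr u)))"
  define a' where "a' = norm (cls (cut (dz u)))"
  define b where "b = norm (cls (cut (dr v)))"
  define b' where "b' = norm (cls (cut (dz v)))"
  define c where "c = norm (cls (cut (dr w)))"
  define c' where "c' = norm (cls (cut (dz w)))"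
  define G where "G = a\<^sup>2 + a'\<^sup>2 + b\<^sup>2 + b'\<^sup>2 + c\<^sup>2 + c'\<^sup>2"
  define q where "q = 2 * sqrt ((\<sigma> + 2) / \<sigma>) * E"
  have q: "q \<ge> 0" using E_nonneg sigma_pos by (simp add: q_def)
  have pos: "a \<ge> 0" "a' \<ge> 0" "b \<ge> 0" "b' \<ge> 0" "c \<ge> 0" "c' \<ge> 0" by (simp_all add: a_def a'_def b_def b'_def c_def c'_def)
  \<comment> \<open>\<open>X\<close> occurs as \<open>- 2 * X\<close> in the momentum equation, as
    \<open>X\<close> in the swirl equation and as \<open>- X\<close> in
    \<open>cross_identity\<close>, which also contributes \<open>- Y - Z\<close>.\<close>
  define X where "X = inner (cls (mV (cut u))) (cls (dvr (cut v)))"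
  define Y where "Y = inner (cls (mV (cut v))) (cls (cut (dr u)))"
  define Z where "Z = inner (cls (mV (cut u))) (cls (cut (dr v)))"
  have X1: "inner (cls (mV (dvr (cut v)))) (cls (cut u)) = X" "inner (cls (mV (dvr (cut u)))) (cls (cut v)) = X"
    unfolding X_def inner_cls[OF W2_mV[OF W2_div[OF Wv(1)]] Wu(1)] inner_cls[OF W2_mV[OF W2_div[OF Wu(1)]] Wv(1)]
      inner_cls[OF W2_mV[OF Wu(1)] W2_div[OF Wv(1)]] by (simp_all add: mult_ac)
  \<comment> \<open>The centrifugal term tested with \<open>u\<close> equals the
    \<open>u v / r\<close> term tested with \<open>v\<close>; the two enter with opposite
    signs.\<close>
  have sw: "inner (cls (dvr (\<lambda>x. cut v x * cut v x))) (cls (cut u)) = inner (cls (dvr (\<lambda>x. cut u x * cut v x))) (cls (cut v))"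
    unfolding inner_cls[OF W2_div[OF V1_W2_mult[OF v v]] Wu(1)] inner_cls[OF W2_div[OF V1_W2_mult[OF u v]] Wv(1)] by (simp add: mult_ac)
  have dd: "inner (cls (dvr (dvr f))) (cls f) \<ge> 0" if f: "W2 f" for f
  proof -
    have "inner (cls (dvr (dvr f))) (cls f) = inner (cls (dvr f)) (cls (dvr f))"
      unfolding inner_cls[OF W2_div[OF W2_div[OF f]] f] inner_cls[OF W2_div[OF f] W2_div[OF f]] by (simp add: mult_ac)
    then show ?thesis by simp
  qed
  define dU where "dU = inner (cls (dvr (dvr (cut u)))) (cls (cut u))"
  define dV where "dV = inner (cls (dvr (dvr (cut v)))) (cls (cut v))"
  define k1 where "k1 = inner (cls (mV (mV (dvr bgbox)))) (cls (cut u))"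
  define k2 where "k2 = inner (cls (mV (dvr (dvr bgbox)))) (cls (cut v))"
  define k3 where "k3 = inner (cls (mV' bgbox)) (cls (cut (dr v)))"
  have "inner (op \<nu> u v w) U = \<nu> * G + \<nu> * dU + \<nu> * dV - 2 * X - Y - Z - k1 + \<nu> * k2 + \<nu> * k3
     - (adv u w u u + adv u w v v + adv u w w w)"
    using X1 sw cross_identity[OF u v]
    unfolding op_def U_def jet_def adv_def dU_def[symmetric] dV_def[symmetric] k1_def[symmetric] k2_def[symmetric] k3_def[symmetric]
      X_def[symmetric] Y_def[symmetric] Z_def[symmetric] G_def a_def a'_def b_def b'_def c_def c'_def power2_norm_eq_inner
    by (simp add: inner_add_left inner_diff_left dU_def dV_def k1_def k2_def k3_def algebra_simps)
  then have main: "inner (op \<nu> u v w) U = \<nu> * G + \<nu> * dU + \<nu> * dV - 2 * X - Y - Z - k1 + \<nu> * k2 + \<nu> * k3"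
    using adv_self[OF uw u] adv_self[OF uw v] adv_self[OF uw w] by simp
  have n: "norm (cls (cut u)) \<le> norm U" "norm (cls (cut v)) \<le> norm U" "norm (cls (cut (dr v))) \<le> norm U"
  proof -
    show "norm (cls (cut u)) \<le> norm U"
      unfolding U_def jet_def by (rule order_trans[OF norm_fst_le norm_fst_le])
    show "norm (cls (cut v)) \<le> norm U"
      unfolding U_def jet_def by (rule order_trans[OF norm_fst_le order_trans[OF norm_fst_le norm_snd_le]])
    show "norm (cls (cut (dr v))) \<le> norm U"
      unfolding U_def jet_def
      by (rule order_trans[OF norm_fst_le order_trans[OF norm_snd_le order_trans[OF norm_fst_le norm_snd_le]]])
  qed
  have K: "k1 - \<nu> * k2 - \<nu> * k3 \<le> force_bound \<nu> * norm U"
  proof -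
    have cs: "\<bar>inner p r\<bar> \<le> norm p * norm U" if "norm r \<le> norm U" for p r :: "(real \<times> real) l2"
      using Cauchy_Schwarz_ineq2[of p r] mult_left_mono[OF that norm_ge_zero[of p]] by linarith
    have "\<bar>k1\<bar> \<le> norm (cls (mV (mV (dvr bgbox)))) * norm U" unfolding k1_def by (rule cs[OF n(1)])
    moreover have "\<nu> * \<bar>k2\<bar> \<le> \<nu> * (norm (cls (mV (dvr (dvr bgbox)))) * norm U)"
      unfolding k2_def using \<nu> by (intro mult_left_mono cs[OF n(2)]) simp
    moreover have "\<nu> * \<bar>k3\<bar> \<le> \<nu> * (norm (cls (mV' bgbox)) * norm U)"
      unfolding k3_def using \<nu> by (intro mult_left_mono cs[OF n(3)]) simp
    moreover have "- (\<nu> * k2) \<le> \<nu> * \<bar>k2\<bar>" "- (\<nu> * k3) \<le> \<nu> * \<bar>k3\<bar>"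
      using \<nu> by (simp_all only: mult_minus_right[symmetric] mult_le_cancel_left_pos abs_ge_minus_self)
    ultimately show ?thesis unfolding force_bound_def distrib_right by (simp add: mult.assoc)
  qed
  have ab: "x * y \<le> x\<^sup>2 + y\<^sup>2" for x y :: real
  proof -
    have "x * y \<le> (x\<^sup>2 + y\<^sup>2) / 2" using sum_squares_bound[of x y] by simp
    also have "\<dots> \<le> x\<^sup>2 + y\<^sup>2" by simp
    finally show ?thesis .
  qed
  have "a\<^sup>2 + b'\<^sup>2 \<le> G" "a\<^sup>2 + b\<^sup>2 \<le> G" by (simp_all add: G_def)
  then have aG: "a * b' \<le> G" "a * b \<le> G"
    using ab[of a b'] ab[of a b] by (blast intro: order_trans)+
  have mu: "norm (cls (mV (cut u))) \<le> q * a" "norm (cls (mV (cut v))) \<le> q * b"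
    using mV_norm[OF u] mV_norm[OF v] by (simp_all only: q_def a_def b_def)
  \<comment> \<open>The factor \<open>1 / r\<close> costs \<open>1 / \<sigma>\<close>, and the
    Poincare inequality replaces \<open>v\<close> by its \<open>z\<close>-derivative at the cost of
    \<open>L\<close>.\<close>
  have X2: "\<bar>X\<bar> \<le> q * (L / \<sigma>) * G"
  proof -
    have "norm (cls (dvr (cut v))) \<le> 1 / \<sigma> * (L * b')"
      unfolding b'_def by (rule order_trans[OF dvr_norm[OF Wv(1)]], rule mult_left_mono[OF poincare_norm[OF v]]) (use sigma_pos in simp)
    then have "norm (cls (mV (cut u))) * norm (cls (dvr (cut v))) \<le> (q * a) * (1 / \<sigma> * (L * b'))"
      by (intro mult_mono mu) (use q pos in auto)
    then have "\<bar>X\<bar> \<le> (q * a) * (1 / \<sigma> * (L * b'))"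
      unfolding X_def using Cauchy_Schwarz_ineq2 order_trans by blast
    also have "\<dots> = q * (L / \<sigma>) * (a * b')" by simp
    also have "\<dots> \<le> q * (L / \<sigma>) * G" using q L_pos sigma_pos by (intro mult_left_mono aG) auto
    finally show ?thesis .
  qed
  have Y2: "\<bar>Y\<bar> \<le> q * G" "\<bar>Z\<bar> \<le> q * G"
  proof -
    have "norm (cls (mV (cut v))) * norm (cls (cut (dr u))) \<le> (q * b) * a"
      "norm (cls (mV (cut u))) * norm (cls (cut (dr v))) \<le> (q * a) * b"
      unfolding a_def[symmetric] b_def[symmetric] by (intro mult_right_mono mu pos)+
    then have "\<bar>Y\<bar> \<le> q * (a * b)" "\<bar>Z\<bar> \<le> q * (a * b)"
      unfolding Y_def Z_def using Cauchy_Schwarz_ineq2[of "cls (mV (cut v))" "cls (cut (dr u))"] Cauchy_Schwarz_ineq2[of "cls (mV (cut u))" "cls (cut (dr v))"]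
      by (simp_all add: mult_ac)
    moreover have "q * (a * b) \<le> q * G" using q by (intro mult_left_mono aG)
    ultimately show "\<bar>Y\<bar> \<le> q * G" "\<bar>Z\<bar> \<le> q * G" by linarith+
  qed
  have G0: "G \<ge> 0" by (simp add: G_def)
  have "2 * X + Y + Z \<le> q * (2 * (L / \<sigma>) + 2) * G"
  proof -
    have "2 * X + Y + Z \<le> 2 * (q * (L / \<sigma>) * G) + q * G + q * G" using X2 Y2 by linarith
    also have "\<dots> = q * (2 * (L / \<sigma>) + 2) * G" by (simp add: algebra_simps)
    finally show ?thesis .
  qed
  also have "\<dots> \<le> \<nu> / 2 * G" using E G0 unfolding q_def[symmetric] by (intro mult_right_mono) auto
  finally have XYZ: "2 * X + Y + Z \<le> \<nu> / 2 * G" .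
  \<comment> \<open>The Poincare inequality bounds the value components of the jet by the gradient
    energy \<open>G\<close>, hence the factor \<open>1 + L^2\<close>.\<close>
  have NU: "(norm U)\<^sup>2 \<le> (1 + L\<^sup>2) * G"
  proof -
    have pn: "(norm (p, r))\<^sup>2 = (norm p)\<^sup>2 + (norm r)\<^sup>2" for p :: "'x::real_normed_vector" and r :: "'y::real_normed_vector"
      by (simp add: norm_Pair)
    have po: "(norm (cls (cut f)))\<^sup>2 \<le> L\<^sup>2 * (norm (cls (cut (dz f))))\<^sup>2" if "f \<in> V1 \<sigma> L" for f
      using power_mono[OF poincare_norm[OF that] norm_ge_zero, of 2] by (simp add: power_mult_distrib)
    have "(norm U)\<^sup>2 = ((norm (cls (cut u)))\<^sup>2 + (a\<^sup>2 + a'\<^sup>2)) + (((norm (cls (cut v)))\<^sup>2 + (b\<^sup>2 + b'\<^sup>2)) + ((norm (cls (cut w)))\<^sup>2 + (c\<^sup>2 + c'\<^sup>2)))"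
      unfolding U_def jet_def pn a_def a'_def b_def b'_def c_def c'_def ..
    also have "\<dots> \<le> (L\<^sup>2 * a'\<^sup>2 + (a\<^sup>2 + a'\<^sup>2)) + ((L\<^sup>2 * b'\<^sup>2 + (b\<^sup>2 + b'\<^sup>2)) + (L\<^sup>2 * c'\<^sup>2 + (c\<^sup>2 + c'\<^sup>2)))"
      unfolding a'_def b'_def c'_def by (intro add_mono po u v w order_refl)
    also have "\<dots> \<le> (1 + L\<^sup>2) * G"
      unfolding G_def by (simp add: algebra_simps)
    finally show ?thesis .
  qed
  have "\<nu> / 2 / (1 + L\<^sup>2) * (norm U)\<^sup>2 \<le> \<nu> / 2 / (1 + L\<^sup>2) * ((1 + L\<^sup>2) * G)"
    using NU \<nu> by (intro mult_left_mono) (auto simp: add_nonneg_nonneg)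
  also have "\<dots> = \<nu> / 2 * G"
  proof -
    have "x / y * (y * z) = x * z" if "y \<noteq> 0" for x y z :: real using that by simp
    moreover have "1 + L\<^sup>2 \<noteq> 0" using zero_le_power2[of L] by linarith
    ultimately show ?thesis by blast
  qed
  finally have "\<nu> / 2 / (1 + L\<^sup>2) * (norm U)\<^sup>2 \<le> \<nu> / 2 * G" .
  moreover have "\<nu> * dU \<ge> 0" "\<nu> * dV \<ge> 0" using \<nu> dd[OF Wu(1)] dd[OF Wv(1)] by (simp_all add: dU_def dV_def)
  moreover have "\<nu> * G = \<nu> / 2 * G + \<nu> / 2 * G" by simp
  ultimately show ?thesis unfolding main using XYZ K by linarith
qed

text \<open>Each entry of \<open>op\<close> is a sum of constants, of bounded multipliers applied to
  a component, which move to the other side of the inner product, and of products of two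
  undifferentiated components, covered by \<open>weak_cont_trilinear\<close>. The functions may be
  selected arbitrarily as long as their jets vary weakly continuously.\<close>

lemma op_continuous:
  fixes X :: "'a topology"
  assumes uw: "\<And>U. U \<in> topspace X \<Longrightarrow> (u U, w U) \<in> V2 \<sigma> L" and v: "\<And>U. U \<in> topspace X \<Longrightarrow> v U \<in> V1 \<sigma> L"
    and b: "\<And>U. U \<in> topspace X \<Longrightarrow> norm (jet (u U)) \<le> R" "\<And>U. U \<in> topspace X \<Longrightarrow> norm (jet (v U)) \<le> R" "\<And>U. U \<in> topspace X \<Longrightarrow> norm (jet (w U)) \<le> R"
    and c: "\<And>p. continuous_map X euclideanreal (\<lambda>U. inner (jet (u U)) p)" "\<And>p. continuous_map X euclideanreal (\<lambda>U. inner (jet (v U)) p)"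
      "\<And>p. continuous_map X euclideanreal (\<lambda>U. inner (jet (w U)) p)"
  shows "continuous_map X euclideanreal (\<lambda>U. inner (op \<nu> (u U) (v U) (w U)) a)"
proof -
  define good where "good f \<longleftrightarrow> (\<forall>U\<in>topspace X. f U \<in> V1 \<sigma> L \<and> norm (jet (f U)) \<le> R) \<and> (\<forall>p. continuous_map X euclideanreal (\<lambda>U. inner (jet (f U)) p))" for f
  have g: "good u" "good v" "good w" using V2_V1[OF uw] v b c by (auto simp: good_def)
  have lin: "continuous_map X euclideanreal (\<lambda>U. inner (cls (cut (f U))) p)" "continuous_map X euclideanreal (\<lambda>U. inner (cls (cut (dr (f U)))) p)"
    "continuous_map X euclideanreal (\<lambda>U. inner (cls (cut (dz (f U)))) p)" if f: "good f" for f p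
  proof -
    have e: "continuous_map X euclideanreal (\<lambda>U. inner (jet (f U)) p)" for p using f unfolding good_def by blast
    show "continuous_map X euclideanreal (\<lambda>U. inner (cls (cut (f U))) p)" using e[of "(p, 0, 0)"] by (simp add: jet_def)
    show "continuous_map X euclideanreal (\<lambda>U. inner (cls (cut (dr (f U)))) p)" using e[of "(0, p, 0)"] by (simp add: jet_def)
    show "continuous_map X euclideanreal (\<lambda>U. inner (cls (cut (dz (f U)))) p)" using e[of "(0, 0, p)"] by (simp add: jet_def)
  qed
  \<comment> \<open>Pairing a class from the strip with \<open>p\<close> means integrating against
    the fixed function \<open>fn p\<close>.\<close>
  have quad: "continuous_map X euclideanreal (\<lambda>U. inner (cls (\<lambda>x. cut (f U) x * cut (h U) x)) p)" if f: "good f" and h: "good h" for f h p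
  proof -
    have "continuous_map X euclideanreal (\<lambda>U. LINT x|lborel. cut (f U) x * cut (h U) x * fn p x * fst x)"
      by (rule weak_cont_trilinear[where R = "R\<^sup>2"])
        (use f h lin W2_fn V1_slice_bound in \<open>auto simp: good_def\<close>)
    moreover have "(LINT x|lborel. cut (f U) x * cut (h U) x * fn p x * fst x) = inner (cls (\<lambda>x. cut (f U) x * cut (h U) x)) p" if U: "U \<in> topspace X" for U
    proof -
      have "W2 (\<lambda>x. cut (f U) x * cut (h U) x)" using f h U by (intro V1_W2_mult) (auto simp: good_def)
      from inner_cls_right[OF this] show ?thesis by (simp add: inner_commute mult_ac)
    qed
    ultimately show ?thesis by (rule continuous_map_eq)
  qed
  \<comment> \<open>Multipliers are self-adjoint, so continuity against \<open>p\<close> follows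
    from continuity of the factor against the multiplied \<open>fn p\<close>.\<close>
  have mult: "continuous_map X euclideanreal (\<lambda>U. inner (cls (\<lambda>x. m x * F U x)) p)"
    if F: "\<And>U. U \<in> topspace X \<Longrightarrow> W2 (F U)" and m: "\<And>f. W2 f \<Longrightarrow> W2 (\<lambda>x. m x * f x)"
      and co: "\<And>p. continuous_map X euclideanreal (\<lambda>U. inner (cls (F U)) p)" for m F p
    by (rule continuous_map_eq[OF co[of "cls (\<lambda>x. m x * fn p x)"]]) (rule inner_multiplier[symmetric, OF F m[OF F] m[OF W2_fn]])
  have WV: "U \<in> topspace X \<Longrightarrow> W2 (cut (f U))" if "good f" for f U using that V1_W2(1) by (auto simp: good_def)
  have WVV: "U \<in> topspace X \<Longrightarrow> W2 (\<lambda>x. cut (f U) x * cut (h U) x)" if "good f" "good h" for f h U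
    using that V1_W2_mult by (auto simp: good_def)
  have t1: "continuous_map X euclideanreal (\<lambda>U. inner (cls (dvr (dvr (cut (f U))))) p)" if "good f" for f p
    by (rule mult, rule W2_div[OF WV[OF that]], assumption, rule W2_div, assumption, rule mult[OF WV[OF that] W2_div lin(1)[OF that]])
  have t2: "continuous_map X euclideanreal (\<lambda>U. inner (cls (mV (dvr (cut (f U))))) p)" if "good f" for f p
    by (rule mult, rule W2_div[OF WV[OF that]], assumption, rule W2_mV, assumption, rule mult[OF WV[OF that] W2_div lin(1)[OF that]])
  have t3: "continuous_map X euclideanreal (\<lambda>U. inner (cls (mV' (cut (f U)))) p)" if "good f" for f p
    by (rule mult[OF WV[OF that] W2_mV' lin(1)[OF that]])
  have t4: "continuous_map X euclideanreal (\<lambda>U. inner (cls (dvr (\<lambda>x. cut (f U) x * cut (h U) x))) p)" if "good f" "good h" for f h p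
    by (rule mult[OF WVV[OF that] W2_div quad[OF that]])
  obtain a1 a2 a3 b1 b2 b3 c1 c2 c3 where a: "a = ((a1, a2, a3), (b1, b2, b3), (c1, c2, c3))" by (cases a) auto
  show ?thesis
    unfolding a op_def inner_Pair inner_add_left inner_diff_left inner_scaleR_left inner_zero_left
    by (intro continuous_map_add continuous_map_diff continuous_map_real_mult continuous_map_canonical_const
        t1 t2 t3 t4 quad lin g)
qed

end

theorem theorem2p1:
  fixes \<sigma> L \<nu> \<rho> \<gamma> :: real
  assumes "\<sigma> > 0" and "L > 0" and "\<nu> > 0" and "\<rho> > 0"
  shows "\<exists>\<epsilon>0\<in>{0<..<1}. \<forall>\<epsilon>. 0 < \<epsilon> \<and> \<epsilon> < \<epsilon>0 \<longrightarrow>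
           (\<forall>\<theta>. cutoff \<sigma> \<epsilon> \<theta> \<longrightarrow> (\<exists>u v w. weak_solution \<sigma> L \<nu> \<gamma> \<theta> u v w))"
proof -
  interpret strip \<sigma> L using assms by unfold_locales
  obtain C where C: "C \<ge> 0"
    and bg: "\<And>\<epsilon> \<theta>. 0 < \<epsilon> \<Longrightarrow> \<epsilon> < 1 \<Longrightarrow> cutoff \<sigma> \<epsilon> \<theta> \<Longrightarrow> \<exists>V V' B. strip_flow \<sigma> L V V' B (C * \<epsilon>) \<and>
      (\<forall>r\<ge>\<sigma>. V r = v_bg \<sigma> \<gamma> \<theta> r \<and> V' r = dv_bg \<sigma> \<gamma> \<theta> r)"
    by (rule background[of \<gamma>]) blast
  \<comment> \<open>With \<open>E = C * \<epsilon>\<close> the smallness hypothesis of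
    \<open>op_coercive\<close> reads \<open>D * \<epsilon> \<le> \<nu> / 2\<close>.\<close>
  define D where "D = 2 * sqrt ((\<sigma> + 2) / \<sigma>) * C * (2 * (L / \<sigma>) + 2)"
  have D: "D \<ge> 0" using C sigma_pos L_pos by (simp add: D_def)
  \<comment> \<open>\<open>D\<close> may be 0, whence \<open>D + 1\<close> in the denominator;
    \<open>1 / 2\<close> keeps the threshold below 1.\<close>
  define \<epsilon>0 where "\<epsilon>0 = min (1 / 2) (\<nu> / (2 * (D + 1)))"
  have \<epsilon>0: "\<epsilon>0 \<in> {0<..<1}" using D assms(3) by (auto simp: \<epsilon>0_def min_def)
  have "\<exists>u v w. weak_solution \<sigma> L \<nu> \<gamma> \<theta> u v w" if e: "0 < \<epsilon>" "\<epsilon> < \<epsilon>0" and cu: "cutoff \<sigma> \<epsilon> \<theta>" for \<epsilon> \<theta>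
  proof -
    have e1: "\<epsilon> < 1" using e \<epsilon>0 by auto
    have De: "2 * sqrt ((\<sigma> + 2) / \<sigma>) * (C * \<epsilon>) * (2 * (L / \<sigma>) + 2) \<le> \<nu> / 2"
    proof -
      have "\<epsilon> < \<nu> / (2 * (D + 1))" using e(2) unfolding \<epsilon>0_def min_less_iff_conj by (rule conjunct2)
      moreover have "0 < 2 * (D + 1)" using D by simp
      ultimately have "\<epsilon> * (2 * (D + 1)) < \<nu>" using pos_less_divide_eq by blast
      moreover have "\<epsilon> * (2 * (D + 1)) = 2 * (D * \<epsilon>) + 2 * \<epsilon>" by (simp add: algebra_simps)
      ultimately have "D * \<epsilon> \<le> \<nu> / 2" using e(1) by linarith
      moreover have "2 * sqrt ((\<sigma> + 2) / \<sigma>) * (C * \<epsilon>) * (2 * (L / \<sigma>) + 2) = D * \<epsilon>" by (simp only: D_def mult_ac)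
      ultimately show ?thesis by (simp only:)
    qed
    obtain V V' B where flow: "strip_flow \<sigma> L V V' B (C * \<epsilon>)"
      and V: "\<And>r. r \<ge> \<sigma> \<Longrightarrow> V r = v_bg \<sigma> \<gamma> \<theta> r" "\<And>r. r \<ge> \<sigma> \<Longrightarrow> V' r = dv_bg \<sigma> \<gamma> \<theta> r"
      using bg[OF e(1) e1 cu] by blast
    interpret strip_flow \<sigma> L V V' B "C * \<epsilon>" by (rule flow)
    \<comment> \<open>A selection of functions for every jet in \<open>M\<close>. Any selection will
      do, since coercivity and continuity are expressed through the jets.\<close>
    have "\<forall>U. \<exists>t. U \<in> M \<longrightarrow> (fst t, snd (snd t)) \<in> V2 \<sigma> L \<and> fst (snd t) \<in> V1 \<sigma> L \<and>
        jet (fst t) = fst U \<and> jet (fst (snd t)) = fst (snd U) \<and> jet (snd (snd t)) = snd (snd U)"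
      unfolding M_iff by (metis fst_conv snd_conv)
    then have "\<exists>t. \<forall>U. U \<in> M \<longrightarrow> (fst (t U), snd (snd (t U))) \<in> V2 \<sigma> L \<and> fst (snd (t U)) \<in> V1 \<sigma> L \<and>
        jet (fst (t U)) = fst U \<and> jet (fst (snd (t U))) = fst (snd U) \<and> jet (snd (snd (t U))) = snd (snd U)"
      by (rule choice)
    then obtain t where t: "\<And>U. U \<in> M \<Longrightarrow> (fst (t U), snd (snd (t U))) \<in> V2 \<sigma> L"
      "\<And>U. U \<in> M \<Longrightarrow> fst (snd (t U)) \<in> V1 \<sigma> L" "\<And>U. U \<in> M \<Longrightarrow> jet (fst (t U)) = fst U"
      "\<And>U. U \<in> M \<Longrightarrow> jet (fst (snd (t U))) = fst (snd U)" "\<And>U. U \<in> M \<Longrightarrow> jet (snd (snd (t U))) = snd (snd U)"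
      by blast
    define G where "G U a = inner (op \<nu> (fst (t U)) (fst (snd (t U))) (snd (snd (t U)))) a" for U a
    define K where "K = force_bound \<nu>"
    define c where "c = \<nu> / 2 / (1 + L\<^sup>2)"
    have c: "c > 0" using assms(3) by (simp add: c_def add_pos_nonneg)
    have K: "K \<ge> 0" using assms(3) by (simp add: K_def force_bound_def)
    \<comment> \<open>With this radius \<open>c * R^2 - K * R\<close> equals \<open>c * R\<close>,
      which is positive.\<close>
    define R where "R = K / c + 1"
    have R: "R > 0" using c K by (simp add: R_def add_nonneg_pos)
    have "\<exists>U\<in>M. norm U \<le> R \<and> (\<forall>a\<in>M. G U a = 0)"
    proof (rule galerkin_zero[OF M_subspace M_closed R])
      fix a
      let ?X = "subtopology weak_topology (M \<inter> cball 0 R)"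
      have top: "topspace ?X = M \<inter> cball 0 R" by simp
      have cw: "continuous_map ?X euclideanreal (\<lambda>U. inner U h)" for h
        by (rule continuous_map_from_subtopology[OF continuous_map_weak_inner])
      show "continuous_map ?X euclideanreal (\<lambda>U. G U a)"
        unfolding G_def
      proof (rule op_continuous)
        fix U assume "U \<in> topspace ?X"
        then have U: "U \<in> M" "norm U \<le> R" by (simp_all add: top)
        show "(fst (t U), snd (snd (t U))) \<in> V2 \<sigma> L" "fst (snd (t U)) \<in> V1 \<sigma> L" using t U by blast+
        note j = t(3-5)[OF U(1)]
        show "norm (jet (fst (t U))) \<le> R" "norm (jet (fst (snd (t U)))) \<le> R" "norm (jet (snd (snd (t U)))) \<le> R"
          unfolding j using U(2) norm_component_le[of U] norm_component_le[of "snd U"] by linarith+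
      next
        fix p
        have j: "jet (fst (t U)) = fst U" "jet (fst (snd (t U))) = fst (snd U)" "jet (snd (snd (t U))) = snd (snd U)" if "U \<in> topspace ?X" for U
          using t(3-5)[of U] that by simp_all
        show "continuous_map ?X euclideanreal (\<lambda>U. inner (jet (fst (t U))) p)"
          by (rule continuous_map_eq[OF cw[of "(p, 0, 0)"]]) (simp only: j, simp add: inner_prod_def)
        show "continuous_map ?X euclideanreal (\<lambda>U. inner (jet (fst (snd (t U)))) p)"
          by (rule continuous_map_eq[OF cw[of "(0, p, 0)"]]) (simp only: j, simp add: inner_prod_def)
        show "continuous_map ?X euclideanreal (\<lambda>U. inner (jet (snd (snd (t U)))) p)"
          by (rule continuous_map_eq[OF cw[of "(0, 0, p)"]]) (simp only: j, simp add: inner_prod_def)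
      qed
    next
      fix U assume U: "U \<in> M" "norm U = R"
      have j: "(jet (fst (t U)), jet (fst (snd (t U))), jet (snd (snd (t U)))) = U"
        by (simp add: t(3-5)[OF U(1)])
      have "c * R\<^sup>2 - K * R \<le> G U U"
        using op_coercive[OF t(1)[OF U(1)] t(2)[OF U(1)] assms(3) De] unfolding j U(2) G_def c_def K_def .
      moreover have "c * R\<^sup>2 - K * R = c * R"
        using c by (simp add: R_def power2_eq_square algebra_simps)
      moreover have "c * R \<ge> 0" using c R by simp
      ultimately show "G U U \<ge> 0" by linarith
    qed (simp_all add: G_def inner_add_right)
    then obtain U where U: "U \<in> M" and z: "\<And>a. a \<in> M \<Longrightarrow> G U a = 0" by blast
    define u where "u = fst (t U)"
    define v where "v = fst (snd (t U))"
    define w where "w = snd (snd (t U))"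
    have uw: "(u, w) \<in> V2 \<sigma> L" and v: "v \<in> V1 \<sigma> L" using t(1,2)[OF U] by (simp_all add: u_def v_def w_def)
    have z: "inner (op \<nu> u v w) a = 0" if "a \<in> M" for a using z[OF that] by (simp add: G_def u_def v_def w_def)
    \<comment> \<open>\<open>M\<close> contains the test jets without swirl and those with swirl
      only, so the single identity on \<open>M\<close> splits into the two weak equations.\<close>
    have z1: "inner (op \<nu> u v w) (jet u1, 0, jet w1) = 0" if "(u1, w1) \<in> V2 \<sigma> L" for u1 w1
    proof (rule z)
      have "(jet u1, jet (\<lambda>_. 0), jet w1) \<in> M" using that zero_V1(1) unfolding M_iff by blast
      then show "(jet u1, 0, jet w1) \<in> M" by (simp only: zero_V1(2))
    qed
    have z2: "inner (op \<nu> u v w) (0, jet v1, 0) = 0" if "v1 \<in> V1 \<sigma> L" for v1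
    proof (rule z)
      have "0 \<in> jet ` V1 \<sigma> L" "0 \<in> jet ` V1_top" using jets_subspace subspace_0 by blast+
      then show "(0, jet v1, 0) \<in> M" using that by (simp add: M_def divf_def)
    qed
    have "weak_perturbation \<sigma> L \<nu> \<gamma> \<theta> u v w"
      unfolding weak_perturbation_def
    proof (intro conjI uw v ballI, clarify, intro ballI conjI)
      fix u1 w1 v1 assume uw1: "(u1, w1) \<in> V2 \<sigma> L" and v1: "v1 \<in> V1 \<sigma> L"
      show "cyl_integral \<sigma> L (\<lambda>x. (u x * d_r \<sigma> L u x + w x * d_z \<sigma> L u x) * u1 x
                            + (u x * d_r \<sigma> L w x + w x * d_z \<sigma> L w x) * w1 x)
        - cyl_integral \<sigma> L (\<lambda>(r, z). (v (r, z) + v_bg \<sigma> \<gamma> \<theta> r)\<^sup>2 / r * u1 (r, z))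
        = - \<nu> * cyl_integral \<sigma> L (\<lambda>x. grad \<sigma> L u x \<bullet> grad \<sigma> L u1 x + grad \<sigma> L w x \<bullet> grad \<sigma> L w1 x)
          - \<nu> * cyl_integral \<sigma> L (\<lambda>(r, z). u (r, z) * u1 (r, z) / r\<^sup>2)"
        by (rule op_momentum[OF uw v uw1 z1[OF uw1] V(1)])
      show "cyl_integral \<sigma> L (\<lambda>x. (u x * d_r \<sigma> L v x + w x * d_z \<sigma> L v x) * v1 x)
        + cyl_integral \<sigma> L (\<lambda>(r, z). u (r, z) * dv_bg \<sigma> \<gamma> \<theta> r * v1 (r, z))
        + cyl_integral \<sigma> L (\<lambda>(r, z). u (r, z) * (v (r, z) + v_bg \<sigma> \<gamma> \<theta> r) / r * v1 (r, z))
        = - \<nu> * cyl_integral \<sigma> L (\<lambda>x. grad \<sigma> L v x \<bullet> grad \<sigma> L v1 x)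
          - \<nu> * cyl_integral \<sigma> L (\<lambda>(r, z). (dv_bg \<sigma> \<gamma> \<theta> r, 0) \<bullet> grad \<sigma> L v1 (r, z))
          - \<nu> * cyl_integral \<sigma> L (\<lambda>(r, z). (v (r, z) + v_bg \<sigma> \<gamma> \<theta> r) * v1 (r, z) / r\<^sup>2)"
        by (rule op_swirl[OF uw v v1 z2[OF v1] V])
    qed
    \<comment> \<open>The solution found is the deviation; \<open>weak_solution\<close> expects the
      full azimuthal velocity and subtracts the background from it.\<close>
    moreover have "v = (\<lambda>(r, z). (\<lambda>(r, z). v (r, z) + v_bg \<sigma> \<gamma> \<theta> r) (r, z) - v_bg \<sigma> \<gamma> \<theta> r)" by (simp add: fun_eq_iff)
    ultimately have "weak_solution \<sigma> L \<nu> \<gamma> \<theta> u (\<lambda>(r, z). v (r, z) + v_bg \<sigma> \<gamma> \<theta> r) w"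
      unfolding weak_solution_def by simp
    then show ?thesis by blast
  qed
  then show ?thesis using \<epsilon>0 by blast
qed

end
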